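(* Let $r<p^*$. Then there exists $\lambda_*>0$ such that for all $\beta>0$ and all $\lambda\in(0,\lambda_* )$, problem $(P_\lambda)$ has at least two weak solutions.
   Context: Setting: $\Omega\subset\mathbb{R}^n$ is a bounded domain with smooth boundary, $n>p$, $1<q<p<r\le p^*$ with $p^*=\frac{np}{n-p}$, $0<\delta<1$, and $\lambda,\beta>0$ are parameters. $\Delta_m u=\nabla\cdot(|\nabla u|^{m-2}\nabla u)$. Problem $(P_\lambda)$ is $$-\Delta_p u-\beta\Delta_q u=\lambda u^{-\delta}+u^{r-1},\quad u>0 \text{ in }\Omega,\qquad u=0\text{ on }\partial\Omega.$$ A function $u\in W^{1,p}_0(\Omega)$ is a weak solution of $(P_\lambda)$ if $u>0$ a.e. in $\Omega$ and $\int_\Omega\big(|\nabla u|^{p-2}\nabla u\cdot\nabla\phi+\beta|\nabla u|^{q-2}\nabla u\cdot\nabla\phi-\lambda u^{-\delta}\phi-u^{r-1}\phi\big)dx=0$ for all $\phi\in W^{1,p}_0(\Omega)$. *)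

theory Defs
  imports "HOL-Analysis.Analysis"
begin

section \<open>Smooth functions and smooth bounded domains\<close>

definition partial_deriv :: "'n::finite \<Rightarrow> (real^'n \<Rightarrow> real) \<Rightarrow> real^'n \<Rightarrow> real" where
  "partial_deriv i f x = frechet_derivative f (at x) (axis i 1)"

fun C_k :: "nat \<Rightarrow> (real^'n::finite \<Rightarrow> real) \<Rightarrow> bool" where
  "C_k 0 f \<longleftrightarrow> continuous_on UNIV f"
| "C_k (Suc k) f \<longleftrightarrow> (\<forall>x. f differentiable (at x)) \<and> (\<forall>i. C_k k (partial_deriv i f))"

definition smooth :: "(real^'n::finite \<Rightarrow> real) \<Rightarrow> bool" where
  "smooth f \<longleftrightarrow> (\<forall>k. C_k k f)"

text \<open>Near each boundary point, the domain is the strict supergraph of a smooth function,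
  in Cartesian coordinates whose last axis is the unit vector \<open>e\<close>.  A function of the other
  \<open>n - 1\<close> coordinates is encoded as a function on the whole space that is invariant
  under translation along \<open>e\<close>.\<close>

definition smooth_boundary :: "(real^'n::finite) set \<Rightarrow> bool" where
  "smooth_boundary \<Omega> \<longleftrightarrow>
     (\<forall>x\<^sub>0 \<in> frontier \<Omega>. \<exists>\<epsilon>>0. \<exists>e \<gamma>. norm e = 1 \<and> smooth \<gamma> \<and> (\<forall>y t. \<gamma> (y + t *\<^sub>R e) = \<gamma> y) \<and>
        \<Omega> \<inter> ball x\<^sub>0 \<epsilon> = {y \<in> ball x\<^sub>0 \<epsilon>. \<gamma> y < y \<bullet> e})"

definition bounded_smooth_domain :: "(real^'n::finite) set \<Rightarrow> bool" where
  "bounded_smooth_domain \<Omega> \<longleftrightarrow>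
     open \<Omega> \<and> connected \<Omega> \<and> \<Omega> \<noteq> {} \<and> bounded \<Omega> \<and> smooth_boundary \<Omega>"

section \<open>Sobolev spaces\<close>

text \<open>Elements of the function spaces are represented by functions on the whole space, of which
  only the values almost everywhere in \<open>\<Omega>\<close> matter.\<close>

definition test_function :: "(real^'n::finite) set \<Rightarrow> (real^'n \<Rightarrow> real) \<Rightarrow> bool" where
  "test_function \<Omega> \<phi> \<longleftrightarrow>
     smooth \<phi> \<and> compact (closure {x. \<phi> x \<noteq> 0}) \<and> closure {x. \<phi> x \<noteq> 0} \<subseteq> \<Omega>"

definition locally_integrable ::
    "(real^'n::finite) set \<Rightarrow> (real^'n \<Rightarrow> 'b::euclidean_space) \<Rightarrow> bool" where
  "locally_integrable \<Omega> f \<longleftrightarrow> (\<forall>K. compact K \<and> K \<subseteq> \<Omega> \<longrightarrow> integrable (lebesgue_on K) f)"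

definition is_weak_gradient ::
    "(real^'n::finite) set \<Rightarrow> (real^'n \<Rightarrow> real) \<Rightarrow> (real^'n \<Rightarrow> real^'n) \<Rightarrow> bool" where
  "is_weak_gradient \<Omega> u g \<longleftrightarrow> locally_integrable \<Omega> u \<and> locally_integrable \<Omega> g \<and>
     (\<forall>\<phi> i. test_function \<Omega> \<phi> \<longrightarrow>
        (LINT x|lebesgue_on \<Omega>. u x * partial_deriv i \<phi> x) = - (LINT x|lebesgue_on \<Omega>. g x $ i * \<phi> x))"

text \<open>The weak gradient is unique up to null sets; an arbitrary representative is chosen.\<close>

definition weak_gradient ::
    "(real^'n::finite) set \<Rightarrow> (real^'n \<Rightarrow> real) \<Rightarrow> real^'n \<Rightarrow> real^'n" where
  "weak_gradient \<Omega> u = (SOME g. is_weak_gradient \<Omega> u g)"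

definition in_Lp ::
    "real \<Rightarrow> (real^'n::finite) set \<Rightarrow> (real^'n \<Rightarrow> 'b::euclidean_space) \<Rightarrow> bool" where
  "in_Lp p \<Omega> f \<longleftrightarrow> f \<in> borel_measurable (lebesgue_on \<Omega>) \<and>
     integrable (lebesgue_on \<Omega>) (\<lambda>x. norm (f x) powr p)"

definition W1p :: "real \<Rightarrow> (real^'n::finite) set \<Rightarrow> (real^'n \<Rightarrow> real) set" where
  "W1p p \<Omega> = {u. in_Lp p \<Omega> u \<and> (\<exists>g. is_weak_gradient \<Omega> u g) \<and> in_Lp p \<Omega> (weak_gradient \<Omega> u)}"

definition W1p_norm :: "real \<Rightarrow> (real^'n::finite) set \<Rightarrow> (real^'n \<Rightarrow> real) \<Rightarrow> real" where
  "W1p_norm p \<Omega> u =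
     ((LINT x|lebesgue_on \<Omega>. \<bar>u x\<bar> powr p) +
      (LINT x|lebesgue_on \<Omega>. norm (weak_gradient \<Omega> u x) powr p)) powr (1 / p)"

text \<open>The closure of the test functions in \<open>W\<^sup>1\<^sup>,\<^sup>p\<close>.\<close>

definition W1p_0 :: "real \<Rightarrow> (real^'n::finite) set \<Rightarrow> (real^'n \<Rightarrow> real) set" where
  "W1p_0 p \<Omega> = {u \<in> W1p p \<Omega>.
     \<forall>\<epsilon>>0. \<exists>\<phi>. test_function \<Omega> \<phi> \<and> W1p_norm p \<Omega> (\<lambda>x. u x - \<phi> x) < \<epsilon>}"

definition sobolev_exponent :: "nat \<Rightarrow> real \<Rightarrow> real" where
  "sobolev_exponent n p = real n * p / (real n - p)"

section \<open>The singular \<open>(p, q)\<close>-Laplacian problem\<close>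

text \<open>As \<open>0 powr a = 0\<close>, this is the usual convention that the field vanishes where
  the gradient does, also for \<open>m < 2\<close>.\<close>

definition m_flux :: "real \<Rightarrow> real^'n::finite \<Rightarrow> real^'n" where
  "m_flux m \<xi> = (norm \<xi> powr (m - 2)) *\<^sub>R \<xi>"

text \<open>The predicate \<open>has_bochner_integral\<close> makes integrability part of the weak formulation;
  a bare equation would hold for every non-integrable integrand, whose integral is \<open>0\<close>
  by convention.\<close>

definition weak_solution ::
    "(real^'n::finite) set \<Rightarrow> real \<Rightarrow> real \<Rightarrow> real \<Rightarrow> real \<Rightarrow> real \<Rightarrow> real \<Rightarrow> (real^'n \<Rightarrow> real) \<Rightarrow> bool" where
  "weak_solution \<Omega> p q r \<delta> \<beta> lam u \<longleftrightarrow>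
     u \<in> W1p_0 p \<Omega> \<and> (AE x in lebesgue_on \<Omega>. u x > 0) \<and>
     (\<forall>\<phi> \<in> W1p_0 p \<Omega>.
        has_bochner_integral (lebesgue_on \<Omega>)
          (\<lambda>x. m_flux p (weak_gradient \<Omega> u x) \<bullet> weak_gradient \<Omega> \<phi> x
             + \<beta> * (m_flux q (weak_gradient \<Omega> u x) \<bullet> weak_gradient \<Omega> \<phi> x)
             - lam * u x powr (- \<delta>) * \<phi> x
             - u x powr (r - 1) * \<phi> x)
          0)"

end

theory Submission
  imports Defs "HOL-Complex_Analysis.Great_Picard" "HOL-Library.Diagonal_Subsequence"
begin

text \<open>Write \<open>s = 1 - \<delta>\<close>.  Along the ray \<open>t \<mapsto> t u\<close> the energy is
  \<open>A t\<^sup>p / p + \<beta> B t\<^sup>q / q - \<lambda> C t\<^sup>s / s - D t\<^sup>r / r\<close>, where \<open>A\<close>, \<open>B\<close> are the \<open>p\<close>- and \<open>q\<close>-integrals of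
  the gradient and \<open>C\<close>, \<open>D\<close> the \<open>s\<close>- and \<open>r\<close>-integrals of \<open>u\<close>.  For small \<open>\<lambda>\<close>, uniformly in \<open>\<beta>\<close>,
  the energy is positive on a sphere \<open>A = \<rho>\<close>.  The first solution minimises it inside the sphere, at
  a negative level.  The second one realises the infimum over all rays of the maximum along the ray,
  at a positive level; the maximum point along each ray is unique, because after division by
  a power of \<open>t\<close> and a change of variable the derivative is strictly concave.

  Both minimisers satisfy a one-sided inequality for small perturbations.  For nonnegative test
  functions, Fatou's lemma then yields positivity and integrability of the singular term; after
  that \<open>\<bar>\<bar>u + \<sigma> \<phi>\<bar>\<^sup>s - u\<^sup>s\<bar> \<le> \<sigma> u\<^sup>s\<^sup>-\<^sup>1 \<bar>\<phi>\<bar>\<close> allows dominated convergence for every test function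
  \<open>\<phi>\<close>, and the resulting inequality for \<open>\<phi>\<close> and \<open>- \<phi>\<close> is the equation.

  Weak compactness is avoided: an \<open>L\<^sup>r\<close> limit of pairs \<open>(u, \<nabla>u)\<close> with bounded energies is again
  the first component of such a pair by uniform convexity.  The subcritical embedding comes from a
  weak-type estimate for dyadic ball averages, and its compactness from the Arzela-Ascoli theorem
  applied to ball averages.\<close>

section \<open>Inequalities for powers\<close>

text \<open>The singular term is the obstacle: the energy is not differentiable at a function that
  vanishes on a set of positive measure, so a mountain pass theorem for C^1 functionals does not
  apply. The second solution is therefore obtained by minimisation as well. When its ray is
  perturbed, the maximum points of the perturbed rays converge to the maximum point of the original
  one, and comparing both energies at the perturbed maximum point gives the inequality of a local
  minimiser up to a factor \<open>t\<close> tending to 1. The two solutions differ because their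
  energies have opposite signs and the energy depends only on classes modulo null sets. Functions
  are carried together with an explicit gradient: \<open>weak_gradient\<close> is a choice of
  representative and is additive only almost everywhere. The strict inequality between
  \<open>r\<close> and the critical exponent is spent twice: on the convergence of a dyadic series
  in the embedding, and on an intermediate exponent that turns convergence in L^p into convergence
  in L^r.\<close>

lemma convex_powr_nonneg:
  fixes x y p t :: real
  assumes "1 \<le> p" "0 \<le> x" "0 \<le> y" "0 \<le> t" "t \<le> 1"
  shows "((1 - t) * x + t * y) powr p \<le> (1 - t) * x powr p + t * y powr p"
proof -
  \<comment> \<open>If one argument is 0, a single term remains, and \<open>s powr p \<le> s\<close>
    on the unit interval suffices.\<close>
  have zero: "(s * z) powr p \<le> s * z powr p" if "0 \<le> s" "s \<le> 1" "0 \<le> z" for s z :: real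
  proof (cases "s = 0")
    case False
    then have "s powr p \<le> s powr 1"
      using that assms by (intro powr_mono') auto
    then show ?thesis
      using that False by (simp add: powr_mult mult_right_mono)
  qed auto
  consider "x = 0" | "y = 0" | "x > 0" "y > 0"
    using assms by linarith
  then show ?thesis
  proof cases
    case 3
    then show ?thesis
      using convex_onD[OF powr_convex[OF assms(1)], of t x y] assms by simp
  qed (use assms zero[of t y] zero[of "1 - t" x] in auto)
qed

text \<open>The weight is kept free for two uses: \<open>t = 1/2\<close> gives the factor
  \<open>2 powr (p - 1)\<close>, while \<open>t\<close> near 0 brings the coefficient of
  \<open>x powr p\<close> close to 1.\<close>

lemma powr_add_le_weighted:
  fixes x y p t :: real
  assumes "1 \<le> p" "0 \<le> x" "0 \<le> y" "0 < t" "t < 1"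
  shows "(x + y) powr p \<le> (1 - t) powr (1 - p) * x powr p + t powr (1 - p) * y powr p"
proof -
  have "((1 - t) * (x / (1 - t)) + t * (y / t)) powr p
      \<le> (1 - t) * (x / (1 - t)) powr p + t * (y / t) powr p"
    using assms by (intro convex_powr_nonneg) auto
  moreover have "s * (z / s) powr p = s powr (1 - p) * z powr p" if "0 < s" "0 \<le> z" for s z :: real
    using that by (simp add: powr_divide powr_diff)
  ultimately show ?thesis
    using assms by simp
qed

lemma powr_add_le:
  fixes x y p :: real
  assumes "1 \<le> p" "0 \<le> x" "0 \<le> y"
  shows "(x + y) powr p \<le> 2 powr (p - 1) * (x powr p + y powr p)"
proof -
  have "(1/2::real) powr (1 - p) = 2 powr (p - 1)"
    using powr_powr[of 2 "- 1" "1 - p"] by (simp add: powr_minus_divide)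
  moreover have "1 - 1/2 = (1/2::real)" by simp
  ultimately show ?thesis
    using powr_add_le_weighted[OF assms, of "1/2"] by (simp only: distrib_left)
qed

text \<open>After division by \<open>x + y\<close> the two quotients add up to 1, and on the unit
  interval \<open>z \<le> z powr a\<close>.\<close>

lemma powr_subadditive:
  fixes x y a :: real
  assumes "0 < a" "a \<le> 1" "0 \<le> x" "0 \<le> y"
  shows "(x + y) powr a \<le> x powr a + y powr a"
proof (cases "x + y = 0")
  case False
  then have s: "x + y > 0" using assms by linarith
  have le: "z / (x + y) \<le> (z / (x + y)) powr a" if "0 \<le> z" "z \<le> x + y" for z
  proof (cases "z = 0")
    case False
    have "(z / (x + y)) powr 1 \<le> (z / (x + y)) powr a"
      using that s False assms by (intro powr_mono') auto
    then show ?thesis using that s by simp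
  qed auto
  have "1 = x / (x + y) + y / (x + y)"
    using s by (simp add: add_divide_distrib[symmetric])
  also have "\<dots> \<le> (x / (x + y)) powr a + (y / (x + y)) powr a"
    using le[of x] le[of y] assms by simp
  also have "\<dots> = (x powr a + y powr a) / (x + y) powr a"
    using assms s by (simp add: powr_divide add_divide_distrib)
  finally show ?thesis using s by (simp add: pos_le_divide_eq)
qed (use assms in auto)

text \<open>A coefficient arbitrarily close to 1 in front of \<open>x powr p\<close> is what yields
  continuity of the power integral; the factor \<open>2 powr (p - 1)\<close> would only yield
  boundedness.\<close>

lemma powr_add_le_eps:
  fixes p e :: real
  assumes "0 < p" "0 < e"
  obtains K where "0 < K" "\<And>x y. 0 \<le> x \<Longrightarrow> 0 \<le> y \<Longrightarrow> (x + y) powr p \<le> (1 + e) * x powr p + K * y powr p"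
proof (cases "p \<le> 1")
  case True
  have "(x + y) powr p \<le> (1 + e) * x powr p + 1 * y powr p" if "0 \<le> x" "0 \<le> y" for x y
    using powr_subadditive[of p x y] assms True that
    by (smt (verit) mult_less_cancel_right2 powr_ge_zero)
  then show ?thesis using that[of 1] by simp
next
  case False
  have "((\<lambda>t. (1 - t) powr (1 - p)) \<longlongrightarrow> (1 - 0) powr (1 - p)) (at_right (0::real))"
    by (intro tendsto_intros) auto
  then have "eventually (\<lambda>t::real. (1 - t) powr (1 - p) < 1 + e) (at_right 0)"
    using assms by (intro order_tendstoD) auto
  moreover have "eventually (\<lambda>t::real. 0 < t \<and> t < 1) (at_right 0)"
    by (intro eventually_conj eventually_at_right_less eventually_at_right_real[of 0 1, THEN eventually_mono]) auto
  ultimately obtain t :: real where t: "0 < t" "t < 1" "(1 - t) powr (1 - p) < 1 + e"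
    using eventually_happens[OF eventually_conj] by (metis (no_types, lifting) trivial_limit_at_right_real)
  have "(x + y) powr p \<le> (1 + e) * x powr p + t powr (1 - p) * y powr p" if "0 \<le> x" "0 \<le> y" for x y
  proof -
    have "(x + y) powr p \<le> (1 - t) powr (1 - p) * x powr p + t powr (1 - p) * y powr p"
      using False t that by (intro powr_add_le_weighted) auto
    also have "\<dots> \<le> (1 + e) * x powr p + t powr (1 - p) * y powr p"
      using t by (intro add_right_mono mult_right_mono) auto
    finally show ?thesis .
  qed
  then show ?thesis using that[of "t powr (1 - p)"] t by simp
qed

lemma powr_interpolate:
  fixes s r t e :: real
  assumes "0 < e" "s < r" "r < t"
  shows "\<exists>C>0. \<forall>x\<ge>0. x powr r \<le> e * x powr t + C * x powr s"
proof -
  \<comment> \<open>The threshold solves \<open>e * m powr (t - r) = 1\<close>: from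
    \<open>m\<close> on the term with exponent \<open>t\<close> dominates, below it
    \<open>x powr (r - s)\<close> is at most \<open>m powr (r - s)\<close>.\<close>
  define m where "m = (1 / e) powr (1 / (t - r))"
  have m: "m > 0" using assms by (simp add: m_def)
  have "x powr r \<le> e * x powr t + m powr (r - s) * x powr s" if x: "0 \<le> x" for x
  proof (cases "x = 0")
    case False
    then have x: "x > 0" using x by simp
    show ?thesis
    proof (cases "x \<ge> m")
      case True
      have "1 / e = m powr (t - r)" using assms by (simp add: m_def powr_powr)
      also have "\<dots> \<le> x powr (t - r)" using True m assms by (intro powr_mono2) auto
      finally have "1 \<le> e * x powr (t - r)" using assms by (simp add: field_simps)
      then have "x powr r * 1 \<le> x powr r * (e * x powr (t - r))"
        by (intro mult_left_mono) auto
      also have "\<dots> = e * x powr t" using x by (simp add: powr_diff)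
      finally show ?thesis using m by (simp add: add_increasing2)
    next
      case False
      have "x powr r = x powr (r - s) * x powr s" using x by (simp add: powr_diff)
      also have "\<dots> \<le> m powr (r - s) * x powr s"
        using False x assms by (intro mult_right_mono powr_mono2) auto
      finally show ?thesis using assms by (simp add: add_increasing)
    qed
  qed auto
  then show ?thesis using m by (intro exI[of _ "m powr (r - s)"]) auto
qed

text \<open>Interpolating between the exponents \<open>0\<close> and \<open>t\<close> needs the constant function
  separately, since \<open>0 powr 0 = 0\<close>.\<close>

lemma powr_le_eps_add:
  fixes r t e :: real
  assumes "0 < e" "0 < r" "r < t"
  shows "\<exists>C>0. \<forall>x\<ge>0. x powr r \<le> e + C * x powr t"
proof -
  define m where "m = e powr (1 / r)"
  have m: "m > 0" using assms by (simp add: m_def)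
  have "x powr r \<le> e + m powr (r - t) * x powr t" if x: "0 \<le> x" for x
  proof (cases "x \<le> m")
    case True
    have "x powr r \<le> m powr r" using True x assms by (intro powr_mono2) auto
    also have "\<dots> = e" using assms by (simp add: m_def powr_powr)
    finally show ?thesis by (simp add: add_increasing2)
  next
    case False
    then have x: "x > 0" using m by simp
    have "x powr r = x powr (r - t) * x powr t" using x by (simp add: powr_diff)
    also have "\<dots> \<le> m powr (r - t) * x powr t"
      using False m x assms by (intro mult_right_mono powr_mono2') auto
    finally show ?thesis using assms by (simp add: add_increasing)
  qed
  then show ?thesis using m by (intro exI[of _ "m powr (r - t)"]) auto
qed

text \<open>Only continuity is required at the left end, so \<open>a = 0\<close> is allowed.\<close>

lemma powr_mvt:
  fixes a b p :: real
  assumes "1 < p" "0 \<le> a" "a < b"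
  shows "\<exists>z. a < z \<and> z < b \<and> b powr p - a powr p = (b - a) * (p * z powr (p - 1))"
proof -
  have der: "((\<lambda>z. z powr p) has_real_derivative p * z powr (p - 1)) (at z)" if "z > 0" for z :: real
    using that by (auto intro!: derivative_eq_intros)
  then have "(\<lambda>z. z powr p) differentiable (at z)" if "a < z" "z < b" for z
    using that \<open>0 \<le> a\<close> real_differentiable_def by (meson le_less_trans)
  moreover have "continuous_on {a..b} (\<lambda>z. z powr p)"
    using assms by (intro continuous_on_powr' continuous_intros) auto
  ultimately obtain l z where z: "a < z" "z < b" "DERIV (\<lambda>z. z powr p) z :> l" "b powr p - a powr p = (b - a) * l"
    using MVT[of a b "\<lambda>z. z powr p"] \<open>a < b\<close> by blast
  have "z > 0" using z(1) assms by simp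
  then have "l = p * z powr (p - 1)"
    using DERIV_unique[OF z(3) der] by simp
  with z show ?thesis by blast
qed

lemma abs_powr_diff_le:
  fixes x y z m :: real
  assumes "1 < m" "0 \<le> x" "0 \<le> y" "x \<le> z" "y \<le> z"
  shows "\<bar>y powr m - x powr m\<bar> \<le> m * z powr (m - 1) * \<bar>y - x\<bar>"
proof -
  have *: "\<bar>b powr m - a powr m\<bar> \<le> m * z powr (m - 1) * \<bar>b - a\<bar>"
    if "0 \<le> a" "a < b" "b \<le> z" for a b
  proof -
    obtain c where c: "a < c" "c < b" "b powr m - a powr m = (b - a) * (m * c powr (m - 1))"
      using powr_mvt[OF assms(1) \<open>0 \<le> a\<close> \<open>a < b\<close>] by blast
    have "\<bar>b powr m - a powr m\<bar> = (m * c powr (m - 1)) * \<bar>b - a\<bar>"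
      unfolding c(3) using assms(1) by (simp add: abs_mult)
    also have "\<dots> \<le> (m * z powr (m - 1)) * \<bar>b - a\<bar>"
      using c that assms(1) by (intro mult_right_mono mult_left_mono powr_mono2) auto
    finally show ?thesis .
  qed
  consider "x < y" | "y < x" | "x = y" by linarith
  then show ?thesis
    using *[of x y] *[of y x] assms by cases (auto simp: abs_minus_commute)
qed

text \<open>Strictness has two sources: for equal norms the parallelogram law, for different norms
  strict convexity of the power on the half line.\<close>

lemma norm_midpoint_powr_less:
  fixes a b :: "'b::real_inner"
  assumes "1 < p" "a \<noteq> b"
  shows "norm ((1/2) *\<^sub>R (a + b)) powr p < (norm a powr p + norm b powr p) / 2"
proof (cases "norm a = norm b")
  case True
  have "(norm (a + b))\<^sup>2 + (norm (a - b))\<^sup>2 = 2 * (norm a)\<^sup>2 + 2 * (norm b)\<^sup>2"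
    by (simp add: power2_norm_eq_inner algebra_simps inner_commute)
  moreover have "(norm (a - b))\<^sup>2 > 0" using assms by simp
  ultimately have "(norm (a + b))\<^sup>2 < (2 * norm a)\<^sup>2"
    unfolding power_mult_distrib True[symmetric] power2_eq_square[of "2::real"] by linarith
  then have "norm (a + b) < 2 * norm a" by (rule power2_less_imp_less) simp
  then have "norm ((1/2) *\<^sub>R (a + b)) < norm a" by simp
  then have "norm ((1/2) *\<^sub>R (a + b)) powr p < norm a powr p"
    using assms by (intro powr_less_mono2) auto
  then show ?thesis using True by simp
next
  case False
  have *: "((x + y) / 2) powr p < (x powr p + y powr p) / 2" if "0 \<le> x" "x < y" for x y :: real
  proof -
    define c where "c = (x + y) / 2"
    have c: "x < c" "c < y" "c > 0" using that by (auto simp: c_def)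
    obtain z1 where z1: "x < z1" "z1 < c" "c powr p - x powr p = (c - x) * (p * z1 powr (p - 1))"
      using powr_mvt[OF assms(1) \<open>0 \<le> x\<close> c(1)] by blast
    obtain z2 where z2: "c < z2" "z2 < y" "y powr p - c powr p = (y - c) * (p * z2 powr (p - 1))"
      using powr_mvt[OF assms(1) less_imp_le[OF c(3)] c(2)] by blast
    have "z1 powr (p - 1) < z2 powr (p - 1)"
      using z1 z2 that assms by (intro powr_less_mono2) auto
    then have "(c - x) * (p * z1 powr (p - 1)) < (c - x) * (p * z2 powr (p - 1))"
      using c assms by (intro mult_strict_left_mono) auto
    moreover have "c - x = y - c" by (simp add: c_def field_simps)
    ultimately have "c powr p - x powr p < y powr p - c powr p"
      unfolding z1(3) z2(3) by (simp only:)
    then show ?thesis by (simp add: c_def)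
  qed
  have "norm ((1/2) *\<^sub>R (a + b)) powr p \<le> ((norm a + norm b) / 2) powr p"
    using assms norm_triangle_ineq[of a b] by (intro powr_mono2) auto
  also have "\<dots> < (norm a powr p + norm b powr p) / 2"
    using *[of "norm a" "norm b"] *[of "norm b" "norm a"] False by (smt (verit) norm_ge_zero)
  finally show ?thesis .
qed

text \<open>Uniform convexity for every exponent at once: the midpoint gap is positive on the compact
  set of normalised pairs with \<open>norm (a - b) powr p \<ge> e\<close>, and everything is homogeneous.\<close>

lemma uniform_convexity_powr:
  fixes p e :: real
  assumes "1 < p" "0 < e"
  obtains K where "0 < K" "\<And>a b :: 'b::euclidean_space.
    norm (a - b) powr p \<le> e * (norm a powr p + norm b powr p)
      + K * ((norm a powr p + norm b powr p) / 2 - norm ((1/2) *\<^sub>R (a + b)) powr p)"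
proof -
  define gap where "gap = (\<lambda>(a::'b, b). (norm a powr p + norm b powr p) / 2 - norm ((1/2) *\<^sub>R (a + b)) powr p)"
  define T where "T = sphere (0::'b \<times> 'b) 1 \<inter> {z. e * (norm (fst z) powr p + norm (snd z) powr p) \<le> norm (fst z - snd z) powr p}"
  have T: "compact T"
    unfolding T_def using assms
    by (intro compact_Int_closed closed_Collect_le continuous_on_powr' continuous_intros) auto
  have gap0: "gap z \<ge> 0" for z
    using norm_midpoint_powr_less[OF assms(1), of "fst z" "snd z"]
    by (cases "fst z = snd z") (auto simp: gap_def split_beta scaleR_2[symmetric] intro: less_imp_le)
  have gapT: "gap z > 0" if "z \<in> T" for z
  proof -
    have "fst z \<noteq> snd z"
    proof
      assume eq: "fst z = snd z"
      then have "norm (fst z) powr p + norm (snd z) powr p \<le> 0"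
        using that assms by (simp add: T_def mult_le_0_iff)
      then have "fst z = 0" using eq by (smt (verit) norm_eq_zero powr_non_neg powr_eq_0_iff)
      with eq that show False by (simp add: T_def norm_prod_def)
    qed
    then show ?thesis using norm_midpoint_powr_less[OF assms(1), of "fst z" "snd z"]
      by (simp add: gap_def split_beta)
  qed
  have cont: "continuous_on T gap"
    unfolding gap_def split_beta using assms by (intro continuous_on_powr' continuous_intros) auto
  have contd: "continuous_on T (\<lambda>z. norm (fst z - snd z) powr p)"
    using assms by (intro continuous_on_powr' continuous_intros) auto
  obtain m D where m: "m > 0" "\<And>z. z \<in> T \<Longrightarrow> m \<le> gap z" and D: "D > 0" "\<And>z. z \<in> T \<Longrightarrow> norm (fst z - snd z) powr p \<le> D"
  proof (cases "T = {}")
    case True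
    then show ?thesis using that[of 1 1] by auto
  next
    case False
    obtain z where "z \<in> T" "\<And>y. y \<in> T \<Longrightarrow> gap z \<le> gap y"
      using continuous_attains_inf[OF T False cont] by auto
    moreover obtain D where "\<And>z. z \<in> T \<Longrightarrow> norm (fst z - snd z) powr p \<le> D"
      using continuous_attains_sup[OF T False contd] by blast
    moreover from this have "norm (fst z - snd z) powr p \<le> max D 1" if "z \<in> T" for z
      using that by (simp add: max.coboundedI1)
    ultimately show ?thesis using that[of "gap z" "max D 1"] gapT by simp
  qed
  define K where "K = D / m"
  have K: "K > 0" using m D by (simp add: K_def)
  have unit: "norm (fst z - snd z) powr p \<le> e * (norm (fst z) powr p + norm (snd z) powr p) + K * gap z"
    if "norm z = 1" for z
  proof (cases "z \<in> T")
    case True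
    have "norm (fst z - snd z) powr p \<le> K * m" using D True m by (simp add: K_def)
    also have "\<dots> \<le> K * gap z" using K m True by simp
    finally show ?thesis using assms by (simp add: add_increasing)
  next
    case False
    then have "norm (fst z - snd z) powr p \<le> e * (norm (fst z) powr p + norm (snd z) powr p)"
      using that by (auto simp: T_def)
    then show ?thesis using gap0[of z] K by (simp add: add_increasing2)
  qed
  have "norm (a - b) powr p \<le> e * (norm a powr p + norm b powr p)
      + K * ((norm a powr p + norm b powr p) / 2 - norm ((1/2) *\<^sub>R (a + b)) powr p)" for a b :: 'b
  proof (cases "(a, b) = 0")
    case False
    define c where "c = norm (a, b)"
    have c: "c > 0" using False by (simp add: c_def)
    define a' b' where "a' = (1/c) *\<^sub>R a" and "b' = (1/c) *\<^sub>R b"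
    have ab: "a = c *\<^sub>R a'" "b = c *\<^sub>R b'" using c by (auto simp: a'_def b'_def)
    have "norm (a', b') = norm ((1/c) *\<^sub>R (a, b))" by (simp add: a'_def b'_def)
    also have "\<dots> = 1" using c unfolding norm_scaleR c_def[symmetric] by simp
    finally have u: "norm (a' - b') powr p \<le> e * (norm a' powr p + norm b' powr p)
      + K * ((norm a' powr p + norm b' powr p) / 2 - norm ((1/2) *\<^sub>R (a' + b')) powr p)"
      using unit[of "(a', b')"] by (simp add: gap_def)
    have s: "norm a = c * norm a'" "norm b = c * norm b'" "norm (a - b) = c * norm (a' - b')"
      "norm ((1/2) *\<^sub>R (a + b)) = c * norm ((1/2) *\<^sub>R (a' + b'))"
      using c by (auto simp: ab scaleR_right_diff_distrib[symmetric] scaleR_right_distrib[symmetric])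
    have "c powr p * norm (a' - b') powr p \<le> c powr p * (e * (norm a' powr p + norm b' powr p)
      + K * ((norm a' powr p + norm b' powr p) / 2 - norm ((1/2) *\<^sub>R (a' + b')) powr p))"
      using u by (intro mult_left_mono) auto
    then show ?thesis unfolding s using c by (simp add: powr_mult algebra_simps)
  qed (auto simp: zero_prod_def)
  with K show ?thesis using that by blast
qed

section \<open>Lebesgue spaces\<close>

definition Lp_fun :: "real \<Rightarrow> 'a measure \<Rightarrow> ('a \<Rightarrow> 'b::euclidean_space) \<Rightarrow> bool" where
  "Lp_fun p M f \<longleftrightarrow> f \<in> borel_measurable M \<and> integrable M (\<lambda>x. norm (f x) powr p)"

text \<open>No root is taken: exponents below 1 occur as well, and the energy is linear in these
  integrals.\<close>

definition Lp_int :: "real \<Rightarrow> 'a measure \<Rightarrow> ('a \<Rightarrow> 'b::euclidean_space) \<Rightarrow> real" where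
  "Lp_int p M f = (LINT x|M. norm (f x) powr p)"

lemma Lp_fun_measurable: "Lp_fun p M f \<Longrightarrow> f \<in> borel_measurable M"
  and Lp_fun_integrable: "Lp_fun p M f \<Longrightarrow> integrable M (\<lambda>x. norm (f x) powr p)"
  by (auto simp: Lp_fun_def)

lemma Lp_int_nonneg [simp]: "0 \<le> Lp_int p M f"
  by (simp add: Lp_int_def)

lemma Lp_funI_bound:
  assumes "f \<in> borel_measurable M" "integrable M g" "AE x in M. norm (f x) powr p \<le> g x"
  shows "Lp_fun p M f"
  unfolding Lp_fun_def using assms
  by (auto intro!: Bochner_Integration.integrable_bound[OF assms(2)] elim!: eventually_mono)

lemma Lp_int_cong_AE:
  assumes "f \<in> borel_measurable M" "g \<in> borel_measurable M" "AE x in M. f x = g x"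
  shows "Lp_int p M f = Lp_int p M g"
  unfolding Lp_int_def using assms by (intro integral_cong_AE) auto

lemma Lp_fun_cong_AE:
  assumes "Lp_fun p M f" "g \<in> borel_measurable M" "AE x in M. f x = g x"
  shows "Lp_fun p M g"
  using assms(2) Lp_fun_integrable[OF assms(1)] assms(3)
  by (intro Lp_funI_bound[of g M "\<lambda>x. norm (f x) powr p"]) auto

lemma Lp_fun_scaleR: "Lp_fun p M f \<Longrightarrow> Lp_fun p M (\<lambda>x. c *\<^sub>R f x)"
  by (auto simp: Lp_fun_def powr_mult)

lemma Lp_int_scaleR: "Lp_int p M (\<lambda>x. c *\<^sub>R f x) = \<bar>c\<bar> powr p * Lp_int p M f"
  by (simp add: Lp_int_def powr_mult)

lemma Lp_int_diff_commute: "Lp_int p M (\<lambda>x. f x - g x) = Lp_int p M (\<lambda>x. g x - f x)"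
  by (simp add: Lp_int_def norm_minus_commute)

lemma Lp_fun_uminus: "Lp_fun p M f \<Longrightarrow> Lp_fun p M (\<lambda>x. - f x)"
  by (simp add: Lp_fun_def)

text \<open>\<open>K\<close> is chosen before the measure and the functions, so that one constant
  serves all members of a sequence.\<close>

lemma Lp_int_add_eps:
  fixes p e :: real
  assumes "0 < p" "0 < e"
  obtains K where "0 < K" "\<And>M (f :: 'a \<Rightarrow> 'b::euclidean_space) g. Lp_fun p M f \<Longrightarrow> Lp_fun p M g \<Longrightarrow>
    Lp_fun p M (\<lambda>x. f x + g x) \<and>
    Lp_int p M (\<lambda>x. f x + g x) \<le> (1 + e) * Lp_int p M f + K * Lp_int p M g"
proof -
  obtain K where K: "0 < K" "\<And>x y. 0 \<le> x \<Longrightarrow> 0 \<le> y \<Longrightarrow> (x + y) powr p \<le> (1 + e) * x powr p + K * y powr p"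
    using powr_add_le_eps[OF assms] by blast
  have "Lp_fun p M (\<lambda>x. f x + g x) \<and>
    Lp_int p M (\<lambda>x. f x + g x) \<le> (1 + e) * Lp_int p M f + K * Lp_int p M g"
    if fg: "Lp_fun p M f" "Lp_fun p M g" for M and f g :: "'a \<Rightarrow> 'b"
  proof
    have pt: "norm (f x + g x) powr p \<le> (1 + e) * norm (f x) powr p + K * norm (g x) powr p" for x
    proof -
      have "norm (f x + g x) powr p \<le> (norm (f x) + norm (g x)) powr p"
        using assms by (intro powr_mono2 norm_triangle_ineq) auto
      also have "\<dots> \<le> (1 + e) * norm (f x) powr p + K * norm (g x) powr p"
        by (intro K) auto
      finally show ?thesis .
    qed
    have int: "integrable M (\<lambda>x. (1 + e) * norm (f x) powr p + K * norm (g x) powr p)"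
      using fg by (auto simp: Lp_fun_def)
    show sum: "Lp_fun p M (\<lambda>x. f x + g x)"
      using fg pt int by (intro Lp_funI_bound[OF _ int]) (auto simp: Lp_fun_def)
    have "Lp_int p M (\<lambda>x. f x + g x) \<le> (LINT x|M. (1 + e) * norm (f x) powr p + K * norm (g x) powr p)"
      unfolding Lp_int_def using Lp_fun_integrable[OF sum] int pt by (intro integral_mono) auto
    also have "\<dots> = (1 + e) * Lp_int p M f + K * Lp_int p M g"
      using fg by (simp add: Lp_int_def Lp_fun_def)
    finally show "Lp_int p M (\<lambda>x. f x + g x) \<le> (1 + e) * Lp_int p M f + K * Lp_int p M g" .
  qed
  then show ?thesis using K(1) that by blast
qed

lemma Lp_fun_add:
  assumes "0 < p" "Lp_fun p M f" "Lp_fun p M g"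
  shows "Lp_fun p M (\<lambda>x. f x + g x)"
  using Lp_int_add_eps[OF assms(1) zero_less_one] assms(2,3) by metis

lemma Lp_fun_diff:
  assumes "0 < p" "Lp_fun p M f" "Lp_fun p M g"
  shows "Lp_fun p M (\<lambda>x. f x - g x)"
  using Lp_fun_add[OF assms(1,2) Lp_fun_uminus[OF assms(3)]] by simp

lemma Lp_int_add_le:
  assumes "1 \<le> p" "Lp_fun p M f" "Lp_fun p M g"
  shows "Lp_int p M (\<lambda>x. f x + g x) \<le> 2 powr (p - 1) * (Lp_int p M f + Lp_int p M g)"
proof -
  have pt: "norm (f x + g x) powr p \<le> 2 powr (p - 1) * (norm (f x) powr p + norm (g x) powr p)" for x
  proof -
    have "norm (f x + g x) powr p \<le> (norm (f x) + norm (g x)) powr p"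
      using assms by (intro powr_mono2 norm_triangle_ineq) auto
    also have "\<dots> \<le> 2 powr (p - 1) * (norm (f x) powr p + norm (g x) powr p)"
      using assms by (intro powr_add_le) auto
    finally show ?thesis .
  qed
  have "Lp_int p M (\<lambda>x. f x + g x) \<le> (LINT x|M. 2 powr (p - 1) * (norm (f x) powr p + norm (g x) powr p))"
    unfolding Lp_int_def using assms Lp_fun_add[of p M f g] pt
    by (intro integral_mono) (auto simp: Lp_fun_def)
  then show ?thesis using assms by (simp add: Lp_int_def Lp_fun_def)
qed

lemma Lp_int_diff_le:
  assumes "1 \<le> p" "Lp_fun p M f" "Lp_fun p M g"
  shows "Lp_int p M (\<lambda>x. f x - g x) \<le> 2 powr (p - 1) * (Lp_int p M f + Lp_int p M g)"
proof -
  have "Lp_int p M (\<lambda>x. - g x) = Lp_int p M g" by (simp add: Lp_int_def)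
  then show ?thesis
    using Lp_int_add_le[OF assms(1,2) Lp_fun_uminus[OF assms(3)]] by simp
qed

lemma Lp_int_triangle:
  assumes "1 \<le> p" "Lp_fun p M f" "Lp_fun p M g" "Lp_fun p M h"
  shows "Lp_int p M (\<lambda>x. f x - h x) \<le> 2 powr (p - 1) * (Lp_int p M (\<lambda>x. f x - g x) + Lp_int p M (\<lambda>x. g x - h x))"
  using Lp_int_add_le[OF assms(1) Lp_fun_diff[OF _ assms(2,3)] Lp_fun_diff[OF _ assms(3,4)]] assms(1)
  by simp

lemma Lp_int_zero_AE:
  assumes "Lp_fun p M f" "Lp_int p M f \<le> 0"
  shows "AE x in M. f x = 0"
proof -
  have "Lp_int p M f = 0" using assms(2) by (simp add: antisym)
  then have "AE x in M. norm (f x) powr p = 0"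
    using integral_nonneg_eq_0_iff_AE[OF Lp_fun_integrable[OF assms(1)]] by (simp add: Lp_int_def)
  then show ?thesis by simp
qed

text \<open>There is no norm when \<open>p < 1\<close>, so the triangle inequality is replaced by
  \<open>Lp_int_add_eps\<close>, applied once to \<open>g\<close> plus the difference and once to
  \<open>f k\<close> minus the difference.\<close>

lemma Lp_int_continuous:
  assumes "0 < p" "\<And>k. Lp_fun p M (f k)" "Lp_fun p M g"
    and lim: "(\<lambda>k. Lp_int p M (\<lambda>x. f k x - g x)) \<longlonglongrightarrow> 0"
  shows "(\<lambda>k. Lp_int p M (f k)) \<longlonglongrightarrow> Lp_int p M g"
proof (rule tendsto_sandwich)
  let ?d = "\<lambda>k. Lp_int p M (\<lambda>x. f k x - g x)"
  have "(\<lambda>k. Lp_int p M (f k) - Lp_int p M g) \<longlonglongrightarrow> 0"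
  proof (rule LIMSEQ_I)
    fix r :: real assume r: "r > 0"
    define L where "L = Lp_int p M g"
    have L: "L \<ge> 0" by (simp add: L_def)
    \<comment> \<open>The choice makes \<open>e * (L + r)\<close> at most \<open>r / 4\<close>, and
      \<open>L + r\<close> also bounds the integral of \<open>f k\<close> as soon as
      \<open>up\<close> is known.\<close>
    define e where "e = min 1 (r / (4 * (L + r + 1)))"
    have e: "0 < e" "e \<le> 1" using r L by (auto simp: e_def)
    have eL: "e * L \<le> r / 4" "e * (L + r) \<le> r / 4"
    proof -
      have "e * (L + r + 1) \<le> r / 4"
        using r L by (simp add: e_def min_def field_simps)
      then show "e * (L + r) \<le> r / 4" using e by (simp add: algebra_simps)
      then show "e * L \<le> r / 4" using e r by (simp add: algebra_simps) (smt (verit) mult_pos_pos)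
    qed
    obtain K where K: "0 < K" "\<And>f g :: 'a \<Rightarrow> 'b. Lp_fun p M f \<Longrightarrow> Lp_fun p M g \<Longrightarrow>
       Lp_fun p M (\<lambda>x. f x + g x) \<and> Lp_int p M (\<lambda>x. f x + g x) \<le> (1 + e) * Lp_int p M f + K * Lp_int p M g"
      using Lp_int_add_eps[OF assms(1) e(1)] by metis
    have "eventually (\<lambda>k. ?d k < r / (4 * K)) sequentially"
      using lim K r by (intro order_tendstoD) auto
    then obtain N where N: "\<And>k. k \<ge> N \<Longrightarrow> ?d k < r / (4 * K)"
      by (auto simp: eventually_sequentially)
    have "norm (Lp_int p M (f k) - Lp_int p M g - 0) < r" if "k \<ge> N" for k
    proof -
      have d: "K * ?d k < r / 4" using N[OF that] K by (simp add: field_simps)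
      have fd: "Lp_fun p M (\<lambda>x. f k x - g x)" using assms by (intro Lp_fun_diff) auto
      have "Lp_int p M (f k) \<le> (1 + e) * L + K * ?d k"
        using K(2)[OF assms(3) fd] by (simp add: L_def)
      then have up: "Lp_int p M (f k) < L + r / 2" using d eL by (simp add: algebra_simps)
      have "L \<le> (1 + e) * Lp_int p M (f k) + K * ?d k"
        using K(2)[OF assms(2)[of k] Lp_fun_uminus[OF fd]] by (simp add: L_def Lp_int_diff_commute[of p M "f k"])
      moreover have "e * Lp_int p M (f k) \<le> e * (L + r)" using up e r by (intro mult_left_mono) auto
      ultimately have "L < Lp_int p M (f k) + r / 2" using d eL by (simp add: algebra_simps)
      with up show ?thesis using r by (simp add: L_def abs_less_iff)
    qed
    then show "\<exists>N. \<forall>k\<ge>N. norm (Lp_int p M (f k) - Lp_int p M g - 0) < r" by blast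
  qed
  then have "(\<lambda>k. Lp_int p M (f k) - Lp_int p M g + Lp_int p M g) \<longlonglongrightarrow> 0 + Lp_int p M g"
    by (intro tendsto_intros)
  then show *: "(\<lambda>k. Lp_int p M (f k)) \<longlonglongrightarrow> Lp_int p M g" by simp
  show "(\<lambda>k. Lp_int p M (f k)) \<longlonglongrightarrow> Lp_int p M g" by (rule *)
qed auto

lemma Lp_fun_lower:
  assumes "finite_measure M" "0 < s" "s \<le> p" "Lp_fun p M f"
  shows "Lp_fun s M f"
proof (cases "s = p")
  case False
  interpret finite_measure M by fact
  obtain C where C: "C > 0" "\<forall>x\<ge>0. x powr s \<le> 1 + C * x powr p"
    using powr_le_eps_add[of 1 s p] assms False by auto
  have int: "integrable M (\<lambda>x. 1 + C * norm (f x) powr p)"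
    using assms by (auto simp: Lp_fun_def)
  show ?thesis using Lp_fun_measurable[OF assms(4)] C by (intro Lp_funI_bound[OF _ int]) auto
qed (use assms in simp)

text \<open>Takes the place of Hoelder's inequality on a finite measure space: a small additive
  error is harmless in limits and in the choice of \<open>lam_star\<close>.\<close>

lemma Lp_int_lower_eps:
  assumes "finite_measure M" "0 < s" "s < p" "0 < e"
  obtains C where "0 < C"
    "\<And>f :: 'a \<Rightarrow> 'b::euclidean_space. Lp_fun p M f \<Longrightarrow> Lp_int s M f \<le> e + C * Lp_int p M f"
proof -
  interpret finite_measure M by fact
  define m where "m = measure M (space M)"
  define e' where "e' = e / (m + 1)"
  have "m \<ge> 0" by (simp add: m_def)
  then have e': "e' > 0" "e' * m \<le> e"
    using assms by (auto simp: e'_def field_simps)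
  obtain C where C: "C > 0" "\<forall>x\<ge>0. x powr s \<le> e' + C * x powr p"
    using powr_le_eps_add[of e' s p] assms e' by auto
  have "Lp_int s M f \<le> e + C * Lp_int p M f" if f: "Lp_fun p M f" for f :: "'a \<Rightarrow> 'b"
  proof -
    have "Lp_int s M f \<le> (LINT x|M. e' + C * norm (f x) powr p)"
      unfolding Lp_int_def using C f Lp_fun_lower[OF assms(1,2) less_imp_le[OF assms(3)] f]
      by (intro integral_mono) (auto simp: Lp_fun_def)
    also have "\<dots> = e' * m + C * Lp_int p M f"
      using f by (simp add: Lp_fun_def Lp_int_def m_def)
    finally show ?thesis using e' by simp
  qed
  then show ?thesis using C that by blast
qed

lemma Lp_convergence_lower:
  assumes "finite_measure M" "0 < s" "s \<le> p" "\<And>k. Lp_fun p M (f k)"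
    and "(\<lambda>k. Lp_int p M (f k)) \<longlonglongrightarrow> 0"
  shows "(\<lambda>k. Lp_int s M (f k)) \<longlonglongrightarrow> 0"
proof (cases "s = p")
  case False
  then have sp: "s < p" using assms(3) by simp
  show ?thesis
  proof (rule LIMSEQ_I)
    fix r :: real assume r: "0 < r"
    obtain C where C: "0 < C" "\<And>f :: 'a \<Rightarrow> 'b. Lp_fun p M f \<Longrightarrow> Lp_int s M f \<le> r / 2 + C * Lp_int p M f"
      using Lp_int_lower_eps[OF assms(1,2) sp half_gt_zero[OF r]] by metis
    have "eventually (\<lambda>k. Lp_int p M (f k) < r / (2 * C)) sequentially"
      using assms(5) C r by (intro order_tendstoD) auto
    then obtain N where N: "\<And>k. k \<ge> N \<Longrightarrow> Lp_int p M (f k) < r / (2 * C)"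
      by (auto simp: eventually_sequentially)
    have "norm (Lp_int s M (f k) - 0) < r" if "k \<ge> N" for k
    proof -
      have "C * Lp_int p M (f k) < r / 2" using N[OF that] C by (simp add: field_simps)
      then show ?thesis using C(2)[OF assms(4)[of k]] by simp
    qed
    then show "\<exists>N. \<forall>k\<ge>N. norm (Lp_int s M (f k) - 0) < r" by blast
  qed
qed (use assms in simp)

lemma Lp_fun_interpolate:
  assumes "0 < s" "s < r" "r < t" "Lp_fun s M f" "Lp_fun t M f"
  shows "Lp_fun r M f"
proof -
  obtain C where C: "C > 0" "\<forall>x\<ge>0. x powr r \<le> 1 * x powr t + C * x powr s"
    using powr_interpolate[of 1 s r t] assms by auto
  have int: "integrable M (\<lambda>x. 1 * norm (f x) powr t + C * norm (f x) powr s)"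
    using assms by (auto simp: Lp_fun_def)
  show ?thesis using Lp_fun_measurable[OF assms(4)] C by (intro Lp_funI_bound[OF _ int]) auto
qed

lemma Lp_int_interpolate:
  assumes "0 < s" "s < r" "r < t" "0 < e"
  obtains C where "0 < C"
    "\<And>M (f :: 'a \<Rightarrow> 'b::euclidean_space). Lp_fun s M f \<Longrightarrow> Lp_fun t M f \<Longrightarrow>
       Lp_int r M f \<le> e * Lp_int t M f + C * Lp_int s M f"
proof -
  obtain C where C: "C > 0" "\<forall>x\<ge>0. x powr r \<le> e * x powr t + C * x powr s"
    using powr_interpolate[of e s r t] assms by auto
  have "Lp_int r M f \<le> e * Lp_int t M f + C * Lp_int s M f"
    if f: "Lp_fun s M f" "Lp_fun t M f" for M and f :: "'a \<Rightarrow> 'b"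
  proof -
    have "Lp_int r M f \<le> (LINT x|M. e * norm (f x) powr t + C * norm (f x) powr s)"
      unfolding Lp_int_def using C f Lp_fun_interpolate[OF assms(1-3) f]
      by (intro integral_mono) (auto simp: Lp_fun_def)
    also have "\<dots> = e * Lp_int t M f + C * Lp_int s M f"
      using f by (simp add: Lp_fun_def Lp_int_def)
    finally show ?thesis .
  qed
  then show ?thesis using C that by blast
qed

section \<open>Almost everywhere limits and completeness\<close>

lemma Lp_AE_convergent_subseq:
  assumes "0 < p" "\<And>k. Lp_fun p M (f k)" "Lp_fun p M g"
    and lim: "(\<lambda>k. Lp_int p M (\<lambda>x. f k x - g x)) \<longlonglongrightarrow> 0"
  obtains \<sigma> :: "nat \<Rightarrow> nat" where "strict_mono \<sigma>" "AE x in M. (\<lambda>k. f (\<sigma> k) x) \<longlonglongrightarrow> g x"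
proof -
  have "integrable M (\<lambda>x. norm (f k x - g x) powr p)" for k
    using Lp_fun_diff[OF assms(1) assms(2) assms(3)] by (simp add: Lp_fun_def)
  then obtain \<sigma> where \<sigma>: "strict_mono \<sigma>" "AE x in M. (\<lambda>k. norm (f (\<sigma> k) x - g x) powr p) \<longlonglongrightarrow> 0"
    using tendsto_L1_AE_subseq[of M "\<lambda>k x. norm (f k x - g x) powr p"] lim
    by (auto simp: Lp_int_def)
  have "AE x in M. (\<lambda>k. f (\<sigma> k) x) \<longlonglongrightarrow> g x"
    using \<sigma>(2)
  proof eventually_elim
    case (elim x)
    have "(\<lambda>k. (norm (f (\<sigma> k) x - g x) powr p) powr (1 / p)) \<longlonglongrightarrow> 0"
      using tendsto_powr'[OF elim tendsto_const[of "1 / p"]] assms(1) by simp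
    then have "(\<lambda>k. norm (f (\<sigma> k) x - g x)) \<longlonglongrightarrow> 0"
      using assms(1) by (simp add: powr_powr)
    then show ?case by (simp add: tendsto_norm_zero_iff LIM_zero_iff)
  qed
  with \<sigma>(1) show ?thesis using that by blast
qed

text \<open>The bounds may vary with \<open>k\<close>, because in the embedding they are gradient
  integrals of approximants that merely converge.\<close>

lemma Lp_int_Fatou:
  assumes "0 < p" "\<And>k. Lp_fun p M (f k)" "g \<in> borel_measurable M"
    and "AE x in M. (\<lambda>k. f k x) \<longlonglongrightarrow> g x" and "\<And>k. Lp_int p M (f k) \<le> c k" "c \<longlonglongrightarrow> c0"
  shows "Lp_fun p M g" "Lp_int p M g \<le> c0"
proof -
  have c0: "0 \<le> c0"
    using order_trans[OF Lp_int_nonneg assms(5)] by (intro LIMSEQ_le_const[OF assms(6)]) auto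
  have "(\<integral>\<^sup>+x. ennreal (norm (g x) powr p) \<partial>M) \<le> (\<integral>\<^sup>+x. liminf (\<lambda>k. ennreal (norm (f k x) powr p)) \<partial>M)"
  proof (rule nn_integral_mono_AE)
    show "AE x in M. ennreal (norm (g x) powr p) \<le> liminf (\<lambda>k. ennreal (norm (f k x) powr p))"
      using assms(4)
    proof eventually_elim
      case (elim x)
      have "(\<lambda>k. norm (f k x) powr p) \<longlonglongrightarrow> norm (g x) powr p"
        using assms(1) by (intro tendsto_powr'[OF tendsto_norm[OF elim] tendsto_const]) auto
      then have "(\<lambda>k. ennreal (norm (f k x) powr p)) \<longlonglongrightarrow> ennreal (norm (g x) powr p)"
        by (rule tendsto_ennrealI)
      from lim_imp_Liminf[OF trivial_limit_sequentially this] show ?case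
        by (simp only: order_refl)
    qed
  qed
  also have "\<dots> \<le> liminf (\<lambda>k. \<integral>\<^sup>+x. ennreal (norm (f k x) powr p) \<partial>M)"
    using assms(2) by (intro nn_integral_liminf) (auto simp: Lp_fun_def)
  also have "\<dots> = liminf (\<lambda>k. ennreal (Lp_int p M (f k)))"
    using assms(2) by (simp add: Lp_int_def Lp_fun_def nn_integral_eq_integral)
  also have "\<dots> \<le> liminf (\<lambda>k. ennreal (c k))"
    using assms(5) by (intro Liminf_mono always_eventually allI ennreal_leI)
  also have "\<dots> = ennreal c0"
    using assms(6) by (intro lim_imp_Liminf tendsto_ennrealI) auto
  finally have le: "(\<integral>\<^sup>+x. ennreal (norm (g x) powr p) \<partial>M) \<le> ennreal c0" .
  show g: "Lp_fun p M g"
    unfolding Lp_fun_def using assms(3) le by (auto intro!: integrableI_bounded simp: order_le_less_trans)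
  show "Lp_int p M g \<le> c0"
    using le c0 Lp_fun_integrable[OF g] by (simp add: Lp_int_def nn_integral_eq_integral)
qed

lemma Lp_complete:
  assumes "1 \<le> p" "\<And>k. Lp_fun p M (f k)"
    and Cauchy: "\<And>e. 0 < e \<Longrightarrow> \<exists>N. \<forall>k\<ge>N. \<forall>l\<ge>N. Lp_int p M (\<lambda>x. f k x - f l x) \<le> e"
  obtains g where "Lp_fun p M g" "(\<lambda>k. Lp_int p M (\<lambda>x. f k x - g x)) \<longlonglongrightarrow> 0"
proof -
  have "\<exists>N. \<forall>k\<ge>N. \<forall>l\<ge>N. Lp_int p M (\<lambda>x. f k x - f l x) \<le> (1/4) ^ j" for j :: nat
    using Cauchy by simp
  then obtain N where N: "\<And>j k l. k \<ge> N j \<Longrightarrow> l \<ge> N j \<Longrightarrow> Lp_int p M (\<lambda>x. f k x - f l x) \<le> (1/4) ^ j"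
    by metis
  \<comment> \<open>The maximum secures strict growth and \<open>N j \<le> \<sigma> j\<close> at
    once.\<close>
  define \<sigma> where "\<sigma> = rec_nat (N 0) (\<lambda>j s. max (Suc s) (N (Suc j)))"
  have \<sigma>: "strict_mono \<sigma>" by (simp add: strict_mono_Suc_iff \<sigma>_def less_max_iff_disj)
  have \<sigma>N: "\<sigma> j \<ge> N j" for j by (cases j) (auto simp: \<sigma>_def)
  \<comment> \<open>The integrals of \<open>a j\<close> are at most \<open>(1/4) ^ j\<close>, so the
    sum of \<open>2 ^ j * a j\<close> has a finite integral. Hence \<open>2 ^ j * a j x\<close> is
    bounded for almost every \<open>x\<close>, and the increments decay geometrically with ratio
    \<open>(1/2) powr (1 / p)\<close>.\<close>
  define a where "a = (\<lambda>j x. norm (f (\<sigma> (Suc j)) x - f (\<sigma> j) x) powr p)"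
  have a: "integrable M (a j)" "(LINT x|M. a j x) \<le> (1/4) ^ j" for j
  proof -
    show "integrable M (a j)"
      using Lp_fun_diff[of p M "f (\<sigma> (Suc j))" "f (\<sigma> j)"] assms by (simp add: a_def Lp_fun_def)
    have "\<sigma> (Suc j) \<ge> N j" using \<sigma>N[of j] strict_monoD[OF \<sigma>, of j "Suc j"] by simp
    then show "(LINT x|M. a j x) \<le> (1/4) ^ j" using N[of j "\<sigma> (Suc j)" "\<sigma> j"] \<sigma>N by (simp add: a_def Lp_int_def)
  qed
  have [measurable]: "f k \<in> borel_measurable M" for k using assms by (simp add: Lp_fun_def)
  have [measurable]: "a j \<in> borel_measurable M" for j by (simp add: a_def)
  have "(\<integral>\<^sup>+x. (\<Sum>j. ennreal (2 ^ j * a j x)) \<partial>M) = (\<Sum>j. \<integral>\<^sup>+x. ennreal (2 ^ j * a j x) \<partial>M)"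
    by (intro nn_integral_suminf) simp
  also have "\<dots> \<le> (\<Sum>j. ennreal ((1/2) ^ j))"
  proof (intro suminf_le summableI)
    fix j
    have "(\<integral>\<^sup>+x. ennreal (2 ^ j * a j x) \<partial>M) = ennreal (2 ^ j * (LINT x|M. a j x))"
      using a by (subst nn_integral_eq_integral) (auto simp: a_def)
    also have "\<dots> \<le> ennreal (2 ^ j * (1/4) ^ j)"
      using a by (intro ennreal_leI mult_left_mono) auto
    also have "2 ^ j * (1/4::real) ^ j = (1/2) ^ j" by (simp add: power_mult_distrib[symmetric])
    finally show "(\<integral>\<^sup>+x. ennreal (2 ^ j * a j x) \<partial>M) \<le> ennreal ((1/2) ^ j)" .
  qed
  also have "\<dots> = ennreal (\<Sum>j. (1/2) ^ j)"
    by (intro suminf_ennreal2 summable_geometric) auto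
  also have "\<dots> < \<infinity>"
    by (simp only: ennreal_less_top infinity_ennreal_def)
  finally have "(\<integral>\<^sup>+x. (\<Sum>j. ennreal (2 ^ j * a j x)) \<partial>M) \<noteq> \<infinity>" by simp
  then have "AE x in M. (\<Sum>j. ennreal (2 ^ j * a j x)) \<noteq> \<infinity>"
    by (intro nn_integral_PInf_AE) auto
  then have conv: "AE x in M. convergent (\<lambda>j. f (\<sigma> j) x)"
  proof eventually_elim
    case (elim x)
    then have "summable (\<lambda>j. 2 ^ j * a j x)"
      by (intro summable_suminf_not_top) (auto simp: a_def)
    then have "Bseq (\<lambda>j. 2 ^ j * a j x)"
      by (intro convergent_imp_Bseq) (auto intro: convergentI summable_LIMSEQ_zero)
    then obtain C where C: "C > 0" "\<And>j. norm (2 ^ j * a j x) \<le> C" by (auto elim: BseqE)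
    have "norm (f (\<sigma> (Suc j)) x - f (\<sigma> j) x) \<le> C powr (1 / p) * ((1/2) powr (1 / p)) ^ j" for j
    proof -
      have "a j x \<le> C * (1/2) ^ j"
        using C(2)[of j] by (simp add: a_def field_simps)
      then have "a j x powr (1 / p) \<le> (C * (1/2) ^ j) powr (1 / p)"
        using assms(1) by (intro powr_mono2) (auto simp: a_def)
      also have "\<dots> = C powr (1 / p) * ((1/2) powr (1 / p)) ^ j"
        using C by (simp add: powr_mult powr_realpow[symmetric] powr_powr mult.commute)
      finally show ?thesis using assms(1) by (simp add: a_def powr_powr)
    qed
    moreover define h where "h = (1/2::real) powr (1 / p)"
    ultimately have "norm (f (\<sigma> (Suc j)) x - f (\<sigma> j) x) \<le> C powr (1 / p) * h ^ j" for j
      by simp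
    moreover have "h < 1 powr (1 / p)"
      unfolding h_def using assms(1) by (intro powr_less_mono2) auto
    then have "norm h < 1" by (simp add: h_def)
    ultimately have "summable (\<lambda>j. f (\<sigma> (Suc j)) x - f (\<sigma> j) x)"
      by (intro summable_comparison_test'[OF summable_mult[OF summable_geometric], where N = 0])
    then have "convergent (\<lambda>n. \<Sum>j<n. f (\<sigma> (Suc j)) x - f (\<sigma> j) x)"
      by (simp add: summable_iff_convergent)
    then have "convergent (\<lambda>n. f (\<sigma> n) x - f (\<sigma> 0) x)"
      by (simp add: sum_lessThan_telescope[of "\<lambda>j. f (\<sigma> j) x"])
    from convergent_add[OF this convergent_const[of "f (\<sigma> 0) x"]] show ?case
      by simp
  qed
  define g where "g = (\<lambda>x. lim (\<lambda>j. f (\<sigma> j) x))"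
  have gm: "g \<in> borel_measurable M"
    unfolding g_def by (intro borel_measurable_lim_metric) simp
  have glim: "AE x in M. (\<lambda>j. f (\<sigma> j) x) \<longlonglongrightarrow> g x"
    using conv by eventually_elim (simp add: g_def convergent_LIMSEQ_iff)
  \<comment> \<open>Fatou's lemma along the subsequence carries the Cauchy bound over to the
    limit.\<close>
  have tail: "Lp_fun p M (\<lambda>x. f k x - g x) \<and> Lp_int p M (\<lambda>x. f k x - g x) \<le> (1/4) ^ i" if k: "k \<ge> N i" for i k
  proof -
    have ae: "AE x in M. (\<lambda>j. f k x - f (\<sigma> (j + i)) x) \<longlonglongrightarrow> f k x - g x"
      using glim by eventually_elim (intro tendsto_intros LIMSEQ_ignore_initial_segment)
    have "\<sigma> (j + i) \<ge> N i" for j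
      using \<sigma>N[of i] strict_mono_leD[OF \<sigma>, of i "j + i"] by simp
    then have le: "Lp_int p M (\<lambda>x. f k x - f (\<sigma> (j + i)) x) \<le> (1/4) ^ i" for j
      using N k by blast
    have lp: "Lp_fun p M (\<lambda>x. f k x - f (\<sigma> (j + i)) x)" for j
      using assms by (intro Lp_fun_diff) auto
    show ?thesis
      using Lp_int_Fatou[OF _ lp _ ae le tendsto_const] assms(1) gm by auto
  qed
  have "Lp_fun p M g"
    using Lp_fun_diff[of p M "f (N 0)" "\<lambda>x. f (N 0) x - g x"] tail[of 0 "N 0"] assms by simp
  moreover have "(\<lambda>k. Lp_int p M (\<lambda>x. f k x - g x)) \<longlonglongrightarrow> 0"
  proof (rule LIMSEQ_I)
    fix r :: real assume "r > 0"
    then obtain i where i: "(1/4::real) ^ i < r" using real_arch_pow_inv[of r "1/4"] by auto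
    then show "\<exists>n. \<forall>k\<ge>n. norm (Lp_int p M (\<lambda>x. f k x - g x) - 0) < r"
      using tail[of i] by (intro exI[of _ "N i"]) force
  qed
  ultimately show ?thesis using that by blast
qed

text \<open>For \<open>a \<noteq> 0\<close> the norm is the square root of a positive quadratic
  polynomial in \<open>t\<close>. For \<open>a = 0\<close> the difference quotient is of order
  \<open>\<bar>t\<bar> powr (m - 1)\<close>, which vanishes in the limit because
  \<open>m > 1\<close>; the formula gives 0 there too.\<close>

lemma has_derivative_norm_powr:
  fixes a b :: "'b::euclidean_space"
  assumes "1 < m"
  shows "((\<lambda>t. norm (a + t *\<^sub>R b) powr m) has_real_derivative m * (norm a powr (m - 2) * (a \<bullet> b))) (at 0)"
proof (cases "a = 0")
  case True
  have "(\<lambda>t. \<bar>t\<bar> powr (m - 1) * norm b powr m) \<midarrow>0\<rightarrow> \<bar>0\<bar> powr (m - 1) * norm b powr m"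
    using assms by (intro tendsto_mult tendsto_const tendsto_powr'[OF tendsto_rabs[OF tendsto_ident_at]]) auto
  then have lim: "(\<lambda>t. \<bar>t\<bar> powr (m - 1) * norm b powr m) \<midarrow>0\<rightarrow> 0" by simp
  have "(\<lambda>t. norm (t *\<^sub>R b) powr m / t) \<midarrow>0\<rightarrow> 0"
  proof (rule Lim_null_comparison[OF _ lim])
    have "norm (norm (t *\<^sub>R b) powr m / t) \<le> \<bar>t\<bar> powr (m - 1) * norm b powr m" for t
    proof (cases "t = 0")
      case False
      then have "\<bar>t\<bar> powr (m - 1) = \<bar>t\<bar> powr m / \<bar>t\<bar>" by (simp add: powr_diff)
      then show ?thesis by (simp add: powr_mult)
    qed simp
    then show "\<forall>\<^sub>F t in at 0. norm (norm (t *\<^sub>R b) powr m / t) \<le> \<bar>t\<bar> powr (m - 1) * norm b powr m"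
      by simp
  qed
  then show ?thesis using True by (simp add: DERIV_def)
next
  case False
  then have pos: "a \<bullet> a > 0" by simp
  have eq: "norm x powr m = (x \<bullet> x) powr (m / 2)" for x :: 'b
    by (simp add: norm_eq_sqrt_inner powr_half_sqrt[symmetric] powr_powr)
  have "((\<lambda>t. ((a + t *\<^sub>R b) \<bullet> (a + t *\<^sub>R b)) powr (m / 2)) has_real_derivative
      (m / 2) * (a \<bullet> a) powr (m / 2 - 1) * (2 * (a \<bullet> b))) (at 0)"
  proof -
    have "((\<lambda>t. (a \<bullet> a + 2 * t * (a \<bullet> b) + t\<^sup>2 * (b \<bullet> b)) powr (m / 2)) has_real_derivative
      (m / 2) * (a \<bullet> a + 2 * 0 * (a \<bullet> b) + 0\<^sup>2 * (b \<bullet> b)) powr (m / 2 - 1) * (2 * (a \<bullet> b))) (at 0)"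
      using pos by (auto intro!: derivative_eq_intros)
    then show ?thesis
      by (simp add: inner_add_left inner_add_right inner_commute power2_eq_square algebra_simps)
  qed
  moreover have e2: "(m / 2) * (a \<bullet> a) powr (m / 2 - 1) * (2 * (a \<bullet> b)) = m * (norm a powr (m - 2) * (a \<bullet> b))"
  proof -
    have "(a \<bullet> a) powr (m / 2 - 1) = norm a powr (m - 2)"
      by (simp add: norm_eq_sqrt_inner powr_half_sqrt[symmetric] powr_powr diff_divide_distrib)
    then show ?thesis by simp
  qed
  ultimately show ?thesis unfolding eq e2 by (simp only: eq)
qed

lemma norm_powr_diff_quotient_bound:
  fixes a b :: "'b::euclidean_space"
  assumes "1 < m" "0 < t" "t \<le> 1"
  shows "\<bar>(norm (a + t *\<^sub>R b) powr m - norm a powr m) / t\<bar> \<le> m * (norm a + norm b) powr m"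
proof -
  define z where "z = norm a + norm b"
  have "norm (a + t *\<^sub>R b) \<le> norm a + t * norm b"
    using assms norm_triangle_ineq[of a "t *\<^sub>R b"] by simp
  moreover have "t * norm b \<le> 1 * norm b" using assms by (intro mult_right_mono) auto
  ultimately have le: "norm (a + t *\<^sub>R b) \<le> z" by (simp add: z_def)
  have "\<bar>norm (a + t *\<^sub>R b) - norm a\<bar> \<le> t * norm b"
    using assms norm_triangle_ineq3[of "a + t *\<^sub>R b" a] by simp
  also have "\<dots> \<le> t * z" using assms by (intro mult_left_mono) (auto simp: z_def)
  finally have d: "\<bar>norm (a + t *\<^sub>R b) - norm a\<bar> \<le> t * z" .
  have "\<bar>norm (a + t *\<^sub>R b) powr m - norm a powr m\<bar> \<le> m * z powr (m - 1) * \<bar>norm (a + t *\<^sub>R b) - norm a\<bar>"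
    using assms le by (intro abs_powr_diff_le) (auto simp: z_def)
  also have "\<dots> \<le> m * z powr (m - 1) * (t * z)"
    using assms d by (intro mult_left_mono) auto
  also have "\<dots> = t * (m * z powr m)"
  proof (cases "z = 0")
    case False
    then have "z > 0" by (simp add: z_def add_nonneg_eq_0_iff less_le)
    then show ?thesis by (simp add: powr_diff)
  qed simp
  finally show ?thesis using assms by (simp add: abs_divide z_def field_simps)
qed

text \<open>Formulated along a sequence of step sizes, since one-sided criticality provides no more
  than that and dominated convergence is sequential.\<close>

lemma Lp_int_derivative:
  fixes f h :: "'a \<Rightarrow> 'b::euclidean_space" and s :: "nat \<Rightarrow> real"
  assumes "1 < m" "Lp_fun m M f" "Lp_fun m M h" and s: "s \<longlonglongrightarrow> 0" "\<And>k. 0 < s k" "\<And>k. s k \<le> 1"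
  shows "integrable M (\<lambda>x. norm (f x) powr (m - 2) * (f x \<bullet> h x))"
    and "(\<lambda>k. (Lp_int m M (\<lambda>x. f x + s k *\<^sub>R h x) - Lp_int m M f) / s k)
      \<longlonglongrightarrow> m * (LINT x|M. norm (f x) powr (m - 2) * (f x \<bullet> h x))"
proof -
  have [measurable]: "f \<in> borel_measurable M" "h \<in> borel_measurable M"
    using assms by (auto simp: Lp_fun_def)
  define F where "F = (\<lambda>k x. (norm (f x + s k *\<^sub>R h x) powr m - norm (f x) powr m) / s k)"
  define D where "D = (\<lambda>x. m * (norm (f x) powr (m - 2) * (f x \<bullet> h x)))"
  have [measurable]: "D \<in> borel_measurable M" by (simp add: D_def)
  have [measurable]: "\<And>k. F k \<in> borel_measurable M" by (simp add: F_def)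
  have "Lp_fun m M (\<lambda>x. norm (f x) + norm (h x))"
    using assms by (intro Lp_fun_add) (auto simp: Lp_fun_def)
  then have w: "integrable M (\<lambda>x. m * (norm (f x) + norm (h x)) powr m)"
    by (auto simp: Lp_fun_def)
  have sf: "filterlim s (at 0) sequentially"
    using s(1) less_imp_neq[OF s(2), symmetric] by (simp add: filterlim_at)
  have lim: "(\<lambda>k. F k x) \<longlonglongrightarrow> D x" for x
    using filterlim_compose[OF has_derivative_norm_powr[OF assms(1), of "f x" "h x", unfolded DERIV_def] sf]
    unfolding F_def D_def by (simp only: add_0 add_0_right scaleR_zero_left)
  have bound: "norm (F k x) \<le> m * (norm (f x) + norm (h x)) powr m" for k x
    unfolding F_def real_norm_def using assms by (intro norm_powr_diff_quotient_bound) auto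
  have intD: "integrable M D"
    by (rule integrable_dominated_convergence[OF _ _ w, of D F]) (auto simp only: lim bound AE_I2 \<open>D \<in> _\<close> \<open>\<And>k. F k \<in> _\<close>)
  have int: "(\<lambda>k. integral\<^sup>L M (F k)) \<longlonglongrightarrow> integral\<^sup>L M D"
    by (rule integral_dominated_convergence[OF _ _ w]) (auto simp only: lim bound AE_I2 \<open>D \<in> _\<close> \<open>\<And>k. F k \<in> _\<close>)
  show "integrable M (\<lambda>x. norm (f x) powr (m - 2) * (f x \<bullet> h x))"
    using intD assms(1) by (simp add: D_def)
  have "integral\<^sup>L M (F k) = (Lp_int m M (\<lambda>x. f x + s k *\<^sub>R h x) - Lp_int m M f) / s k" for k
    using Lp_fun_add[OF _ assms(2) Lp_fun_scaleR[OF assms(3), of "s k"]] assms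
    by (simp add: F_def Lp_int_def Lp_fun_def)
  then show "(\<lambda>k. (Lp_int m M (\<lambda>x. f x + s k *\<^sub>R h x) - Lp_int m M f) / s k)
      \<longlonglongrightarrow> m * (LINT x|M. norm (f x) powr (m - 2) * (f x \<bullet> h x))"
    using int by (simp add: D_def)
qed

section \<open>Convexity of the power integrals\<close>

lemma Lp_int_midpoint_le:
  assumes "1 < p" "Lp_fun p M f" "Lp_fun p M g"
  shows "Lp_int p M (\<lambda>x. (1/2) *\<^sub>R (f x + g x)) \<le> (Lp_int p M f + Lp_int p M g) / 2"
proof -
  have pt: "norm ((1/2) *\<^sub>R (f x + g x)) powr p \<le> (norm (f x) powr p + norm (g x) powr p) / 2" for x
    using norm_midpoint_powr_less[OF assms(1), of "f x" "g x"]
    by (cases "f x = g x") (auto simp: scaleR_2[symmetric])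
  have "Lp_fun p M (\<lambda>x. (1/2) *\<^sub>R (f x + g x))"
    using assms by (intro Lp_fun_scaleR Lp_fun_add) auto
  then have "Lp_int p M (\<lambda>x. (1/2) *\<^sub>R (f x + g x)) \<le> (LINT x|M. (norm (f x) powr p + norm (g x) powr p) / 2)"
    unfolding Lp_int_def using assms pt by (intro integral_mono) (auto simp: Lp_fun_def)
  then show ?thesis using assms by (simp add: Lp_int_def Lp_fun_def)
qed

lemma Lp_uniform_convexity:
  assumes "1 < p" "0 < e"
  shows "\<exists>K>0. \<forall>(f :: 'a \<Rightarrow> 'b::euclidean_space) g. Lp_fun p M f \<longrightarrow> Lp_fun p M g \<longrightarrow>
    Lp_int p M (\<lambda>x. f x - g x) \<le> e * (Lp_int p M f + Lp_int p M g)
      + K * ((Lp_int p M f + Lp_int p M g) / 2 - Lp_int p M (\<lambda>x. (1/2) *\<^sub>R (f x + g x)))"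
proof -
  obtain K where K: "0 < K" "\<And>a b :: 'b.
    norm (a - b) powr p \<le> e * (norm a powr p + norm b powr p)
      + K * ((norm a powr p + norm b powr p) / 2 - norm ((1/2) *\<^sub>R (a + b)) powr p)"
    using uniform_convexity_powr[OF assms] by metis
  have "Lp_int p M (\<lambda>x. f x - g x) \<le> e * (Lp_int p M f + Lp_int p M g)
      + K * ((Lp_int p M f + Lp_int p M g) / 2 - Lp_int p M (\<lambda>x. (1/2) *\<^sub>R (f x + g x)))"
    if fg: "Lp_fun p M f" "Lp_fun p M g" for f g :: "'a \<Rightarrow> 'b"
  proof -
    have mid: "Lp_fun p M (\<lambda>x. (1/2) *\<^sub>R (f x + g x))"
      using assms fg by (intro Lp_fun_scaleR Lp_fun_add) auto
    have diff: "Lp_fun p M (\<lambda>x. f x - g x)" using assms fg by (intro Lp_fun_diff) auto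
    note ints = fg[THEN Lp_fun_integrable] mid[THEN Lp_fun_integrable] diff[THEN Lp_fun_integrable]
    have "Lp_int p M (\<lambda>x. f x - g x) \<le> (LINT x|M. e * (norm (f x) powr p + norm (g x) powr p)
      + K * ((norm (f x) powr p + norm (g x) powr p) / 2 - norm ((1/2) *\<^sub>R (f x + g x)) powr p))"
      unfolding Lp_int_def
    proof (rule integral_mono)
      show "integrable M (\<lambda>x. norm (f x - g x) powr p)" by (rule ints)
      show "integrable M (\<lambda>x. e * (norm (f x) powr p + norm (g x) powr p)
      + K * ((norm (f x) powr p + norm (g x) powr p) / 2 - norm ((1/2) *\<^sub>R (f x + g x)) powr p))"
        using ints by (intro Bochner_Integration.integrable_add Bochner_Integration.integrable_diff
             integrable_mult_right integrable_divide)
    qed (rule K)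
    also have "\<dots> = e * (Lp_int p M f + Lp_int p M g)
      + K * ((Lp_int p M f + Lp_int p M g) / 2 - Lp_int p M (\<lambda>x. (1/2) *\<^sub>R (f x + g x)))"
      unfolding Lp_int_def using ints
      by (simp only: Bochner_Integration.integral_add Bochner_Integration.integral_diff
           integral_mult_right_zero integral_divide_zero Bochner_Integration.integrable_add
           Bochner_Integration.integrable_diff integrable_mult_right integrable_divide)
    finally show ?thesis .
  qed
  then show ?thesis using K(1) by blast
qed

text \<open>In the application \<open>V u g\<close> says that \<open>u\<close> belongs to the Sobolev space with zero boundary
  values and that \<open>g\<close> is its weak gradient.\<close>

locale gradient_pairs =
  fixes M :: "'a measure" and p q :: real
    and V :: "('a \<Rightarrow> real) \<Rightarrow> ('a \<Rightarrow> 'b::euclidean_space) \<Rightarrow> bool"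
  assumes finite_M: "finite_measure M"
    and exponents: "1 < q" "q < p"
    and V_Lp: "V u g \<Longrightarrow> Lp_fun p M u" "V u g \<Longrightarrow> Lp_fun p M g"
    and V_scale: "V u g \<Longrightarrow> V (\<lambda>x. c * u x) (\<lambda>x. c *\<^sub>R g x)"
    and V_add: "V u g \<Longrightarrow> V v h \<Longrightarrow> V (\<lambda>x. u x + v x) (\<lambda>x. g x + h x)"
    and V_closed: "(\<And>k::nat. V (us k) (gs k)) \<Longrightarrow> Lp_fun p M u \<Longrightarrow> Lp_fun p M g \<Longrightarrow>
      (\<lambda>k. Lp_int p M (\<lambda>x. us k x - u x)) \<longlonglongrightarrow> 0 \<Longrightarrow>
      (\<lambda>k. Lp_int p M (\<lambda>x. gs k x - g x)) \<longlonglongrightarrow> 0 \<Longrightarrow> V u g"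
begin

lemma V_diff: "V u g \<Longrightarrow> V v h \<Longrightarrow> V (\<lambda>x. u x - v x) (\<lambda>x. g x - h x)"
  using V_add[of u g "\<lambda>x. - 1 * v x" "\<lambda>x. - 1 *\<^sub>R h x"] V_scale[of v h "- 1"] by simp

lemma V_Lq: "V u g \<Longrightarrow> Lp_fun q M g"
  by (rule Lp_fun_lower[OF finite_M _ _ V_Lp(2)]) (use exponents in simp_all)

text \<open>This replaces weak compactness and weak lower semicontinuity.  The admissible pairs with
  tolerance \<open>\<epsilon>\<close> form a convex set, and near-minimisers of the \<open>p\<close>-energy over these sets are
  Cauchy by uniform convexity.\<close>

lemma convex_limit:
  assumes u: "Lp_fun p M u"
    and approx: "\<And>\<epsilon>. 0 < \<epsilon> \<Longrightarrow> \<exists>v h. V v h \<and> Lp_int p M (\<lambda>x. v x - u x) \<le> \<epsilon> \<and>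
      Lp_int p M h \<le> a + \<epsilon> \<and> Lp_int q M h \<le> b + \<epsilon>"
  obtains g where "V u g" "Lp_int p M g \<le> a" "Lp_int q M g \<le> b"
proof -
  have p1: "1 < p" "0 < p" "1 \<le> p" using exponents by auto
  define C where "C = (\<lambda>\<epsilon> v h. V v h \<and> Lp_int p M (\<lambda>x. v x - u x) \<le> \<epsilon> \<and>
      Lp_int p M h \<le> a + \<epsilon> \<and> Lp_int q M h \<le> b + \<epsilon>)"
  have mono: "C \<delta> v h" if "C \<epsilon> v h" "\<epsilon> \<le> \<delta>" for \<epsilon> \<delta> v h
    using that by (auto simp: C_def)
  have mid: "C \<epsilon> (\<lambda>x. (1/2) * (v x + w x)) (\<lambda>x. (1/2) *\<^sub>R (h x + k x))"
    if "C \<epsilon> v h" "C \<epsilon> w k" for \<epsilon> v h w k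
  proof -
    have V: "V v h" "V w k" using that by (auto simp: C_def)
    have "(\<lambda>x. (1/2) * (v x + w x) - u x) = (\<lambda>x. (1/2) *\<^sub>R ((v x - u x) + (w x - u x)))"
      by (auto simp: field_simps)
    then have "Lp_int p M (\<lambda>x. (1/2) * (v x + w x) - u x)
        \<le> (Lp_int p M (\<lambda>x. v x - u x) + Lp_int p M (\<lambda>x. w x - u x)) / 2"
      using V V_Lp u p1 Lp_int_midpoint_le[of p M "\<lambda>x. v x - u x" "\<lambda>x. w x - u x"]
      by (simp add: Lp_fun_diff)
    moreover have "Lp_int p M (\<lambda>x. (1/2) *\<^sub>R (h x + k x)) \<le> (Lp_int p M h + Lp_int p M k) / 2"
      using V V_Lp p1 by (intro Lp_int_midpoint_le) auto
    moreover have "Lp_int q M (\<lambda>x. (1/2) *\<^sub>R (h x + k x)) \<le> (Lp_int q M h + Lp_int q M k) / 2"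
      using V V_Lq exponents by (intro Lp_int_midpoint_le) auto
    ultimately show ?thesis
      using that V_scale[OF V_add[OF V], of "1/2"] by (simp add: C_def)
  qed
  define \<epsilon> where "\<epsilon> = (\<lambda>k::nat. 1 / real (Suc k))"
  have \<epsilon>: "\<epsilon> k > 0" "\<epsilon> k \<le> 1" "l \<ge> k \<Longrightarrow> \<epsilon> l \<le> \<epsilon> k" for k l
    by (auto simp: \<epsilon>_def divide_simps)
  have \<epsilon>0: "\<epsilon> \<longlonglongrightarrow> 0" unfolding \<epsilon>_def by (rule LIMSEQ_Suc[OF lim_1_over_n])
  define S where "S = (\<lambda>k. {Lp_int p M h |v h. C (\<epsilon> k) v h})"
  define d where "d = (\<lambda>k. Inf (S k))"
  have S: "S k \<noteq> {}" "bdd_below (S k)" for k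
  proof -
    show "S k \<noteq> {}" using approx[OF \<epsilon>(1)[of k]] by (auto simp: S_def C_def)
    show "bdd_below (S k)" by (rule bdd_belowI[of _ 0]) (auto simp: S_def)
  qed
  have d_le: "d k \<le> Lp_int p M h" if "C (\<epsilon> k) v h" for k v h
    unfolding d_def using S(2) that by (intro cInf_lower) (auto simp: S_def)
  \<comment> \<open>A smaller tolerance admits fewer pairs, so the infima increase; they stay below
    \<open>a + 1\<close> and therefore converge.\<close>
  have "S l \<subseteq> S k" if "k \<le> l" for k l
    using mono[OF _ \<epsilon>(3)[OF that]] by (auto simp: S_def)
  then have d_mono: "d k \<le> d l" if "k \<le> l" for k l
    unfolding d_def using that S by (intro cInf_superset_mono) auto
  have d_bound: "d k \<le> a + 1" for k
  proof -
    obtain v h where "C (\<epsilon> k) v h" using S(1)[of k] by (auto simp: S_def)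
    then show ?thesis using d_le[of k v h] \<epsilon>(2)[of k] by (simp add: C_def)
  qed
  obtain D where D: "d \<longlonglongrightarrow> D" "\<And>k. d k \<le> D"
    using incseq_convergent[of d "a + 1"] d_mono d_bound by (metis incseq_def)
  have "\<exists>v h. C (\<epsilon> k) v h \<and> Lp_int p M h \<le> d k + \<epsilon> k" for k
  proof -
    obtain y where "y \<in> S k" "y < d k + \<epsilon> k"
      using cInf_lessD[OF S(1), of k "d k + \<epsilon> k"] \<epsilon>(1)[of k] by (auto simp: d_def)
    then show ?thesis by (auto simp: S_def intro: less_imp_le)
  qed
  then obtain v h where vh: "\<And>k. C (\<epsilon> k) (v k) (h k)" "\<And>k. Lp_int p M (h k) \<le> d k + \<epsilon> k"
    by metis
  have Vk: "V (v k) (h k)" for k using vh(1) by (simp add: C_def)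
  have hLp: "Lp_fun p M (h k)" for k using V_Lp Vk by blast
  have h_bound: "Lp_int p M (h k) \<le> \<bar>a\<bar> + 1" for k
    using vh(1)[of k] \<epsilon>(2)[of k] abs_ge_self[of a] unfolding C_def by linarith
  \<comment> \<open>The midpoint of the pairs with indices \<open>k\<close> and \<open>l\<close> is
    admissible for the larger tolerance \<open>\<epsilon> k\<close>, so its energy is at least
    \<open>d k\<close>. Both energies exceed their infima by at most \<open>\<epsilon> k\<close>,
    which makes the convexity gap small.\<close>
  have half: "Lp_int p M (\<lambda>x. h k x - h l x) \<le> e"
    if "k \<le> l" and eK: "e' * (2 * \<bar>a\<bar> + 2) \<le> e / 2" "0 < e'" "0 < K" "K * ((D - d k) / 2 + \<epsilon> k) \<le> e / 2"
     and K: "\<And>f g :: 'a \<Rightarrow> 'b. Lp_fun p M f \<Longrightarrow> Lp_fun p M g \<Longrightarrow>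
    Lp_int p M (\<lambda>x. f x - g x) \<le> e' * (Lp_int p M f + Lp_int p M g)
      + K * ((Lp_int p M f + Lp_int p M g) / 2 - Lp_int p M (\<lambda>x. (1/2) *\<^sub>R (f x + g x)))"
     for k l e e' K
  proof -
    have "d k \<le> Lp_int p M (\<lambda>x. (1/2) *\<^sub>R (h k x + h l x))"
      using mid[OF vh(1)[of k] mono[OF vh(1)[of l] \<epsilon>(3)[OF that(1)]]] by (rule d_le)
    then have gap: "(Lp_int p M (h k) + Lp_int p M (h l)) / 2 - Lp_int p M (\<lambda>x. (1/2) *\<^sub>R (h k x + h l x))
        \<le> (D - d k) / 2 + \<epsilon> k"
      using vh(2)[of k] vh(2)[of l] D(2)[of l] \<epsilon>(3)[OF that(1)] by (simp add: field_simps)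
    have "Lp_int p M (\<lambda>x. h k x - h l x) \<le> e' * (Lp_int p M (h k) + Lp_int p M (h l))
      + K * ((Lp_int p M (h k) + Lp_int p M (h l)) / 2 - Lp_int p M (\<lambda>x. (1/2) *\<^sub>R (h k x + h l x)))"
      by (intro K hLp)
    also have "\<dots> \<le> e' * (2 * \<bar>a\<bar> + 2) + K * ((D - d k) / 2 + \<epsilon> k)"
      using gap eK add_mono[OF h_bound[of k] h_bound[of l]] by (intro add_mono[OF mult_left_mono mult_left_mono]) auto
    also have "\<dots> \<le> e" using eK by simp
    finally show ?thesis .
  qed
  have Cauchy: "\<exists>N. \<forall>k\<ge>N. \<forall>l\<ge>N. Lp_int p M (\<lambda>x. h k x - h l x) \<le> e" if "0 < e" for e
  proof -
    define A where "A = \<bar>a\<bar> + 1"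
    define e' where "e' = e / (4 * A)"
    have A: "A > 0" "2 * \<bar>a\<bar> + 2 = 2 * A" by (auto simp: A_def)
    have e': "e' > 0" "e' * (2 * \<bar>a\<bar> + 2) \<le> e / 2"
      unfolding A(2) using that A(1) by (simp_all add: e'_def)
    obtain K where K: "0 < K" "\<And>f g :: 'a \<Rightarrow> 'b. Lp_fun p M f \<Longrightarrow> Lp_fun p M g \<Longrightarrow>
    Lp_int p M (\<lambda>x. f x - g x) \<le> e' * (Lp_int p M f + Lp_int p M g)
      + K * ((Lp_int p M f + Lp_int p M g) / 2 - Lp_int p M (\<lambda>x. (1/2) *\<^sub>R (f x + g x)))"
      using Lp_uniform_convexity[OF p1(1) e'(1), of M] by blast
    have "(\<lambda>k. K * ((D - d k) / 2 + \<epsilon> k)) \<longlonglongrightarrow> K * ((D - D) / 2 + 0)"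
      by (intro tendsto_intros D \<epsilon>0) auto
    then have "eventually (\<lambda>k. K * ((D - d k) / 2 + \<epsilon> k) < e / 2) sequentially"
      using that by (intro order_tendstoD) auto
    then obtain N where N: "\<And>k. k \<ge> N \<Longrightarrow> K * ((D - d k) / 2 + \<epsilon> k) \<le> e / 2"
      by (auto simp: eventually_sequentially intro: less_imp_le)
    have "Lp_int p M (\<lambda>x. h k x - h l x) \<le> e" if "k \<ge> N" "l \<ge> N" for k l
    proof (cases "k \<le> l")
      case True
      then show ?thesis using half[OF True e'(2,1) K(1) N[OF that(1)] K(2)] by blast
    next
      case False
      then have "l \<le> k" by simp
      from half[OF this e'(2,1) K(1) N[OF that(2)] K(2)] show ?thesis
        unfolding Lp_int_diff_commute[of p M "h k"] by blast
    qed
    then show ?thesis by blast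
  qed
  obtain g where g: "Lp_fun p M g" "(\<lambda>k. Lp_int p M (\<lambda>x. h k x - g x)) \<longlonglongrightarrow> 0"
    using Lp_complete[OF p1(3) hLp Cauchy] by metis
  have "(\<lambda>k. Lp_int p M (\<lambda>x. v k x - u x)) \<longlonglongrightarrow> 0"
    using vh(1) by (intro real_tendsto_sandwich[OF _ _ tendsto_const \<epsilon>0]) (auto simp: C_def)
  then have "V u g" using V_closed[OF Vk u g(1) _ g(2)] by blast
  moreover have "Lp_int p M g \<le> a"
  proof -
    have "(\<lambda>k. Lp_int p M (h k)) \<longlonglongrightarrow> Lp_int p M g"
      by (intro Lp_int_continuous p1 hLp g)
    moreover have "(\<lambda>k. a + \<epsilon> k) \<longlonglongrightarrow> a + 0" by (intro tendsto_intros \<epsilon>0)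
    ultimately have "Lp_int p M g \<le> a + 0"
      using vh(1) by (intro LIMSEQ_le) (auto simp: C_def)
    then show ?thesis by simp
  qed
  moreover have "Lp_int q M g \<le> b"
  proof -
    have "(\<lambda>k. Lp_int q M (\<lambda>x. h k x - g x)) \<longlonglongrightarrow> 0"
      using exponents by (intro Lp_convergence_lower[OF finite_M _ _ _ g(2)] Lp_fun_diff hLp g) auto
    then have "(\<lambda>k. Lp_int q M (h k)) \<longlonglongrightarrow> Lp_int q M g"
      using exponents Lp_fun_lower[OF finite_M, of q p] hLp g by (intro Lp_int_continuous) auto
    moreover have "(\<lambda>k. b + \<epsilon> k) \<longlonglongrightarrow> b + 0" by (intro tendsto_intros \<epsilon>0)
    ultimately have "Lp_int q M g \<le> b + 0"
      using vh(1) by (intro LIMSEQ_le) (auto simp: C_def)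
    then show ?thesis by simp
  qed
  ultimately show ?thesis using that by blast
qed

end

section \<open>Energies along rays\<close>

text \<open>Convexity at three points with the denominators cleared, the form in which three zeros
  of one function can be combined linearly.\<close>

lemma powr_strict_convex:
  fixes x y z m :: real
  assumes "1 < m" "0 \<le> x" "x < z" "z < y"
  shows "(y - x) * z powr m < (y - z) * x powr m + (z - x) * y powr m"
proof -
  obtain a where a: "x < a" "a < z" "z powr m - x powr m = (z - x) * (m * a powr (m - 1))"
    using powr_mvt[OF assms(1,2,3)] by blast
  obtain b where b: "z < b" "b < y" "y powr m - z powr m = (y - z) * (m * b powr (m - 1))"
    using powr_mvt[OF assms(1) _ assms(4)] assms by auto
  have "a powr (m - 1) < b powr (m - 1)" using a b assms by (intro powr_less_mono2) auto
  then have "(y - z) * (z - x) * (m * a powr (m - 1)) < (y - z) * (z - x) * (m * b powr (m - 1))"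
    using assms by (intro mult_strict_left_mono) auto
  then have "(y - z) * (z powr m - x powr m) < (z - x) * (y powr m - z powr m)"
    unfolding a(3) b(3) by (simp only: ac_simps)
  then show ?thesis by (simp add: algebra_simps)
qed

text \<open>Concavity for the exponent \<open>m\<close> is convexity for \<open>1 / m\<close>, read
  through the inverse function.\<close>

lemma powr_concave:
  fixes x y z m :: real
  assumes "0 < m" "m < 1" "0 \<le> x" "x < z" "z < y"
  shows "(y - z) * x powr m + (z - x) * y powr m \<le> (y - x) * z powr m"
proof -
  define t where "t = (z - x) / (y - x)"
  have t: "0 \<le> t" "t \<le> 1" using assms by (auto simp: t_def)
  have "((1 - t) * x powr m + t * y powr m) powr (1 / m)
      \<le> (1 - t) * (x powr m) powr (1 / m) + t * (y powr m) powr (1 / m)"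
    using assms t by (intro convex_powr_nonneg) auto
  also have "\<dots> = x + t * (y - x)" using assms by (simp add: powr_powr algebra_simps)
  also have "\<dots> = z" using assms by (simp add: t_def)
  finally have "(((1 - t) * x powr m + t * y powr m) powr (1 / m)) powr m \<le> z powr m"
    using assms by (intro powr_mono2) auto
  then have "(1 - t) * x powr m + t * y powr m \<le> z powr m"
    using assms t by (simp add: powr_powr)
  then have "(y - x) * ((1 - t) * x powr m + t * y powr m) \<le> (y - x) * z powr m"
    using assms by (intro mult_left_mono) auto
  moreover have "(y - x) * ((1 - t) * x powr m + t * y powr m)
      = ((y - x) * (1 - t)) * x powr m + ((y - x) * t) * y powr m" by (simp only: distrib_left mult.assoc)
  moreover have "(y - x) * t = z - x" using assms by (simp add: t_def)
  moreover from this have "(y - x) * (1 - t) = y - z" by (simp add: right_diff_distrib)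
  ultimately show ?thesis by simp
qed

text \<open>The energy along the ray through a function whose coefficients are \<open>A\<close>, \<open>B\<close>, \<open>C\<close>, \<open>D\<close>.\<close>

definition fiber :: "real \<Rightarrow> real \<Rightarrow> real \<Rightarrow> real \<Rightarrow> real \<Rightarrow> real \<Rightarrow> real \<Rightarrow> real \<Rightarrow> real \<Rightarrow> real \<Rightarrow> real \<Rightarrow> real" where
  "fiber p q r s \<beta> lam A B C D t =
     A * t powr p / p + \<beta> * B * t powr q / q - lam * C * t powr s / s - D * t powr r / r"

locale fiber_exponents =
  fixes p q r s :: real
  assumes s: "0 < s" "s < 1" and q: "1 < q" and p: "q < p" and r: "p < r"
begin

lemma fiber_zero: "fiber p q r s \<beta> lam A B C D 0 = 0"
  by (simp add: fiber_def)

lemma tendsto_fiber: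
  assumes "A \<longlonglongrightarrow> A0" "B \<longlonglongrightarrow> B0" "C \<longlonglongrightarrow> C0" "D \<longlonglongrightarrow> D0" "t \<longlonglongrightarrow> t0" "\<And>k. 0 \<le> t k"
  shows "(\<lambda>k. fiber p q r s \<beta> lam (A k) (B k) (C k) (D k) (t k)) \<longlonglongrightarrow> fiber p q r s \<beta> lam A0 B0 C0 D0 t0"
proof -
  have "(\<lambda>k. t k powr m) \<longlonglongrightarrow> t0 powr m" if "0 < m" for m
    using assms(5,6) that by (intro tendsto_powr'[OF _ tendsto_const]) auto
  then show ?thesis
    unfolding fiber_def using s q p r assms(1-4)
    by (intro tendsto_add tendsto_diff tendsto_divide tendsto_mult tendsto_const) auto
qed

lemma fiber_mono:
  assumes "A \<le> A'" "B \<le> B'" "0 \<le> \<beta>"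
  shows "fiber p q r s \<beta> lam A B C D t \<le> fiber p q r s \<beta> lam A' B' C D t"
  unfolding fiber_def using assms s q p r
  by (intro diff_right_mono add_mono divide_right_mono mult_right_mono mult_left_mono) auto

text \<open>\<open>T\<close> is uniform in the coefficients, so the maximum points of a whole family
  of perturbed rays remain in one compact interval.\<close>

lemma fiber_nonpos:
  assumes "0 < D0" "0 \<le> \<beta>" "0 \<le> lam" "0 \<le> A0" "0 \<le> B0"
  shows "\<exists>T\<ge>1. \<forall>A\<le>A0. \<forall>B\<le>B0. \<forall>C\<ge>0. \<forall>D\<ge>D0. \<forall>t\<ge>T. fiber p q r s \<beta> lam A B C D t \<le> 0"
proof -
  define K where "K = A0 / p + \<beta> * B0 / q"
  \<comment> \<open>Beyond 1 both gradient terms together are at most \<open>K * t powr p\<close>;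
    the other argument of the maximum is where \<open>D0 * t powr r / r\<close> catches up with
    that.\<close>
  define T where "T = max 1 ((r * K / D0) powr (1 / (r - p)))"
  have "fiber p q r s \<beta> lam A B C D t \<le> 0"
    if "A \<le> A0" "B \<le> B0" "0 \<le> C" "D0 \<le> D" "T \<le> t" for A B C D t
  proof -
    have K: "0 \<le> K" using assms p q by (simp add: K_def)
    have t: "1 \<le> t" using that by (simp add: T_def)
    have "r * K / D0 = ((r * K / D0) powr (1 / (r - p))) powr (r - p)"
      using K r assms p q by (simp add: powr_powr)
    also have "\<dots> \<le> t powr (r - p)"
      using that r by (intro powr_mono2) (auto simp: T_def)
    finally have "K \<le> D0 * t powr (r - p) / r" using assms p q r by (simp add: field_simps)
    then have "K * t powr p \<le> D0 * t powr (r - p) / r * t powr p" by (intro mult_right_mono) auto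
    also have "\<dots> = D0 * t powr r / r" using t by (simp add: powr_diff)
    also have "\<dots> \<le> D * t powr r / r"
      using that p q r by (intro divide_right_mono mult_right_mono) auto
    finally have 1: "K * t powr p \<le> D * t powr r / r" .
    have "A * t powr p / p \<le> A0 * t powr p / p"
      using that p q by (intro divide_right_mono mult_right_mono) auto
    moreover have "\<beta> * B * t powr q / q \<le> \<beta> * B0 * t powr q / q"
      using that assms p q t by (intro divide_right_mono mult_right_mono mult_left_mono) auto
    moreover have "\<beta> * B0 * t powr q / q \<le> \<beta> * B0 * t powr p / q"
      using that assms p q t by (intro divide_right_mono mult_left_mono powr_mono) auto
    moreover have "K * t powr p = A0 * t powr p / p + \<beta> * B0 * t powr p / q"
      by (simp add: K_def distrib_right)
    moreover have "0 \<le> lam * C * t powr s / s" using that assms s by simp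
    ultimately show ?thesis using 1 unfolding fiber_def by linarith
  qed
  moreover have "1 \<le> T" by (simp add: T_def)
  ultimately show ?thesis by blast
qed

text \<open>Beyond some \<open>T\<close> the fiber is at most 0, its value at 0, so the maximum over
  the compact interval is global.\<close>

lemma fiber_attains_max:
  assumes "0 < D" "0 \<le> \<beta>" "0 \<le> lam" "0 \<le> A" "0 \<le> B" "0 \<le> C"
  shows "\<exists>t\<ge>0. \<forall>t'\<ge>0. fiber p q r s \<beta> lam A B C D t' \<le> fiber p q r s \<beta> lam A B C D t"
proof -
  obtain T where T: "1 \<le> T" "\<And>t. T \<le> t \<Longrightarrow> fiber p q r s \<beta> lam A B C D t \<le> 0"
    using fiber_nonpos[OF assms(1-5)] assms(6) by blast
  have cont: "continuous_on {0..T} (fiber p q r s \<beta> lam A B C D)"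
    unfolding fiber_def using s q p r
    by (intro continuous_on_add continuous_on_diff continuous_on_divide continuous_on_mult
        continuous_on_const continuous_on_powr' continuous_on_id) auto
  obtain t where t: "t \<in> {0..T}" "\<And>y. y \<in> {0..T} \<Longrightarrow> fiber p q r s \<beta> lam A B C D y \<le> fiber p q r s \<beta> lam A B C D t"
    using continuous_attains_sup[OF compact_Icc _ cont] T(1) by auto
  have "fiber p q r s \<beta> lam A B C D t' \<le> fiber p q r s \<beta> lam A B C D t" if "0 \<le> t'" for t'
  proof (cases "t' \<le> T")
    case False
    then have "fiber p q r s \<beta> lam A B C D t' \<le> 0" by (intro T(2)) simp
    also have "\<dots> \<le> fiber p q r s \<beta> lam A B C D t"
      using t(2)[of 0] T(1) by (simp add: fiber_zero)
    finally show ?thesis .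
  qed (use t that in auto)
  then show ?thesis using t(1) by auto
qed

text \<open>Since \<open>s\<close> is the smallest exponent, factoring out \<open>t powr s\<close>
  leaves a function that tends to \<open>- lam * C / s\<close>.\<close>

lemma fiber_neg:
  assumes "0 < lam * C" "0 < e" "0 \<le> D"
  obtains t where "0 < t" "t < e" "fiber p q r s \<beta> lam A B C D t < 0"
proof -
  define g where "g = (\<lambda>t. A * t powr (p - s) / p + \<beta> * B * t powr (q - s) / q - lam * C / s)"
  have "(g \<longlongrightarrow> A * 0 powr (p - s) / p + \<beta> * B * 0 powr (q - s) / q - lam * C / s) (at_right 0)"
    unfolding g_def using s q p r
    by (intro tendsto_add tendsto_diff tendsto_divide tendsto_mult tendsto_const
           tendsto_powr'[OF tendsto_ident_at tendsto_const])
       (auto simp: eventually_at intro!: exI[of _ 1])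
  moreover have "A * 0 powr (p - s) / p + \<beta> * B * 0 powr (q - s) / q - lam * C / s < 0"
    using assms s q p by simp
  ultimately have "eventually (\<lambda>t. g t < 0) (at_right 0)" by (intro order_tendstoD(2))
  moreover have "eventually (\<lambda>t. t \<in> {0<..<e}) (at_right 0)"
    using assms by (intro eventually_at_right_real) auto
  ultimately have "eventually (\<lambda>t. g t < 0 \<and> t \<in> {0<..<e}) (at_right 0)"
    by (rule eventually_conj)
  from eventually_happens[OF this] have "\<exists>t. g t < 0 \<and> t \<in> {0<..<e}"
    using trivial_limit_at_right_real[of "0::real"] by blast
  then obtain t where t: "g t < 0" "0 < t" "t < e" by auto
  have split: "t powr m = t powr s * t powr (m - s)" for m
    using t by (simp add: powr_add[symmetric])
  have "fiber p q r s \<beta> lam A B C D t = t powr s * g t - D * t powr r / r"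
    unfolding fiber_def g_def split[of p] split[of q] by (simp add: algebra_simps)
  also have "\<dots> < 0"
  proof -
    have "0 \<le> D * t powr r / r" using assms p q r by simp
    moreover have "t powr s * g t < 0" using t by (simp add: mult_pos_neg)
    ultimately show ?thesis by linarith
  qed
  finally show ?thesis using t that by blast
qed

text \<open>In the variable \<open>t powr (p - s)\<close> the derivative of the fiber is a strictly concave function
  times a positive factor, so it cannot vanish at three points.\<close>

lemma fiber_max_unique:
  assumes D: "0 < D" and pos: "0 \<le> \<beta>" "0 \<le> B" and t: "0 < t1" "t1 < t2"
    and max1: "\<And>t. 0 \<le> t \<Longrightarrow> fiber p q r s \<beta> lam A B C D t \<le> fiber p q r s \<beta> lam A B C D t1"
    and max2: "\<And>t. 0 \<le> t \<Longrightarrow> fiber p q r s \<beta> lam A B C D t \<le> fiber p q r s \<beta> lam A B C D t2"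
  shows False
proof -
  let ?f = "fiber p q r s \<beta> lam A B C D"
  define k where "k = p - s"
  define G where "G = (\<lambda>z. A * z + \<beta> * B * z powr ((q - s) / k) - lam * C - D * z powr ((r - s) / k))"
  have k: "k > 0" using s q p by (simp add: k_def)
  have der: "(?f has_real_derivative t powr (s - 1) * G (t powr k)) (at t)" if "0 < t" for t
  proof -
    have "(?f has_real_derivative
       A * t powr (p - 1) + \<beta> * B * t powr (q - 1) - lam * C * t powr (s - 1) - D * t powr (r - 1)) (at t)"
      unfolding fiber_def using that s q p r
      by (auto intro!: derivative_eq_intros)
    moreover have "t powr (s - 1) * G (t powr k) =
       A * t powr (p - 1) + \<beta> * B * t powr (q - 1) - lam * C * t powr (s - 1) - D * t powr (r - 1)"
    proof -
      have "(t powr k) powr ((q - s) / k) = t powr (q - s)" "(t powr k) powr ((r - s) / k) = t powr (r - s)"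
        using k by (simp_all add: powr_powr)
      then have "t powr (s - 1) * G (t powr k) = A * (t powr (s - 1) * t powr (p - s))
         + \<beta> * B * (t powr (s - 1) * t powr (q - s)) - lam * C * t powr (s - 1)
         - D * (t powr (s - 1) * t powr (r - s))"
        unfolding G_def k_def[symmetric] by (simp add: algebra_simps)
      then show ?thesis by (simp add: powr_add[symmetric])
    qed
    ultimately show ?thesis by simp
  qed
  have crit: "G (t powr k) = 0" if "0 < t" and m: "\<And>t'. 0 \<le> t' \<Longrightarrow> ?f t' \<le> ?f t" for t
  proof -
    have "t powr (s - 1) * G (t powr k) = 0"
      by (rule DERIV_local_max[OF der[OF that(1)] that(1)]) (use m in auto)
    then show ?thesis using that(1) by simp
  qed
  \<comment> \<open>The two maximum points have equal values, so the mean value theorem supplies a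
    third critical point between them.\<close>
  obtain z where z: "t1 < z" "z < t2" "?f t2 - ?f t1 = (t2 - t1) * (z powr (s - 1) * G (z powr k))"
    using MVT2[OF t(2), of ?f "\<lambda>t. t powr (s - 1) * G (t powr k)"] der t(1) by (metis less_le_trans)
  have "?f t1 = ?f t2" using max1[of t2] max2[of t1] t by simp
  then have Gz: "G (z powr k) = 0" using z t by simp
  have G1: "G (t1 powr k) = 0" "G (t2 powr k) = 0"
    using crit[of t1] crit[of t2] max1 max2 t by auto
  define a b c where "a = t1 powr k" and "b = t2 powr k" and "c = z powr k"
  have abc: "0 \<le> a" "a < c" "c < b"
    using t z k by (auto simp: a_def b_def c_def intro!: powr_less_mono2)
  \<comment> \<open>In the new variable the \<open>A\<close> term is linear, the \<open>B\<close>
    term has an exponent below 1 and the subtracted \<open>D\<close> term one above 1, whence strict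
    concavity.\<close>
  have kap: "0 < (q - s) / k" "(q - s) / k < 1" "1 < (r - s) / k"
    using k s q p r by (auto simp: k_def)
  have "(b - c) * (\<beta> * B * a powr ((q - s) / k)) + (c - a) * (\<beta> * B * b powr ((q - s) / k))
      \<le> (b - a) * (\<beta> * B * c powr ((q - s) / k))"
    using mult_left_mono[OF powr_concave[OF kap(1,2) abc], of "\<beta> * B"] pos
    by (simp add: algebra_simps)
  moreover have "(b - a) * (D * c powr ((r - s) / k))
      < (b - c) * (D * a powr ((r - s) / k)) + (c - a) * (D * b powr ((r - s) / k))"
    using mult_strict_left_mono[OF powr_strict_convex[OF kap(3) abc] D]
    by (simp add: algebra_simps)
  moreover have "(b - c) * (A * a - lam * C) + (c - a) * (A * b - lam * C) = (b - a) * (A * c - lam * C)"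
    by (simp add: algebra_simps)
  moreover have "(b - c) * G a + (c - a) * G b - (b - a) * G c
    = ((b - c) * (A * a - lam * C) + (c - a) * (A * b - lam * C) - (b - a) * (A * c - lam * C))
     + ((b - c) * (\<beta> * B * a powr ((q - s) / k)) + (c - a) * (\<beta> * B * b powr ((q - s) / k))
        - (b - a) * (\<beta> * B * c powr ((q - s) / k)))
     - ((b - c) * (D * a powr ((r - s) / k)) + (c - a) * (D * b powr ((r - s) / k))
        - (b - a) * (D * c powr ((r - s) / k)))"
    by (simp add: G_def algebra_simps)
  ultimately have "(b - c) * G a + (c - a) * G b - (b - a) * G c < 0" by linarith
  then show False using Gz G1 by (simp add: a_def b_def c_def)
qed

end

section \<open>Two critical points\<close>

text \<open>These are the only facts about the Sobolev space that the variational argument sees.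
  \<open>V_abs\<close> makes minimisers nonnegative, \<open>V_positive\<close> lets positivity be
  tested by countably many functions that reach almost every point, and \<open>V_unique\<close>
  makes the energy a function of the class of \<open>u\<close>.\<close>

locale compact_gradient_pairs = gradient_pairs M p q V + fiber_exponents p q r s
  for M :: "'a measure" and p q r s :: real
    and V :: "('a \<Rightarrow> real) \<Rightarrow> ('a \<Rightarrow> 'b::euclidean_space) \<Rightarrow> bool" +
  assumes V_embed: "\<exists>S>0. \<forall>u g. V u g \<longrightarrow> Lp_fun r M u \<and> Lp_int r M u \<le> S * Lp_int p M g powr (r / p)"
    and V_compact: "(\<And>k::nat. V (us k) (gs k)) \<Longrightarrow> (\<And>k. Lp_int p M (gs k) \<le> L) \<Longrightarrow>
      \<exists>\<sigma> u. strict_mono (\<sigma> :: nat \<Rightarrow> nat) \<and> Lp_fun r M u \<and> (\<lambda>k. Lp_int r M (\<lambda>x. us (\<sigma> k) x - u x)) \<longlonglongrightarrow> 0"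
    and V_abs: "V u g \<Longrightarrow> \<exists>h. V (\<lambda>x. \<bar>u x\<bar>) h \<and> Lp_int p M h \<le> Lp_int p M g \<and> Lp_int q M h \<le> Lp_int q M g"
    and V_positive: "\<exists>\<phi> \<psi>. (\<forall>j::nat. V (\<phi> j) (\<psi> j) \<and> (\<forall>x. 0 \<le> \<phi> j x)) \<and> (AE x in M. \<exists>j. 0 < \<phi> j x)"
    and V_unique: "V u g \<Longrightarrow> V v h \<Longrightarrow> AE x in M. u x = v x \<Longrightarrow> AE x in M. g x = h x"
    and space_nonnull: "emeasure M (space M) \<noteq> 0"
begin

definition energy :: "real \<Rightarrow> real \<Rightarrow> ('a \<Rightarrow> real) \<Rightarrow> ('a \<Rightarrow> 'b) \<Rightarrow> real \<Rightarrow> real" where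
  "energy \<beta> lam u g = fiber p q r s \<beta> lam (Lp_int p M g) (Lp_int q M g) (Lp_int s M u) (Lp_int r M u)"

lemma V_Lr: "V u g \<Longrightarrow> Lp_fun r M u"
  using V_embed by blast

lemma V_Ls: "V u g \<Longrightarrow> Lp_fun s M u"
  by (rule Lp_fun_lower[OF finite_M _ _ V_Lr]) (use s q p r in simp_all)

lemma energy_scale:
  assumes "0 \<le> c" "0 \<le> t"
  shows "energy \<beta> lam (\<lambda>x. c * u x) (\<lambda>x. c *\<^sub>R g x) t = energy \<beta> lam u g (c * t)"
  using assms Lp_int_scaleR[of _ M c u] Lp_int_scaleR[of _ M c g]
  by (simp add: energy_def fiber_def powr_mult mult_ac)

lemma V_zero: "V (\<lambda>x. 0) (\<lambda>x. 0)"
proof -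
  obtain u g where "V u g" using V_positive by blast
  from V_scale[OF this, of 0] show ?thesis by simp
qed

lemma Lr_zero_imp_Ls_zero:
  assumes "V u g" "Lp_int r M u \<le> 0"
  shows "Lp_int s M u = 0"
proof -
  have "AE x in M. u x = 0" using Lp_int_zero_AE[OF V_Lr] assms by blast
  then have "Lp_int s M u = Lp_int s M (\<lambda>x. 0::real)"
    using Lp_fun_measurable[OF V_Lr[OF assms(1)]] by (intro Lp_int_cong_AE) auto
  then show ?thesis by (simp add: Lp_int_def)
qed

lemma ex_positive:
  obtains u g where "V u g" "\<And>x. 0 \<le> u x" "0 < Lp_int r M u" "0 < Lp_int s M u"
proof -
  obtain \<phi> \<psi> where \<phi>: "\<And>j::nat. V (\<phi> j) (\<psi> j)" "\<And>j x. 0 \<le> \<phi> j x" "AE x in M. \<exists>j. 0 < \<phi> j x"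
    using V_positive by blast
  have "\<exists>j. 0 < Lp_int s M (\<phi> j)"
  proof (rule ccontr)
    assume "\<not> ?thesis"
    then have "AE x in M. \<phi> j x = 0" for j
      using Lp_int_zero_AE[OF V_Ls[OF \<phi>(1)], of j] by (meson not_le)
    then have "AE x in M. \<forall>j. \<phi> j x = 0" by (simp add: AE_all_countable)
    with \<phi>(3) have "AE x in M. False" by eventually_elim auto
    then show False using space_nonnull by (simp add: AE_iff_null null_sets_def)
  qed
  then obtain j where j: "0 < Lp_int s M (\<phi> j)" by blast
  then have "0 < Lp_int r M (\<phi> j)"
    using Lr_zero_imp_Ls_zero[OF \<phi>(1), of j] by (cases "Lp_int r M (\<phi> j) \<le> 0") auto
  then show ?thesis using that[of "\<phi> j" "\<psi> j"] \<phi> j by blast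
qed

text \<open>The integrals of \<open>us\<close> converge to those of \<open>u\<close>, but the
  gradient integrals converge only as numbers \<open>a\<close> and \<open>b\<close>; the limit
  function has a gradient whose integrals do not exceed them. Passing to the absolute value keeps
  both bounds.\<close>

lemma minimizing_sequence:
  assumes "\<And>k::nat. V (us k) (gs k)" "\<And>k. Lp_int p M (gs k) \<le> L"
  obtains \<sigma> u g a b where "strict_mono (\<sigma> :: nat \<Rightarrow> nat)" "V u g" "\<forall>x. 0 \<le> u x"
    "(\<lambda>k. Lp_int p M (gs (\<sigma> k))) \<longlonglongrightarrow> a" "(\<lambda>k. Lp_int q M (gs (\<sigma> k))) \<longlonglongrightarrow> b"
    "(\<lambda>k. Lp_int s M (us (\<sigma> k))) \<longlonglongrightarrow> Lp_int s M u" "(\<lambda>k. Lp_int r M (us (\<sigma> k))) \<longlonglongrightarrow> Lp_int r M u"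
    "Lp_int p M g \<le> a" "Lp_int q M g \<le> b"
proof -
  obtain \<rho> u where \<rho>: "strict_mono (\<rho> :: nat \<Rightarrow> nat)" "Lp_fun r M u"
    "(\<lambda>k. Lp_int r M (\<lambda>x. us (\<rho> k) x - u x)) \<longlonglongrightarrow> 0"
    using V_compact[of us gs L] assms by blast
  obtain C where C: "0 < C" "\<And>f :: 'a \<Rightarrow> 'b. Lp_fun p M f \<Longrightarrow> Lp_int q M f \<le> 1 + C * Lp_int p M f"
    using Lp_int_lower_eps[OF finite_M _ p, of 1] q by (metis less_trans zero_less_one)
  have "Lp_int q M (gs k) \<le> 1 + C * L" for k
    using C(2)[OF V_Lp(2)[OF assms(1)], of k] mult_left_mono[OF assms(2) less_imp_le[OF C(1)], of k]
    by linarith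
  then have "(Lp_int p M (gs (\<rho> k)), Lp_int q M (gs (\<rho> k))) \<in> {0..L} \<times> {0..1 + C * L}" for k
    using assms(2) by simp
  \<comment> \<open>Both gradient integrals are treated as one point of the plane, so that a single
    extraction makes both converge.\<close>
  then have "bounded (range (\<lambda>k. (Lp_int p M (gs (\<rho> k)), Lp_int q M (gs (\<rho> k)))))"
    by (intro bounded_subset[OF bounded_Times[OF bounded_closed_interval[of 0 L]
          bounded_closed_interval[of 0 "1 + C * L"]]]) auto
  then obtain ab \<tau> where \<tau>: "strict_mono (\<tau> :: nat \<Rightarrow> nat)"
    "((\<lambda>k. (Lp_int p M (gs (\<rho> k)), Lp_int q M (gs (\<rho> k)))) \<circ> \<tau>) \<longlonglongrightarrow> ab"
    using bounded_imp_convergent_subsequence by blast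
  define \<sigma> where "\<sigma> = \<rho> \<circ> \<tau>"
  have \<sigma>: "strict_mono \<sigma>" using strict_mono_o[OF \<rho>(1) \<tau>(1)] by (simp add: \<sigma>_def)
  have a: "(\<lambda>k. Lp_int p M (gs (\<sigma> k))) \<longlonglongrightarrow> fst ab" and b: "(\<lambda>k. Lp_int q M (gs (\<sigma> k))) \<longlonglongrightarrow> snd ab"
    using tendsto_fst[OF \<tau>(2)] tendsto_snd[OF \<tau>(2)] by (simp_all add: \<sigma>_def o_def)
  have ur: "(\<lambda>k. Lp_int r M (\<lambda>x. us (\<sigma> k) x - u x)) \<longlonglongrightarrow> 0"
    using LIMSEQ_subseq_LIMSEQ[OF \<rho>(3) \<tau>(1)] by (simp add: \<sigma>_def o_def)
  have diff: "Lp_fun r M (\<lambda>x. us (\<sigma> k) x - u x)" for k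
    using V_Lr[OF assms(1)] \<rho>(2) p q r by (intro Lp_fun_diff) auto
  have up: "(\<lambda>k. Lp_int p M (\<lambda>x. us (\<sigma> k) x - u x)) \<longlonglongrightarrow> 0"
    using p q r by (intro Lp_convergence_lower[OF finite_M _ _ diff ur]) auto
  have us: "(\<lambda>k. Lp_int s M (\<lambda>x. us (\<sigma> k) x - u x)) \<longlonglongrightarrow> 0"
    using p q r s by (intro Lp_convergence_lower[OF finite_M _ _ diff ur]) auto
  have uLp: "Lp_fun p M u" using p q r by (intro Lp_fun_lower[OF finite_M _ _ \<rho>(2)]) auto
  have uLs: "Lp_fun s M u" using p q r s by (intro Lp_fun_lower[OF finite_M _ _ \<rho>(2)]) auto
  have lim: "(\<lambda>k. Lp_int s M (us (\<sigma> k))) \<longlonglongrightarrow> Lp_int s M u" "(\<lambda>k. Lp_int r M (us (\<sigma> k))) \<longlonglongrightarrow> Lp_int r M u"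
    using Lp_int_continuous[OF s(1) V_Ls[OF assms(1)] uLs us]
      Lp_int_continuous[OF _ V_Lr[OF assms(1)] \<rho>(2) ur] p q r by auto
  have "\<exists>v h. V v h \<and> Lp_int p M (\<lambda>x. v x - u x) \<le> \<epsilon> \<and> Lp_int p M h \<le> fst ab + \<epsilon> \<and> Lp_int q M h \<le> snd ab + \<epsilon>"
    if "0 < \<epsilon>" for \<epsilon>
  proof -
    have "eventually (\<lambda>k. Lp_int p M (\<lambda>x. us (\<sigma> k) x - u x) < \<epsilon>) sequentially"
      "eventually (\<lambda>k. Lp_int p M (gs (\<sigma> k)) < fst ab + \<epsilon>) sequentially"
      "eventually (\<lambda>k. Lp_int q M (gs (\<sigma> k)) < snd ab + \<epsilon>) sequentially"
      using that by (intro order_tendstoD[OF up] order_tendstoD[OF a] order_tendstoD[OF b]; simp)+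
    then have "eventually (\<lambda>k. Lp_int p M (\<lambda>x. us (\<sigma> k) x - u x) < \<epsilon> \<and> Lp_int p M (gs (\<sigma> k)) < fst ab + \<epsilon>
       \<and> Lp_int q M (gs (\<sigma> k)) < snd ab + \<epsilon>) sequentially"
      by eventually_elim simp
    then obtain k where "Lp_int p M (\<lambda>x. us (\<sigma> k) x - u x) < \<epsilon>" "Lp_int p M (gs (\<sigma> k)) < fst ab + \<epsilon>"
       "Lp_int q M (gs (\<sigma> k)) < snd ab + \<epsilon>"
      by (auto simp: eventually_sequentially)
    then show ?thesis using assms(1)[of "\<sigma> k"] by (meson less_imp_le)
  qed
  then obtain g where g: "V u g" "Lp_int p M g \<le> fst ab" "Lp_int q M g \<le> snd ab"
    using convex_limit[OF uLp, of "fst ab" "snd ab"] by metis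
  obtain h where h: "V (\<lambda>x. \<bar>u x\<bar>) h" "Lp_int p M h \<le> Lp_int p M g" "Lp_int q M h \<le> Lp_int q M g"
    using V_abs[OF g(1)] by blast
  have "Lp_int m M (\<lambda>x. \<bar>u x\<bar>) = Lp_int m M u" for m by (simp add: Lp_int_def)
  then show ?thesis
    using that[OF \<sigma> h(1) _ a b] lim g h by auto
qed

text \<open>The nonnegative term with \<open>\<beta>\<close> is discarded, so \<open>\<rho>\<close>
  and \<open>lam_star\<close> are independent of \<open>\<beta>\<close>. One half of
  \<open>\<rho> / p\<close> pays for the term with exponent \<open>r\<close>, the other half for the
  singular term.\<close>

lemma sphere_positive:
  "\<exists>\<rho>>0. \<exists>lam_star>0. \<forall>\<beta>\<ge>0. \<forall>lam u g. 0 < lam \<and> lam < lam_star \<and> V u g \<and> Lp_int p M g = \<rho> \<longrightarrow>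
     0 < energy \<beta> lam u g 1"
proof -
  obtain S where S: "0 < S" "\<And>u g. V u g \<Longrightarrow> Lp_int r M u \<le> S * Lp_int p M g powr (r / p)"
    using V_embed by blast
  obtain C where C: "0 < C" "\<And>f :: 'a \<Rightarrow> real. Lp_fun r M f \<Longrightarrow> Lp_int s M f \<le> 1 + C * Lp_int r M f"
    using Lp_int_lower_eps[OF finite_M s(1) _ zero_less_one, of r] s q p r
    by (metis less_trans)
  \<comment> \<open>Solves \<open>S * \<rho> powr (r / p) / r = \<rho> / (2 * p)\<close>, which is
    possible because \<open>r > p\<close>.\<close>
  define \<rho> where "\<rho> = (r / (2 * p * S)) powr (p / (r - p))"
  have pos: "0 < p" "0 < r" "0 < r - p" using q p r by auto
  have \<rho>: "0 < \<rho>" using pos S(1) by (simp add: \<rho>_def)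
  have "r / p = 1 + (r - p) / p" using pos by (simp add: field_simps)
  then have "\<rho> powr (r / p) = \<rho> powr (1 + (r - p) / p)" by simp
  also have "\<dots> = \<rho> * \<rho> powr ((r - p) / p)" using \<rho> by (simp only: powr_add powr_one)
  also have "\<rho> powr ((r - p) / p) = r / (2 * p * S)" using pos S(1) by (simp add: \<rho>_def powr_powr)
  finally have S\<rho>: "S * \<rho> powr (r / p) / r = \<rho> / (2 * p)" using pos S(1) by simp
  define L where "L = 1 + C * (S * \<rho> powr (r / p))"
  have L: "0 < L" using C(1) S(1) by (simp add: L_def add_pos_nonneg)
  \<comment> \<open>\<open>L\<close> bounds the \<open>s\<close>-integral on the sphere; below this
    value the singular term stays strictly under \<open>\<rho> / (2 * p)\<close>.\<close>
  define lam_star where "lam_star = \<rho> / (2 * p) * s / L"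
  have ls: "0 < lam_star" using \<rho> pos L s by (simp add: lam_star_def)
  have "0 < energy \<beta> lam u g 1"
    if "0 \<le> \<beta>" "0 < lam" "lam < lam_star" "V u g" "Lp_int p M g = \<rho>" for \<beta> lam u g
  proof -
    have D: "Lp_int r M u \<le> S * \<rho> powr (r / p)" using S(2)[OF that(4)] that(5) by simp
    then have "C * Lp_int r M u \<le> C * (S * \<rho> powr (r / p))" using C(1) by (intro mult_left_mono) auto
    then have "Lp_int s M u \<le> L" using C(2)[OF V_Lr[OF that(4)]] by (simp add: L_def)
    then have "lam * Lp_int s M u \<le> lam * L" using that by (intro mult_left_mono) auto
    also have "\<dots> < lam_star * L" using that L by (intro mult_strict_right_mono) auto
    also have "\<dots> = \<rho> / (2 * p) * s" using L by (simp add: lam_star_def)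
    finally have "lam * Lp_int s M u / s < \<rho> / (2 * p)" using s(1) by (simp add: pos_divide_less_eq)
    moreover have "Lp_int r M u / r \<le> \<rho> / (2 * p)"
      using divide_right_mono[OF D less_imp_le[OF pos(2)]] S\<rho> by simp
    moreover have "0 \<le> \<beta> * Lp_int q M g / q" using that q by simp
    moreover have "\<rho> / p = \<rho> / (2 * p) + \<rho> / (2 * p)" by (simp add: field_simps)
    ultimately show ?thesis using that(5) by (simp add: energy_def fiber_def)
  qed
  with \<rho> ls show ?thesis by blast
qed

text \<open>The one-sided criticality shared by a local minimiser and by a minimiser of the maximum along
  rays; the factors \<open>t\<close> are needed for the latter only.\<close>

definition subcritical :: "real \<Rightarrow> real \<Rightarrow> ('a \<Rightarrow> real) \<Rightarrow> ('a \<Rightarrow> 'b) \<Rightarrow> bool" where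
  "subcritical \<beta> lam u g \<longleftrightarrow> V u g \<and> (\<forall>x. 0 \<le> u x) \<and>
     (\<forall>\<phi> h. V \<phi> h \<longrightarrow> (\<exists>\<sigma> t :: nat \<Rightarrow> real. \<sigma> \<longlonglongrightarrow> 0 \<and> t \<longlonglongrightarrow> 1 \<and>
        (\<forall>k. 0 < \<sigma> k \<and> \<sigma> k \<le> 1 \<and> 0 < t k \<and>
          energy \<beta> lam u g (t k) \<le> energy \<beta> lam (\<lambda>x. u x + \<sigma> k * \<phi> x) (\<lambda>x. g x + \<sigma> k *\<^sub>R h x) (t k))))"

lemma coefficients_continuous:
  assumes "V u g" "V \<phi> h" and \<sigma>: "\<sigma> \<longlonglongrightarrow> 0"
  shows "(\<lambda>k. Lp_int p M (\<lambda>x. g x + \<sigma> k *\<^sub>R h x)) \<longlonglongrightarrow> Lp_int p M g"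
    and "(\<lambda>k. Lp_int q M (\<lambda>x. g x + \<sigma> k *\<^sub>R h x)) \<longlonglongrightarrow> Lp_int q M g"
    and "(\<lambda>k. Lp_int s M (\<lambda>x. u x + \<sigma> k * \<phi> x)) \<longlonglongrightarrow> Lp_int s M u"
    and "(\<lambda>k. Lp_int r M (\<lambda>x. u x + \<sigma> k * \<phi> x)) \<longlonglongrightarrow> Lp_int r M u"
proof -
  have *: "(\<lambda>k. Lp_int m M (\<lambda>x. f x + \<sigma> k *\<^sub>R f' x)) \<longlonglongrightarrow> Lp_int m M f"
    if "0 < m" "Lp_fun m M f" "Lp_fun m M f'" for m and f f' :: "'a \<Rightarrow> 'c::euclidean_space"
  proof (rule Lp_int_continuous[OF that(1) _ that(2)])
    show "Lp_fun m M (\<lambda>x. f x + \<sigma> k *\<^sub>R f' x)" for k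
      by (intro Lp_fun_add Lp_fun_scaleR that)
    have "(\<lambda>k. \<bar>\<sigma> k\<bar> powr m * Lp_int m M f') \<longlonglongrightarrow> \<bar>0\<bar> powr m * Lp_int m M f'"
      using that(1) by (intro tendsto_mult tendsto_powr'[OF tendsto_rabs[OF \<sigma>]] tendsto_const) auto
    then show "(\<lambda>k. Lp_int m M (\<lambda>x. f x + \<sigma> k *\<^sub>R f' x - f x)) \<longlonglongrightarrow> 0"
      by (simp add: Lp_int_scaleR)
  qed
  show "(\<lambda>k. Lp_int p M (\<lambda>x. g x + \<sigma> k *\<^sub>R h x)) \<longlonglongrightarrow> Lp_int p M g"
    using p q V_Lp(2) assms by (intro *) auto
  show "(\<lambda>k. Lp_int q M (\<lambda>x. g x + \<sigma> k *\<^sub>R h x)) \<longlonglongrightarrow> Lp_int q M g"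
    using p q V_Lq assms by (intro *) auto
  show "(\<lambda>k. Lp_int s M (\<lambda>x. u x + \<sigma> k * \<phi> x)) \<longlonglongrightarrow> Lp_int s M u"
    using *[OF s(1) V_Ls[OF assms(1)] V_Ls[OF assms(2)]] by simp
  show "(\<lambda>k. Lp_int r M (\<lambda>x. u x + \<sigma> k * \<phi> x)) \<longlonglongrightarrow> Lp_int r M u"
    using *[OF _ V_Lr[OF assms(1)] V_Lr[OF assms(2)]] p q r by simp
qed

text \<open>Makes the infimum over the gradient ball finite: only the two subtracted terms can be
  negative, and the embedding bounds them.\<close>

lemma energy_lower_bound:
  assumes "0 \<le> \<beta>" "0 \<le> lam"
  shows "\<exists>c. \<forall>u g. V u g \<longrightarrow> Lp_int p M g \<le> \<rho> \<longrightarrow> c \<le> energy \<beta> lam u g 1"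
proof -
  obtain S where S: "0 < S" "\<And>u g. V u g \<Longrightarrow> Lp_int r M u \<le> S * Lp_int p M g powr (r / p)"
    using V_embed by blast
  obtain C where C: "0 < C" "\<And>f :: 'a \<Rightarrow> real. Lp_fun r M f \<Longrightarrow> Lp_int s M f \<le> 1 + C * Lp_int r M f"
    using Lp_int_lower_eps[OF finite_M s(1) _ zero_less_one, of r] s q p r
    by (metis less_trans)
  define K where "K = S * \<rho> powr (r / p)"
  have "- (lam * (1 + C * K) / s) - K / r \<le> energy \<beta> lam u g 1" if V: "V u g" and le: "Lp_int p M g \<le> \<rho>" for u g
  proof -
    have "Lp_int p M g powr (r / p) \<le> \<rho> powr (r / p)"
      using le p q r by (intro powr_mono2) auto
    then have D: "Lp_int r M u \<le> K"
      unfolding K_def using S(1) by (intro order_trans[OF S(2)[OF V]] mult_left_mono) auto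
    then have "Lp_int s M u \<le> 1 + C * K"
      using C(2)[OF V_Lr[OF V]] mult_left_mono[OF D less_imp_le[OF C(1)]] by linarith
    then have "lam * Lp_int s M u / s \<le> lam * (1 + C * K) / s"
      using assms s by (intro divide_right_mono mult_left_mono) auto
    moreover have "Lp_int r M u / r \<le> K / r" using D p q r by (intro divide_right_mono) auto
    moreover have "0 \<le> Lp_int p M g / p" "0 \<le> \<beta> * Lp_int q M g / q" using assms p q by auto
    ultimately show ?thesis by (simp add: energy_def fiber_def)
  qed
  then show ?thesis by blast
qed

text \<open>Small multiples of a fixed function have negative energy, so the infimum over the ball
  is negative. On the boundary sphere the energy is positive, so the minimiser lies strictly inside
  and every small perturbation is a competitor.\<close>

lemma first_solution:
  assumes "0 \<le> \<beta>" "0 < lam" "0 < \<rho>"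
    and sphere: "\<And>u g. V u g \<Longrightarrow> Lp_int p M g = \<rho> \<Longrightarrow> 0 < energy \<beta> lam u g 1"
  obtains u g where "subcritical \<beta> lam u g" "energy \<beta> lam u g 1 < 0"
proof -
  define S where "S = {energy \<beta> lam u g 1 |u g. V u g \<and> Lp_int p M g \<le> \<rho>}"
  define c where "c = Inf S"
  have S: "S \<noteq> {}" "bdd_below S"
  proof -
    have "Lp_int p M (\<lambda>x. 0 :: 'b) \<le> \<rho>" using assms(3) by (simp add: Lp_int_def)
    then show "S \<noteq> {}" using V_zero unfolding S_def by blast
    show "bdd_below S"
      using energy_lower_bound[OF assms(1) less_imp_le[OF assms(2)], of \<rho>]
      by (auto simp: S_def bdd_below_def)
  qed
  have lower: "c \<le> energy \<beta> lam u g 1" if "V u g" "Lp_int p M g \<le> \<rho>" for u g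
    unfolding c_def using that S(2) by (intro cInf_lower) (auto simp: S_def)
  have "\<exists>u g. V u g \<and> Lp_int p M g \<le> \<rho> \<and> energy \<beta> lam u g 1 < c + 1 / real (Suc k)" for k
    using cInf_lessD[OF S(1), of "c + 1 / real (Suc k)"] by (auto simp: S_def c_def)
  then obtain us gs where us: "\<And>k. V (us k) (gs k)" "\<And>k. Lp_int p M (gs k) \<le> \<rho>"
    "\<And>k. energy \<beta> lam (us k) (gs k) 1 < c + 1 / real (Suc k)" by metis
  obtain \<sigma> u g a b where lim: "strict_mono (\<sigma> :: nat \<Rightarrow> nat)" "V u g" "\<forall>x. 0 \<le> u x"
    "(\<lambda>k. Lp_int p M (gs (\<sigma> k))) \<longlonglongrightarrow> a" "(\<lambda>k. Lp_int q M (gs (\<sigma> k))) \<longlonglongrightarrow> b"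
    "(\<lambda>k. Lp_int s M (us (\<sigma> k))) \<longlonglongrightarrow> Lp_int s M u" "(\<lambda>k. Lp_int r M (us (\<sigma> k))) \<longlonglongrightarrow> Lp_int r M u"
    "Lp_int p M g \<le> a" "Lp_int q M g \<le> b"
    by (rule minimizing_sequence[of us gs \<rho>, OF us(1,2)])
  have "a \<le> \<rho>" using us(2) by (intro LIMSEQ_le_const2[OF lim(4)]) auto
  then have g\<rho>: "Lp_int p M g \<le> \<rho>" using lim(8) by simp
  \<comment> \<open>The limit of the energies has \<open>a\<close> and \<open>b\<close> in place of
    the gradient integrals of \<open>u\<close>; by \<open>fiber_mono\<close> replacing them only
    lowers the value.\<close>
  have "fiber p q r s \<beta> lam a b (Lp_int s M u) (Lp_int r M u) 1 \<le> c"
  proof (rule LIMSEQ_le)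
    show "(\<lambda>k. energy \<beta> lam (us (\<sigma> k)) (gs (\<sigma> k)) 1) \<longlonglongrightarrow> fiber p q r s \<beta> lam a b (Lp_int s M u) (Lp_int r M u) 1"
      unfolding energy_def by (intro tendsto_fiber lim tendsto_const) auto
    have "(\<lambda>k. c + 1 / real (Suc k)) \<longlonglongrightarrow> c + 0"
      by (intro tendsto_add tendsto_const LIMSEQ_Suc[OF lim_1_over_n])
    from LIMSEQ_subseq_LIMSEQ[OF this lim(1)] show "(\<lambda>k. c + 1 / real (Suc (\<sigma> k))) \<longlonglongrightarrow> c"
      by (simp add: o_def)
    show "\<exists>N. \<forall>k\<ge>N. energy \<beta> lam (us (\<sigma> k)) (gs (\<sigma> k)) 1 \<le> c + 1 / real (Suc (\<sigma> k))"
      using us(3) by (intro exI[of _ 0] allI impI less_imp_le)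
  qed
  then have ec: "energy \<beta> lam u g 1 \<le> c"
    using fiber_mono[OF lim(8,9) assms(1)] by (metis energy_def order_trans)
  have "c < 0"
  proof -
    obtain v h where v: "V v h" "0 < Lp_int r M v" "0 < Lp_int s M v" using ex_positive by metis
    \<comment> \<open>The largest admissible size for \<open>t powr p\<close>: it keeps
      \<open>t\<close> times the gradient inside the ball, and adding 1 guards against a vanishing
      denominator.\<close>
    define w where "w = \<rho> / (Lp_int p M h + 1)"
    have h1: "0 < Lp_int p M h + 1" by (intro add_nonneg_pos) auto
    have w: "0 < w" "w * Lp_int p M h \<le> \<rho>" using assms(3) h1 by (auto simp: w_def field_simps)
    define e where "e = w powr (1 / p)"
    have e: "0 < e" using w by (simp add: e_def)
    obtain t where t: "0 < t" "t < e" "energy \<beta> lam v h t < 0"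
      unfolding energy_def by (rule fiber_neg[OF mult_pos_pos[OF assms(2) v(3)] e less_imp_le[OF v(2)]])
    have "t powr p \<le> e powr p" using t p q by (intro powr_mono2) auto
    also have "\<dots> = w" using w p q by (simp add: e_def powr_powr)
    finally have "t powr p * Lp_int p M h \<le> w * Lp_int p M h"
      by (intro mult_right_mono) auto
    also note w(2)
    finally have "Lp_int p M (\<lambda>x. t *\<^sub>R h x) \<le> \<rho>" using t by (simp add: Lp_int_scaleR)
    then have "c \<le> energy \<beta> lam (\<lambda>x. t * v x) (\<lambda>x. t *\<^sub>R h x) 1"
      by (intro lower V_scale v)
    also have "\<dots> < 0" using t energy_scale[of t 1] by simp
    finally show ?thesis .
  qed
  with ec have neg: "energy \<beta> lam u g 1 < 0" by simp
  \<comment> \<open>Strictness leaves room for perturbations, so the constant sequence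
    \<open>t k = 1\<close> serves in \<open>subcritical\<close>.\<close>
  then have strict: "Lp_int p M g < \<rho>" using g\<rho> sphere[OF lim(2)] by (cases "Lp_int p M g = \<rho>") auto
  have "subcritical \<beta> lam u g"
    unfolding subcritical_def
  proof (intro conjI lim(2,3), intro allI impI)
    fix \<phi> h assume \<phi>: "V \<phi> h"
    define \<epsilon> where "\<epsilon> = (\<lambda>k::nat. 1 / real (Suc k))"
    have \<epsilon>0: "\<epsilon> \<longlonglongrightarrow> 0" unfolding \<epsilon>_def by (rule LIMSEQ_Suc[OF lim_1_over_n])
    obtain N where N: "\<And>k. k \<ge> N \<Longrightarrow> Lp_int p M (\<lambda>x. g x + \<epsilon> k *\<^sub>R h x) < \<rho>"
      using order_tendstoD(2)[OF coefficients_continuous(1)[OF lim(2) \<phi> \<epsilon>0] strict]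
      by (auto simp: eventually_sequentially)
    have "energy \<beta> lam u g 1 \<le> energy \<beta> lam (\<lambda>x. u x + \<epsilon> (k + N) * \<phi> x) (\<lambda>x. g x + \<epsilon> (k + N) *\<^sub>R h x) 1" for k
      using lower[OF V_add[OF lim(2) V_scale[OF \<phi>]] less_imp_le[OF N[of "k + N"]]] ec by simp
    moreover have "(\<lambda>k. \<epsilon> (k + N)) \<longlonglongrightarrow> 0" using \<epsilon>0 by (rule LIMSEQ_ignore_initial_segment)
    ultimately show "\<exists>\<sigma> t :: nat \<Rightarrow> real. \<sigma> \<longlonglongrightarrow> 0 \<and> t \<longlonglongrightarrow> 1 \<and>
        (\<forall>k. 0 < \<sigma> k \<and> \<sigma> k \<le> 1 \<and> 0 < t k \<and>
          energy \<beta> lam u g (t k) \<le> energy \<beta> lam (\<lambda>x. u x + \<sigma> k * \<phi> x) (\<lambda>x. g x + \<sigma> k *\<^sub>R h x) (t k))"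
      by (intro exI[of _ "\<lambda>k. \<epsilon> (k + N)"] exI[of _ "\<lambda>k. 1"]) (auto simp: \<epsilon>_def)
  qed
  with neg show ?thesis using that by blast
qed

end

section \<open>The minimax over rays\<close>

context compact_gradient_pairs
begin

lemma energy_at_zero: "energy \<beta> lam u g 0 = 0"
  by (simp add: energy_def fiber_zero)

lemma energy_attains_max:
  assumes "0 \<le> \<beta>" "0 \<le> lam" "0 < Lp_int r M u"
  shows "\<exists>t\<ge>0. \<forall>t'\<ge>0. energy \<beta> lam u g t' \<le> energy \<beta> lam u g t"
  unfolding energy_def using assms by (intro fiber_attains_max) auto

lemma gradient_energy_pos:
  assumes "V u g" "0 < Lp_int r M u"
  shows "0 < Lp_int p M g"
proof (rule ccontr)
  assume "\<not> ?thesis"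
  then have z: "Lp_int p M g = 0" by (simp add: antisym not_less)
  obtain S where "\<And>u g. V u g \<Longrightarrow> Lp_int r M u \<le> S * Lp_int p M g powr (r / p)"
    using V_embed by blast
  from this[OF assms(1)] show False using assms(2) z by simp
qed

text \<open>Every ray with positive \<open>r\<close>-integral reaches at least the level
  \<open>c\<close>, and the ray of the limit stays below it. A perturbed ray reaches
  \<open>c\<close> at some point where the unperturbed ray is at most \<open>c\<close>, and
  uniqueness of the maximum forces these points to converge to 1.\<close>

lemma second_solution:
  assumes \<beta>: "0 \<le> \<beta>" and lam: "0 < lam" and "0 < \<rho>"
    and sphere: "\<And>u g. V u g \<Longrightarrow> Lp_int p M g = \<rho> \<Longrightarrow> 0 < energy \<beta> lam u g 1"
  obtains u g where "subcritical \<beta> lam u g" "0 < energy \<beta> lam u g 1"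
proof -
  \<comment> \<open>An upper bound for one whole ray; the infimum of such bounds is the minimax
    level, and no maximum point has to be selected.\<close>
  define P where "P = (\<lambda>c. \<exists>w g. V w g \<and> 0 < Lp_int r M w \<and> (\<forall>t\<ge>0. energy \<beta> lam w g t \<le> c))"
  define c where "c = Inf (Collect P)"
  have lam': "0 \<le> lam" using lam by simp
  have nonneg: "0 \<le> c'" if "P c'" for c'
    using that energy_at_zero unfolding P_def by (metis order_refl)
  have bdd: "bdd_below (Collect P)" using nonneg by (intro bdd_belowI[of _ 0]) auto
  have ne: "Collect P \<noteq> {}"
  proof -
    obtain w g where w: "V w g" "0 < Lp_int r M w" using ex_positive by metis
    obtain t where "\<And>t'. 0 \<le> t' \<Longrightarrow> energy \<beta> lam w g t' \<le> energy \<beta> lam w g t"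
      using energy_attains_max[OF \<beta> lam' w(2)] by blast
    then have "P (energy \<beta> lam w g t)" using w unfolding P_def by blast
    then show ?thesis by blast
  qed
  have c_le: "c \<le> c'" if "P c'" for c' unfolding c_def using that bdd by (intro cInf_lower) auto
  \<comment> \<open>Rescaling moves along the same ray and so keeps the bound; gradients of energy 1
    give the boundedness that compactness requires.\<close>
  have normalized: "\<exists>w g. V w g \<and> Lp_int p M g = 1 \<and> (\<forall>t\<ge>0. energy \<beta> lam w g t \<le> c + 1 / real (Suc k))" for k
  proof -
    obtain c' where "P c'" "c' < c + 1 / real (Suc k)"
      using cInf_lessD[OF ne, of "c + 1 / real (Suc k)"] by (auto simp: c_def)
    then obtain w g where w: "V w g" "0 < Lp_int r M w" "\<And>t. 0 \<le> t \<Longrightarrow> energy \<beta> lam w g t \<le> c + 1 / real (Suc k)"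
      unfolding P_def by (meson less_imp_le order_trans)
    define a where "a = Lp_int p M g powr (- 1 / p)"
    have A: "0 < Lp_int p M g" by (rule gradient_energy_pos[OF w(1,2)])
    have a: "0 < a" using A by (simp add: a_def)
    have "Lp_int p M (\<lambda>x. a *\<^sub>R g x) = a powr p * Lp_int p M g" using a by (simp add: Lp_int_scaleR)
    also have "a powr p = Lp_int p M g powr (- 1)" using p q by (simp add: a_def powr_powr)
    also have "\<dots> * Lp_int p M g = 1" using A by (simp add: powr_minus)
    finally have "Lp_int p M (\<lambda>x. a *\<^sub>R g x) = 1" .
    moreover have "energy \<beta> lam (\<lambda>x. a * w x) (\<lambda>x. a *\<^sub>R g x) t \<le> c + 1 / real (Suc k)" if "0 \<le> t" for t
      using w(3)[of "a * t"] a that by (simp add: energy_scale)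
    ultimately show ?thesis using V_scale[OF w(1), of a] by blast
  qed
  then obtain ws gs where ws: "\<And>k. V (ws k) (gs k)" "\<And>k. Lp_int p M (gs k) = 1"
    "\<And>k t. 0 \<le> t \<Longrightarrow> energy \<beta> lam (ws k) (gs k) t \<le> c + 1 / real (Suc k)" by metis
  obtain \<sigma> u g a b where lim: "strict_mono (\<sigma> :: nat \<Rightarrow> nat)" "V u g" "\<forall>x. 0 \<le> u x"
    "(\<lambda>k. Lp_int p M (gs (\<sigma> k))) \<longlonglongrightarrow> a" "(\<lambda>k. Lp_int q M (gs (\<sigma> k))) \<longlonglongrightarrow> b"
    "(\<lambda>k. Lp_int s M (ws (\<sigma> k))) \<longlonglongrightarrow> Lp_int s M u" "(\<lambda>k. Lp_int r M (ws (\<sigma> k))) \<longlonglongrightarrow> Lp_int r M u"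
    "Lp_int p M g \<le> a" "Lp_int q M g \<le> b"
    by (rule minimizing_sequence[of ws gs 1, OF ws(1) eq_refl[OF ws(2)]])
  have a1: "a = 1" using LIMSEQ_unique[OF lim(4)] ws(2) by simp
  have b0: "0 \<le> b" using Lp_int_nonneg lim(9) by (rule order_trans)
  have level: "fiber p q r s \<beta> lam a b (Lp_int s M u) (Lp_int r M u) t \<le> c" if "0 \<le> t" for t
  proof (rule LIMSEQ_le)
    show "(\<lambda>k. energy \<beta> lam (ws (\<sigma> k)) (gs (\<sigma> k)) t) \<longlonglongrightarrow> fiber p q r s \<beta> lam a b (Lp_int s M u) (Lp_int r M u) t"
      unfolding energy_def by (intro tendsto_fiber lim tendsto_const that)
    have "(\<lambda>k. c + 1 / real (Suc k)) \<longlonglongrightarrow> c + 0"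
      by (intro tendsto_add tendsto_const LIMSEQ_Suc[OF lim_1_over_n])
    from LIMSEQ_subseq_LIMSEQ[OF this lim(1)] show "(\<lambda>k. c + 1 / real (Suc (\<sigma> k))) \<longlonglongrightarrow> c"
      by (simp add: o_def)
    show "\<exists>N. \<forall>k\<ge>N. energy \<beta> lam (ws (\<sigma> k)) (gs (\<sigma> k)) t \<le> c + 1 / real (Suc (\<sigma> k))"
      using ws(3)[OF that] by blast
  qed
  \<comment> \<open>Were the limit zero, both subtracted terms would vanish along the limiting
    fiber, which would then grow at least like \<open>t powr p / p\<close>, since
    \<open>a = 1\<close>, and pass the level \<open>c\<close>.\<close>
  have Dpos: "0 < Lp_int r M u"
  proof (rule ccontr)
    assume "\<not> ?thesis"
    then have D: "Lp_int r M u = 0" by (simp add: antisym not_less)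
    then have C: "Lp_int s M u = 0" using Lr_zero_imp_Ls_zero[OF lim(2)] by simp
    define t where "t = (p * (\<bar>c\<bar> + 1)) powr (1 / p)"
    have "t powr p = p * (\<bar>c\<bar> + 1)" using p q by (simp add: t_def powr_powr)
    then have "fiber p q r s \<beta> lam a b (Lp_int s M u) (Lp_int r M u) t = \<bar>c\<bar> + 1 + \<beta> * b * t powr q / q"
      using p q by (simp add: fiber_def D C a1)
    moreover have "0 \<le> \<beta> * b * t powr q / q" using \<beta> b0 q by simp
    moreover have "0 \<le> t" by (simp add: t_def)
    ultimately show False using level[of t] by linarith
  qed
  have below: "energy \<beta> lam u g t \<le> c" if "0 \<le> t" for t
    using order_trans[OF fiber_mono[OF lim(8,9) \<beta>] level[OF that]] by (simp add: energy_def)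
  have attains: "\<exists>t\<ge>0. c \<le> energy \<beta> lam w h t" if wh: "V w h" "0 < Lp_int r M w" for w h
  proof -
    obtain t where t: "0 \<le> t" "\<And>t'. 0 \<le> t' \<Longrightarrow> energy \<beta> lam w h t' \<le> energy \<beta> lam w h t"
      using energy_attains_max[OF \<beta> lam' wh(2)] by blast
    then have "P (energy \<beta> lam w h t)" using wh unfolding P_def by blast
    then show ?thesis using c_le t(1) by blast
  qed
  obtain t where t: "0 \<le> t" "c \<le> energy \<beta> lam u g t" using attains[OF lim(2) Dpos] by blast
  \<comment> \<open>The ray of \<open>u\<close> crosses the sphere of gradient energy
    \<open>\<rho>\<close>, where the energy is positive.\<close>
  have cpos: "0 < c"
  proof -
    have A: "0 < Lp_int p M g" by (rule gradient_energy_pos[OF lim(2) Dpos])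
    define e where "e = (\<rho> / Lp_int p M g) powr (1 / p)"
    have e: "0 \<le> e" by (simp add: e_def)
    have "e powr p = \<rho> / Lp_int p M g" using A assms(3) p q by (simp add: e_def powr_powr)
    then have "Lp_int p M (\<lambda>x. e *\<^sub>R g x) = \<rho>" using A e by (simp add: Lp_int_scaleR)
    then have "0 < energy \<beta> lam (\<lambda>x. e * u x) (\<lambda>x. e *\<^sub>R g x) 1"
      by (intro sphere V_scale lim)
    also have "\<dots> = energy \<beta> lam u g e" using e by (simp add: energy_scale)
    also have "\<dots> \<le> c" by (rule below[OF e])
    finally show ?thesis .
  qed
  then have tpos: "0 < t" using t energy_at_zero by (cases "t = 0") auto
  define v where "v = (\<lambda>x. t * u x)"
  define k where "k = (\<lambda>x. t *\<^sub>R g x)"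
  have V: "V v k" unfolding v_def k_def by (rule V_scale[OF lim(2)])
  have en: "energy \<beta> lam v k t' = energy \<beta> lam u g (t * t')" if "0 \<le> t'" for t'
    unfolding v_def k_def using t(1) that by (rule energy_scale)
  have vmax: "energy \<beta> lam v k t' \<le> c" if "0 \<le> t'" for t'
    using that t(1) by (simp add: en below)
  have v1: "energy \<beta> lam v k 1 = c" using t below[OF t(1)] by (simp add: en)
  have Dv: "0 < Lp_int r M v"
    using Dpos tpos Lp_int_scaleR[of r M t u] by (simp add: v_def)
  have "subcritical \<beta> lam v k"
    unfolding subcritical_def
  proof (intro conjI V, use t(1) lim(3) in \<open>simp add: v_def\<close>, intro allI impI)
    fix \<phi> h assume \<phi>: "V \<phi> h"
    define \<epsilon> where "\<epsilon> = (\<lambda>j::nat. 1 / real (Suc j))"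
    have \<epsilon>0: "\<epsilon> \<longlonglongrightarrow> 0" unfolding \<epsilon>_def by (rule LIMSEQ_Suc[OF lim_1_over_n])
    have \<epsilon>: "0 < \<epsilon> j" "\<epsilon> j \<le> 1" for j by (auto simp: \<epsilon>_def)
    define w where "w = (\<lambda>j x. v x + \<epsilon> j * \<phi> x)"
    define l where "l = (\<lambda>j x. k x + \<epsilon> j *\<^sub>R h x)"
    have coeff: "(\<lambda>j. Lp_int p M (l j)) \<longlonglongrightarrow> Lp_int p M k" "(\<lambda>j. Lp_int q M (l j)) \<longlonglongrightarrow> Lp_int q M k"
      "(\<lambda>j. Lp_int s M (w j)) \<longlonglongrightarrow> Lp_int s M v" "(\<lambda>j. Lp_int r M (w j)) \<longlonglongrightarrow> Lp_int r M v"
      unfolding w_def l_def by (rule coefficients_continuous[OF V \<phi> \<epsilon>0])+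
    have Vw: "V (w j) (l j)" for j unfolding w_def l_def by (intro V_add V V_scale \<phi>)
    have "eventually (\<lambda>j. Lp_int r M v / 2 < Lp_int r M (w j)) sequentially"
      using Dv by (intro order_tendstoD(1)[OF coeff(4)]) simp
    moreover have "eventually (\<lambda>j. Lp_int p M (l j) < Lp_int p M k + 1) sequentially"
      by (intro order_tendstoD(2)[OF coeff(1)]) simp
    moreover have "eventually (\<lambda>j. Lp_int q M (l j) < Lp_int q M k + 1) sequentially"
      by (intro order_tendstoD(2)[OF coeff(2)]) simp
    ultimately have "eventually (\<lambda>j. Lp_int r M v / 2 < Lp_int r M (w j) \<and> Lp_int p M (l j) < Lp_int p M k + 1
        \<and> Lp_int q M (l j) < Lp_int q M k + 1) sequentially"
      by eventually_elim simp
    then obtain N where N: "\<And>j. j \<ge> N \<Longrightarrow> Lp_int r M v / 2 < Lp_int r M (w j) \<and> Lp_int p M (l j) < Lp_int p M k + 1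
        \<and> Lp_int q M (l j) < Lp_int q M k + 1"
      unfolding eventually_sequentially by blast
    \<comment> \<open>Above \<open>T\<close> the perturbed fibers are at most 0, below the positive
      level \<open>c\<close>, so the points where they reach \<open>c\<close> form a bounded
      sequence.\<close>
    have "\<exists>T\<ge>1. \<forall>A\<le>Lp_int p M k + 1. \<forall>B\<le>Lp_int q M k + 1. \<forall>C\<ge>0. \<forall>D\<ge>Lp_int r M v / 2. \<forall>t\<ge>T.
        fiber p q r s \<beta> lam A B C D t \<le> 0"
      using Dv \<beta> lam by (intro fiber_nonpos) (auto intro: add_nonneg_nonneg)
    then obtain T where T: "1 \<le> T" "\<And>A B C D t. A \<le> Lp_int p M k + 1 \<Longrightarrow> B \<le> Lp_int q M k + 1 \<Longrightarrow> 0 \<le> C \<Longrightarrow>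
        Lp_int r M v / 2 \<le> D \<Longrightarrow> T \<le> t \<Longrightarrow> fiber p q r s \<beta> lam A B C D t \<le> 0"
      by blast
    have "\<exists>t. 0 \<le> t \<and> t \<le> T \<and> c \<le> energy \<beta> lam (w (j + N)) (l (j + N)) t" for j
    proof -
      have n: "Lp_int r M v / 2 < Lp_int r M (w (j + N))" "Lp_int p M (l (j + N)) < Lp_int p M k + 1"
        "Lp_int q M (l (j + N)) < Lp_int q M k + 1"
        using N[of "j + N"] by auto
      then have "0 < Lp_int r M (w (j + N))" using Dv by simp
      then obtain t where t: "0 \<le> t" "c \<le> energy \<beta> lam (w (j + N)) (l (j + N)) t"
        using attains[OF Vw] by blast
      have "energy \<beta> lam (w (j + N)) (l (j + N)) t \<le> 0" if "T \<le> t"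
        unfolding energy_def using n that by (intro T(2)) auto
      then have "t \<le> T" using t cpos by (cases "t \<le> T") auto
      with t show ?thesis by blast
    qed
    then obtain ts where ts: "\<And>j. 0 \<le> ts j" "\<And>j. ts j \<le> T"
      "\<And>j. c \<le> energy \<beta> lam (w (j + N)) (l (j + N)) (ts j)" by metis
    have ts_pos: "0 < ts j" for j
      using ts(1,3)[of j] cpos energy_at_zero by (cases "ts j = 0") (auto simp: less_le)
    have "bounded (range ts)"
      using ts(1,2) by (intro bounded_subset[OF bounded_closed_interval[of 0 T]]) auto
    then obtain t0 \<tau> where \<tau>: "strict_mono (\<tau> :: nat \<Rightarrow> nat)" "(ts \<circ> \<tau>) \<longlonglongrightarrow> t0"
      using bounded_imp_convergent_subsequence by blast
    have t0: "0 \<le> t0" using ts(1) by (intro LIMSEQ_le_const[OF \<tau>(2)]) auto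
    have sub: "(\<lambda>i. f (\<tau> i + N)) \<longlonglongrightarrow> y" if "f \<longlonglongrightarrow> y" for f :: "nat \<Rightarrow> real" and y
      using LIMSEQ_subseq_LIMSEQ[OF LIMSEQ_ignore_initial_segment[OF that, of N] \<tau>(1)] by (simp add: o_def)
    have "(\<lambda>i. energy \<beta> lam (w (\<tau> i + N)) (l (\<tau> i + N)) (ts (\<tau> i))) \<longlonglongrightarrow> energy \<beta> lam v k t0"
      unfolding energy_def using \<tau>(2) ts(1) by (intro tendsto_fiber sub coeff) (auto simp: o_def)
    then have "c \<le> energy \<beta> lam v k t0"
      using ts(3) by (intro LIMSEQ_le_const) auto
    then have e0: "energy \<beta> lam v k t0 = c" using vmax[OF t0] by simp
    then have t0_pos: "0 < t0" using t0 cpos energy_at_zero by (cases "t0 = 0") auto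
    have fmax: "fiber p q r s \<beta> lam (Lp_int p M k) (Lp_int q M k) (Lp_int s M v) (Lp_int r M v) t'
        \<le> fiber p q r s \<beta> lam (Lp_int p M k) (Lp_int q M k) (Lp_int s M v) (Lp_int r M v) y"
      if "0 \<le> t'" "y = 1 \<or> y = t0" for t' y
      using vmax[OF that(1)] that(2) e0 v1 by (auto simp: energy_def)
    \<comment> \<open>Both 1 and \<open>t0\<close> maximise the fiber of \<open>v\<close>, and there
      is only one positive maximum point.\<close>
    have t0_1: "t0 = 1"
    proof (rule ccontr)
      assume "t0 \<noteq> 1"
      then consider "t0 < 1" | "1 < t0" by linarith
      then show False
        by cases (use fiber_max_unique[OF Dv \<beta> Lp_int_nonneg t0_pos _ fmax fmax]
           fiber_max_unique[OF Dv \<beta> Lp_int_nonneg zero_less_one _ fmax fmax] in blast)+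
    qed
    show "\<exists>\<sigma> t :: nat \<Rightarrow> real. \<sigma> \<longlonglongrightarrow> 0 \<and> t \<longlonglongrightarrow> 1 \<and>
        (\<forall>j. 0 < \<sigma> j \<and> \<sigma> j \<le> 1 \<and> 0 < t j \<and>
          energy \<beta> lam v k (t j) \<le> energy \<beta> lam (\<lambda>x. v x + \<sigma> j * \<phi> x) (\<lambda>x. k x + \<sigma> j *\<^sub>R h x) (t j))"
    proof (intro exI conjI allI)
      show "(\<lambda>i. \<epsilon> (\<tau> i + N)) \<longlonglongrightarrow> 0" by (rule sub[OF \<epsilon>0])
      show "(\<lambda>i. ts (\<tau> i)) \<longlonglongrightarrow> 1" using \<tau>(2) t0_1 by (simp add: o_def)
      fix i
      show "0 < \<epsilon> (\<tau> i + N)" "\<epsilon> (\<tau> i + N) \<le> 1" "0 < ts (\<tau> i)" by (rule \<epsilon> ts_pos)+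
      \<comment> \<open>The level \<open>c\<close> separates the two sides at the same parameter:
        the ray of \<open>v\<close> never exceeds it, the perturbed ray reaches it there.\<close>
      show "energy \<beta> lam v k (ts (\<tau> i)) \<le> energy \<beta> lam (\<lambda>x. v x + \<epsilon> (\<tau> i + N) * \<phi> x)
          (\<lambda>x. k x + \<epsilon> (\<tau> i + N) *\<^sub>R h x) (ts (\<tau> i))"
        using order_trans[OF vmax[OF ts(1)] ts(3)] by (simp add: w_def l_def)
    qed
  qed
  then show ?thesis using that v1 cpos by blast
qed

end

section \<open>The first variation of the singular energy\<close>

text \<open>Homogeneity reduces the claim to
  \<open>\<bar>y powr s - 1\<bar> \<le> \<bar>y - 1\<bar>\<close> for \<open>y = z / u\<close>. The
  factor \<open>u powr (s - 1)\<close> is the dominating weight for the singular difference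
  quotients.\<close>

lemma powr_sub_difference_le:
  fixes u z s :: real
  assumes "0 < s" "s < 1" "0 < u" "0 \<le> z"
  shows "\<bar>z powr s - u powr s\<bar> \<le> u powr (s - 1) * \<bar>z - u\<bar>"
proof -
  have *: "\<bar>y powr s - 1\<bar> \<le> \<bar>y - 1\<bar>" if "0 \<le> y" for y :: real
  proof (cases "1 \<le> y")
    case True
    have "y powr s \<le> y powr 1" using True assms by (intro powr_mono) auto
    moreover have "1 \<le> y powr s" using True assms by (simp add: ge_one_powr_ge_zero)
    ultimately show ?thesis using True by simp
  next
    case False
    show ?thesis
    proof (cases "y = 0")
      case False
      have "y powr 1 \<le> y powr s" using False \<open>\<not> 1 \<le> y\<close> that assms by (intro powr_mono') auto
      moreover have "y powr s \<le> 1 powr s" using \<open>\<not> 1 \<le> y\<close> that assms by (intro powr_mono2) auto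
      ultimately show ?thesis using False \<open>\<not> 1 \<le> y\<close> that by simp
    qed simp
  qed
  define y where "y = z / u"
  have z: "z = u * y" using assms by (simp add: y_def)
  have y: "0 \<le> y" using assms by (simp add: y_def)
  have "\<bar>z powr s - u powr s\<bar> = u powr s * \<bar>y powr s - 1\<bar>"
  proof -
    have "z powr s - u powr s = u powr s * (y powr s - 1)"
      using assms y by (simp add: z powr_mult algebra_simps)
    then show ?thesis by (simp add: abs_mult)
  qed
  also have "\<dots> \<le> u powr s * \<bar>y - 1\<bar>" by (intro mult_left_mono * y) auto
  also have "\<dots> = u powr (s - 1) * (u * \<bar>y - 1\<bar>)" using assms by (simp add: powr_diff)
  also have "u * \<bar>y - 1\<bar> = \<bar>u * (y - 1)\<bar>" using assms(3) by (simp only: abs_mult abs_of_pos)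
  also have "u * (y - 1) = z - u" by (simp add: z algebra_simps)
  finally show ?thesis .
qed

lemma norm_powr_inner_real:
  fixes x y m :: real
  assumes "0 \<le> x"
  shows "norm x powr (m - 2) * (x \<bullet> y) = x powr (m - 1) * y"
  using powr_mult_base[OF assms, of "m - 2"] assms by (simp add: mult_ac)

lemma singular_quotient_tendsto:
  fixes u y s :: real
  assumes "0 < u" "\<sigma> \<longlonglongrightarrow> 0" "\<And>k. 0 < \<sigma> k"
  shows "(\<lambda>k. (norm (u + \<sigma> k * y) powr s - norm u powr s) / \<sigma> k) \<longlonglongrightarrow> s * (u powr (s - 1) * y)"
proof -
  have "((\<lambda>t. (u + t * y) powr s) has_real_derivative s * (u + 0 * y) powr (s - 1) * y) (at 0)"
    using assms(1) by (auto intro!: derivative_eq_intros)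
  moreover have "filterlim \<sigma> (at 0) sequentially"
    using assms(2) less_imp_neq[OF assms(3), symmetric] by (simp add: filterlim_at)
  ultimately have "(\<lambda>k. ((u + (0 + \<sigma> k) * y) powr s - (u + 0 * y) powr s) / \<sigma> k) \<longlonglongrightarrow> s * (u + 0 * y) powr (s - 1) * y"
    unfolding DERIV_def by (rule filterlim_compose)
  then have lim: "(\<lambda>k. ((u + \<sigma> k * y) powr s - u powr s) / \<sigma> k) \<longlonglongrightarrow> s * (u powr (s - 1) * y)"
    by (simp add: mult.assoc)
  have "(\<lambda>k. u + \<sigma> k * y) \<longlonglongrightarrow> u + 0 * y" by (intro tendsto_intros assms)
  then have "eventually (\<lambda>k. 0 < u + \<sigma> k * y) sequentially"
    using assms(1) by (intro order_tendstoD(1)) auto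
  then have "eventually (\<lambda>k. ((u + \<sigma> k * y) powr s - u powr s) / \<sigma> k =
      (norm (u + \<sigma> k * y) powr s - norm u powr s) / \<sigma> k) sequentially"
    by eventually_elim (use assms(1) in simp)
  from Lim_transform_eventually[OF lim this] show ?thesis .
qed

text \<open>At a zero of \<open>u\<close> the quotient grows like
  \<open>\<sigma> k powr (s - 1)\<close>. This blow-up is what forbids a solution to vanish on a set
  of positive measure.\<close>

lemma singular_quotient_unbounded:
  fixes y s N :: real
  assumes "0 < s" "s < 1" "0 < y" "\<sigma> \<longlonglongrightarrow> 0" "\<And>k. 0 < \<sigma> k"
  shows "eventually (\<lambda>k. N \<le> norm (\<sigma> k * y) powr s / \<sigma> k) sequentially"
proof -
  have "(\<lambda>k. \<sigma> k powr (1 - s)) \<longlonglongrightarrow> 0 powr (1 - s)"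
    using assms(2) less_imp_le[OF assms(5)] by (intro tendsto_powr'[OF assms(4) tendsto_const]) auto
  then have "eventually (\<lambda>k. \<sigma> k powr (1 - s) < y powr s / (\<bar>N\<bar> + 1)) sequentially"
    using assms by (intro order_tendstoD(2)) auto
  then show ?thesis
  proof eventually_elim
    case (elim k)
    have "\<sigma> k powr (1 - s) * N \<le> \<sigma> k powr (1 - s) * (\<bar>N\<bar> + 1)" by (intro mult_left_mono) auto
    also have "\<dots> < y powr s" using elim by (simp add: pos_less_divide_eq)
    finally have "\<sigma> k powr (1 - s) * N * \<sigma> k powr s \<le> y powr s * \<sigma> k powr s"
      by (intro mult_right_mono) auto
    moreover have "\<sigma> k powr (1 - s) * \<sigma> k powr s = \<sigma> k"
      using assms(5)[of k] by (simp add: powr_add[symmetric])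
    ultimately have "N * \<sigma> k \<le> y powr s * \<sigma> k powr s"
      by (simp add: mult_ac)
    then show ?case using assms(3) assms(5)[of k]
      by (simp add: abs_mult powr_mult pos_le_divide_eq mult.commute)
  qed
qed

section \<open>From one-sided criticality to the equation\<close>

context compact_gradient_pairs
begin

definition weak_pair :: "real \<Rightarrow> real \<Rightarrow> ('a \<Rightarrow> real) \<Rightarrow> ('a \<Rightarrow> 'b) \<Rightarrow> bool" where
  "weak_pair \<beta> lam u g \<longleftrightarrow> V u g \<and> (AE x in M. 0 < u x) \<and>
     (\<forall>\<phi> h. V \<phi> h \<longrightarrow> has_bochner_integral M
        (\<lambda>x. norm (g x) powr (p - 2) * (g x \<bullet> h x) + \<beta> * (norm (g x) powr (q - 2) * (g x \<bullet> h x))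
           - lam * u x powr (s - 1) * \<phi> x - u x powr (r - 1) * \<phi> x) 0)"

text \<open>Everything in the first variation except for the singular term.\<close>

definition regular_part :: "real \<Rightarrow> ('a \<Rightarrow> real) \<Rightarrow> ('a \<Rightarrow> 'b) \<Rightarrow> ('a \<Rightarrow> real) \<Rightarrow> ('a \<Rightarrow> 'b) \<Rightarrow> real" where
  "regular_part \<beta> u g \<phi> h = (LINT x|M. norm (g x) powr (p - 2) * (g x \<bullet> h x))
     + \<beta> * (LINT x|M. norm (g x) powr (q - 2) * (g x \<bullet> h x)) - (LINT x|M. u x powr (r - 1) * \<phi> x)"

lemma regular_integrable:
  assumes "V u g" "V \<phi> h" "\<forall>x. 0 \<le> u x"
  shows "integrable M (\<lambda>x. norm (g x) powr (p - 2) * (g x \<bullet> h x))"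
    "integrable M (\<lambda>x. norm (g x) powr (q - 2) * (g x \<bullet> h x))"
    "integrable M (\<lambda>x. u x powr (r - 1) * \<phi> x)"
proof -
  \<comment> \<open>Any admissible step sizes do here, as only the integrability part of
    \<open>Lp_int_derivative\<close> is wanted.\<close>
  have \<epsilon>: "(\<lambda>k. 1 / real (Suc k)) \<longlonglongrightarrow> 0" by (rule LIMSEQ_Suc[OF lim_1_over_n])
  show "integrable M (\<lambda>x. norm (g x) powr (p - 2) * (g x \<bullet> h x))"
    using assms p q by (intro Lp_int_derivative(1)[OF _ _ _ \<epsilon>] V_Lp(2)) auto
  show "integrable M (\<lambda>x. norm (g x) powr (q - 2) * (g x \<bullet> h x))"
    using assms p q V_Lq by (intro Lp_int_derivative(1)[OF _ _ _ \<epsilon>]) auto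
  have "integrable M (\<lambda>x. norm (u x) powr (r - 2) * (u x \<bullet> \<phi> x))"
    using assms p q r V_Lr by (intro Lp_int_derivative(1)[OF _ _ _ \<epsilon>]) auto
  then show "integrable M (\<lambda>x. u x powr (r - 1) * \<phi> x)"
    by (simp only: norm_powr_inner_real[OF assms(3)[rule_format]])
qed

text \<open>The energy inequality is solved for the difference quotient of the singular term. What
  remains on the other side converges by differentiability of the other integrals, since all powers
  of \<open>t k\<close> tend to 1.\<close>

lemma singular_difference_bound:
  assumes sub: "subcritical \<beta> lam u g" and lam: "0 < lam" and \<phi>: "V \<phi> h"
  shows "\<exists>\<sigma> c. \<sigma> \<longlonglongrightarrow> 0 \<and> (\<forall>k. 0 < \<sigma> k) \<and> c \<longlonglongrightarrow> s / lam * regular_part \<beta> u g \<phi> h \<and>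
     (\<forall>k::nat. (Lp_int s M (\<lambda>x. u x + \<sigma> k * \<phi> x) - Lp_int s M u) / \<sigma> k \<le> c k)"
proof -
  have V: "V u g" and u0: "\<forall>x. 0 \<le> u x" using sub by (auto simp: subcritical_def)
  from sub[unfolded subcritical_def, THEN conjunct2, THEN conjunct2, rule_format, OF \<phi>]
  obtain \<sigma> t :: "nat \<Rightarrow> real" where st: "\<sigma> \<longlonglongrightarrow> 0" "t \<longlonglongrightarrow> 1"
    "\<forall>k. 0 < \<sigma> k \<and> \<sigma> k \<le> 1 \<and> 0 < t k \<and>
      energy \<beta> lam u g (t k) \<le> energy \<beta> lam (\<lambda>x. u x + \<sigma> k * \<phi> x) (\<lambda>x. g x + \<sigma> k *\<^sub>R h x) (t k)"
    by (elim exE conjE) (rule that)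
  have \<sigma>: "\<sigma> \<longlonglongrightarrow> 0" "\<And>k. 0 < \<sigma> k" "\<And>k. \<sigma> k \<le> 1" and t: "t \<longlonglongrightarrow> 1" "\<And>k. 0 < t k"
    and le: "\<And>k. energy \<beta> lam u g (t k) \<le> energy \<beta> lam (\<lambda>x. u x + \<sigma> k * \<phi> x) (\<lambda>x. g x + \<sigma> k *\<^sub>R h x) (t k)"
    using st by simp_all
  define a where "a = (\<lambda>k. (Lp_int p M (\<lambda>x. g x + \<sigma> k *\<^sub>R h x) - Lp_int p M g) / \<sigma> k)"
  define b where "b = (\<lambda>k. (Lp_int q M (\<lambda>x. g x + \<sigma> k *\<^sub>R h x) - Lp_int q M g) / \<sigma> k)"
  define d where "d = (\<lambda>k. (Lp_int r M (\<lambda>x. u x + \<sigma> k * \<phi> x) - Lp_int r M u) / \<sigma> k)"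
  define e where "e = (\<lambda>k. (Lp_int s M (\<lambda>x. u x + \<sigma> k * \<phi> x) - Lp_int s M u) / \<sigma> k)"
  define c where "c = (\<lambda>k. s / (lam * t k powr s) *
     (a k * t k powr p / p + \<beta> * b k * t k powr q / q - d k * t k powr r / r))"
  have pos: "0 < p" "0 < q" "0 < r" "0 < s" using p q r s by auto
  have alim: "a \<longlonglongrightarrow> p * (LINT x|M. norm (g x) powr (p - 2) * (g x \<bullet> h x))"
    unfolding a_def using V \<phi> V_Lp p q \<sigma> by (intro Lp_int_derivative(2)) auto
  have blim: "b \<longlonglongrightarrow> q * (LINT x|M. norm (g x) powr (q - 2) * (g x \<bullet> h x))"
    unfolding b_def using V \<phi> V_Lq p q \<sigma> by (intro Lp_int_derivative(2)) auto
  have "(\<lambda>k. (Lp_int r M (\<lambda>x. u x + \<sigma> k *\<^sub>R \<phi> x) - Lp_int r M u) / \<sigma> k)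
      \<longlonglongrightarrow> r * (LINT x|M. norm (u x) powr (r - 2) * (u x \<bullet> \<phi> x))"
    using V \<phi> V_Lr p q r \<sigma> by (intro Lp_int_derivative(2)) auto
  then have dlim: "d \<longlonglongrightarrow> r * (LINT x|M. u x powr (r - 1) * \<phi> x)"
    unfolding d_def by (simp only: norm_powr_inner_real[OF u0[rule_format]] real_scaleR_def)
  have tlim: "(\<lambda>k. t k powr m) \<longlonglongrightarrow> 1" for m
    using tendsto_powr[OF t(1) tendsto_const, of m] by simp
  have clim: "c \<longlonglongrightarrow> s / (lam * 1) * (p * (LINT x|M. norm (g x) powr (p - 2) * (g x \<bullet> h x)) * 1 / p
     + \<beta> * (q * (LINT x|M. norm (g x) powr (q - 2) * (g x \<bullet> h x))) * 1 / q
     - r * (LINT x|M. u x powr (r - 1) * \<phi> x) * 1 / r)"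
    unfolding c_def using lam pos
    by (intro tendsto_mult tendsto_divide tendsto_add tendsto_diff tendsto_const tlim alim blim dlim) auto
  have "e k \<le> c k" for k
  proof -
    have eqs: "Lp_int p M (\<lambda>x. g x + \<sigma> k *\<^sub>R h x) = Lp_int p M g + \<sigma> k * a k"
      "Lp_int q M (\<lambda>x. g x + \<sigma> k *\<^sub>R h x) = Lp_int q M g + \<sigma> k * b k"
      "Lp_int r M (\<lambda>x. u x + \<sigma> k * \<phi> x) = Lp_int r M u + \<sigma> k * d k"
      "Lp_int s M (\<lambda>x. u x + \<sigma> k * \<phi> x) = Lp_int s M u + \<sigma> k * e k"
      using \<sigma>(2)[of k] by (simp_all add: a_def b_def d_def e_def)
    have "\<sigma> k * (lam * e k * t k powr s / s) \<le>
        \<sigma> k * (a k * t k powr p / p + \<beta> * b k * t k powr q / q - d k * t k powr r / r)"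
      using le[of k] unfolding energy_def fiber_def eqs
      by (simp add: algebra_simps add_divide_distrib)
    then have "lam * e k * t k powr s / s \<le> a k * t k powr p / p + \<beta> * b k * t k powr q / q - d k * t k powr r / r"
      using \<sigma>(2)[of k] by (rule mult_left_le_imp_le)
    then have "s / (lam * t k powr s) * (lam * e k * t k powr s / s) \<le> c k"
      unfolding c_def using pos lam by (intro mult_left_mono) auto
    then show ?thesis using pos lam t(2)[of k] by simp
  qed
  then show ?thesis
    using \<sigma>(1,2) clim pos lam unfolding e_def regular_part_def
    by (intro exI[of _ \<sigma>] exI[of _ c]) (auto simp: mult_ac)
qed

lemma singular_quotient_integral:
  assumes "V u g" "V \<phi> h" "0 < \<sigma>"
  shows "integrable M (\<lambda>x. (norm (u x + \<sigma> * \<phi> x) powr s - norm (u x) powr s) / \<sigma>)"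
    and "(LINT x|M. (norm (u x + \<sigma> * \<phi> x) powr s - norm (u x) powr s) / \<sigma>)
      = (Lp_int s M (\<lambda>x. u x + \<sigma> * \<phi> x) - Lp_int s M u) / \<sigma>"
  using Lp_fun_integrable[OF V_Ls[OF assms(1)]]
    Lp_fun_integrable[OF V_Ls[OF V_add[OF assms(1) V_scale[OF assms(2), of \<sigma>]]]]
  by (simp_all add: Lp_int_def)

text \<open>For nonnegative \<open>\<phi>\<close> all quotients are nonnegative, so their lower
  limit can be integrated in the extended reals before any integrability is known. A finite integral
  rules out the zeros of \<open>u\<close> where \<open>\<phi>\<close> is positive.\<close>

lemma singular_part_nonneg:
  assumes sub: "subcritical \<beta> lam u g" and lam: "0 < lam" and \<phi>: "V \<phi> h" "\<And>x. 0 \<le> \<phi> x"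
  shows "AE x in M. 0 < \<phi> x \<longrightarrow> 0 < u x" and "integrable M (\<lambda>x. u x powr (s - 1) * \<phi> x)"
proof -
  have V: "V u g" and u0: "\<And>x. 0 \<le> u x" using sub by (auto simp: subcritical_def)
  have [measurable]: "u \<in> borel_measurable M" "\<phi> \<in> borel_measurable M"
    using V_Ls[OF V] V_Ls[OF \<phi>(1)] by (auto simp: Lp_fun_def)
  obtain \<sigma> c where \<sigma>: "\<sigma> \<longlonglongrightarrow> 0" "\<And>k. 0 < \<sigma> k" and c: "c \<longlonglongrightarrow> s / lam * regular_part \<beta> u g \<phi> h"
    and le: "\<And>k::nat. (Lp_int s M (\<lambda>x. u x + \<sigma> k * \<phi> x) - Lp_int s M u) / \<sigma> k \<le> c k"
    using singular_difference_bound[OF sub lam \<phi>(1)] by blast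
  define Q where "Q = (\<lambda>k x. (norm (u x + \<sigma> k * \<phi> x) powr s - norm (u x) powr s) / \<sigma> k)"
  have [measurable]: "\<And>k. Q k \<in> borel_measurable M" by (simp add: Q_def)
  have Q0: "0 \<le> Q k x" for k x
  proof -
    have "norm (u x) powr s \<le> norm (u x + \<sigma> k * \<phi> x) powr s"
      using u0[of x] \<phi>(2)[of x] \<sigma>(2)[of k] s by (intro powr_mono2) (auto intro: add_nonneg_nonneg)
    then show ?thesis using \<sigma>(2)[of k] by (simp add: Q_def)
  qed
  have "(\<integral>\<^sup>+x. liminf (\<lambda>k. ennreal (Q k x)) \<partial>M) \<le> liminf (\<lambda>k. \<integral>\<^sup>+x. ennreal (Q k x) \<partial>M)"
    by (intro nn_integral_liminf) simp
  also have "\<dots> \<le> liminf (\<lambda>k. ennreal (c k))"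
  proof (intro Liminf_mono always_eventually allI)
    fix k
    have "(\<integral>\<^sup>+x. ennreal (Q k x) \<partial>M) = ennreal (LINT x|M. Q k x)"
      using singular_quotient_integral(1)[OF V \<phi>(1) \<sigma>(2)[of k]] Q0
      by (intro nn_integral_eq_integral) (auto simp: Q_def)
    also have "\<dots> \<le> ennreal (c k)"
      unfolding Q_def singular_quotient_integral(2)[OF V \<phi>(1) \<sigma>(2)] by (intro ennreal_leI le)
    finally show "(\<integral>\<^sup>+x. ennreal (Q k x) \<partial>M) \<le> ennreal (c k)" .
  qed
  also have "\<dots> = ennreal (s / lam * regular_part \<beta> u g \<phi> h)"
    using c by (intro lim_imp_Liminf tendsto_ennrealI) auto
  finally have bound: "(\<integral>\<^sup>+x. liminf (\<lambda>k. ennreal (Q k x)) \<partial>M) \<le> ennreal (s / lam * regular_part \<beta> u g \<phi> h)" .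
  then have "(\<integral>\<^sup>+x. liminf (\<lambda>k. ennreal (Q k x)) \<partial>M) \<noteq> \<infinity>"
    using ennreal_less_top by (metis infinity_ennreal_def leD)
  then have "AE x in M. liminf (\<lambda>k. ennreal (Q k x)) \<noteq> \<infinity>"
    by (intro nn_integral_PInf_AE) auto
  then show "AE x in M. 0 < \<phi> x \<longrightarrow> 0 < u x"
  proof eventually_elim
    case (elim x)
    show ?case
    proof (rule impI, rule ccontr)
      assume *: "0 < \<phi> x" "\<not> 0 < u x"
      then have ux: "u x = 0" using u0[of x] by simp
      have "of_nat N \<le> liminf (\<lambda>k. ennreal (Q k x))" for N
      proof (rule Liminf_bounded)
        have "eventually (\<lambda>k. real N \<le> Q k x) sequentially"
          using singular_quotient_unbounded[OF s *(1) \<sigma>, of "real N"] by (simp add: Q_def ux)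
        then show "eventually (\<lambda>k. of_nat N \<le> ennreal (Q k x)) sequentially"
          by eventually_elim (metis ennreal_leI ennreal_of_nat_eq_real_of_nat)
      qed
      then show False
        using elim ennreal_Ex_less_of_nat by (metis infinity_ennreal_def leD less_top)
    qed
  qed
  \<comment> \<open>At zeros of \<open>u\<close> the convention \<open>0 powr (s - 1) = 0\<close>
    makes the bound trivial.\<close>
  have "ennreal (s * (u x powr (s - 1) * \<phi> x)) \<le> liminf (\<lambda>k. ennreal (Q k x))" for x
  proof (cases "u x = 0")
    case False
    then have "0 < u x" using u0[of x] by simp
    then have "(\<lambda>k. ennreal (Q k x)) \<longlonglongrightarrow> ennreal (s * (u x powr (s - 1) * \<phi> x))"
      unfolding Q_def by (intro tendsto_ennrealI singular_quotient_tendsto \<sigma>)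
    from lim_imp_Liminf[OF trivial_limit_sequentially this] show ?thesis
      by (simp only: order_refl)
  qed simp
  then have "(\<integral>\<^sup>+x. ennreal (s * (u x powr (s - 1) * \<phi> x)) \<partial>M) \<le> (\<integral>\<^sup>+x. liminf (\<lambda>k. ennreal (Q k x)) \<partial>M)"
    by (intro nn_integral_mono) auto
  also note bound
  finally have "(\<integral>\<^sup>+x. ennreal (s * (u x powr (s - 1) * \<phi> x)) \<partial>M) < \<infinity>"
    by (rule order_le_less_trans) (simp only: ennreal_less_top infinity_ennreal_def)
  then have "integrable M (\<lambda>x. s * (u x powr (s - 1) * \<phi> x))"
    using s \<phi>(2) by (intro integrableI_nonneg) auto
  then show "integrable M (\<lambda>x. u x powr (s - 1) * \<phi> x)"
    using s by simp
qed

lemma subcritical_positive: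
  assumes "subcritical \<beta> lam u g" "0 < lam"
  shows "AE x in M. 0 < u x"
proof -
  obtain \<phi> \<psi> where \<phi>: "\<And>j::nat. V (\<phi> j) (\<psi> j)" "\<And>j x. 0 \<le> \<phi> j x" "AE x in M. \<exists>j. 0 < \<phi> j x"
    using V_positive by blast
  have "AE x in M. \<forall>j. 0 < \<phi> j x \<longrightarrow> 0 < u x"
    unfolding AE_all_countable using singular_part_nonneg(1)[OF assms \<phi>(1,2)] by blast
  with \<phi>(3) show ?thesis by eventually_elim auto
qed

lemma singular_part_integrable:
  assumes "subcritical \<beta> lam u g" "0 < lam" "V \<phi> h"
  shows "integrable M (\<lambda>x. u x powr (s - 1) * \<bar>\<phi> x\<bar>)" "integrable M (\<lambda>x. u x powr (s - 1) * \<phi> x)"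
proof -
  obtain k where "V (\<lambda>x. \<bar>\<phi> x\<bar>) k" using V_abs[OF assms(3)] by blast
  from singular_part_nonneg(2)[OF assms(1,2) this]
  show *: "integrable M (\<lambda>x. u x powr (s - 1) * \<bar>\<phi> x\<bar>)" by simp
  have [measurable]: "u \<in> borel_measurable M" "\<phi> \<in> borel_measurable M"
    using assms V_Ls by (auto simp: Lp_fun_def subcritical_def)
  show "integrable M (\<lambda>x. u x powr (s - 1) * \<phi> x)"
    by (rule Bochner_Integration.integrable_bound[OF *]) (auto simp: abs_mult)
qed

lemma subcritical_inequality:
  assumes sub: "subcritical \<beta> lam u g" and lam: "0 < lam" and \<phi>: "V \<phi> h"
  shows "lam * (LINT x|M. u x powr (s - 1) * \<phi> x) \<le> regular_part \<beta> u g \<phi> h"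
proof -
  have V: "V u g" and u0: "\<And>x. 0 \<le> u x" using sub by (auto simp: subcritical_def)
  have [measurable]: "u \<in> borel_measurable M" "\<phi> \<in> borel_measurable M"
    using V_Ls[OF V] V_Ls[OF \<phi>] by (auto simp: Lp_fun_def)
  obtain \<sigma> c where \<sigma>: "\<sigma> \<longlonglongrightarrow> 0" "\<And>k. 0 < \<sigma> k" and c: "c \<longlonglongrightarrow> s / lam * regular_part \<beta> u g \<phi> h"
    and le: "\<And>k::nat. (Lp_int s M (\<lambda>x. u x + \<sigma> k * \<phi> x) - Lp_int s M u) / \<sigma> k \<le> c k"
    using singular_difference_bound[OF sub lam \<phi>] by blast
  define Q where "Q = (\<lambda>k x. (norm (u x + \<sigma> k * \<phi> x) powr s - norm (u x) powr s) / \<sigma> k)"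
  have "(\<lambda>k. LINT x|M. Q k x) \<longlonglongrightarrow> (LINT x|M. s * (u x powr (s - 1) * \<phi> x))"
  proof (rule integral_dominated_convergence)
    show "integrable M (\<lambda>x. u x powr (s - 1) * \<bar>\<phi> x\<bar>)"
      by (rule singular_part_integrable[OF sub lam \<phi>])
    show "(\<lambda>x. s * (u x powr (s - 1) * \<phi> x)) \<in> borel_measurable M" by simp
    show "Q k \<in> borel_measurable M" for k by (simp add: Q_def)
    show "AE x in M. (\<lambda>k. Q k x) \<longlonglongrightarrow> s * (u x powr (s - 1) * \<phi> x)"
      using subcritical_positive[OF sub lam] unfolding Q_def
      by eventually_elim (rule singular_quotient_tendsto[OF _ \<sigma>])
    show "AE x in M. norm (Q k x) \<le> u x powr (s - 1) * \<bar>\<phi> x\<bar>" for k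
      using subcritical_positive[OF sub lam]
    proof eventually_elim
      case (elim x)
      have "\<bar>norm (u x + \<sigma> k * \<phi> x) powr s - u x powr s\<bar> \<le> u x powr (s - 1) * \<bar>norm (u x + \<sigma> k * \<phi> x) - u x\<bar>"
        by (rule powr_sub_difference_le[OF s elim norm_ge_zero])
      also have "\<dots> \<le> u x powr (s - 1) * (\<sigma> k * \<bar>\<phi> x\<bar>)"
      proof (rule mult_left_mono)
        show "\<bar>norm (u x + \<sigma> k * \<phi> x) - u x\<bar> \<le> \<sigma> k * \<bar>\<phi> x\<bar>"
          using norm_triangle_ineq3[of "u x + \<sigma> k * \<phi> x" "u x"] elim \<sigma>(2)[of k] by (simp add: abs_mult)
      qed simp
      finally show ?case using elim \<sigma>(2)[of k] by (simp add: Q_def abs_divide pos_divide_le_eq mult_ac)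
    qed
  qed
  moreover have "(LINT x|M. Q k x) \<le> c k" for k
    unfolding Q_def singular_quotient_integral(2)[OF V \<phi> \<sigma>(2)] by (rule le)
  ultimately have "(LINT x|M. s * (u x powr (s - 1) * \<phi> x)) \<le> s / lam * regular_part \<beta> u g \<phi> h"
    by (intro LIMSEQ_le[OF _ c]) auto
  then show ?thesis using s lam by (simp add: field_simps)
qed

lemma subcritical_weak_pair:
  assumes sub: "subcritical \<beta> lam u g" and lam: "0 < lam"
  shows "weak_pair \<beta> lam u g"
  unfolding weak_pair_def
proof (intro conjI allI impI subcritical_positive[OF assms])
  have V: "V u g" and u0: "\<forall>x. 0 \<le> u x" using sub by (auto simp: subcritical_def)
  show "V u g" by (rule V)
  fix \<phi> h assume \<phi>: "V \<phi> h"
  note ints = regular_integrable[OF V \<phi> u0] singular_part_integrable(2)[OF sub lam \<phi>]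
  have neg: "V (\<lambda>x. - \<phi> x) (\<lambda>x. - h x)" using V_scale[OF \<phi>, of "- 1"] by simp
  have "lam * (LINT x|M. u x powr (s - 1) * \<phi> x) \<le> regular_part \<beta> u g \<phi> h"
    by (rule subcritical_inequality[OF sub lam \<phi>])
  moreover have "regular_part \<beta> u g \<phi> h \<le> lam * (LINT x|M. u x powr (s - 1) * \<phi> x)"
    using subcritical_inequality[OF sub lam neg] by (simp add: regular_part_def)
  ultimately have eq: "lam * (LINT x|M. u x powr (s - 1) * \<phi> x) = regular_part \<beta> u g \<phi> h"
    by (rule antisym)
  have "has_bochner_integral M
        (\<lambda>x. norm (g x) powr (p - 2) * (g x \<bullet> h x) + \<beta> * (norm (g x) powr (q - 2) * (g x \<bullet> h x))
           - lam * (u x powr (s - 1) * \<phi> x) - u x powr (r - 1) * \<phi> x)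
        ((LINT x|M. norm (g x) powr (p - 2) * (g x \<bullet> h x)) + \<beta> * (LINT x|M. norm (g x) powr (q - 2) * (g x \<bullet> h x))
          - lam * (LINT x|M. u x powr (s - 1) * \<phi> x) - (LINT x|M. u x powr (r - 1) * \<phi> x))"
    by (intro has_bochner_integral_diff has_bochner_integral_add has_bochner_integral_mult_right
          has_bochner_integral_integrable ints)
  then show "has_bochner_integral M
        (\<lambda>x. norm (g x) powr (p - 2) * (g x \<bullet> h x) + \<beta> * (norm (g x) powr (q - 2) * (g x \<bullet> h x))
           - lam * u x powr (s - 1) * \<phi> x - u x powr (r - 1) * \<phi> x) 0"
    using eq by (simp add: regular_part_def mult.assoc)
qed

theorem two_weak_pairs:
  "\<exists>lam_star>0. \<forall>\<beta>>0. \<forall>lam. 0 < lam \<and> lam < lam_star \<longrightarrow>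
     (\<exists>u g v h. weak_pair \<beta> lam u g \<and> weak_pair \<beta> lam v h \<and> \<not> (AE x in M. u x = v x))"
proof -
  obtain \<rho> lam_star where \<rho>: "0 < \<rho>" "0 < lam_star"
    and sphere: "\<And>\<beta> lam u g. 0 \<le> \<beta> \<Longrightarrow> 0 < lam \<Longrightarrow> lam < lam_star \<Longrightarrow> V u g \<Longrightarrow> Lp_int p M g = \<rho> \<Longrightarrow>
      0 < energy \<beta> lam u g 1"
    using sphere_positive by blast
  have "\<exists>u g v h. weak_pair \<beta> lam u g \<and> weak_pair \<beta> lam v h \<and> \<not> (AE x in M. u x = v x)"
    if "0 < \<beta>" and lam: "0 < lam" "lam < lam_star" for \<beta> lam
  proof -
    have \<beta>: "0 \<le> \<beta>" using that(1) by simp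
    note sph = sphere[OF \<beta> lam]
    obtain u g where u: "subcritical \<beta> lam u g" "energy \<beta> lam u g 1 < 0"
      using first_solution[OF \<beta> lam(1) \<rho>(1) sph] by metis
    obtain v h where v: "subcritical \<beta> lam v h" "0 < energy \<beta> lam v h 1"
      using second_solution[OF \<beta> lam(1) \<rho>(1) sph] by metis
    have V: "V u g" "V v h" using u v by (auto simp: subcritical_def)
    \<comment> \<open>Functions that agree almost everywhere have gradients that agree almost
      everywhere, hence equal energies, against the opposite signs.\<close>
    have "\<not> (AE x in M. u x = v x)"
    proof
      assume ae: "AE x in M. u x = v x"
      note m = Lp_fun_measurable[OF V_Lp(1)[OF V(1)]] Lp_fun_measurable[OF V_Lp(1)[OF V(2)]]
        Lp_fun_measurable[OF V_Lp(2)[OF V(1)]] Lp_fun_measurable[OF V_Lp(2)[OF V(2)]]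
      have "energy \<beta> lam u g 1 = energy \<beta> lam v h 1"
        unfolding energy_def using Lp_int_cong_AE[OF m(1,2) ae] Lp_int_cong_AE[OF m(3,4) V_unique[OF V ae]]
        by simp
      then show False using u v by simp
    qed
    then show ?thesis using subcritical_weak_pair u(1) v(1) lam(1) by blast
  qed
  then show ?thesis using \<rho>(2) by blast
qed

end

section \<open>Smooth functions\<close>

lemma partial_deriv_eq:
  "(f has_derivative f') (at x) \<Longrightarrow> partial_deriv i f x = f' (axis i 1)"
  unfolding partial_deriv_def using frechet_derivative_at by metis

lemma C_k_mono_Suc: "C_k (Suc k) f \<Longrightarrow> C_k k f"
proof (induction k arbitrary: f)
  case 0
  then show ?case
    by (simp add: continuous_at_imp_continuous_on differentiable_imp_continuous_within)
qed simp

lemma C_k_const: "C_k k (\<lambda>x. c)"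
proof (induction k arbitrary: c)
  case (Suc k)
  have "partial_deriv i (\<lambda>x. c) = (\<lambda>x. 0)" for i :: 'a
    using partial_deriv_eq[OF has_derivative_const] by blast
  then show ?case using Suc by simp
qed simp

lemma C_k_coord: "C_k k (\<lambda>x. x $ j)"
proof (cases k)
  case (Suc m)
  have der: "((\<lambda>x. x $ j) has_derivative (\<lambda>v. v $ j)) (at x)" for x :: "real^'a"
    by (intro bounded_linear_imp_has_derivative bounded_linear_vec_nth)
  then have "partial_deriv i (\<lambda>x. x $ j) = (\<lambda>x. axis i 1 $ j)" for i
    using partial_deriv_eq by blast
  then show ?thesis using Suc der C_k_const by (auto simp: differentiable_def)
qed (simp add: continuous_on_component)

lemma C_k_add: "C_k k f \<Longrightarrow> C_k k g \<Longrightarrow> C_k k (\<lambda>x. f x + g x)"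
proof (induction k arbitrary: f g)
  case (Suc k)
  have "partial_deriv i (\<lambda>x. f x + g x) = (\<lambda>x. partial_deriv i f x + partial_deriv i g x)" for i
  proof
    fix x
    have "f differentiable (at x)" "g differentiable (at x)" using Suc.prems by auto
    then have "(f has_derivative frechet_derivative f (at x)) (at x)" "(g has_derivative frechet_derivative g (at x)) (at x)"
      by (simp_all add: frechet_derivative_works)
    from partial_deriv_eq[OF has_derivative_add[OF this]]
    show "partial_deriv i (\<lambda>x. f x + g x) x = partial_deriv i f x + partial_deriv i g x"
      by (simp add: partial_deriv_def)
  qed
  then show ?case using Suc by (simp add: differentiable_add)
qed (simp add: continuous_on_add)

lemma C_k_mult: "C_k k f \<Longrightarrow> C_k k g \<Longrightarrow> C_k k (\<lambda>x. f x * g x)"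
proof (induction k arbitrary: f g)
  case (Suc k)
  have "partial_deriv i (\<lambda>x. f x * g x) = (\<lambda>x. f x * partial_deriv i g x + partial_deriv i f x * g x)" for i
  proof
    fix x
    have "f differentiable (at x)" "g differentiable (at x)" using Suc.prems by auto
    then have "(f has_derivative frechet_derivative f (at x)) (at x)" "(g has_derivative frechet_derivative g (at x)) (at x)"
      by (simp_all add: frechet_derivative_works)
    from partial_deriv_eq[OF has_derivative_mult[OF this]]
    show "partial_deriv i (\<lambda>x. f x * g x) x = f x * partial_deriv i g x + partial_deriv i f x * g x"
      by (simp add: partial_deriv_def)
  qed
  moreover have "C_k k f" "C_k k g" using Suc.prems C_k_mono_Suc by blast+
  ultimately show ?case using Suc by (simp add: C_k_add)
qed (simp add: continuous_on_mult)

text \<open>The induction has to range over all members of \<open>S\<close>, because the chain rule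
  replaces \<open>h\<close> by its derivative.\<close>

lemma C_k_compose:
  fixes S :: "(real \<Rightarrow> real) set"
  assumes S: "\<And>h. h \<in> S \<Longrightarrow> \<exists>h'\<in>S. \<forall>t. (h has_real_derivative h' t) (at t)"
  shows "h \<in> S \<Longrightarrow> C_k k f \<Longrightarrow> C_k k (\<lambda>x. h (f x))"
proof (induction k arbitrary: f h)
  case 0
  obtain h' where "\<And>t. (h has_real_derivative h' t) (at t)" using S[OF 0(1)] by blast
  then have "continuous_on UNIV h" by (metis DERIV_continuous_on DERIV_subset subset_UNIV)
  then show ?case using 0(2) by (auto intro: continuous_on_compose2)
next
  case (Suc k)
  obtain h' where h': "h' \<in> S" "\<And>t. (h has_real_derivative h' t) (at t)" using S[OF Suc.prems(1)] by blast
  have der: "((\<lambda>x. h (f x)) has_derivative (\<lambda>v. frechet_derivative f (at x) v * h' (f x))) (at x)" for x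
  proof -
    have "f differentiable (at x)" using Suc.prems by auto
    then have "(f has_derivative frechet_derivative f (at x)) (at x)"
      by (simp add: frechet_derivative_works)
    from DERIV_compose_FDERIV[OF h'(2) this] show ?thesis .
  qed
  then have "partial_deriv i (\<lambda>x. h (f x)) = (\<lambda>x. partial_deriv i f x * h' (f x))" for i
    using partial_deriv_eq by (fastforce simp: partial_deriv_def)
  moreover have "C_k k f" using Suc.prems C_k_mono_Suc by blast
  then have "C_k k (\<lambda>x. h' (f x))" using Suc.IH h'(1) by blast
  moreover have "(\<lambda>x. h (f x)) differentiable (at x)" for x
    unfolding differentiable_def using der by blast
  ultimately show ?case using Suc.prems(2) by (simp add: C_k_mult)
qed

lemma smooth_const: "smooth (\<lambda>x. c)"
  by (simp add: smooth_def C_k_const)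

lemma smooth_coord: "smooth (\<lambda>x. x $ j)"
  by (simp add: smooth_def C_k_coord)

lemma smooth_add: "smooth f \<Longrightarrow> smooth g \<Longrightarrow> smooth (\<lambda>x. f x + g x)"
  by (simp add: smooth_def C_k_add)

lemma smooth_mult: "smooth f \<Longrightarrow> smooth g \<Longrightarrow> smooth (\<lambda>x. f x * g x)"
  by (simp add: smooth_def C_k_mult)

lemma smooth_diff: "smooth f \<Longrightarrow> smooth g \<Longrightarrow> smooth (\<lambda>x. f x - g x)"
  using smooth_add[of f "\<lambda>x. - 1 * g x"] smooth_mult[OF smooth_const, of g "- 1"] by simp

lemma smooth_prod: "finite I \<Longrightarrow> (\<And>i. i \<in> I \<Longrightarrow> smooth (f i)) \<Longrightarrow> smooth (\<lambda>x. \<Prod>i\<in>I. f i x)"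
  by (induction I rule: finite_induct) (auto simp: smooth_const smooth_mult)

lemma smooth_compose:
  fixes S :: "(real \<Rightarrow> real) set"
  assumes "\<And>h. h \<in> S \<Longrightarrow> \<exists>h'\<in>S. \<forall>t. (h has_real_derivative h' t) (at t)" "h \<in> S" "smooth f"
  shows "smooth (\<lambda>x. h (f x))"
  unfolding smooth_def
proof
  fix k
  show "C_k k (\<lambda>x. h (f x))"
    by (rule C_k_compose[OF assms(1,2)]) (use assms(3) in \<open>auto simp: smooth_def\<close>)
qed

lemma smooth_partial_deriv: "smooth f \<Longrightarrow> smooth (partial_deriv i f)"
  unfolding smooth_def using C_k.simps(2) by blast

lemma smooth_differentiable: "smooth f \<Longrightarrow> f differentiable (at x)"
  unfolding smooth_def using C_k.simps(2) by blast

lemma smooth_continuous_on: "smooth f \<Longrightarrow> continuous_on A f"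
  unfolding smooth_def using C_k.simps(1) continuous_on_subset by blast

definition grad :: "(real^'n::finite \<Rightarrow> real) \<Rightarrow> real^'n \<Rightarrow> real^'n" where
  "grad f x = (\<chi> i. partial_deriv i f x)"

lemma grad_has_derivative:
  assumes "smooth f"
  shows "(f has_derivative (\<lambda>v. grad f x \<bullet> v)) (at x)"
proof -
  have der: "(f has_derivative frechet_derivative f (at x)) (at x)"
    using smooth_differentiable[OF assms] by (simp add: frechet_derivative_works)
  then interpret linear "frechet_derivative f (at x)" by (rule has_derivative_linear)
  have "frechet_derivative f (at x) v = grad f x \<bullet> v" for v
  proof -
    have "v = (\<Sum>i\<in>UNIV. v $ i *\<^sub>R axis i 1)"
      by (metis (no_types) basis_expansion scalar_mult_eq_scaleR)
    then have "frechet_derivative f (at x) v = frechet_derivative f (at x) (\<Sum>i\<in>UNIV. v $ i *\<^sub>R axis i 1)"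
      by (rule arg_cong)
    also have "\<dots> = (\<Sum>i\<in>UNIV. v $ i * frechet_derivative f (at x) (axis i 1))"
      by (simp only: sum scale real_scaleR_def)
    finally show ?thesis by (simp add: grad_def inner_vec_def partial_deriv_def mult.commute)
  qed
  then show ?thesis using der by (metis (no_types, lifting) ext)
qed

lemma partial_deriv_grad: "partial_deriv i f x = grad f x $ i"
  by (simp add: grad_def)

lemma grad_eqI:
  assumes "(f has_derivative (\<lambda>v. w \<bullet> v)) (at x)"
  shows "grad f x = w"
proof -
  have "partial_deriv i f x = w $ i" for i
    unfolding partial_deriv_eq[OF assms] by (simp add: inner_axis)
  then show ?thesis unfolding grad_def by (simp only: vec_nth_inverse)
qed

lemma continuous_on_grad: "smooth f \<Longrightarrow> continuous_on A (grad f)"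
  unfolding grad_def by (intro continuous_on_vec_lambda smooth_continuous_on smooth_partial_deriv)

lemma grad_add: "smooth f \<Longrightarrow> smooth g \<Longrightarrow> grad (\<lambda>x. f x + g x) x = grad f x + grad g x"
  using grad_eqI[of "\<lambda>x. f x + g x" "grad f x + grad g x"]
    has_derivative_add[OF grad_has_derivative[of f x] grad_has_derivative[of g x]]
  by (simp add: inner_add_left)

lemma grad_diff: "smooth f \<Longrightarrow> smooth g \<Longrightarrow> grad (\<lambda>x. f x - g x) x = grad f x - grad g x"
  using grad_eqI[of "\<lambda>x. f x - g x" "grad f x - grad g x"]
    has_derivative_diff[OF grad_has_derivative[of f x] grad_has_derivative[of g x]]
  by (simp add: inner_diff_left)

lemma grad_scale: "smooth f \<Longrightarrow> grad (\<lambda>x. c * f x) x = c *\<^sub>R grad f x"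
  using grad_eqI[of "\<lambda>x. c * f x" "c *\<^sub>R grad f x"]
    has_derivative_mult_right[OF grad_has_derivative[of f x], of c]
  by simp

lemma grad_mult: "smooth f \<Longrightarrow> smooth g \<Longrightarrow> grad (\<lambda>x. f x * g x) x = f x *\<^sub>R grad g x + g x *\<^sub>R grad f x"
  using grad_eqI[of "\<lambda>x. f x * g x" "f x *\<^sub>R grad g x + g x *\<^sub>R grad f x"]
    has_derivative_mult[OF grad_has_derivative[of f x] grad_has_derivative[of g x]]
  by (simp add: inner_add_left mult.commute)

lemma grad_outside_support:
  assumes "x \<notin> closure {x. f x \<noteq> 0}"
  shows "grad f x = 0"
proof (rule grad_eqI)
  define C where "C = closure {x. f x \<noteq> 0}"
  have C: "closed C" "x \<notin> C" "\<And>y. y \<notin> C \<Longrightarrow> f y = 0"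
    using assms closure_subset[of "{x. f x \<noteq> 0}"] unfolding C_def by blast+
  have "(f has_derivative (\<lambda>v. 0)) (at x)"
  proof (rule has_derivative_transform_within_open)
    show "((\<lambda>x. 0) has_derivative (\<lambda>v. 0)) (at x)" by simp
    show "open (- C)" "x \<in> - C" using C by auto
    show "0 = f y" if "y \<in> - C" for y using C(3) that by simp
  qed
  then show "(f has_derivative (\<lambda>v. 0 \<bullet> v)) (at x)" by simp
qed

section \<open>Algebra of test functions\<close>

lemma closed_subset_compact: "compact K \<Longrightarrow> closed C \<Longrightarrow> C \<subseteq> K \<Longrightarrow> compact C"
  using compact_Int_closed[of K C] by (simp add: Int_absorb1)

lemma test_functionI:
  assumes "test_function \<Omega> \<phi>" "smooth \<psi>" "{x. \<psi> x \<noteq> 0} \<subseteq> closure {x. \<phi> x \<noteq> 0}"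
  shows "test_function \<Omega> \<psi>"
proof -
  have "closure {x. \<psi> x \<noteq> 0} \<subseteq> closure {x. \<phi> x \<noteq> 0}"
    by (rule closure_minimal[OF assms(3) closed_closure])
  then show ?thesis using assms(1,2) closed_subset_compact[OF _ closed_closure]
    unfolding test_function_def by blast
qed

lemma test_function_smooth: "test_function \<Omega> \<phi> \<Longrightarrow> smooth \<phi>"
  by (simp add: test_function_def)

lemma test_function_add:
  assumes "test_function \<Omega> \<phi>" "test_function \<Omega> \<psi>"
  shows "test_function \<Omega> (\<lambda>x. \<phi> x + \<psi> x)"
proof -
  have sub: "closure {x. \<phi> x + \<psi> x \<noteq> 0} \<subseteq> closure {x. \<phi> x \<noteq> 0} \<union> closure {x. \<psi> x \<noteq> 0}"
    unfolding closure_Un[symmetric] by (intro closure_mono) auto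
  moreover have "compact (closure {x. \<phi> x \<noteq> 0} \<union> closure {x. \<psi> x \<noteq> 0})"
    using assms by (intro compact_Un) (auto simp: test_function_def)
  ultimately have "compact (closure {x. \<phi> x + \<psi> x \<noteq> 0})"
    using closed_subset_compact[OF _ closed_closure] by blast
  moreover have "closure {x. \<phi> x \<noteq> 0} \<union> closure {x. \<psi> x \<noteq> 0} \<subseteq> \<Omega>"
    using assms by (simp add: test_function_def)
  moreover have "smooth (\<lambda>x. \<phi> x + \<psi> x)" using assms by (intro smooth_add test_function_smooth)
  ultimately show ?thesis using sub unfolding test_function_def by blast
qed

lemma test_function_scale: "test_function \<Omega> \<phi> \<Longrightarrow> test_function \<Omega> (\<lambda>x. c * \<phi> x)"
  by (rule test_functionI[of \<Omega> \<phi>]) (auto simp: test_function_smooth smooth_mult smooth_const closure_subset[THEN subsetD])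

lemma test_function_diff: "test_function \<Omega> \<phi> \<Longrightarrow> test_function \<Omega> \<psi> \<Longrightarrow> test_function \<Omega> (\<lambda>x. \<phi> x - \<psi> x)"
  using test_function_add[of \<Omega> \<phi> "\<lambda>x. - 1 * \<psi> x"] test_function_scale[of \<Omega> \<psi> "- 1"] by simp

lemma test_function_mult: "test_function \<Omega> \<phi> \<Longrightarrow> smooth \<psi> \<Longrightarrow> test_function \<Omega> (\<lambda>x. \<phi> x * \<psi> x)"
  by (rule test_functionI[of \<Omega> \<phi>]) (auto simp: test_function_smooth smooth_mult closure_subset[THEN subsetD])

lemma test_function_outside: "test_function \<Omega> \<phi> \<Longrightarrow> x \<notin> \<Omega> \<Longrightarrow> \<phi> x = 0"
  unfolding test_function_def using closure_subset[of "{x. \<phi> x \<noteq> 0}"] by blast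

lemma test_function_grad_outside: "test_function \<Omega> \<phi> \<Longrightarrow> x \<notin> \<Omega> \<Longrightarrow> grad \<phi> x = 0"
  unfolding test_function_def using grad_outside_support by blast

text \<open>A function of one variable is smooth if it lies in a family closed under differentiation; this
  is how \<open>smooth_compose\<close> is applied.\<close>

definition exp_family :: "(real \<Rightarrow> real) set" where
  "exp_family = {\<lambda>t. if 0 < t then poly P (1 / t) * exp (- (1 / t)) else 0 |P. True}"

lemma poly_exp_tendsto_0: "((\<lambda>x::real. poly P x * exp (- x)) \<longlongrightarrow> 0) at_top"
proof -
  have "((\<lambda>x. \<Sum>i\<le>degree P. coeff P i * (x ^ i / exp x)) \<longlongrightarrow> (\<Sum>i\<le>degree P. coeff P i * 0)) at_top"
    by (intro tendsto_sum tendsto_mult tendsto_const tendsto_power_div_exp_0)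
  then show ?thesis
    by (simp add: poly_altdef exp_minus sum_distrib_right divide_inverse mult.assoc)
qed

lemma exp_family_closed:
  assumes "h \<in> exp_family"
  shows "\<exists>h'\<in>exp_family. \<forall>t. (h has_real_derivative h' t) (at t)"
proof -
  obtain P where h: "h = (\<lambda>t. if 0 < t then poly P (1 / t) * exp (- (1 / t)) else 0)"
    using assms by (auto simp: exp_family_def)
  \<comment> \<open>With \<open>x = 1 / t\<close> the derivative of \<open>P(x) * exp (- x)\<close>
    with respect to \<open>t\<close> is \<open>x * x * (P(x) - P'(x)) * exp (- x)\<close>.\<close>
  define Q where "Q = [:0, 0, 1:] * (P - pderiv P)"
  define h' where "h' = (\<lambda>t. if 0 < t then poly Q (1 / t) * exp (- (1 / t)) else 0)"
  have "(h has_real_derivative h' t) (at t)" for t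
  proof -
    consider "0 < t" | "t < 0" | "t = 0" by linarith
    then show ?thesis
    proof cases
      case 1
      have "((\<lambda>t. poly P (1 / t) * exp (- (1 / t))) has_real_derivative
          poly P (1 / t) * (exp (- (1 / t)) * (1 / (t * t))) + (poly (pderiv P) (1 / t) * (- 1 / (t * t))) * exp (- (1 / t))) (at t)"
        using 1 by (auto intro!: derivative_eq_intros poly_DERIV simp: field_simps)
      moreover have "poly P (1 / t) * (exp (- (1 / t)) * (1 / (t * t))) + (poly (pderiv P) (1 / t) * (- 1 / (t * t))) * exp (- (1 / t)) = h' t"
        using 1 by (simp add: h'_def Q_def algebra_simps)
      ultimately have "((\<lambda>t. poly P (1 / t) * exp (- (1 / t))) has_real_derivative h' t) (at t)" by simp
      then show ?thesis
        by (rule has_field_derivative_transform_within_open[of _ _ _ "{0<..}"]) (use 1 in \<open>auto simp: h\<close>)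
    next
      case 2
      have "((\<lambda>t. 0) has_real_derivative h' t) (at t)" using 2 by (simp add: h'_def)
      then show ?thesis
        by (rule has_field_derivative_transform_within_open[of _ _ _ "{..<0}"]) (use 2 in \<open>auto simp: h\<close>)
    next
      case 3
      \<comment> \<open>To the right of 0 the difference quotient \<open>h t / t\<close> equals
        \<open>x * P(x) * exp (- x)\<close> with \<open>x = 1 / t\<close>, which accounts for the
        extra factor \<open>pCons 0\<close>.\<close>
      have "((\<lambda>x. poly (pCons 0 P) x * exp (- x)) \<longlongrightarrow> 0) at_top" by (rule poly_exp_tendsto_0)
      then have "((\<lambda>t. poly (pCons 0 P) (inverse t) * exp (- inverse t)) \<longlongrightarrow> 0) (at_right 0)"
        by (rule filterlim_compose[OF _ filterlim_inverse_at_top_right])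
      moreover have "eventually (\<lambda>t. poly (pCons 0 P) (inverse t) * exp (- inverse t) = h t / t) (at_right 0)"
        using eventually_at_right_less[of "0::real"]
        by eventually_elim (simp add: h inverse_eq_divide)
      ultimately have r: "((\<lambda>t. h t / t) \<longlongrightarrow> 0) (at_right 0)"
        by (rule Lim_transform_eventually)
      have "eventually (\<lambda>t. 0 = h t / t) (at_left 0)"
        using eventually_at_left_real[of "-1" 0] by (auto simp: h elim!: eventually_mono)
      then have l: "((\<lambda>t. h t / t) \<longlongrightarrow> 0) (at_left 0)"
        by (rule Lim_transform_eventually[OF tendsto_const])
      from filterlim_split_at[OF l r] have "((\<lambda>t. h t / t) \<longlongrightarrow> 0) (at 0)" .
      then show ?thesis using 3 by (simp add: DERIV_def h h'_def cong: if_cong)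
    qed
  qed
  moreover have "h' \<in> exp_family" by (auto simp: exp_family_def h'_def)
  ultimately show ?thesis by blast
qed

definition flat_exp :: "real \<Rightarrow> real" where
  "flat_exp t = (if 0 < t then exp (- (1 / t)) else 0)"

lemma smooth_flat_exp:
  assumes "smooth f"
  shows "smooth (\<lambda>x. flat_exp (f x))"
proof -
  have "flat_exp = (\<lambda>t. if 0 < t then poly 1 (1 / t) * exp (- (1 / t)) else 0)"
    by (auto simp: flat_exp_def)
  then have "flat_exp \<in> exp_family" unfolding exp_family_def by blast
  from smooth_compose[OF exp_family_closed this assms] show ?thesis .
qed

definition sqrt_family :: "real \<Rightarrow> (real \<Rightarrow> real) set" where
  "sqrt_family e = {\<lambda>t. poly P t * (t\<^sup>2 + e\<^sup>2) powr a |P a. True}"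

lemma sqrt_family_closed:
  assumes "e \<noteq> 0" "h \<in> sqrt_family e"
  shows "\<exists>h'\<in>sqrt_family e. \<forall>t. (h has_real_derivative h' t) (at t)"
proof -
  obtain P a where h: "h = (\<lambda>t. poly P t * (t\<^sup>2 + e\<^sup>2) powr a)"
    using assms by (auto simp: sqrt_family_def)
  define Q where "Q = pderiv P * [:e\<^sup>2, 0, 1:] + smult (2 * a) (P * [:0, 1:])"
  have "(h has_real_derivative poly Q t * (t\<^sup>2 + e\<^sup>2) powr (a - 1)) (at t)" for t
  proof -
    have pos: "0 < t\<^sup>2 + e\<^sup>2" using assms(1) by (simp add: add_nonneg_pos)
    have "(h has_real_derivative poly P t * (a * (t\<^sup>2 + e\<^sup>2) powr (a - 1) * (2 * t)) + poly (pderiv P) t * (t\<^sup>2 + e\<^sup>2) powr a) (at t)"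
      unfolding h using pos by (auto intro!: derivative_eq_intros poly_DERIV)
    moreover have "(t\<^sup>2 + e\<^sup>2) powr a = (t\<^sup>2 + e\<^sup>2) powr (a - 1) * (t\<^sup>2 + e\<^sup>2)"
      using pos by (simp add: powr_diff)
    ultimately show ?thesis
      by (simp add: Q_def algebra_simps power2_eq_square)
  qed
  moreover have "(\<lambda>t. poly Q t * (t\<^sup>2 + e\<^sup>2) powr (a - 1)) \<in> sqrt_family e"
    unfolding sqrt_family_def by blast
  ultimately show ?thesis by (intro bexI[of _ "\<lambda>t. poly Q t * (t\<^sup>2 + e\<^sup>2) powr (a - 1)"]) auto
qed

lemma smooth_sqrt:
  assumes "e \<noteq> 0" "smooth f"
  shows "smooth (\<lambda>x. sqrt ((f x)\<^sup>2 + e\<^sup>2))"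
proof -
  have "(\<lambda>t. poly 1 t * (t\<^sup>2 + e\<^sup>2) powr (1/2)) \<in> sqrt_family e" unfolding sqrt_family_def by blast
  from smooth_compose[OF sqrt_family_closed[OF assms(1)] this assms(2)]
  show ?thesis by (simp add: powr_half_sqrt)
qed

section \<open>Translation estimates\<close>

lemma powr_tangent_le:
  fixes x m p :: real
  assumes "1 < p" "0 \<le> x" "0 < m"
  shows "m powr p + p * m powr (p - 1) * (x - m) \<le> x powr p"
proof -
  consider "x = m" | "m < x" | "x < m" by linarith
  then show ?thesis
  proof cases
    case 2
    then obtain z where z: "m < z" "x powr p - m powr p = (x - m) * (p * z powr (p - 1))"
      using powr_mvt[OF assms(1) less_imp_le[OF assms(3)] 2] by blast
    have "(x - m) * (p * m powr (p - 1)) \<le> (x - m) * (p * z powr (p - 1))"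
      using z 2 assms by (intro mult_left_mono powr_mono2) auto
    then show ?thesis using z by (simp add: algebra_simps)
  next
    case 3
    then obtain z where z: "x < z" "z < m" "m powr p - x powr p = (m - x) * (p * z powr (p - 1))"
      using powr_mvt[OF assms(1,2) 3] by blast
    have "(m - x) * (p * z powr (p - 1)) \<le> (m - x) * (p * m powr (p - 1))"
      using z 3 assms by (intro mult_left_mono powr_mono2) auto
    then show ?thesis using z by (simp add: algebra_simps)
  qed simp
qed

text \<open>Jensen's inequality for a measure that need not have total mass 1, which explains the
  power of the mass. It follows from the supporting line of the power at the mean.\<close>

lemma power_mean_integral:
  fixes f :: "'a \<Rightarrow> real"
  assumes "finite_measure N" "1 < p" "f \<in> borel_measurable N" "integrable N (\<lambda>x. \<bar>f x\<bar> powr p)"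
  shows "\<bar>LINT x|N. f x\<bar> powr p \<le> measure N (space N) powr (p - 1) * (LINT x|N. \<bar>f x\<bar> powr p)"
proof -
  interpret finite_measure N by fact
  define W where "W = measure N (space N)"
  define I where "I = (LINT x|N. \<bar>f x\<bar>)"
  have "Lp_fun p N f" using assms by (simp add: Lp_fun_def)
  then have "Lp_fun 1 N f" by (rule Lp_fun_lower[OF assms(1), rotated 2]) (use assms(2) in auto)
  then have int: "integrable N (\<lambda>x. \<bar>f x\<bar>)" by (simp add: Lp_fun_def)
  have W0: "0 \<le> W" and I0: "0 \<le> I" by (auto simp: W_def I_def)
  have fI: "\<bar>LINT x|N. f x\<bar> \<le> I" unfolding I_def by (rule integral_abs_bound)
  show ?thesis
  proof (cases "I = 0")
    case True
    then have "(LINT x|N. f x) = 0" using fI by simp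
    then show ?thesis by simp
  next
    case False
    then have Ipos: "0 < I" using I0 by simp
    have Wpos: "0 < W"
    proof (rule ccontr)
      assume "\<not> 0 < W"
      then have "W = 0" using W0 by simp
      then have "emeasure N (space N) = 0" by (simp add: W_def emeasure_eq_measure)
      then have "AE x in N. \<bar>f x\<bar> = 0" by (intro AE_I[of _ _ "space N"]) auto
      then have "I = 0" unfolding I_def by (simp add: integral_eq_zero_AE)
      with False show False by simp
    qed
    \<comment> \<open>At the mean the linear part of the tangent integrates to 0.\<close>
    define m where "m = I / W"
    have m: "0 < m" using Ipos Wpos by (simp add: m_def)
    have "(LINT x|N. m powr p + p * m powr (p - 1) * (\<bar>f x\<bar> - m)) \<le> (LINT x|N. \<bar>f x\<bar> powr p)"
      using assms(2,4) int m by (intro integral_mono powr_tangent_le) auto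
    moreover have "(LINT x|N. m powr p + p * m powr (p - 1) * (\<bar>f x\<bar> - m)) = W * m powr p + p * m powr (p - 1) * (I - m * W)"
      using int by (simp add: W_def I_def mult.commute)
    ultimately have "W * m powr p \<le> (LINT x|N. \<bar>f x\<bar> powr p)"
      using Wpos by (simp add: m_def)
    moreover have "I powr p = W powr (p - 1) * (W * m powr p)"
    proof -
      have "I = W * m" using Wpos by (simp add: m_def)
      then have "I powr p = W powr p * m powr p" using Wpos m by (simp add: powr_mult)
      then show ?thesis using Wpos by (simp add: powr_diff)
    qed
    ultimately have "I powr p \<le> W powr (p - 1) * (LINT x|N. \<bar>f x\<bar> powr p)"
      by (simp add: mult_left_mono)
    moreover have "\<bar>LINT x|N. f x\<bar> powr p \<le> I powr p"
      using fI assms(2) by (intro powr_mono2) auto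
    ultimately show ?thesis by (simp add: W_def)
  qed
qed

lemma power_mean_sum:
  fixes f :: "nat \<Rightarrow> real"
  assumes "1 < p"
  shows "\<bar>\<Sum>j<n. f j\<bar> powr p \<le> real n powr (p - 1) * (\<Sum>j<n. \<bar>f j\<bar> powr p)"
proof -
  have "finite_measure (count_space {..<n})" by (rule finite_measure_count_space) simp
  from power_mean_integral[OF this assms, of f] show ?thesis
    by (simp add: lebesgue_integral_count_space_finite integrable_count_space measure_count_space)
qed

lemma continuous_compact_support:
  fixes f :: "real^'n::finite \<Rightarrow> 'b::euclidean_space"
  assumes "continuous_on UNIV f" "\<And>x. R < norm x \<Longrightarrow> f x = 0"
  shows "integrable lborel f" and "\<exists>B>0. \<forall>x. norm (f x) \<le> B"
proof -
  have c: "compact (cball (0::real^'n) R)" "continuous_on (cball 0 R) f"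
    using assms(1) continuous_on_subset by (auto intro: continuous_on_subset)
  have "integrable lborel (\<lambda>x. indicator (cball 0 R) x *\<^sub>R f x)"
    using borel_integrable_compact[OF c] by simp
  moreover have "(\<lambda>x. indicator (cball 0 R) x *\<^sub>R f x) = f"
    using assms(2) by (fastforce simp: indicator_def not_le)
  ultimately show "integrable lborel f" by simp
  have "compact (f ` cball 0 R)" using c by (rule compact_continuous_image[rotated])
  then obtain B where B: "0 < B" "\<And>x. x \<in> cball 0 R \<Longrightarrow> norm (f x) \<le> B"
    using compact_imp_bounded bounded_pos by (metis imageI)
  have "norm (f x) \<le> B" for x
    using B assms(2)[of x] by (cases "norm x \<le> R") auto
  then show "\<exists>B>0. \<forall>x. norm (f x) \<le> B" using B(1) by blast
qed

lemma lborel_integral_translate: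
  fixes f :: "real^'n::finite \<Rightarrow> real"
  assumes "f \<in> borel_measurable borel"
  shows "(LINT x|lborel. f (x + c)) = (LINT x|lborel. f x)"
proof -
  have "(LINT x|lborel. f x) = (LINT x|distr lborel borel ((+) c). f x)"
    by (simp add: lborel_distr_plus)
  also have "\<dots> = (LINT x|lborel. f (c + x))"
    using assms by (intro integral_distr) auto
  finally show ?thesis by (simp add: add.commute)
qed

lemma nn_integral_lborel_translate:
  fixes f :: "real^'n::finite \<Rightarrow> ennreal"
  assumes "f \<in> borel_measurable borel"
  shows "(\<integral>\<^sup>+x. f (x + c) \<partial>lborel) = (\<integral>\<^sup>+x. f x \<partial>lborel)"
proof -
  have "(\<integral>\<^sup>+x. f x \<partial>lborel) = (\<integral>\<^sup>+x. f x \<partial>distr lborel borel ((+) c))"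
    by (simp add: lborel_distr_plus)
  also have "\<dots> = (\<integral>\<^sup>+x. f (c + x) \<partial>lborel)"
    using assms by (intro nn_integral_distr) auto
  finally show ?thesis by (simp add: add.commute)
qed

text \<open>The support is confined to a fixed ball instead of the domain, because all estimates
  take place on the whole space and depend on the domain through \<open>R\<close> only.\<close>

definition smooth_bounded_support :: "real \<Rightarrow> (real^'n::finite \<Rightarrow> real) \<Rightarrow> bool" where
  "smooth_bounded_support R f \<longleftrightarrow> smooth f \<and> (\<forall>x. R < norm x \<longrightarrow> f x = 0 \<and> grad f x = 0)"

lemma test_function_bounded_support:
  assumes "test_function \<Omega> f" "\<Omega> \<subseteq> cball 0 R"
  shows "smooth_bounded_support R f"
proof -
  have "x \<notin> \<Omega>" if "R < norm x" for x using assms(2) that by auto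
  then show ?thesis
    using test_function_outside[OF assms(1)] test_function_grad_outside[OF assms(1)] test_function_smooth[OF assms(1)]
    by (simp add: smooth_bounded_support_def)
qed

section \<open>Estimates for one smooth function of bounded support\<close>

context
  fixes R :: real and f :: "real^'n::finite \<Rightarrow> real"
  assumes f: "smooth_bounded_support R f"
begin

lemma sbs_smooth: "smooth f" and sbs_outside: "R < norm x \<Longrightarrow> f x = 0"
  and sbs_grad_outside: "R < norm x \<Longrightarrow> grad f x = 0"
  using f by (auto simp: smooth_bounded_support_def)

lemma sbs_continuous: "continuous_on A f" and sbs_grad_continuous: "continuous_on A (grad f)"
  using smooth_continuous_on[OF sbs_smooth] continuous_on_grad[OF sbs_smooth] by auto

lemma sbs_measurable [measurable]: "f \<in> borel_measurable borel" "grad f \<in> borel_measurable borel"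
  using sbs_continuous sbs_grad_continuous by (auto intro: borel_measurable_continuous_onI)

lemma sbs_Lipschitz: "\<exists>L>0. \<forall>x y. \<bar>f x - f y\<bar> \<le> L * norm (x - y)"
proof -
  obtain L where L: "L > 0" "\<And>x. norm (grad f x) \<le> L"
    using continuous_compact_support(2)[OF sbs_grad_continuous sbs_grad_outside] by blast
  have "norm (f x - f y) \<le> L * norm (x - y)" for x y
  proof (rule differentiable_bound[of UNIV f "\<lambda>x v. grad f x \<bullet> v"])
    show "onorm (\<lambda>v. grad f x \<bullet> v) \<le> L" for x
    proof (rule onorm_bound)
      show "norm (grad f x \<bullet> v) \<le> L * norm v" for v
        using Cauchy_Schwarz_ineq2[of "grad f x" v] mult_right_mono[OF L(2), of "norm v" x] by simp
    qed (use L in simp)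
  qed (auto intro: grad_has_derivative[OF sbs_smooth])
  then show ?thesis using L(1) by auto
qed

lemma sbs_translate_outside: "\<bar>R\<bar> + norm c < norm x \<Longrightarrow> f (x + c) = 0"
  using norm_triangle_ineq4[of "x + c" c] by (intro sbs_outside) simp

lemma sbs_translate_continuous: "continuous_on A (\<lambda>x. f (x + c))"
  by (rule continuous_on_compose2[OF sbs_continuous[of UNIV]]) (auto intro!: continuous_intros)

definition "difference_quotient v k x = real (Suc k) * (f (x + (1 / real (Suc k)) *\<^sub>R v) - f x)"

lemma difference_quotient_tendsto: "(\<lambda>k. difference_quotient v k x) \<longlonglongrightarrow> grad f x \<bullet> v"
proof -
  have "((\<lambda>t. f (x + t *\<^sub>R v)) has_derivative (\<lambda>t. grad f x \<bullet> (t *\<^sub>R v))) (at 0)"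
  proof (rule has_derivative_compose[of "\<lambda>t. x + t *\<^sub>R v" "\<lambda>t. t *\<^sub>R v" 0 UNIV f "\<lambda>w. grad f x \<bullet> w"])
    show "((\<lambda>t. x + t *\<^sub>R v) has_derivative (\<lambda>t. t *\<^sub>R v)) (at 0)"
      by (auto intro!: derivative_eq_intros)
    show "(f has_derivative (\<lambda>w. grad f x \<bullet> w)) (at (x + 0 *\<^sub>R v))"
      using grad_has_derivative[OF sbs_smooth] by simp
  qed
  then have "((\<lambda>t. f (x + t *\<^sub>R v)) has_real_derivative grad f x \<bullet> v) (at 0)"
    by (simp add: has_field_derivative_def mult.commute[of _ "grad f x \<bullet> v"] inner_scaleR_right)
  then have lim: "(\<lambda>t. (f (x + (0 + t) *\<^sub>R v) - f (x + 0 *\<^sub>R v)) / t) \<midarrow>0\<rightarrow> grad f x \<bullet> v"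
    by (simp only: DERIV_def)
  have "filterlim (\<lambda>k. 1 / real (Suc k)) (at 0) sequentially"
    using LIMSEQ_Suc[OF lim_1_over_n] by (auto simp: filterlim_at)
  from filterlim_compose[OF lim this] show ?thesis
    by (simp add: difference_quotient_def mult.commute)
qed

lemma difference_quotient_bound:
  "\<exists>L>0. \<forall>k x. \<bar>difference_quotient v k x\<bar> \<le> L * indicator (cball 0 (\<bar>R\<bar> + norm v)) x"
proof -
  obtain L where L: "L > 0" "\<And>x y. \<bar>f x - f y\<bar> \<le> L * norm (x - y)" using sbs_Lipschitz by blast
  have "\<bar>difference_quotient v k x\<bar> \<le> (L * (norm v + 1)) * indicator (cball 0 (\<bar>R\<bar> + norm v)) x" for k x
  proof (cases "x \<in> cball 0 (\<bar>R\<bar> + norm v)")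
    case True
    have "\<bar>f (x + (1 / real (Suc k)) *\<^sub>R v) - f x\<bar> \<le> L * (norm v / real (Suc k))"
      using L(2)[of "x + (1 / real (Suc k)) *\<^sub>R v" x] by simp
    then have "real (Suc k) * \<bar>f (x + (1 / real (Suc k)) *\<^sub>R v) - f x\<bar> \<le> real (Suc k) * (L * (norm v / real (Suc k)))"
      by (intro mult_left_mono) auto
    then have "\<bar>difference_quotient v k x\<bar> \<le> L * norm v"
      unfolding difference_quotient_def abs_mult by simp
    then show ?thesis using True L(1) by (simp add: distrib_left)
  next
    case False
    then have n: "\<bar>R\<bar> + norm v < norm x" by simp
    have "norm ((1 / real (Suc k)) *\<^sub>R v) \<le> norm v" by (simp add: divide_le_eq mult_le_cancel_left1)
    then have "\<bar>R\<bar> < norm (x + (1 / real (Suc k)) *\<^sub>R v)"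
      using n norm_triangle_ineq4[of "x + (1 / real (Suc k)) *\<^sub>R v" "(1 / real (Suc k)) *\<^sub>R v"] by simp
    moreover have "R < norm x" using n norm_ge_zero[of v] by linarith
    ultimately have "difference_quotient v k x = 0"
      using sbs_outside by (simp add: difference_quotient_def abs_less_iff)
    then show ?thesis using False by simp
  qed
  moreover have "0 < L * (norm v + 1)" using L(1) by (simp add: add_nonneg_pos)
  ultimately show ?thesis by blast
qed

text \<open>Translation invariance makes the integral of every difference quotient vanish, and
  dominated convergence passes to the limit. Applied to products it is integration by parts.\<close>

lemma integral_grad_zero: "(LINT x|lborel. grad f x \<bullet> v) = 0"
proof -
  obtain L where L: "\<And>k x. \<bar>difference_quotient v k x\<bar> \<le> L * indicator (cball 0 (\<bar>R\<bar> + norm v)) x"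
    using difference_quotient_bound by blast
  have int: "integrable lborel f"
    by (rule continuous_compact_support(1)[OF sbs_continuous sbs_outside])
  have int': "integrable lborel (\<lambda>x. f (x + c))" for c
    by (rule continuous_compact_support(1)[OF sbs_translate_continuous sbs_translate_outside])
  have "(LINT x|lborel. difference_quotient v k x) = 0" for k
    unfolding difference_quotient_def
    using int int' by (simp add: lborel_integral_translate)
  moreover have "(\<lambda>k. LINT x|lborel. difference_quotient v k x) \<longlonglongrightarrow> (LINT x|lborel. grad f x \<bullet> v)"
  proof (rule integral_dominated_convergence)
    show "integrable lborel (\<lambda>x :: real^'n. L * indicator (cball 0 (\<bar>R\<bar> + norm v)) x :: real)"
      using emeasure_bounded_finite[OF bounded_cball, of "0::real^'n" "\<bar>R\<bar> + norm v"]
      by (intro integrable_mult_right integrable_real_indicator) auto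
    show "(\<lambda>x. grad f x \<bullet> v) \<in> borel_measurable lborel" by simp
    show "difference_quotient v k \<in> borel_measurable lborel" for k
      unfolding difference_quotient_def by simp
  qed (use L difference_quotient_tendsto in auto)
  ultimately show ?thesis using LIMSEQ_unique[OF _ tendsto_const] by fastforce
qed

lemma integral_grad_power_limit:
  assumes "1 < p"
  shows "(\<lambda>k. LINT x|lborel. \<bar>difference_quotient v k x\<bar> powr p) \<longlonglongrightarrow> (LINT x|lborel. \<bar>grad f x \<bullet> v\<bar> powr p)"
proof -
  obtain L where L: "0 < L" "\<And>k x. \<bar>difference_quotient v k x\<bar> \<le> L * indicator (cball 0 (\<bar>R\<bar> + norm v)) x"
    using difference_quotient_bound by blast
  show ?thesis
  proof (rule integral_dominated_convergence)
    show "integrable lborel (\<lambda>x :: real^'n. L powr p * indicator (cball 0 (\<bar>R\<bar> + norm v)) x :: real)"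
      using emeasure_bounded_finite[OF bounded_cball, of "0::real^'n" "\<bar>R\<bar> + norm v"]
      by (intro integrable_mult_right integrable_real_indicator) auto
    show "(\<lambda>x. \<bar>grad f x \<bullet> v\<bar> powr p) \<in> borel_measurable lborel" by simp
    show "(\<lambda>x. \<bar>difference_quotient v k x\<bar> powr p) \<in> borel_measurable lborel" for k
      unfolding difference_quotient_def by simp
    have "(\<lambda>k. \<bar>difference_quotient v k x\<bar> powr p) \<longlonglongrightarrow> \<bar>grad f x \<bullet> v\<bar> powr p" for x
      using assms by (intro tendsto_powr'[OF tendsto_rabs[OF difference_quotient_tendsto] tendsto_const]) auto
    then show "AE x in lborel. (\<lambda>k. \<bar>difference_quotient v k x\<bar> powr p) \<longlonglongrightarrow> \<bar>grad f x \<bullet> v\<bar> powr p"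
      by simp
    have "\<bar>difference_quotient v k x\<bar> powr p \<le> L powr p * indicator (cball 0 (\<bar>R\<bar> + norm v)) x" for k x
    proof -
      have "\<bar>difference_quotient v k x\<bar> powr p \<le> (L * indicator (cball 0 (\<bar>R\<bar> + norm v)) x) powr p"
        using L(2)[of k x] assms by (intro powr_mono2) auto
      also have "\<dots> = L powr p * indicator (cball 0 (\<bar>R\<bar> + norm v)) x"
        by (auto simp: indicator_def)
      finally show ?thesis .
    qed
    then show "AE x in lborel. norm (\<bar>difference_quotient v k x\<bar> powr p) \<le> L powr p * indicator (cball 0 (\<bar>R\<bar> + norm v)) x" for k
      by simp
  qed
qed

lemma difference_power_integrable:
  assumes "0 < p"
  shows "integrable lborel (\<lambda>x. \<bar>f (x + a) - f (x + b)\<bar> powr p)"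
proof (rule continuous_compact_support(1)[where R = "\<bar>R\<bar> + norm a + norm b"])
  show "continuous_on UNIV (\<lambda>x. \<bar>f (x + a) - f (x + b)\<bar> powr p)"
    using assms by (intro continuous_on_powr' continuous_on_rabs continuous_on_diff
        sbs_translate_continuous continuous_on_const) auto
  show "\<bar>f (x + a) - f (x + b)\<bar> powr p = 0" if "\<bar>R\<bar> + norm a + norm b < norm x" for x
    using that sbs_translate_outside[of a x] sbs_translate_outside[of b x] norm_ge_zero[of a] norm_ge_zero[of b]
    by simp
qed

text \<open>Telescoping over \<open>k\<close> equal steps and letting \<open>k\<close> tend to infinity avoids integrating along
  segments.\<close>

lemma translation_estimate_aux:
  assumes "1 < p"
  shows "(LINT x|lborel. \<bar>f (x + v) - f x\<bar> powr p) \<le> (LINT x|lborel. \<bar>grad f x \<bullet> v\<bar> powr p)"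
proof -
  have "(LINT x|lborel. \<bar>f (x + v) - f x\<bar> powr p) \<le> (LINT x|lborel. \<bar>difference_quotient v k x\<bar> powr p)" for k
  proof -
    define n where "n = Suc k"
    define w where "w = (1 / real n) *\<^sub>R v"
    have nw: "real n *\<^sub>R w = v" by (simp add: w_def n_def)
    have pt: "\<bar>f (x + v) - f x\<bar> powr p
      \<le> real n powr (p - 1) * (\<Sum>j<n. \<bar>f (x + real (Suc j) *\<^sub>R w) - f (x + real j *\<^sub>R w)\<bar> powr p)" for x
    proof -
      have "f (x + v) - f x = (\<Sum>j<n. f (x + real (Suc j) *\<^sub>R w) - f (x + real j *\<^sub>R w))"
        unfolding sum_lessThan_telescope[of "\<lambda>j. f (x + real j *\<^sub>R w)" n] by (simp add: nw)
      then show ?thesis using power_mean_sum[OF assms, of "\<lambda>j. f (x + real (Suc j) *\<^sub>R w) - f (x + real j *\<^sub>R w)" n]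
        by simp
    qed
    have int: "integrable lborel (\<lambda>x. \<bar>f (x + a) - f (x + b)\<bar> powr p)" for a b
      using assms by (intro difference_power_integrable) auto
    have step: "(LINT x|lborel. \<bar>f (x + real (Suc j) *\<^sub>R w) - f (x + real j *\<^sub>R w)\<bar> powr p)
        = (LINT x|lborel. \<bar>f (x + w) - f x\<bar> powr p)" for j
    proof -
      have "(\<lambda>x. \<bar>f (x + w) - f x\<bar> powr p) \<in> borel_measurable borel" by simp
      from lborel_integral_translate[OF this, of "real j *\<^sub>R w"] show ?thesis
        by (simp add: algebra_simps)
    qed
    have "(LINT x|lborel. \<bar>f (x + v) - f x\<bar> powr p)
      \<le> (LINT x|lborel. real n powr (p - 1) * (\<Sum>j<n. \<bar>f (x + real (Suc j) *\<^sub>R w) - f (x + real j *\<^sub>R w)\<bar> powr p))"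
      using int[of v 0] int pt by (intro integral_mono) (auto intro!: integrable_mult_right)
    also have "\<dots> = real n powr (p - 1) * (real n * (LINT x|lborel. \<bar>f (x + w) - f x\<bar> powr p))"
      using int by (simp only: integral_mult_right_zero Bochner_Integration.integral_sum step sum_constant card_lessThan)
    also have "\<dots> = real n powr p * (LINT x|lborel. \<bar>f (x + w) - f x\<bar> powr p)"
      by (simp add: n_def powr_diff)
    also have "\<dots> = (LINT x|lborel. \<bar>difference_quotient v k x\<bar> powr p)"
      by (simp add: difference_quotient_def abs_mult powr_mult n_def w_def)
    finally show ?thesis .
  qed
  then show ?thesis
    by (intro LIMSEQ_le_const[OF integral_grad_power_limit[OF assms]]) auto
qed

lemma grad_power_integrable:
  assumes "0 < p"
  shows "integrable lborel (\<lambda>x. norm (grad f x) powr p)" "integrable lborel (\<lambda>x. \<bar>f x\<bar> powr p)"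
  using assms sbs_continuous sbs_grad_continuous sbs_outside sbs_grad_outside
  by (auto intro!: continuous_compact_support(1)[where R = R] continuous_on_powr' continuous_on_norm
      continuous_on_rabs continuous_on_const)

lemma translation_estimate:
  assumes "1 < p"
  shows "(LINT x|lborel. \<bar>f (x + v) - f x\<bar> powr p) \<le> norm v powr p * (LINT x|lborel. norm (grad f x) powr p)"
proof -
  note translation_estimate_aux[OF assms, of v]
  also have "(LINT x|lborel. \<bar>grad f x \<bullet> v\<bar> powr p) \<le> (LINT x|lborel. norm v powr p * norm (grad f x) powr p)"
  proof (rule integral_mono_AE')
    show "integrable lborel (\<lambda>x. norm v powr p * norm (grad f x) powr p)"
      using assms grad_power_integrable(1)[of p] by simp
    have "\<bar>grad f x \<bullet> v\<bar> powr p \<le> norm v powr p * norm (grad f x) powr p" for x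
    proof -
      have "\<bar>grad f x \<bullet> v\<bar> powr p \<le> (norm (grad f x) * norm v) powr p"
        using assms by (intro powr_mono2 Cauchy_Schwarz_ineq2) auto
      then show ?thesis by (simp add: powr_mult mult.commute)
    qed
    then show "AE x in lborel. \<bar>grad f x \<bullet> v\<bar> powr p \<le> norm v powr p * norm (grad f x) powr p" by simp
  qed simp
  finally show ?thesis by simp
qed

text \<open>A shift longer than the diameter of the ball moves the support off itself, so the
  difference of the function and its translate dominates the translate.\<close>

lemma Poincare:
  assumes "1 < p" "0 \<le> R"
  shows "(LINT x|lborel. \<bar>f x\<bar> powr p) \<le> (2 * R + 1) powr p * (LINT x|lborel. norm (grad f x) powr p)"
proof -
  \<comment> \<open>The length \<open>2 * R + 1\<close> exceeds the diameter; the direction of the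
    axis is arbitrary.\<close>
  define v :: "real^'n" where "v = (2 * R + 1) *\<^sub>R axis undefined 1"
  have v: "norm v = 2 * R + 1" using assms by (simp add: v_def norm_axis_1)
  have int: "integrable lborel (\<lambda>x. \<bar>f x\<bar> powr p)" "integrable lborel (\<lambda>x. \<bar>f (x + v) - f x\<bar> powr p)"
    using assms grad_power_integrable(2)[of p] difference_power_integrable[of p v 0] by auto
  have "\<bar>f (x + v)\<bar> powr p \<le> \<bar>f (x + v) - f x\<bar> powr p" for x
  proof (cases "R < norm x")
    case False
    have "norm v \<le> norm (x + v) + norm x" using norm_triangle_ineq4[of "x + v" x] by simp
    then have "R < norm (x + v)" using False v assms by simp
    then show ?thesis using sbs_outside assms by simp
  qed (use sbs_outside in simp)
  moreover have "integrable lborel (\<lambda>x. \<bar>f (x + v)\<bar> powr p)"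
    using assms by (intro continuous_compact_support(1)[where R = "\<bar>R\<bar> + norm v"] continuous_on_powr'
       continuous_on_rabs sbs_translate_continuous continuous_on_const) (auto simp: sbs_translate_outside)
  ultimately have "(LINT x|lborel. \<bar>f (x + v)\<bar> powr p) \<le> (LINT x|lborel. \<bar>f (x + v) - f x\<bar> powr p)"
    using int by (intro integral_mono) auto
  moreover have "(LINT x|lborel. \<bar>f (x + v)\<bar> powr p) = (LINT x|lborel. \<bar>f x\<bar> powr p)"
    by (rule lborel_integral_translate) simp
  ultimately show ?thesis
    using translation_estimate[OF assms(1), of v] v by simp
qed

end

declare sbs_measurable [measurable del]

section \<open>Ball averages and the Sobolev embedding\<close>

definition ball_volume :: "'n::finite itself \<Rightarrow> real \<Rightarrow> real" where
  "ball_volume _ h = unit_ball_vol (real CARD('n)) * h powr real CARD('n)"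

text \<open>The ball is centred at 0; averages around other points are averages of shifted
  functions, so that a single finite measure is used for all centres.\<close>

definition ball_average :: "real \<Rightarrow> (real^'n::finite \<Rightarrow> real) \<Rightarrow> real" where
  "ball_average h g = (LINT y|restrict_space lborel (ball 0 h). g y) / ball_volume TYPE('n) h"

lemma ball_volume_pos: "0 < h \<Longrightarrow> 0 < ball_volume TYPE('n::finite) h"
  by (simp add: ball_volume_def unit_ball_vol_pos)

lemma emeasure_ball_volume:
  "0 < h \<Longrightarrow> emeasure lborel (ball (c::real^'n::finite) h) = ennreal (ball_volume TYPE('n) h)"
  by (simp add: emeasure_ball ball_volume_def powr_realpow)

lemma space_ball_restrict: "space (restrict_space lborel (ball (0::real^'n::finite) h)) = ball 0 h"
  by (simp add: space_restrict_space)

lemma measure_ball_restrict: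
  assumes "0 < h"
  shows "measure (restrict_space lborel (ball (0::real^'n::finite) h)) (ball 0 h) = ball_volume TYPE('n) h"
proof -
  have "emeasure (restrict_space lborel (ball (0::real^'n) h)) (ball 0 h) = emeasure lborel (ball (0::real^'n) h)"
    by (rule emeasure_restrict_space) auto
  then show ?thesis
    using assms ball_volume_pos[OF assms, where 'n = 'n] by (simp add: measure_def emeasure_ball_volume)
qed

lemma finite_measure_ball: "finite_measure (restrict_space lborel (ball (0::real^'n::finite) h))"
proof
  have "emeasure (restrict_space lborel (ball (0::real^'n) h)) (ball 0 h) = emeasure lborel (ball (0::real^'n) h)"
    by (rule emeasure_restrict_space) auto
  then show "emeasure (restrict_space lborel (ball (0::real^'n) h)) (space (restrict_space lborel (ball 0 h))) \<noteq> \<infinity>"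
    using emeasure_bounded_finite[OF bounded_ball, of "0::real^'n" h] by (simp add: space_ball_restrict)
qed

lemma ball_integrable:
  fixes g :: "real^'n::finite \<Rightarrow> real"
  assumes "continuous_on UNIV g"
  shows "integrable (restrict_space lborel (ball 0 h)) g"
proof -
  interpret finite_measure "restrict_space lborel (ball (0::real^'n) h)" by (rule finite_measure_ball)
  have "compact (g ` cball 0 h)"
    using assms by (intro compact_continuous_image) (auto intro: continuous_on_subset)
  then obtain B where B: "\<And>y. y \<in> cball 0 h \<Longrightarrow> norm (g y) \<le> B"
    using compact_imp_bounded bounded_pos by (metis imageI)
  have "g \<in> borel_measurable (restrict_space lborel (ball 0 h))"
    using borel_measurable_continuous_onI[OF assms] by (intro measurable_restrict_space1) simp
  then show ?thesis
    using B by (intro integrable_const_bound[of _ B]) (auto simp: space_ball_restrict intro!: AE_I2)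
qed

lemma ball_average_power:
  fixes g :: "real^'n::finite \<Rightarrow> real"
  assumes "1 < p" "0 < h" "continuous_on UNIV g"
  shows "\<bar>ball_average h g\<bar> powr p \<le> ball_average h (\<lambda>y. \<bar>g y\<bar> powr p)"
proof -
  define W where "W = ball_volume TYPE('n) h"
  have W: "0 < W" unfolding W_def by (rule ball_volume_pos[OF assms(2)])
  have cont: "continuous_on UNIV (\<lambda>y. \<bar>g y\<bar> powr p)"
    using assms by (intro continuous_on_powr' continuous_on_rabs continuous_on_const) auto
  let ?N = "restrict_space lborel (ball (0::real^'n) h)"
  have "\<bar>LINT y|?N. g y\<bar> powr p \<le> W powr (p - 1) * (LINT y|?N. \<bar>g y\<bar> powr p)"
    using power_mean_integral[OF finite_measure_ball[of h] assms(1) borel_measurable_integrable[OF ball_integrable[OF assms(3), of h]]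
       ball_integrable[OF cont, of h]]
    unfolding space_ball_restrict measure_ball_restrict[OF assms(2)] W_def .
  then have "\<bar>LINT y|?N. g y\<bar> powr p / W powr p \<le> W powr (p - 1) * (LINT y|?N. \<bar>g y\<bar> powr p) / W powr p"
    by (intro divide_right_mono) auto
  also have "\<dots> = (LINT y|?N. \<bar>g y\<bar> powr p) / W" using W by (simp add: powr_diff)
  finally show ?thesis using W
    by (simp add: ball_average_def W_def[symmetric] abs_divide powr_divide)
qed

lemma ball_average_diff:
  assumes "continuous_on UNIV g" "continuous_on UNIV g'"
  shows "ball_average h (\<lambda>y. g y - g' y) = ball_average h g - ball_average h g'"
  using ball_integrable[OF assms(1), of h] ball_integrable[OF assms(2), of h]
  by (simp add: ball_average_def diff_divide_distrib)

lemma ball_average_const: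
  assumes "0 < h"
  shows "ball_average h (\<lambda>y::real^'n::finite. c) = c"
  using assms ball_volume_pos[OF assms, where 'n = 'n] measure_ball_restrict[OF assms, where 'n = 'n]
  by (simp add: ball_average_def space_ball_restrict)

lemma ball_average_mono:
  assumes "continuous_on UNIV g" "continuous_on UNIV g'" "0 < h" "\<And>y. norm y < h \<Longrightarrow> g y \<le> g' y"
  shows "ball_average h g \<le> ball_average h g'"
  unfolding ball_average_def using assms ball_volume_pos[OF assms(3)]
  by (intro divide_right_mono integral_mono ball_integrable) (auto simp: space_ball_restrict intro: less_imp_le)

lemma nn_ball_average:
  fixes g :: "real^'n::finite \<Rightarrow> real"
  assumes "continuous_on UNIV g" "0 < h" "\<And>y. 0 \<le> g y"
  shows "ennreal (ball_average h g) =
    (\<integral>\<^sup>+y. ennreal (g y) * indicator (ball 0 h) y \<partial>lborel) / ennreal (ball_volume TYPE('n) h)"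
proof -
  have "ennreal (LINT y|restrict_space lborel (ball 0 h). g y) = (\<integral>\<^sup>+y. ennreal (g y) \<partial>restrict_space lborel (ball 0 h))"
    using assms by (intro nn_integral_eq_integral[symmetric] ball_integrable) auto
  also have "\<dots> = (\<integral>\<^sup>+y. ennreal (g y) * indicator (ball 0 h) y \<partial>lborel)"
    by (rule nn_integral_restrict_space) auto
  finally have "ennreal (LINT y|restrict_space lborel (ball 0 h). g y)
      = (\<integral>\<^sup>+y. ennreal (g y) * indicator (ball 0 h) y \<partial>lborel)" .
  moreover have "ennreal (ball_average h g)
      = ennreal (LINT y|restrict_space lborel (ball 0 h). g y) / ennreal (ball_volume TYPE('n) h)"
    unfolding ball_average_def
    by (intro divide_ennreal[symmetric] Bochner_Integration.integral_nonneg ball_volume_pos assms)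
  ultimately show ?thesis by simp
qed

lemma ball_average_le_lborel:
  fixes g :: "real^'n::finite \<Rightarrow> real"
  assumes "continuous_on UNIV g" "0 < h" "\<And>y. 0 \<le> g y" "integrable lborel g"
  shows "ball_average h g \<le> (LINT y|lborel. g y) / ball_volume TYPE('n) h"
proof -
  have V: "0 < ball_volume TYPE('n) h" by (rule ball_volume_pos[OF assms(2)])
  have "ennreal (ball_average h g) \<le> (\<integral>\<^sup>+y. ennreal (g y) \<partial>lborel) / ennreal (ball_volume TYPE('n) h)"
    unfolding nn_ball_average[OF assms(1-3)]
    by (intro divide_right_mono_ennreal nn_integral_mono) (auto simp: indicator_def)
  also have "\<dots> = ennreal ((LINT y|lborel. g y) / ball_volume TYPE('n) h)"
    using assms V by (simp add: nn_integral_eq_integral divide_ennreal integral_nonneg_AE)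
  finally show ?thesis using assms V by (simp add: ennreal_le_iff integral_nonneg_AE)
qed

lemma nn_integral_ball_translate:
  fixes k :: "real^'n::finite \<Rightarrow> real"
  assumes [measurable]: "k \<in> borel_measurable borel"
  shows "(\<integral>\<^sup>+y. ennreal (k y) * indicator (ball 0 h) y \<partial>lborel)
    = (\<integral>\<^sup>+w. ennreal (k (w + z)) * indicator (ball 0 h) (w + z) \<partial>lborel)"
  by (rule nn_integral_lborel_translate[symmetric]) (measurable, unfold mem_ball, measurable)

section \<open>Averages of a smooth function on balls of one radius\<close>

context
  fixes R p :: real and f :: "real^'n::finite \<Rightarrow> real"
  assumes f: "smooth_bounded_support R f" and p: "1 < p"
begin

abbreviation (input) "G\<^sub>p \<equiv> LINT x|lborel. norm (grad f x) powr p"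

lemma continuous_shift: "continuous_on A (\<lambda>y. f (x + y))"
  using sbs_translate_continuous[OF f, of A x] by (simp add: add.commute)

lemma continuous_shift_power: "continuous_on UNIV (\<lambda>y. \<bar>c - f (x + y)\<bar> powr p)"
  using p by (intro continuous_on_powr' continuous_on_rabs continuous_on_diff continuous_shift continuous_on_const) auto

lemma nn_translation:
  "(\<integral>\<^sup>+x. ennreal (\<bar>f x - f (x + v)\<bar> powr p) \<partial>lborel) \<le> ennreal (norm v powr p * G\<^sub>p)"
proof -
  have "integrable lborel (\<lambda>x. \<bar>f (x + v) - f x\<bar> powr p)"
    using difference_power_integrable[OF f, of p v 0] p by simp
  then have "(\<integral>\<^sup>+x. ennreal (\<bar>f (x + v) - f x\<bar> powr p) \<partial>lborel) = ennreal (LINT x|lborel. \<bar>f (x + v) - f x\<bar> powr p)"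
    by (intro nn_integral_eq_integral) auto
  then show ?thesis
    using translation_estimate[OF f p, of v] by (simp add: abs_minus_commute)
qed

lemma ball_average_shift_power:
  assumes "0 < h"
  shows "\<bar>c - ball_average h (\<lambda>y. f (x + y))\<bar> powr p \<le> ball_average h (\<lambda>y. \<bar>c - f (x + y)\<bar> powr p)"
proof -
  have "c - ball_average h (\<lambda>y. f (x + y)) = ball_average h (\<lambda>y. c - f (x + y))"
    using assms continuous_shift by (simp add: ball_average_diff ball_average_const)
  then show ?thesis
    using ball_average_power[OF p assms, of "\<lambda>y. c - f (x + y)"] continuous_shift
    by (simp add: continuous_on_diff)
qed

lemma ball_average_bound:
  assumes "0 < h" "0 \<le> R"
  shows "\<bar>ball_average h (\<lambda>y. f (x + y))\<bar> powr p \<le> (2 * R + 1) powr p * G\<^sub>p / ball_volume TYPE('n) h"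
proof -
  have int: "integrable lborel (\<lambda>y. \<bar>f (x + y)\<bar> powr p)"
    using p continuous_shift_power[of 0 x] sbs_translate_outside[OF f, of x]
    by (intro continuous_compact_support(1)[where R = "\<bar>R\<bar> + norm x"]) (auto simp: add.commute)
  have "\<bar>ball_average h (\<lambda>y. f (x + y))\<bar> powr p \<le> ball_average h (\<lambda>y. \<bar>f (x + y)\<bar> powr p)"
    using ball_average_power[OF p assms(1) continuous_shift] .
  also have "\<dots> \<le> (LINT y|lborel. \<bar>f (x + y)\<bar> powr p) / ball_volume TYPE('n) h"
    using continuous_shift_power[of 0 x] assms int by (intro ball_average_le_lborel) auto
  also have "(LINT y|lborel. \<bar>f (x + y)\<bar> powr p) = (LINT y|lborel. \<bar>f y\<bar> powr p)"
    using lborel_integral_translate[of "\<lambda>y. \<bar>f y\<bar> powr p" x] sbs_measurable(1)[OF f] by (simp add: add.commute)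
  also have "\<dots> / ball_volume TYPE('n) h \<le> (2 * R + 1) powr p * G\<^sub>p / ball_volume TYPE('n) h"
    using Poincare[OF f p assms(2)] ball_volume_pos[OF assms(1), where 'n = 'n]
    by (intro divide_right_mono) auto
  finally show ?thesis .
qed

text \<open>The constant depends on the function only through its gradient energy, which makes
  averages over a bounded sequence equicontinuous.\<close>

lemma ball_average_Lipschitz:
  assumes "0 < h"
  shows "\<bar>ball_average h (\<lambda>y. f (x + y)) - ball_average h (\<lambda>y. f (x' + y))\<bar> powr p
    \<le> norm (x - x') powr p * G\<^sub>p / ball_volume TYPE('n) h"
proof -
  have int: "integrable lborel (\<lambda>y. \<bar>f (x + y) - f (x' + y)\<bar> powr p)"
    using difference_power_integrable[OF f, of p x x'] p by (simp add: add.commute)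
  have cont: "continuous_on UNIV (\<lambda>y. \<bar>f (x + y) - f (x' + y)\<bar> powr p)"
    using p by (intro continuous_on_powr' continuous_on_rabs continuous_on_diff continuous_shift continuous_on_const) auto
  have "\<bar>ball_average h (\<lambda>y. f (x + y)) - ball_average h (\<lambda>y. f (x' + y))\<bar> powr p
      = \<bar>ball_average h (\<lambda>y. f (x + y) - f (x' + y))\<bar> powr p"
    by (simp add: ball_average_diff continuous_shift)
  also have "\<dots> \<le> ball_average h (\<lambda>y. \<bar>f (x + y) - f (x' + y)\<bar> powr p)"
    by (intro ball_average_power p assms continuous_on_diff continuous_shift)
  also have "\<dots> \<le> (LINT y|lborel. \<bar>f (x + y) - f (x' + y)\<bar> powr p) / ball_volume TYPE('n) h"
    using cont assms int by (intro ball_average_le_lborel) auto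
  also have "(LINT y|lborel. \<bar>f (x + y) - f (x' + y)\<bar> powr p) = (LINT y|lborel. \<bar>f (y + (x - x')) - f y\<bar> powr p)"
    using lborel_integral_translate[of "\<lambda>y. \<bar>f (y + (x - x')) - f y\<bar> powr p" x'] sbs_measurable(1)[OF f]
    by (simp add: algebra_simps)
  also have "\<dots> / ball_volume TYPE('n) h \<le> norm (x - x') powr p * G\<^sub>p / ball_volume TYPE('n) h"
    using translation_estimate[OF f p, of "x - x'"] ball_volume_pos[OF assms, where 'n = 'n]
    by (intro divide_right_mono) auto
  finally show ?thesis .
qed

text \<open>Here the Lipschitz constant of \<open>f\<close> itself is enough: only measurability of
  the averages depends on this.\<close>

lemma continuous_ball_average:
  assumes "0 < h"
  shows "continuous_on UNIV (\<lambda>x. ball_average h (\<lambda>y. f (x + y)))"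
proof -
  obtain L where L: "0 < L" "\<And>x y. \<bar>f x - f y\<bar> \<le> L * norm (x - y)" using sbs_Lipschitz[OF f] by blast
  have "\<bar>ball_average h (\<lambda>y. f (x + y)) - ball_average h (\<lambda>y. f (x' + y))\<bar> \<le> L * norm (x - x')" for x x'
  proof -
    have le: "ball_average h (\<lambda>y. f (a + y)) - ball_average h (\<lambda>y. f (b + y)) \<le> L * norm (a - b)" for a b
    proof -
      have "ball_average h (\<lambda>y. f (a + y)) - ball_average h (\<lambda>y. f (b + y)) = ball_average h (\<lambda>y. f (a + y) - f (b + y))"
        by (simp add: ball_average_diff continuous_shift)
      also have "\<dots> \<le> ball_average h (\<lambda>y::real^'n. L * norm (a - b))"
      proof (intro ball_average_mono continuous_on_diff continuous_shift continuous_on_const assms)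
        show "f (a + y) - f (b + y) \<le> L * norm (a - b)" for y
          using L(2)[of "a + y" "b + y"] by simp
      qed
      finally show ?thesis by (simp add: ball_average_const[OF assms])
    qed
    show ?thesis using le[of x x'] le[of x' x] by (simp add: norm_minus_commute abs_le_iff)
  qed
  then have "L-lipschitz_on UNIV (\<lambda>x. ball_average h (\<lambda>y. f (x + y)))"
    using L(1) by (intro lipschitz_onI) (auto simp: dist_norm)
  then show ?thesis by (rule lipschitz_on_continuous_on)
qed

text \<open>The shift \<open>c\<close> serves \<open>ball_average_halving\<close>, where the centre
  is fixed and the pairs of points around it vary.\<close>

lemma measurable_pair_difference:
  "(\<lambda>(x, y). ennreal (\<bar>f (x + c) - f (x + c + y)\<bar> powr p) * indicator (ball 0 h) y)
    \<in> borel_measurable (lborel \<Otimes>\<^sub>M lborel)"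
  using sbs_measurable(1)[OF f, measurable] by measurable (unfold mem_ball, measurable)

text \<open>Jensen's inequality moves the power inside the average, the order of integration is
  exchanged, and each fixed increment \<open>y\<close> obeys the translation estimate with
  \<open>norm y < h\<close>.\<close>

lemma nn_average_difference:
  assumes "0 < h"
  shows "(\<integral>\<^sup>+x. ennreal (\<bar>f x - ball_average h (\<lambda>y. f (x + y))\<bar> powr p) \<partial>lborel) \<le> ennreal (h powr p * G\<^sub>p)"
proof -
  define W where "W = ball_volume TYPE('n) h"
  have W: "0 < W" unfolding W_def by (rule ball_volume_pos[OF assms])
  have "(\<integral>\<^sup>+x. ennreal (\<bar>f x - ball_average h (\<lambda>y. f (x + y))\<bar> powr p) \<partial>lborel)
     \<le> (\<integral>\<^sup>+x. (\<integral>\<^sup>+y. ennreal (\<bar>f x - f (x + y)\<bar> powr p) * indicator (ball 0 h) y \<partial>lborel) / ennreal W \<partial>lborel)"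
  proof (rule nn_integral_mono)
    fix x
    have "ennreal (\<bar>f x - ball_average h (\<lambda>y. f (x + y))\<bar> powr p) \<le> ennreal (ball_average h (\<lambda>y. \<bar>f x - f (x + y)\<bar> powr p))"
      by (intro ennreal_leI ball_average_shift_power assms)
    also have "\<dots> = (\<integral>\<^sup>+y. ennreal (\<bar>f x - f (x + y)\<bar> powr p) * indicator (ball 0 h) y \<partial>lborel) / ennreal W"
      unfolding W_def by (rule nn_ball_average[OF continuous_shift_power assms]) simp
    finally show "ennreal (\<bar>f x - ball_average h (\<lambda>y. f (x + y))\<bar> powr p)
       \<le> (\<integral>\<^sup>+y. ennreal (\<bar>f x - f (x + y)\<bar> powr p) * indicator (ball 0 h) y \<partial>lborel) / ennreal W" .
  qed
  also have "\<dots> = (\<integral>\<^sup>+x. (\<integral>\<^sup>+y. ennreal (\<bar>f x - f (x + y)\<bar> powr p) * indicator (ball 0 h) y \<partial>lborel) \<partial>lborel) / ennreal W"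
    using measurable_pair_difference[of 0 h]
    by (intro nn_integral_divide lborel.borel_measurable_nn_integral) simp
  also have "(\<integral>\<^sup>+x. (\<integral>\<^sup>+y. ennreal (\<bar>f x - f (x + y)\<bar> powr p) * indicator (ball 0 h) y \<partial>lborel) \<partial>lborel)
     = (\<integral>\<^sup>+y. (\<integral>\<^sup>+x. ennreal (\<bar>f x - f (x + y)\<bar> powr p) * indicator (ball 0 h) y \<partial>lborel) \<partial>lborel)"
    using measurable_pair_difference[of 0 h] by (intro lborel_pair.Fubini') simp
  also have "\<dots> \<le> (\<integral>\<^sup>+y. ennreal (h powr p * G\<^sub>p) * indicator (ball (0::real^'n) h) y \<partial>lborel)"
  proof (rule nn_integral_mono)
    fix y :: "real^'n"
    have "(\<integral>\<^sup>+x. ennreal (\<bar>f x - f (x + y)\<bar> powr p) \<partial>lborel) \<le> ennreal (h powr p * G\<^sub>p)" if "y \<in> ball 0 h"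
    proof -
      have "norm y powr p * G\<^sub>p \<le> h powr p * G\<^sub>p"
        using that p by (intro mult_right_mono powr_mono2) auto
      then show ?thesis using nn_translation[of y] by (meson ennreal_leI order_trans)
    qed
    then show "(\<integral>\<^sup>+x. ennreal (\<bar>f x - f (x + y)\<bar> powr p) * indicator (ball 0 h) y \<partial>lborel)
        \<le> ennreal (h powr p * G\<^sub>p) * indicator (ball 0 h) y"
      by (cases "y \<in> ball 0 h") auto
  qed
  also have "\<dots> = ennreal (h powr p * G\<^sub>p) * ennreal W"
    by (simp add: nn_integral_cmult_indicator emeasure_ball_volume[OF assms] W_def)
  finally have "(\<integral>\<^sup>+x. ennreal (\<bar>f x - ball_average h (\<lambda>y. f (x + y))\<bar> powr p) \<partial>lborel)
     \<le> ennreal (h powr p * G\<^sub>p) * ennreal W / ennreal W"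
    by (simp add: divide_right_mono_ennreal)
  then show ?thesis using W by (simp add: ennreal_mult[symmetric] divide_ennreal)
qed

text \<open>Both averages are compared with each other through all pairs of points at distance less
  than \<open>2 * h\<close>.\<close>

lemma ball_average_halving:
  assumes "0 < h"
  shows "\<bar>ball_average h (\<lambda>y. f (x + y)) - ball_average (h / 2) (\<lambda>y. f (x + y))\<bar> powr p
    \<le> ball_volume TYPE('n) (2 * h) * ((2 * h) powr p * G\<^sub>p) / (ball_volume TYPE('n) h * ball_volume TYPE('n) (h / 2))"
proof -
  have h2: "0 < h / 2" "0 < 2 * h" using assms by auto
  define W W2 W4 where "W = ball_volume TYPE('n) h" and "W2 = ball_volume TYPE('n) (h / 2)"
    and "W4 = ball_volume TYPE('n) (2 * h)"
  have W: "0 < W" "0 < W2" "0 < W4" using ball_volume_pos[where 'n = 'n] assms h2 by (auto simp: W_def W2_def W4_def)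
  define a where "a = ball_average h (\<lambda>y. f (x + y))"
  have "ennreal (\<bar>a - ball_average (h / 2) (\<lambda>y. f (x + y))\<bar> powr p) \<le> ennreal (ball_average (h / 2) (\<lambda>z. \<bar>a - f (x + z)\<bar> powr p))"
    by (intro ennreal_leI ball_average_shift_power h2)
  also have "\<dots> = (\<integral>\<^sup>+z. ennreal (\<bar>a - f (x + z)\<bar> powr p) * indicator (ball 0 (h / 2)) z \<partial>lborel) / ennreal W2"
    unfolding W2_def by (rule nn_ball_average[OF continuous_shift_power h2(1)]) simp
  also have "\<dots> \<le> (\<integral>\<^sup>+z. (\<integral>\<^sup>+w. ennreal (\<bar>f (z + x) - f (z + x + w)\<bar> powr p) * indicator (ball 0 (2 * h)) w \<partial>lborel) / ennreal W \<partial>lborel) / ennreal W2"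
  proof (intro divide_right_mono_ennreal nn_integral_mono)
    fix z :: "real^'n"
    show "ennreal (\<bar>a - f (x + z)\<bar> powr p) * indicator (ball 0 (h / 2)) z
      \<le> (\<integral>\<^sup>+w. ennreal (\<bar>f (z + x) - f (z + x + w)\<bar> powr p) * indicator (ball 0 (2 * h)) w \<partial>lborel) / ennreal W"
    proof (cases "z \<in> ball 0 (h / 2)")
      case True
      have "ennreal (\<bar>f (x + z) - a\<bar> powr p) \<le> ennreal (ball_average h (\<lambda>y. \<bar>f (x + z) - f (x + y)\<bar> powr p))"
        unfolding a_def by (intro ennreal_leI ball_average_shift_power assms)
      also have "\<dots> = (\<integral>\<^sup>+y. ennreal (\<bar>f (x + z) - f (x + y)\<bar> powr p) * indicator (ball 0 h) y \<partial>lborel) / ennreal W"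
        unfolding W_def by (rule nn_ball_average[OF continuous_shift_power assms]) simp
      also have "(\<integral>\<^sup>+y. ennreal (\<bar>f (x + z) - f (x + y)\<bar> powr p) * indicator (ball 0 h) y \<partial>lborel)
         = (\<integral>\<^sup>+w. ennreal (\<bar>f (x + z) - f (x + (w + z))\<bar> powr p) * indicator (ball 0 h) (w + z) \<partial>lborel)"
        by (rule nn_integral_ball_translate[OF borel_measurable_continuous_onI[OF continuous_shift_power]])
      also have "\<dots> / ennreal W \<le> (\<integral>\<^sup>+w. ennreal (\<bar>f (z + x) - f (z + x + w)\<bar> powr p) * indicator (ball 0 (2 * h)) w \<partial>lborel) / ennreal W"
      proof (intro divide_right_mono_ennreal nn_integral_mono)
        fix w :: "real^'n"
        \<comment> \<open>The norm of \<open>w\<close> is less than \<open>h + h / 2\<close>; the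
          radius \<open>2 * h\<close> is a convenient bound for it.\<close>
        have "w + z \<in> ball 0 h \<Longrightarrow> w \<in> ball 0 (2 * h)"
          using True norm_triangle_ineq4[of "w + z" z] assms by simp
        then show "ennreal (\<bar>f (x + z) - f (x + (w + z))\<bar> powr p) * indicator (ball 0 h) (w + z)
          \<le> ennreal (\<bar>f (z + x) - f (z + x + w)\<bar> powr p) * indicator (ball 0 (2 * h)) w"
          by (auto simp: indicator_def ac_simps)
      qed
      finally show ?thesis using True by (simp add: abs_minus_commute)
    qed simp
  qed
  also have "(\<integral>\<^sup>+z. (\<integral>\<^sup>+w. ennreal (\<bar>f (z + x) - f (z + x + w)\<bar> powr p) * indicator (ball 0 (2 * h)) w \<partial>lborel) / ennreal W \<partial>lborel)
     = (\<integral>\<^sup>+z. (\<integral>\<^sup>+w. ennreal (\<bar>f (z + x) - f (z + x + w)\<bar> powr p) * indicator (ball 0 (2 * h)) w \<partial>lborel) \<partial>lborel) / ennreal W"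
    using measurable_pair_difference[of x "2 * h"]
    by (intro nn_integral_divide lborel.borel_measurable_nn_integral) simp
  also have "(\<integral>\<^sup>+z. (\<integral>\<^sup>+w. ennreal (\<bar>f (z + x) - f (z + x + w)\<bar> powr p) * indicator (ball 0 (2 * h)) w \<partial>lborel) \<partial>lborel)
    = (\<integral>\<^sup>+w. (\<integral>\<^sup>+z. ennreal (\<bar>f (z + x) - f (z + x + w)\<bar> powr p) * indicator (ball 0 (2 * h)) w \<partial>lborel) \<partial>lborel)"
    using measurable_pair_difference[of x "2 * h"] by (intro lborel_pair.Fubini') simp
  also have "\<dots> / ennreal W / ennreal W2
      \<le> (\<integral>\<^sup>+w. ennreal ((2 * h) powr p * G\<^sub>p) * indicator (ball (0::real^'n) (2 * h)) w \<partial>lborel) / ennreal W / ennreal W2"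
  proof (intro divide_right_mono_ennreal nn_integral_mono)
    fix w :: "real^'n"
    have "(\<integral>\<^sup>+z. ennreal (\<bar>f (z + x) - f (z + x + w)\<bar> powr p) \<partial>lborel) \<le> ennreal ((2 * h) powr p * G\<^sub>p)" if "w \<in> ball 0 (2 * h)"
    proof -
      have "(\<integral>\<^sup>+z. ennreal (\<bar>f (z + x) - f (z + x + w)\<bar> powr p) \<partial>lborel) = (\<integral>\<^sup>+z. ennreal (\<bar>f z - f (z + w)\<bar> powr p) \<partial>lborel)"
        using nn_integral_lborel_translate[of "\<lambda>z. ennreal (\<bar>f z - f (z + w)\<bar> powr p)" x]
          sbs_measurable(1)[OF f] by (simp add: ac_simps)
      also have "\<dots> \<le> ennreal (norm w powr p * G\<^sub>p)" by (rule nn_translation)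
      also have "\<dots> \<le> ennreal ((2 * h) powr p * G\<^sub>p)"
        using that p by (intro ennreal_leI mult_right_mono powr_mono2) auto
      finally show ?thesis .
    qed
    then show "(\<integral>\<^sup>+z. ennreal (\<bar>f (z + x) - f (z + x + w)\<bar> powr p) * indicator (ball 0 (2 * h)) w \<partial>lborel)
        \<le> ennreal ((2 * h) powr p * G\<^sub>p) * indicator (ball 0 (2 * h)) w"
      by (cases "w \<in> ball 0 (2 * h)") auto
  qed
  also have "(\<integral>\<^sup>+w. ennreal ((2 * h) powr p * G\<^sub>p) * indicator (ball (0::real^'n) (2 * h)) w \<partial>lborel) = ennreal (W4 * ((2 * h) powr p * G\<^sub>p))"
  proof -
    have "(\<integral>\<^sup>+w. ennreal ((2 * h) powr p * G\<^sub>p) * indicator (ball (0::real^'n) (2 * h)) w \<partial>lborel)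
        = ennreal ((2 * h) powr p * G\<^sub>p) * emeasure lborel (ball (0::real^'n) (2 * h))"
      by (rule nn_integral_cmult_indicator) simp
    also have "\<dots> = ennreal ((2 * h) powr p * G\<^sub>p * W4)"
      unfolding emeasure_ball_volume[OF h2(2)] W4_def[symmetric]
      using W by (intro ennreal_mult[symmetric]) auto
    finally show ?thesis by (simp only: mult.commute[of W4])
  qed
  also have "\<dots> / ennreal W / ennreal W2 = ennreal (W4 * ((2 * h) powr p * G\<^sub>p) / (W * W2))"
    using W by (simp add: divide_ennreal)
  finally show ?thesis
    using W by (simp add: a_def W_def[symmetric] W2_def[symmetric] W4_def[symmetric])
qed

end

text \<open>\<open>\<theta>\<close> is the growth rate of averages on the scales
  \<open>2 powr - k\<close>; \<open>\<theta>\<close> times the critical exponent is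
  \<open>N\<close>. \<open>K1\<close> is the root of the constant for halving the radius. In
  \<open>C\<close> the first summand covers radius 1, the second sums the geometric series of the
  halving errors.\<close>

context
  fixes R p :: real and N v \<theta> K1 C :: real
  defines "N \<equiv> real CARD('n::finite)"
  defines "v \<equiv> unit_ball_vol N"
  defines "\<theta> \<equiv> (N - p) / p"
  defines "K1 \<equiv> (2 powr (2 * N + p) / v) powr (1 / p)"
  defines "C \<equiv> ((2 * R + 1) powr p / v) powr (1 / p) + K1 / (2 powr \<theta> - 1)"
  assumes R: "0 \<le> R" and p: "1 < p" "p < N"
begin

lemma dyadic_constants: "0 < v" "0 < \<theta>" "0 < K1" "0 < C" "1 < 2 powr \<theta>"
proof -
  show v: "0 < v" by (simp add: v_def N_def unit_ball_vol_pos)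
  show \<theta>: "0 < \<theta>" using p by (simp add: \<theta>_def)
  show K1: "0 < K1" using v by (simp add: K1_def)
  have "2 powr 0 < 2 powr \<theta>" using \<theta> by (intro powr_less_mono) auto
  then show 2: "1 < 2 powr \<theta>" by simp
  show "0 < C" unfolding C_def using K1 2 by (intro add_nonneg_pos divide_pos_pos) auto
qed

lemma ball_volume_dyadic: "ball_volume TYPE('n) h = v * h powr N"
  by (simp add: ball_volume_def v_def N_def)

lemma halving_constant:
  assumes "0 < h"
  shows "ball_volume TYPE('n) (2 * h) * ((2 * h) powr p * E) / (ball_volume TYPE('n) h * ball_volume TYPE('n) (h / 2))
    = 2 powr (2 * N + p) / v * h powr (p - N) * E"
proof -
  have "(2 * h) powr N = 2 powr N * h powr N" "(2 * h) powr p = 2 powr p * h powr p" "(h / 2) powr N = h powr N / 2 powr N"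
    using assms by (simp_all add: powr_mult powr_divide)
  moreover have "2 powr (2 * N + p) = 2 powr N * 2 powr N * 2 powr p"
    by (simp add: powr_add[symmetric])
  moreover have "h powr (p - N) = h powr p / h powr N" by (simp add: powr_diff)
  moreover have "h powr N \<noteq> 0" "2 powr N \<noteq> 0" "v \<noteq> 0" using assms dyadic_constants by auto
  ultimately show ?thesis by (simp add: ball_volume_dyadic field_simps)
qed

context
  fixes f :: "real^'n \<Rightarrow> real" and E g :: real
  assumes f: "smooth_bounded_support R f"
  defines "E \<equiv> LINT x|lborel. norm (grad f x) powr p"
  defines "g \<equiv> E powr (1 / p)"
begin

lemma E_g: "0 \<le> E" "0 \<le> g" "g powr p = E"
proof -
  show "0 \<le> E" unfolding E_def by simp
  then show "g powr p = E" using p by (simp add: g_def powr_powr)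
  show "0 \<le> g" by (simp add: g_def)
qed

text \<open>Each halving of the radius changes the average by at most
  \<open>K1 * 2 powr (real k * \<theta>) * g\<close>, and \<open>C\<close> is large enough for the
  bound on the next scale to absorb this.\<close>

lemma dyadic_average_bound:
  "\<bar>ball_average (2 powr (- real k)) (\<lambda>y. f (x + y))\<bar> \<le> C * 2 powr (real k * \<theta>) * g"
proof (induction k)
  case 0
  have "\<bar>ball_average 1 (\<lambda>y. f (x + y))\<bar> powr p \<le> (2 * R + 1) powr p * E / v"
    using ball_average_bound[OF f p(1) zero_less_one R, of x] by (simp add: ball_volume_dyadic E_def)
  then have "(\<bar>ball_average 1 (\<lambda>y. f (x + y))\<bar> powr p) powr (1 / p) \<le> ((2 * R + 1) powr p / v * E) powr (1 / p)"
    using p by (intro powr_mono2) auto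
  also have "\<dots> = ((2 * R + 1) powr p / v) powr (1 / p) * g"
    unfolding g_def by (rule powr_mult)
  also have "\<dots> \<le> C * g"
  proof (rule mult_right_mono)
    have "0 \<le> K1 / (2 powr \<theta> - 1)" using less_imp_le[OF dyadic_constants(3)] dyadic_constants(5) by (intro divide_nonneg_nonneg) (simp_all only: diff_ge_0_iff_ge less_imp_le)
    then show "((2 * R + 1) powr p / v) powr (1 / p) \<le> C" by (simp add: C_def)
  qed (rule E_g)
  finally show ?case using p by (simp add: powr_powr)
next
  case (Suc k)
  define h where "h = 2 powr (- real k)"
  have h: "0 < h" by (simp add: h_def)
  have "- real (Suc k) = - real k - 1" by simp
  then have h2: "h / 2 = 2 powr (- real (Suc k))" by (simp only: h_def powr_diff) simp
  have "real k * \<theta> * p = - real k * (p - N)"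
    using p by (simp add: \<theta>_def) (simp add: algebra_simps)
  then have "h powr (p - N) = (2 powr (real k * \<theta>)) powr p"
    unfolding h_def powr_powr by simp
  then have "\<bar>ball_average h (\<lambda>y. f (x + y)) - ball_average (h / 2) (\<lambda>y. f (x + y))\<bar> powr p
      \<le> 2 powr (2 * N + p) / v * (2 powr (real k * \<theta>)) powr p * g powr p"
    using ball_average_halving[OF f p(1) h, of x] halving_constant[OF h, of E] E_g by (simp add: E_def)
  then have "(\<bar>ball_average h (\<lambda>y. f (x + y)) - ball_average (h / 2) (\<lambda>y. f (x + y))\<bar> powr p) powr (1 / p)
      \<le> (2 powr (2 * N + p) / v * (2 powr (real k * \<theta>)) powr p * g powr p) powr (1 / p)"
    using p by (intro powr_mono2) auto
  also have "\<dots> = K1 * ((2 powr (real k * \<theta>)) powr p) powr (1 / p) * (g powr p) powr (1 / p)"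
    by (simp only: powr_mult K1_def)
  also have "\<dots> = K1 * 2 powr (real k * \<theta>) * g"
    using p E_g(2) by (simp add: powr_powr)
  finally have d: "\<bar>ball_average h (\<lambda>y. f (x + y)) - ball_average (h / 2) (\<lambda>y. f (x + y))\<bar> \<le> K1 * 2 powr (real k * \<theta>) * g"
    using p by (simp add: powr_powr)
  \<comment> \<open>The second summand of \<open>C\<close> is made for this: passing from
    \<open>C\<close> to \<open>C * 2 powr \<theta>\<close> gains at least \<open>K1\<close>.\<close>
  have "K1 + C \<le> C * 2 powr \<theta>"
  proof -
    have "K1 = K1 / (2 powr \<theta> - 1) * (2 powr \<theta> - 1)" using dyadic_constants by simp
    also have "\<dots> \<le> C * (2 powr \<theta> - 1)"
      by (rule mult_right_mono) (simp add: C_def, use dyadic_constants(5) in linarith)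
    finally show ?thesis by (simp add: algebra_simps)
  qed
  then have "(K1 + C) * (2 powr (real k * \<theta>) * g) \<le> C * 2 powr \<theta> * (2 powr (real k * \<theta>) * g)"
    using E_g by (intro mult_right_mono) auto
  also have "\<dots> = C * 2 powr (real (Suc k) * \<theta>) * g"
    by (simp add: powr_add distrib_right)
  finally have "(K1 + C) * (2 powr (real k * \<theta>) * g) \<le> C * 2 powr (real (Suc k) * \<theta>) * g" .
  moreover have "\<bar>ball_average (h / 2) (\<lambda>y. f (x + y))\<bar> \<le> (K1 + C) * (2 powr (real k * \<theta>) * g)"
    using d Suc.IH by (simp add: h_def algebra_simps)
  ultimately show ?case unfolding h2[symmetric] by simp
qed

text \<open>Where \<open>\<bar>f\<bar>\<close> exceeds twice the bound for its average on the scale \<open>2 powr - k\<close>, it differs from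
  that average by at least the bound.\<close>

lemma weak_type_estimate:
  assumes "0 < g"
  shows "emeasure lborel {x. 2 * C * 2 powr (real k * \<theta>) * g < \<bar>f x\<bar>} \<le> ennreal (C powr (- p) * 2 powr (- (real k * N)))"
proof -
  define h where "h = 2 powr (- real k)"
  define c where "c = C * 2 powr (real k * \<theta>) * g"
  define S where "S = {x. 2 * c < \<bar>f x\<bar>}"
  have h: "0 < h" by (simp add: h_def)
  have c: "0 < c" using assms dyadic_constants by (simp add: c_def)
  have [measurable]: "f \<in> borel_measurable borel" using sbs_measurable(1)[OF f] .
  have S: "S \<in> sets lborel" unfolding S_def by simp
  have "ennreal (c powr p) * emeasure lborel S = (\<integral>\<^sup>+x. ennreal (c powr p) * indicator S x \<partial>lborel)"
    by (rule nn_integral_cmult_indicator[symmetric, OF S])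
  also have "\<dots> \<le> (\<integral>\<^sup>+x. ennreal (\<bar>f x - ball_average h (\<lambda>y. f (x + y))\<bar> powr p) \<partial>lborel)"
  proof (rule nn_integral_mono)
    fix x
    have "c powr p \<le> \<bar>f x - ball_average h (\<lambda>y. f (x + y))\<bar> powr p" if "x \<in> S"
    proof (rule powr_mono2)
      show "c \<le> \<bar>f x - ball_average h (\<lambda>y. f (x + y))\<bar>"
        using dyadic_average_bound[of k x] that unfolding S_def c_def[symmetric] h_def by simp
    qed (use c p in auto)
    then show "ennreal (c powr p) * indicator S x \<le> ennreal (\<bar>f x - ball_average h (\<lambda>y. f (x + y))\<bar> powr p)"
      by (auto simp: indicator_def intro: ennreal_leI)
  qed
  also have "\<dots> \<le> ennreal (h powr p * E)"
    unfolding E_def by (rule nn_average_difference[OF f p(1) h])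
  also have "h powr p * E = c powr p * (C powr (- p) * 2 powr (- (real k * N)))"
  proof -
    have "c powr p = C powr p * 2 powr (real k * (N - p)) * E"
      using dyadic_constants E_g p by (simp add: c_def powr_mult powr_powr \<theta>_def)
    moreover have "h powr p = 2 powr (- (real k * p))" by (simp add: h_def powr_powr)
    moreover have "2 powr (- (real k * p)) = 2 powr (real k * (N - p)) * 2 powr (- (real k * N))"
      by (simp add: powr_add[symmetric] algebra_simps)
    moreover have "C powr p * C powr (- p) = 1" using dyadic_constants by (simp add: powr_minus)
    ultimately show ?thesis by (simp add: mult_ac)
  qed
  also have "ennreal (c powr p * (C powr (- p) * 2 powr (- (real k * N))))
      = ennreal (c powr p) * ennreal (C powr (- p) * 2 powr (- (real k * N)))"
    by (intro ennreal_mult) auto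
  finally have le: "ennreal (c powr p) * emeasure lborel S \<le> ennreal (c powr p) * ennreal (C powr (- p) * 2 powr (- (real k * N)))" .
  have cp: "0 < c powr p" using c by simp
  have "emeasure lborel S \<le> ennreal (C powr (- p) * 2 powr (- (real k * N)))"
    using le cp by (subst (asm) ennreal_mult_le_mult_iff) auto
  then show ?thesis by (simp add: S_def c_def mult.assoc)
qed

text \<open>The values of \<open>\<bar>f\<bar>\<close> are sorted into dyadic levels. By the
  weak-type estimate the level with index \<open>k\<close> contributes at most a constant times
  \<open>2 powr (\<theta> * s - N)\<close> to the power \<open>k\<close>, and the series converges
  because \<open>s\<close> is below the critical exponent.\<close>

lemma embedding_aux:
  assumes "0 < s" "\<theta> * s < N"
  shows "(LINT x|lborel. \<bar>f x\<bar> powr s) \<le>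
    ((2 * C) powr s * (v * R powr N) + (2 * C * 2 powr \<theta>) powr s * C powr (- p) / (1 - 2 powr (\<theta> * s - N))) * E powr (s / p)"
\<comment> \<open>The levels are proportional to \<open>g\<close>, so a vanishing gradient energy is
  treated apart: the function is then 0 almost everywhere.\<close>
proof (cases "g = 0")
  case True
  then have "E = 0" using E_g(3) p by simp
  then have "(LINT x|lborel. \<bar>f x\<bar> powr p) \<le> 0"
    using Poincare[OF f p(1) R] by (simp add: E_def)
  then have "(LINT x|lborel. \<bar>f x\<bar> powr p) = 0" by (simp add: antisym)
  then have "AE x in lborel. \<bar>f x\<bar> powr p = 0"
    using grad_power_integrable(2)[OF f, of p] p by (subst (asm) integral_nonneg_eq_0_iff_AE) auto
  then have "(LINT x|lborel. \<bar>f x\<bar> powr s) = 0"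
    by (intro integral_eq_zero_AE) (auto elim!: eventually_mono)
  then show ?thesis using True \<open>E = 0\<close> by simp
next
  case False
  then have g: "0 < g" using E_g by simp
  define l where "l = (\<lambda>k. 2 * C * 2 powr (real k * \<theta>) * g)"
  define A where "A = (2 * C * 2 powr \<theta> * g) powr s * C powr (- p)"
  define \<rho> where "\<rho> = 2 powr (\<theta> * s - N)"
  have l: "0 < l k" for k using g dyadic_constants by (simp add: l_def)
  have \<rho>: "0 \<le> \<rho>" "\<rho> < 1"
  proof -
    have "2 powr (\<theta> * s - N) < 2 powr 0" using assms by (intro powr_less_mono) auto
    then show "\<rho> < 1" by (simp add: \<rho>_def)
  qed (simp add: \<rho>_def)
  have [measurable]: "f \<in> borel_measurable borel" using sbs_measurable(1)[OF f] .
  define T where "T = (\<lambda>k. {x. l k < \<bar>f x\<bar>})"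
  have T: "T k \<in> sets lborel" for k unfolding T_def by simp
  \<comment> \<open>Values up to the lowest level are charged to the ball of radius
    \<open>R\<close>. A larger value lies between \<open>l k\<close> and \<open>l (Suc k)\<close>,
    where \<open>Suc k\<close> is the least index of a level that bounds it.\<close>
  have pt: "ennreal (\<bar>f x\<bar> powr s) \<le> ennreal (l 0 powr s) * indicator (cball 0 R) x
      + (\<Sum>k. ennreal (l (Suc k) powr s) * indicator (T k) x)" for x
  proof (cases "\<bar>f x\<bar> \<le> l 0")
    case True
    have "ennreal (\<bar>f x\<bar> powr s) \<le> ennreal (l 0 powr s) * indicator (cball 0 R) x"
    proof (cases "x \<in> cball 0 R")
      case True
      then show ?thesis using \<open>\<bar>f x\<bar> \<le> l 0\<close> assms by (auto intro!: ennreal_leI powr_mono2)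
    next
      case False
      then have "f x = 0" using sbs_outside[OF f, of x] by simp
      then show ?thesis by simp
    qed
    then show ?thesis by (rule order_trans) (rule add_increasing2, auto)
  next
    case False
    have "\<exists>m. \<bar>f x\<bar> \<le> l m"
    proof -
      obtain m where m: "\<bar>f x\<bar> / (2 * C * g) < (2 powr \<theta>) ^ m"
        using real_arch_pow[OF dyadic_constants(5)] by blast
      have "(2 powr \<theta>) ^ m = 2 powr (real m * \<theta>)"
        by (simp add: powr_realpow[symmetric] powr_powr mult.commute)
      then have "\<bar>f x\<bar> \<le> l m" using m g dyadic_constants by (simp add: l_def field_simps)
      then show ?thesis by blast
    qed
    define m where "m = (LEAST m. \<bar>f x\<bar> \<le> l m)"
    have m: "\<bar>f x\<bar> \<le> l m" unfolding m_def using \<open>\<exists>m. \<bar>f x\<bar> \<le> l m\<close> by (rule LeastI_ex)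
    then have "m \<noteq> 0" using False by (metis)
    then obtain k where k: "m = Suc k" using not0_implies_Suc by blast
    then have lk: "l k < \<bar>f x\<bar>" using not_less_Least[of k "\<lambda>m. \<bar>f x\<bar> \<le> l m"] by (simp add: m_def not_le)
    have "ennreal (\<bar>f x\<bar> powr s) \<le> ennreal (l (Suc k) powr s) * indicator (T k) x"
      using lk m k assms by (auto simp: T_def intro!: ennreal_leI powr_mono2)
    also have "\<dots> \<le> (\<Sum>k. ennreal (l (Suc k) powr s) * indicator (T k) x)"
      using sum_le_suminf[OF summableI, of "{k}" "\<lambda>k. ennreal (l (Suc k) powr s) * indicator (T k) x"]
      by (simp only: sum.insert finite.emptyI empty_iff sum.empty not_False_eq_True add_0_right zero_le finite.insertI simp_thms)
    finally show ?thesis by (rule order_trans) (rule add_increasing, auto)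
  qed
  have "(\<integral>\<^sup>+x. ennreal (\<bar>f x\<bar> powr s) \<partial>lborel) \<le> (\<integral>\<^sup>+x. ennreal (l 0 powr s) * indicator (cball 0 R) x
      + (\<Sum>k. ennreal (l (Suc k) powr s) * indicator (T k) x) \<partial>lborel)"
    by (intro nn_integral_mono pt)
  also have "\<dots> = (\<integral>\<^sup>+x. ennreal (l 0 powr s) * indicator (cball (0::real^'n) R) x \<partial>lborel)
      + (\<Sum>k. \<integral>\<^sup>+x. ennreal (l (Suc k) powr s) * indicator (T k) x \<partial>lborel)"
  proof -
    have "(\<lambda>x. ennreal (l 0 powr s) * indicator (cball 0 R) x) \<in> borel_measurable (lborel :: (real^'n) measure)"
      by (intro borel_measurable_times_ennreal borel_measurable_const borel_measurable_indicator) simp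
    moreover have m: "(\<lambda>x. ennreal (l (Suc k) powr s) * indicator (T k) x) \<in> borel_measurable lborel" for k
      by (intro borel_measurable_times_ennreal borel_measurable_const borel_measurable_indicator T)
    moreover have "(\<lambda>x. \<Sum>k. ennreal (l (Suc k) powr s) * indicator (T k) x) \<in> borel_measurable lborel"
      by (intro borel_measurable_suminf_order m)
    ultimately show ?thesis by (simp only: nn_integral_add nn_integral_suminf)
  qed
  also have "\<dots> = ennreal (l 0 powr s) * emeasure lborel (cball (0::real^'n) R)
      + (\<Sum>k. ennreal (l (Suc k) powr s) * emeasure lborel (T k))"
    using T by (simp only: nn_integral_cmult_indicator sets_lborel borel_closed closed_cball)
  also have "\<dots> \<le> ennreal (l 0 powr s * (v * R powr N)) + ennreal (A / (1 - \<rho>))"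
  proof (rule add_mono)
    have "R ^ CARD('n) = R powr N"
      using R by (cases "R = 0") (auto simp: N_def powr_realpow)
    then have "emeasure lborel (cball (0::real^'n) R) = ennreal (v * R powr N)"
      using R by (simp add: emeasure_cball v_def N_def)
    then show "ennreal (l 0 powr s) * emeasure lborel (cball (0::real^'n) R) \<le> ennreal (l 0 powr s * (v * R powr N))"
      using dyadic_constants by (simp add: ennreal_mult)
    have "(\<Sum>k. ennreal (l (Suc k) powr s) * emeasure lborel (T k)) \<le> (\<Sum>k. ennreal (A * \<rho> ^ k))"
    proof (intro suminf_le summableI)
      fix k
      have "ennreal (l (Suc k) powr s) * emeasure lborel (T k)
          \<le> ennreal (l (Suc k) powr s) * ennreal (C powr (- p) * 2 powr (- (real k * N)))"
        unfolding T_def l_def by (intro mult_left_mono weak_type_estimate g) auto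
      also have "\<dots> = ennreal (l (Suc k) powr s * (C powr (- p) * 2 powr (- (real k * N))))"
        by (intro ennreal_mult[symmetric]) auto
      also have "l (Suc k) powr s * (C powr (- p) * 2 powr (- (real k * N))) = A * \<rho> ^ k"
      proof -
        have "l (Suc k) = (2 * C * 2 powr \<theta> * g) * 2 powr (real k * \<theta>)"
          by (simp add: l_def powr_add distrib_right)
        then have "l (Suc k) powr s = (2 * C * 2 powr \<theta> * g) powr s * 2 powr (real k * \<theta> * s)"
          using g dyadic_constants by (simp add: powr_mult powr_powr)
        moreover have "\<rho> ^ k = 2 powr (real k * \<theta> * s) * 2 powr (- (real k * N))"
        proof -
          have "\<rho> ^ k = \<rho> powr real k" by (rule powr_realpow[symmetric]) (simp add: \<rho>_def)
          also have "\<dots> = 2 powr (real k * \<theta> * s - real k * N)"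
            by (simp add: \<rho>_def powr_powr algebra_simps)
          finally show ?thesis by (simp add: powr_diff powr_minus_divide)
        qed
        ultimately show ?thesis by (simp add: A_def)
      qed
      finally show "ennreal (l (Suc k) powr s) * emeasure lborel (T k) \<le> ennreal (A * \<rho> ^ k)" .
    qed
    also have "\<dots> = ennreal (\<Sum>k. A * \<rho> ^ k)"
      using \<rho> by (intro suminf_ennreal2 summable_mult summable_geometric) (auto simp: A_def)
    also have "(\<Sum>k. A * \<rho> ^ k) = A / (1 - \<rho>)"
      using \<rho> by (simp add: suminf_mult summable_geometric suminf_geometric)
    finally show "(\<Sum>k. ennreal (l (Suc k) powr s) * emeasure lborel (T k)) \<le> ennreal (A / (1 - \<rho>))" .
  qed
  also have "\<dots> = ennreal (l 0 powr s * (v * R powr N) + A / (1 - \<rho>))"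
    using \<rho> dyadic_constants by (intro ennreal_plus[symmetric]) (auto simp: A_def)
  finally have le: "(\<integral>\<^sup>+x. ennreal (\<bar>f x\<bar> powr s) \<partial>lborel) \<le> ennreal (l 0 powr s * (v * R powr N) + A / (1 - \<rho>))" .
  have nonneg: "0 \<le> l 0 powr s * (v * R powr N) + A / (1 - \<rho>)"
    using \<rho> dyadic_constants by (auto simp: A_def)
  have "integrable lborel (\<lambda>x. \<bar>f x\<bar> powr s)" by (rule grad_power_integrable(2)[OF f assms(1)])
  then have "(LINT x|lborel. \<bar>f x\<bar> powr s) \<le> l 0 powr s * (v * R powr N) + A / (1 - \<rho>)"
    using le nonneg by (simp add: nn_integral_eq_integral)
  also have "\<dots> = ((2 * C) powr s * (v * R powr N) + (2 * C * 2 powr \<theta>) powr s * C powr (- p) / (1 - 2 powr (\<theta> * s - N))) * g powr s"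
    using dyadic_constants E_g(2) by (simp add: l_def A_def \<rho>_def powr_mult algebra_simps)
  also have "g powr s = E powr (s / p)" by (simp add: g_def powr_powr)
  finally show ?thesis .
qed

end

end

lemma Sobolev_embedding:
  assumes "0 \<le> R" "1 < p" "p < real CARD('n::finite)" "0 < s" "s < sobolev_exponent CARD('n) p"
  shows "\<exists>K>0. \<forall>f :: real^'n \<Rightarrow> real. smooth_bounded_support R f \<longrightarrow>
    (LINT x|lborel. \<bar>f x\<bar> powr s) \<le> K * (LINT x|lborel. norm (grad f x) powr p) powr (s / p)"
proof -
  have "(real CARD('n) - p) / p * s < real CARD('n)"
    using assms by (simp add: sobolev_exponent_def field_simps)
  from embedding_aux[OF assms(1-3) _ assms(4) this]
  obtain K where K: "\<And>f :: real^'n \<Rightarrow> real. smooth_bounded_support R f \<Longrightarrow>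
    (LINT x|lborel. \<bar>f x\<bar> powr s) \<le> K * (LINT x|lborel. norm (grad f x) powr p) powr (s / p)"
    by blast
  have "(LINT x|lborel. \<bar>f x\<bar> powr s) \<le> max K 1 * (LINT x|lborel. norm (grad f x) powr p) powr (s / p)"
    if "smooth_bounded_support R f" for f :: "real^'n \<Rightarrow> real"
    by (rule order_trans[OF K[OF that]]) (intro mult_right_mono, auto)
  then show ?thesis by (intro exI[of _ "max K 1"]) auto
qed

section \<open>Compactness\<close>

lemma powr_add3_le:
  fixes x y z p :: real
  assumes "0 < p" "0 \<le> x" "0 \<le> y" "0 \<le> z"
  shows "(x + y + z) powr p \<le> 3 powr p * (x powr p + y powr p + z powr p)"
proof -
  define m where "m = max x (max y z)"
  have "(x + y + z) powr p \<le> (3 * m) powr p"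
    using assms by (intro powr_mono2) (auto simp: m_def)
  also have "\<dots> = 3 powr p * m powr p" by (rule powr_mult)
  also have "m powr p \<le> x powr p + y powr p + z powr p"
    by (auto simp: m_def max_def)
  finally show ?thesis by simp
qed

lemma sbs_power_difference_integrable:
  assumes "smooth_bounded_support R f" "smooth_bounded_support R g" "0 < s"
  shows "integrable lborel (\<lambda>x. \<bar>f x - g x\<bar> powr s)"
proof (rule continuous_compact_support(1)[where R = R])
  show "continuous_on UNIV (\<lambda>x. \<bar>f x - g x\<bar> powr s)"
    using assms by (intro continuous_on_powr' continuous_on_rabs continuous_on_diff
        sbs_continuous[OF assms(1)] sbs_continuous[OF assms(2)] continuous_on_const) auto
  show "\<bar>f x - g x\<bar> powr s = 0" if "R < norm x" for x
    using that sbs_outside[OF assms(1)] sbs_outside[OF assms(2)] by simp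
qed

text \<open>The averages of \<open>f k\<close> on a fixed small scale are uniformly bounded and Lipschitz.\<close>

lemma close_subsequence:
  fixes f :: "nat \<Rightarrow> real^'n::finite \<Rightarrow> real"
  assumes R: "0 \<le> R" and p: "1 < p" and f: "\<And>k. smooth_bounded_support R (f k)"
    and L: "\<And>k. (LINT x|lborel. norm (grad (f k) x) powr p) \<le> L" and e: "0 < e"
  shows "\<exists>r. strict_mono (r :: nat \<Rightarrow> nat) \<and> (\<forall>k l. (LINT x|lborel. \<bar>f (r k) x - f (r l) x\<bar> powr p) \<le> e)"
proof -
  \<comment> \<open>Three errors are added: two between function and average, one between the
    averages. The constant \<open>3 powr p\<close> is that of \<open>powr_add3_le\<close>.\<close>
  define E where "E = e / 3 powr p / 3"
  have E: "0 < E" using e by (simp add: E_def)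
  \<comment> \<open>On this scale averaging costs at most \<open>E\<close> for every member of the
    sequence, because \<open>h powr p * L \<le> E\<close>.\<close>
  define h where "h = (E / (\<bar>L\<bar> + 1)) powr (1 / p)"
  have h: "0 < h" using E by (simp add: h_def)
  have hL: "h powr p * L \<le> E"
  proof -
    have "h powr p = E / (\<bar>L\<bar> + 1)" using E p by (simp add: h_def powr_powr)
    then have "h powr p * (\<bar>L\<bar> + 1) = E" by simp
    moreover have "h powr p * L \<le> h powr p * (\<bar>L\<bar> + 1)" by (intro mult_left_mono) auto
    ultimately show ?thesis by simp
  qed
  define W where "W = ball_volume TYPE('n) h"
  have W: "0 < W" unfolding W_def by (rule ball_volume_pos[OF h])
  define a where "a = (\<lambda>k x. ball_average h (\<lambda>y. f k (x + y)))"
  have L0: "0 \<le> L" using order_trans[OF _ L] by simp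
  have root: "x \<le> y powr (1 / p)" if "x powr p \<le> y" "0 \<le> x" for x y
  proof -
    have "(x powr p) powr (1 / p) \<le> y powr (1 / p)" using that p by (intro powr_mono2) auto
    then show ?thesis using that p by (simp add: powr_powr)
  qed
  have bound: "norm (a k x) \<le> ((2 * R + 1) powr p * L / W) powr (1 / p)" for k x
  proof (rule root)
    have "\<bar>a k x\<bar> powr p \<le> (2 * R + 1) powr p * (LINT x|lborel. norm (grad (f k) x) powr p) / W"
      unfolding a_def W_def by (rule ball_average_bound[OF f p h R])
    also have "\<dots> \<le> (2 * R + 1) powr p * L / W"
      using W L by (intro divide_right_mono mult_left_mono) auto
    finally show "norm (a k x) powr p \<le> (2 * R + 1) powr p * L / W" by simp
  qed simp
  define B where "B = (L / W) powr (1 / p)"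
  have lip: "norm (a k x - a k y) \<le> norm (x - y) * B" for k x y
  proof -
    have "\<bar>a k x - a k y\<bar> powr p \<le> norm (x - y) powr p * (LINT x|lborel. norm (grad (f k) x) powr p) / W"
      unfolding a_def W_def by (rule ball_average_Lipschitz[OF f p h])
    also have "\<dots> \<le> norm (x - y) powr p * L / W"
      using W L by (intro divide_right_mono mult_left_mono) auto
    finally have "\<bar>a k x - a k y\<bar> \<le> (norm (x - y) powr p * L / W) powr (1 / p)"
      by (intro root) auto
    also have "\<dots> = (norm (x - y) powr p * (L / W)) powr (1 / p)" by simp
    also have "\<dots> = (norm (x - y) powr p) powr (1 / p) * B" unfolding B_def by (rule powr_mult)
    also have "\<dots> = norm (x - y) * B" using p by (simp add: powr_powr)
    finally show ?thesis by simp
  qed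
  have B: "0 \<le> B" by (simp add: B_def)
  obtain g k where k: "strict_mono (k :: nat \<Rightarrow> nat)"
    "\<And>e. 0 < e \<Longrightarrow> \<exists>N. \<forall>n x. n \<ge> N \<and> x \<in> cball 0 R \<longrightarrow> norm (a (k n) x - g x) < e"
  proof (rule Arzela_Ascoli[of "cball (0::real^'n) R" a "((2 * R + 1) powr p * L / W) powr (1 / p)"])
    show "compact (cball (0::real^'n) R)" by simp
    show "norm (a n x) \<le> ((2 * R + 1) powr p * L / W) powr (1 / p)" for n x by (rule bound)
    show "\<exists>d>0. \<forall>n y. y \<in> cball 0 R \<and> norm (x - y) < d \<longrightarrow> norm (a n x - a n y) < \<epsilon>" if "0 < \<epsilon>" for x \<epsilon>
    proof (intro exI[of _ "\<epsilon> / (B + 1)"] conjI allI impI)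
      show "0 < \<epsilon> / (B + 1)" using that B by simp
      fix n y assume y: "y \<in> cball 0 R \<and> norm (x - y) < \<epsilon> / (B + 1)"
      have "norm (a n x - a n y) \<le> norm (x - y) * B" by (rule lip)
      also have "\<dots> \<le> norm (x - y) * (B + 1)" by (intro mult_left_mono) auto
      also have "\<dots> < \<epsilon>" using y B by (simp add: pos_less_divide_eq)
      finally show "norm (a n x - a n y) < \<epsilon>" .
    qed
  qed (use that in blast)
  define vol where "vol = measure lborel (cball (0::real^'n) R)"
  \<comment> \<open>Uniform closeness \<open>\<eta>\<close> of the averages on the ball costs at
    most \<open>E\<close> after integration; adding 1 keeps the denominator positive.\<close>
  define \<eta> where "\<eta> = (E / (vol + 1)) powr (1 / p)"
  have \<eta>: "0 < \<eta>" "\<eta> powr p * vol \<le> E"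
  proof -
    have vol: "0 \<le> vol" by (simp add: vol_def)
    then show "0 < \<eta>" using E by (simp add: \<eta>_def add_nonneg_pos)
    have "\<eta> powr p = E / (vol + 1)" using E p vol by (simp add: \<eta>_def powr_powr)
    then have "\<eta> powr p * (vol + 1) = E" using vol by simp
    moreover have "\<eta> powr p * vol \<le> \<eta> powr p * (vol + 1)" by (intro mult_left_mono) auto
    ultimately show "\<eta> powr p * vol \<le> E" by simp
  qed
  obtain N where N: "\<And>n x. n \<ge> N \<Longrightarrow> x \<in> cball 0 R \<Longrightarrow> norm (a (k n) x - g x) < \<eta> / 2"
    using k(2)[of "\<eta> / 2"] \<eta>(1) by auto
  define r where "r = (\<lambda>j. k (j + N))"
  have r: "strict_mono r" using k(1) by (simp add: r_def strict_mono_def)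
  have close: "\<bar>a (r i) x - a (r j) x\<bar> \<le> \<eta>" if "x \<in> cball 0 R" for i j x
    using N[of "i + N" x, OF _ that] N[of "j + N" x, OF _ that] unfolding r_def real_norm_def
    by linarith
  have nn: "(\<integral>\<^sup>+x. ennreal (\<bar>f (r i) x - f (r j) x\<bar> powr p) \<partial>lborel) \<le> ennreal e" for i j
  proof -
    have meas: "(\<lambda>x. \<bar>f (r i) x - a (r i) x\<bar> powr p) \<in> borel_measurable borel" for i
      unfolding a_def using p
      by (intro borel_measurable_continuous_onI continuous_on_powr' continuous_on_rabs continuous_on_diff
          sbs_continuous[OF f] continuous_ball_average[OF f p h] continuous_on_const) auto
    have "(\<integral>\<^sup>+x. ennreal (\<bar>f (r i) x - f (r j) x\<bar> powr p) \<partial>lborel)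
      \<le> (\<integral>\<^sup>+x. ennreal (3 powr p) * (ennreal (\<bar>f (r i) x - a (r i) x\<bar> powr p) + ennreal (\<eta> powr p) * indicator (cball 0 R) x
         + ennreal (\<bar>f (r j) x - a (r j) x\<bar> powr p)) \<partial>lborel)"
    proof (rule nn_integral_mono)
      fix x
      show "ennreal (\<bar>f (r i) x - f (r j) x\<bar> powr p) \<le> ennreal (3 powr p) * (ennreal (\<bar>f (r i) x - a (r i) x\<bar> powr p)
         + ennreal (\<eta> powr p) * indicator (cball 0 R) x + ennreal (\<bar>f (r j) x - a (r j) x\<bar> powr p))"
      proof (cases "x \<in> cball 0 R")
        case True
        have "\<bar>f (r i) x - f (r j) x\<bar> powr p \<le> (\<bar>f (r i) x - a (r i) x\<bar> + \<eta> + \<bar>f (r j) x - a (r j) x\<bar>) powr p"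
          using close[OF True, of i j] p by (intro powr_mono2) auto
        also have "\<dots> \<le> 3 powr p * (\<bar>f (r i) x - a (r i) x\<bar> powr p + \<eta> powr p + \<bar>f (r j) x - a (r j) x\<bar> powr p)"
          using p \<eta>(1) by (intro powr_add3_le) auto
        finally show ?thesis using True
          by (simp add: ennreal_mult[symmetric] ennreal_plus[symmetric] ennreal_leI del: ennreal_plus)
      next
        case False
        then have "f (r i) x = 0" "f (r j) x = 0" using sbs_outside[OF f, of x] by auto
        then show ?thesis by simp
      qed
    qed
    also have "\<dots> = ennreal (3 powr p) * ((\<integral>\<^sup>+x. ennreal (\<bar>f (r i) x - a (r i) x\<bar> powr p) \<partial>lborel)
        + ennreal (\<eta> powr p) * emeasure lborel (cball (0::real^'n) R)
        + (\<integral>\<^sup>+x. ennreal (\<bar>f (r j) x - a (r j) x\<bar> powr p) \<partial>lborel))"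
    proof -
      define u where "u = (\<lambda>i x. ennreal (\<bar>f (r i) x - a (r i) x\<bar> powr p))"
      define w where "w = (\<lambda>x::real^'n. ennreal (\<eta> powr p) * indicator (cball 0 R) x)"
      have u [measurable]: "\<And>i. u i \<in> borel_measurable lborel" using meas by (simp add: u_def)
      have w [measurable]: "w \<in> borel_measurable lborel"
        unfolding w_def by (intro borel_measurable_times_ennreal borel_measurable_const borel_measurable_indicator) simp
      have uw: "(\<lambda>x. u i x + w x) \<in> borel_measurable lborel" by measurable
      then have uwu: "(\<lambda>x. u i x + w x + u j x) \<in> borel_measurable lborel" using u by measurable
      have "(\<integral>\<^sup>+x. w x \<partial>lborel) = ennreal (\<eta> powr p) * emeasure lborel (cball (0::real^'n) R)"
        unfolding w_def by (rule nn_integral_cmult_indicator) simp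
      then have "(\<integral>\<^sup>+x. ennreal (3 powr p) * (u i x + w x + u j x) \<partial>lborel)
          = ennreal (3 powr p) * ((\<integral>\<^sup>+x. u i x \<partial>lborel) + ennreal (\<eta> powr p) * emeasure lborel (cball (0::real^'n) R) + (\<integral>\<^sup>+x. u j x \<partial>lborel))"
        by (simp only: nn_integral_cmult[OF uwu] nn_integral_add[OF uw u] nn_integral_add[OF u w])
      then show ?thesis unfolding u_def w_def .
    qed
    also have "\<dots> \<le> ennreal (3 powr p) * (ennreal E + ennreal E + ennreal E)"
    proof (intro mult_left_mono add_mono)
      have avg: "(\<integral>\<^sup>+x. ennreal (\<bar>f (r i) x - a (r i) x\<bar> powr p) \<partial>lborel) \<le> ennreal E" for i
      proof -
        have "(\<integral>\<^sup>+x. ennreal (\<bar>f (r i) x - a (r i) x\<bar> powr p) \<partial>lborel)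
            \<le> ennreal (h powr p * (LINT x|lborel. norm (grad (f (r i)) x) powr p))"
          unfolding a_def by (rule nn_average_difference[OF f p h])
        also have "\<dots> \<le> ennreal E"
          using L[of "r i"] by (intro ennreal_leI order_trans[OF _ hL] mult_left_mono) auto
        finally show ?thesis .
      qed
      show "(\<integral>\<^sup>+x. ennreal (\<bar>f (r i) x - a (r i) x\<bar> powr p) \<partial>lborel) \<le> ennreal E"
        "(\<integral>\<^sup>+x. ennreal (\<bar>f (r j) x - a (r j) x\<bar> powr p) \<partial>lborel) \<le> ennreal E" by (rule avg)+
      have "emeasure lborel (cball (0::real^'n) R) = ennreal vol"
        unfolding vol_def using emeasure_bounded_finite[OF bounded_cball, of "0::real^'n" R]
        by (intro emeasure_eq_ennreal_measure) auto
      then have "ennreal (\<eta> powr p) * emeasure lborel (cball (0::real^'n) R) = ennreal (\<eta> powr p * vol)"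
        by (simp add: ennreal_mult vol_def)
      also have "\<dots> \<le> ennreal E" using \<eta>(2) by (rule ennreal_leI)
      finally show "ennreal (\<eta> powr p) * emeasure lborel (cball (0::real^'n) R) \<le> ennreal E" .
    qed simp
    also have "\<dots> = ennreal (3 powr p * (E + E + E))"
      using E by (simp add: ennreal_mult[symmetric] ennreal_plus[symmetric] del: ennreal_plus)
    also have "3 powr p * (E + E + E) = e" by (simp add: E_def)
    finally show ?thesis .
  qed
  have "(LINT x|lborel. \<bar>f (r i) x - f (r j) x\<bar> powr p) \<le> e" for i j
    using nn[of i j] e p sbs_power_difference_integrable[OF f f, of p "r i" "r j"]
    by (simp add: nn_integral_eq_integral)
  then show ?thesis using r by blast
qed

text \<open>\<open>close_subsequence\<close> reaches one fixed accuracy; the diagonal sequence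
  reaches the accuracies \<open>1 / real (Suc n)\<close> one after the other.\<close>

lemma Cauchy_subsequence:
  fixes f :: "nat \<Rightarrow> real^'n::finite \<Rightarrow> real"
  assumes "0 \<le> R" "1 < p" "\<And>k. smooth_bounded_support R (f k)"
    and "\<And>k. (LINT x|lborel. norm (grad (f k) x) powr p) \<le> L"
  obtains r where "strict_mono (r :: nat \<Rightarrow> nat)"
    "\<And>e. 0 < e \<Longrightarrow> \<exists>N. \<forall>k\<ge>N. \<forall>l\<ge>N. (LINT x|lborel. \<bar>f (r k) x - f (r l) x\<bar> powr p) \<le> e"
proof -
  define P where "P = (\<lambda>n (s :: nat \<Rightarrow> nat). \<forall>k l. (LINT x|lborel. \<bar>f (s k) x - f (s l) x\<bar> powr p) \<le> 1 / real (Suc n))"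
  interpret subseqs P
  proof
    fix n and s :: "nat \<Rightarrow> nat" assume "strict_mono s"
    show "\<exists>r'. strict_mono r' \<and> P n (s \<circ> r')"
      using close_subsequence[OF assms(1,2), of "\<lambda>k. f (s k)" L "1 / real (Suc n)"] assms(3,4)
      by (simp add: P_def)
  qed
  \<comment> \<open>From index \<open>Suc n\<close> on, the diagonal sequence is a subsequence of
    the one extracted for accuracy \<open>n\<close>.\<close>
  have P: "P n (diagseq \<circ> ((+) (Suc n)))" for n
    by (rule diagseq_holds) (simp add: P_def)
  have "\<exists>N. \<forall>k\<ge>N. \<forall>l\<ge>N. (LINT x|lborel. \<bar>f (diagseq k) x - f (diagseq l) x\<bar> powr p) \<le> e" if e: "0 < e" for e
  proof -
    obtain n where n: "1 / real (Suc n) < e" using e nat_approx_posE by metis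
    have "(LINT x|lborel. \<bar>f (diagseq k) x - f (diagseq l) x\<bar> powr p) \<le> e" if "k \<ge> Suc n" "l \<ge> Suc n" for k l
    proof -
      have "(LINT x|lborel. \<bar>f (diagseq (Suc n + (k - Suc n))) x - f (diagseq (Suc n + (l - Suc n))) x\<bar> powr p) \<le> 1 / real (Suc n)"
        using P[of n] unfolding P_def o_def by blast
      then show ?thesis using that n by simp
    qed
    then show ?thesis by blast
  qed
  then show ?thesis using that subseq_diagseq by blast
qed

section \<open>The fundamental lemma of the calculus of variations\<close>

lemma enn2real_inject: "a \<noteq> \<infinity> \<Longrightarrow> b \<noteq> \<infinity> \<Longrightarrow> enn2real a = enn2real b \<Longrightarrow> a = b"
  by (metis ennreal_enn2real infinity_ennreal_def less_top)

text \<open>The positive and the negative part of \<open>F\<close> are densities of two measures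
  that agree on boxes. Boxes generate the Borel sets and are closed under intersection, so the
  measures, and with them the densities, coincide.\<close>

lemma lborel_zero_box_integrals:
  fixes F :: "'a::euclidean_space \<Rightarrow> real"
  assumes F: "integrable lborel F" and zero: "\<And>a b. (LINT x|lborel. indicator (box a b) x * F x) = 0"
  shows "AE x in lborel. F x = 0"
proof -
  have [measurable]: "F \<in> borel_measurable borel" using borel_measurable_integrable[OF F] by simp
  define P where "P = (\<lambda>x. ennreal (F x))"
  define Q where "Q = (\<lambda>x. ennreal (- F x))"
  have [measurable]: "P \<in> borel_measurable borel" "Q \<in> borel_measurable borel" by (simp_all add: P_def Q_def)
  have eq: "emeasure (density lborel P) (box a b) = emeasure (density lborel Q) (box a b)
      \<and> emeasure (density lborel P) (box a b) \<noteq> \<infinity>" for a b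
  proof -
    let ?g = "\<lambda>x. indicator (box a b) x * F x"
    have int: "integrable lborel ?g" using integrable_mult_indicator[OF _ F, of "box a b"] by simp
    have "P x * indicator (box a b) x = ennreal (?g x)" "Q x * indicator (box a b) x = ennreal (- ?g x)" for x
      by (cases "x \<in> box a b"; simp add: P_def Q_def)+
    moreover have "P \<in> borel_measurable lborel" "Q \<in> borel_measurable lborel" "box a b \<in> sets lborel" by simp_all
    ultimately have P: "emeasure (density lborel P) (box a b) = (\<integral>\<^sup>+x. ennreal (?g x) \<partial>lborel)"
      and Q: "emeasure (density lborel Q) (box a b) = (\<integral>\<^sup>+x. ennreal (- ?g x) \<partial>lborel)"
      by (simp_all only: emeasure_density)
    have fin: "(\<integral>\<^sup>+x. ennreal (?g x) \<partial>lborel) \<noteq> \<infinity>" "(\<integral>\<^sup>+x. ennreal (- ?g x) \<partial>lborel) \<noteq> \<infinity>"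
      using int unfolding real_integrable_def by blast+
    have "enn2real (\<integral>\<^sup>+x. ennreal (?g x) \<partial>lborel) = enn2real (\<integral>\<^sup>+x. ennreal (- ?g x) \<partial>lborel)"
      using real_lebesgue_integral_def[OF int] zero[of a b] by simp
    then have "(\<integral>\<^sup>+x. ennreal (?g x) \<partial>lborel) = (\<integral>\<^sup>+x. ennreal (- ?g x) \<partial>lborel)"
      by (rule enn2real_inject[OF fin])
    then show ?thesis unfolding P Q using fin by blast
  qed
  have "density lborel P = density lborel Q"
  proof (rule measure_eqI_generator_eq)
    let ?E = "range (\<lambda>(a, b). box a b :: 'a set)"
    show "Int_stable ?E" by (auto simp: Int_stable_def box_Int_box)
    show "?E \<subseteq> Pow UNIV" "sets (density lborel P) = sigma_sets UNIV ?E" "sets (density lborel Q) = sigma_sets UNIV ?E"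
      by (simp_all add: borel_eq_box)
    let ?A = "\<lambda>n::nat. box (- (real n *\<^sub>R One)) (real n *\<^sub>R One) :: 'a set"
    show "range ?A \<subseteq> ?E" "(\<Union>i. ?A i) = UNIV"
      unfolding UN_box_eq_UNIV by auto
    show "emeasure (density lborel P) (?A i) \<noteq> \<infinity>" for i using eq by blast
    show "emeasure (density lborel P) X = emeasure (density lborel Q) X" if "X \<in> ?E" for X
      using that eq by auto
  qed
  then have "AE x in lborel. P x = Q x"
    by (intro sigma_finite_measure.density_unique[OF sigma_finite_lborel]) auto
  then show ?thesis
  proof eventually_elim
    case (elim x)
    show ?case
    proof (rule ccontr)
      assume "F x \<noteq> 0"
      then consider "0 < F x" | "0 < - F x" by linarith
      then show False using elim by cases (auto simp: P_def Q_def ennreal_neg)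
    qed
  qed
qed

lemma lebesgue_zero_box_integrals:
  fixes F :: "'a::euclidean_space \<Rightarrow> real"
  assumes F: "integrable lebesgue F" and zero: "\<And>a b. (LINT x|lebesgue. indicator (box a b) x * F x) = 0"
  shows "AE x in lebesgue. F x = 0"
proof -
  obtain F' where F': "F' \<in> borel_measurable lborel" "AE x in lborel. F x = F' x"
    using completion_ex_borel_measurable_real[of F lborel] borel_measurable_integrable[OF F] by blast
  have ae: "AE x in lebesgue. F x = F' x" using F'(2) by (rule AE_completion)
  have F'c: "F' \<in> borel_measurable lebesgue" using F'(1) by (rule measurable_completion)
  have "integrable lebesgue F'"
    using F integrable_cong_AE[OF borel_measurable_integrable[OF F] F'c ae] by simp
  then have int: "integrable lborel F'" using integrable_completion[OF F'(1)] by simp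
  have "(LINT x|lborel. indicator (box a b) x * F' x) = 0" for a b :: 'a
  proof -
    have m: "(\<lambda>x. indicator (box a b) x * F' x) \<in> borel_measurable lborel" using F'(1) by simp
    have "(LINT x|lborel. indicator (box a b) x * F' x) = (LINT x|lebesgue. indicator (box a b) x * F' x)"
      by (rule integral_completion[OF m, symmetric])
    also have "\<dots> = (LINT x|lebesgue. indicator (box a b) x * F x)"
    proof (rule integral_cong_AE)
      show "(\<lambda>x. indicator (box a b) x * F' x) \<in> borel_measurable lebesgue" using m by (rule measurable_completion)
      show "(\<lambda>x. indicator (box a b) x * F x) \<in> borel_measurable lebesgue"
        by (intro borel_measurable_times borel_measurable_indicator borel_measurable_integrable[OF F]) auto
    qed (use ae in \<open>auto elim!: eventually_mono\<close>)
    finally show ?thesis using zero by simp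
  qed
  from lborel_zero_box_integrals[OF int this] have "AE x in lborel. F x = 0"
    using F'(2) by eventually_elim simp
  then show ?thesis by (rule AE_completion)
qed

section \<open>Smooth bumps on boxes\<close>

lemma flat_exp_bounds: "0 \<le> flat_exp t" "flat_exp t \<le> 1" "0 < flat_exp t \<longleftrightarrow> 0 < t"
  by (auto simp: flat_exp_def)

lemma flat_exp_tendsto: "0 < t \<Longrightarrow> (\<lambda>k. flat_exp (real (Suc k) * t)) \<longlonglongrightarrow> 1"
proof -
  assume t: "0 < t"
  have "(\<lambda>k. exp (- ((1 / real (Suc k)) * (1 / t)))) \<longlonglongrightarrow> exp (- (0 * (1 / t)))"
    by (intro tendsto_intros LIMSEQ_Suc[OF lim_1_over_n])
  then show ?thesis using t by (simp add: flat_exp_def)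
qed

text \<open>For every \<open>k\<close> positive exactly on the open box. Since
  \<open>flat_exp\<close> tends to 1 at infinity, the bumps tend to the indicator of the box as
  \<open>k\<close> grows.\<close>

definition box_bump :: "real^'n::finite \<Rightarrow> real^'n \<Rightarrow> nat \<Rightarrow> real^'n \<Rightarrow> real" where
  "box_bump a b k x =
     (\<Prod>i\<in>UNIV. flat_exp (real (Suc k) * (x $ i - a $ i)) * flat_exp (real (Suc k) * (b $ i - x $ i)))"

lemma smooth_box_bump: "smooth (box_bump a b k)"
  unfolding box_bump_def
  by (intro smooth_prod smooth_mult smooth_flat_exp smooth_diff smooth_const smooth_coord) auto

lemma box_bump_bounds: "0 \<le> box_bump a b k x" "box_bump a b k x \<le> 1"
  unfolding box_bump_def by (auto intro!: prod_nonneg prod_le_1 mult_nonneg_nonneg mult_le_one simp: flat_exp_bounds)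

lemma box_bump_pos: "0 < box_bump a b k x \<longleftrightarrow> x \<in> box a b"
proof
  assume "x \<in> box a b"
  then show "0 < box_bump a b k x" unfolding box_bump_def
    by (intro prod_pos mult_pos_pos) (auto simp: flat_exp_bounds mem_box_cart)
next
  assume *: "0 < box_bump a b k x"
  have "flat_exp (real (Suc k) * (x $ i - a $ i)) * flat_exp (real (Suc k) * (b $ i - x $ i)) \<noteq> 0" for i
  proof
    assume "flat_exp (real (Suc k) * (x $ i - a $ i)) * flat_exp (real (Suc k) * (b $ i - x $ i)) = 0"
    then have "box_bump a b k x = 0" unfolding box_bump_def by (intro prod_zero) auto
    with * show False by simp
  qed
  then have "0 < flat_exp (real (Suc k) * (x $ i - a $ i)) \<and> 0 < flat_exp (real (Suc k) * (b $ i - x $ i))" for i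
    by (metis flat_exp_bounds(1) less_eq_real_def mult_zero_left mult_zero_right)
  then show "x \<in> box a b" by (simp add: flat_exp_bounds mem_box_cart zero_less_mult_iff)
qed

lemma box_bump_tendsto: "(\<lambda>k. box_bump a b k x) \<longlonglongrightarrow> indicator (box a b) x"
proof (cases "x \<in> box a b")
  case True
  then have "(\<lambda>k. box_bump a b k x) \<longlonglongrightarrow> (\<Prod>i\<in>(UNIV :: 'a set). 1 * 1)"
    unfolding box_bump_def by (intro tendsto_prod tendsto_mult flat_exp_tendsto) (auto simp: mem_box_cart)
  then show ?thesis using True by simp
next
  case False
  then have "box_bump a b k x = 0" for k using box_bump_pos box_bump_bounds(1) by (metis less_eq_real_def)
  then show ?thesis using False by simp
qed

lemma test_function_box_bump:
  assumes "cbox a b \<subseteq> \<Omega>"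
  shows "test_function \<Omega> (box_bump a b k)"
proof -
  have "{x. box_bump a b k x \<noteq> 0} \<subseteq> cbox a b"
    using box_bump_pos box_bump_bounds(1) box_subset_cbox by (smt (verit) mem_Collect_eq subset_iff)
  then have "closure {x. box_bump a b k x \<noteq> 0} \<subseteq> cbox a b" by (rule closure_minimal) (rule closed_cbox)
  moreover from this have "compact (closure {x. box_bump a b k x \<noteq> 0})"
    by (intro closed_subset_compact[OF compact_cbox closed_closure])
  ultimately show ?thesis using assms smooth_box_bump unfolding test_function_def by blast
qed

lemma smooth_lebesgue_measurable: "smooth f \<Longrightarrow> f \<in> borel_measurable lebesgue"
  by (intro measurable_completion) (simp add: borel_measurable_continuous_onI smooth_continuous_on)

lemma locally_integrable_compact:
  fixes f :: "real^'n::finite \<Rightarrow> 'b::euclidean_space"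
  assumes "locally_integrable \<Omega> f" "compact K" "K \<subseteq> \<Omega>"
  shows "integrable lebesgue (\<lambda>x. indicator K x *\<^sub>R f x)"
proof -
  have "integrable (lebesgue_on K) f" using assms by (auto simp: locally_integrable_def)
  moreover have "K \<inter> space lebesgue \<in> sets lebesgue"
    using compact_imp_closed[OF assms(2)] by simp
  ultimately show ?thesis by (simp add: integrable_restrict_space)
qed

text \<open>Bumps turn the hypothesis into vanishing integrals over all boxes inside the domain; a
  countable cover of the domain by closed boxes then reduces the claim to
  \<open>lebesgue_zero_box_integrals\<close>.\<close>

lemma test_integrals_zero_imp_AE_zero:
  fixes f :: "real^'n::finite \<Rightarrow> real"
  assumes \<Omega>: "open \<Omega>" and f: "locally_integrable \<Omega> f"
    and zero: "\<And>\<phi>. test_function \<Omega> \<phi> \<Longrightarrow> (LINT x|lebesgue_on \<Omega>. f x * \<phi> x) = 0"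
  shows "AE x in lebesgue_on \<Omega>. f x = 0"
proof -
  have \<Omega>s: "\<Omega> \<inter> space lebesgue \<in> sets lebesgue" using \<Omega> by auto
  have box0: "(LINT x|lebesgue. indicator (box a b) x * f x) = 0" if ab: "cbox a b \<subseteq> \<Omega>" for a b
  proof -
    have int: "integrable lebesgue (\<lambda>x. indicator (cbox a b) x *\<^sub>R f x)"
      by (rule locally_integrable_compact[OF f compact_cbox ab])
    let ?s = "\<lambda>k x. indicator (cbox a b) x * f x * box_bump a b k x"
    have "(\<lambda>k. LINT x|lebesgue. ?s k x) \<longlonglongrightarrow> (LINT x|lebesgue. indicator (box a b) x * f x)"
    proof (rule integral_dominated_convergence)
      have m: "(\<lambda>x. indicator (cbox a b) x * f x) \<in> borel_measurable lebesgue"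
        using borel_measurable_integrable[OF int] by simp
      show "?s k \<in> borel_measurable lebesgue" for k
        by (intro borel_measurable_times m smooth_lebesgue_measurable smooth_box_bump)
      have "(\<lambda>x. indicator (box a b) x * (indicator (cbox a b) x * f x)) \<in> borel_measurable lebesgue"
        by (intro borel_measurable_times m borel_measurable_indicator) auto
      moreover have "indicator (box a b) x * (indicator (cbox a b) x * f x) = indicator (box a b) x * f x" for x
        using box_subset_cbox[of a b] by (auto simp: indicator_def)
      ultimately show "(\<lambda>x. indicator (box a b) x * f x) \<in> borel_measurable lebesgue" by simp
      show "integrable lebesgue (\<lambda>x. \<bar>indicator (cbox a b) x *\<^sub>R f x\<bar>)" using int by (rule integrable_abs)
      have "(\<lambda>k. ?s k x) \<longlonglongrightarrow> indicator (cbox a b) x * f x * indicator (box a b) x" for x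
        by (intro tendsto_mult tendsto_const box_bump_tendsto)
      moreover have "indicator (cbox a b) x * f x * indicator (box a b) x = indicator (box a b) x * f x" for x
        using box_subset_cbox[of a b] by (auto simp: indicator_def)
      ultimately show "AE x in lebesgue. (\<lambda>k. ?s k x) \<longlonglongrightarrow> indicator (box a b) x * f x" by simp
      show "AE x in lebesgue. norm (?s k x) \<le> \<bar>indicator (cbox a b) x *\<^sub>R f x\<bar>" for k
        using box_bump_bounds[of a b k] by (auto simp: abs_mult intro!: mult_left_le)
    qed
    moreover have "(LINT x|lebesgue. ?s k x) = 0" for k
    proof -
      have "indicator \<Omega> x *\<^sub>R (f x * box_bump a b k x) = ?s k x" for x
      proof (cases "x \<in> cbox a b")
        case False
        then have "box_bump a b k x = 0"
          using box_bump_pos[of a b k x] box_bump_bounds(1)[of a b k x] box_subset_cbox[of a b] by auto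
        then show ?thesis by simp
      qed (use ab in \<open>auto simp: indicator_def\<close>)
      then have "(LINT x|lebesgue. ?s k x) = (LINT x|lebesgue_on \<Omega>. f x * box_bump a b k x)"
        by (simp only: integral_restrict_space[OF \<Omega>s])
      then show ?thesis using zero[OF test_function_box_bump[OF ab]] by simp
    qed
    ultimately show ?thesis using LIMSEQ_unique[OF _ tendsto_const] by fastforce
  qed
  \<comment> \<open>Cut off to one box inside the domain, \<open>f\<close> becomes integrable on the
    whole space. Its integral over any box is an integral over an intersection of boxes, again a
    box, to which \<open>box0\<close> applies.\<close>
  have ae: "AE x in lebesgue. x \<in> cbox c d \<longrightarrow> f x = 0" if cd: "cbox c d \<subseteq> \<Omega>" for c d
  proof -
    let ?F = "\<lambda>x. indicator (box c d) x * f x"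
    have "integrable lebesgue (\<lambda>x. indicator (box c d) x *\<^sub>R (indicator (cbox c d) x *\<^sub>R f x))"
      by (intro integrable_mult_indicator locally_integrable_compact[OF f compact_cbox cd]) auto
    moreover have "indicator (box c d) x *\<^sub>R (indicator (cbox c d) x *\<^sub>R f x) = ?F x" for x
      using box_subset_cbox[of c d] by (auto simp: indicator_def)
    ultimately have int: "integrable lebesgue ?F" by (simp only:)
    have "(LINT x|lebesgue. indicator (box a b) x * ?F x) = 0" for a b
    proof -
      define a' b' where "a' = (\<Sum>i\<in>Basis. max (a\<bullet>i) (c\<bullet>i) *\<^sub>R i)" and "b' = (\<Sum>i\<in>Basis. min (b\<bullet>i) (d\<bullet>i) *\<^sub>R i)"
      have eq: "box a b \<inter> box c d = box a' b'" by (simp add: box_Int_box a'_def b'_def)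
      have "cbox a' b' \<subseteq> cbox c d" by (auto simp: mem_box a'_def b'_def)
      then have "(LINT x|lebesgue. indicator (box a' b') x * f x) = 0" using box0 cd by blast
      moreover have "indicator (box a b) x * ?F x = indicator (box a' b') x * f x" for x
        unfolding eq[symmetric] by (simp add: indicator_inter_arith)
      ultimately show ?thesis by (simp only:)
    qed
    from lebesgue_zero_box_integrals[OF int this] have "AE x in lebesgue. ?F x = 0" .
    \<comment> \<open>The faces of a box form a null set, so the closed box can replace the open
      one.\<close>
    moreover have "AE x in lebesgue. x \<notin> cbox c d - box c d"
      using negligible_frontier_interval[of c d] by (intro AE_not_in) (simp add: negligible_iff_null_sets)
    ultimately show ?thesis by eventually_elim (auto simp: indicator_def)
  qed
  obtain D where D: "countable D" "D \<subseteq> Pow \<Omega>" "\<And>X. X \<in> D \<Longrightarrow> \<exists>a b. X = cbox a b" "\<Union>D = \<Omega>"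
    using open_countable_Union_open_cbox[OF \<Omega>] by metis
  have "AE x in lebesgue. \<forall>X\<in>D. x \<in> X \<longrightarrow> f x = 0"
  proof (subst AE_ball_countable[OF D(1)], rule ballI)
    fix X assume X: "X \<in> D"
    then obtain a b where "X = cbox a b" using D(3) by blast
    then show "AE x in lebesgue. x \<in> X \<longrightarrow> f x = 0" using ae X D(2) by blast
  qed
  then have "AE x in lebesgue. x \<in> \<Omega> \<longrightarrow> f x = 0"
    by eventually_elim (use D(4) in blast)
  then show ?thesis by (simp add: AE_restrict_space_iff[OF \<Omega>s])
qed

section \<open>Functions with their gradients\<close>

text \<open>The gradient is a datum, approximated by gradients of test functions jointly with the
  function. Linearity thus holds exactly and not merely up to null sets.\<close>

definition sobolev_pair ::
    "real \<Rightarrow> (real^'n::finite) set \<Rightarrow> (real^'n \<Rightarrow> real) \<Rightarrow> (real^'n \<Rightarrow> real^'n) \<Rightarrow> bool" where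
  "sobolev_pair p \<Omega> u g \<longleftrightarrow> Lp_fun p (lebesgue_on \<Omega>) u \<and> Lp_fun p (lebesgue_on \<Omega>) g \<and>
     (\<forall>\<epsilon>>0. \<exists>\<phi>. test_function \<Omega> \<phi> \<and> Lp_int p (lebesgue_on \<Omega>) (\<lambda>x. u x - \<phi> x) < \<epsilon> \<and>
        Lp_int p (lebesgue_on \<Omega>) (\<lambda>x. g x - grad \<phi> x) < \<epsilon>)"

text \<open>\<open>weak_gradient\<close> is an arbitrary representative, and completeness of
  Lebesgue measure is what transfers measurability to it.\<close>

lemma AE_eq_measurable_lebesgue_on:
  fixes f g :: "'a::euclidean_space \<Rightarrow> 'b::euclidean_space"
  assumes "\<Omega> \<in> sets lebesgue" "f \<in> borel_measurable (lebesgue_on \<Omega>)" "AE x in lebesgue_on \<Omega>. f x = g x"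
  shows "g \<in> borel_measurable (lebesgue_on \<Omega>)"
proof -
  have s: "\<Omega> \<inter> space lebesgue \<in> sets lebesgue" using assms(1) by simp
  have "AE x in lebesgue. indicator \<Omega> x *\<^sub>R f x = indicator \<Omega> x *\<^sub>R g x"
    using assms(3) unfolding AE_restrict_space_iff[OF s] by eventually_elim (auto simp: indicator_def)
  moreover have "(\<lambda>x. indicator \<Omega> x *\<^sub>R f x) \<in> borel_measurable lebesgue"
    using assms(2) by (simp only: borel_measurable_restrict_space_iff[OF s])
  ultimately have "(\<lambda>x. indicator \<Omega> x *\<^sub>R g x) \<in> borel_measurable lebesgue"
    by (rule borel_measurable_AE[rotated])
  then show ?thesis by (simp only: borel_measurable_restrict_space_iff[OF s])
qed

section \<open>Test functions and weak gradients on a bounded open set\<close>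

context
  fixes \<Omega> :: "(real^'n::finite) set" and R :: real
  assumes \<Omega>: "open \<Omega>" "\<Omega> \<subseteq> cball 0 R"
begin

lemma domain_sets: "\<Omega> \<in> sets lebesgue" "\<Omega> \<inter> space lebesgue \<in> sets lebesgue"
  using \<Omega>(1) by auto

lemma finite_measure_domain: "finite_measure (lebesgue_on \<Omega>)"
proof
  have "bounded \<Omega>" using \<Omega>(2) bounded_cball bounded_subset by blast
  then have "\<Omega> \<in> lmeasurable" using \<Omega>(1) by (intro bounded_set_imp_lmeasurable) auto
  then have "emeasure lebesgue \<Omega> < \<infinity>" by (auto simp: fmeasurable_def)
  moreover have "emeasure (lebesgue_on \<Omega>) \<Omega> = emeasure lebesgue \<Omega>" by (rule emeasure_restrict_space) (use domain_sets in auto)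
  ultimately show "emeasure (lebesgue_on \<Omega>) (space (lebesgue_on \<Omega>)) \<noteq> \<infinity>" by (simp add: space_restrict_space)
qed

lemma continuous_measurable_domain:
  fixes f :: "real^'n \<Rightarrow> 'b::euclidean_space"
  assumes "continuous_on UNIV f"
  shows "f \<in> borel_measurable (lebesgue_on \<Omega>)"
  using borel_measurable_continuous_onI[OF assms]
  by (intro measurable_restrict_space1 measurable_completion) simp

lemma integral_domain_lborel:
  fixes f :: "real^'n \<Rightarrow> real"
  assumes "continuous_on UNIV f" "\<And>x. x \<notin> \<Omega> \<Longrightarrow> f x = 0"
  shows "(LINT x|lebesgue_on \<Omega>. f x) = (LINT x|lborel. f x)" "integrable (lebesgue_on \<Omega>) f"
proof -
  have f: "f \<in> borel_measurable lborel" using borel_measurable_continuous_onI[OF assms(1)] by simp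
  have "indicator \<Omega> x *\<^sub>R f x = f x" for x by (cases "x \<in> \<Omega>") (simp_all add: assms(2))
  then have eq: "(\<lambda>x. indicator \<Omega> x *\<^sub>R f x) = f" by (rule ext)
  show "(LINT x|lebesgue_on \<Omega>. f x) = (LINT x|lborel. f x)"
    by (simp only: integral_restrict_space[OF domain_sets(2)] eq integral_completion[OF f])
  have "R < norm x \<Longrightarrow> f x = 0" for x using assms(2) \<Omega>(2) by force
  then have "integrable lborel f" by (rule continuous_compact_support(1)[OF assms(1)])
  then show "integrable (lebesgue_on \<Omega>) f"
    by (simp only: integrable_restrict_space[OF domain_sets(2)] eq integrable_completion[OF f])
qed

lemma test_function_sbs: "test_function \<Omega> \<phi> \<Longrightarrow> smooth_bounded_support R \<phi>"
  using test_function_bounded_support \<Omega>(2) by blast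

lemma test_function_Lp:
  assumes "test_function \<Omega> \<phi>" "0 < s"
  shows "Lp_fun s (lebesgue_on \<Omega>) \<phi>" "Lp_fun s (lebesgue_on \<Omega>) (grad \<phi>)"
    "Lp_int s (lebesgue_on \<Omega>) \<phi> = (LINT x|lborel. \<bar>\<phi> x\<bar> powr s)" "Lp_int s (lebesgue_on \<Omega>) (grad \<phi>) = (LINT x|lborel. norm (grad \<phi> x) powr s)"
proof -
  note sbs = test_function_sbs[OF assms(1)]
  have c: "continuous_on UNIV (\<lambda>x. norm (\<phi> x) powr s)" "continuous_on UNIV (\<lambda>x. norm (grad \<phi> x) powr s)"
    by (intro continuous_on_powr' continuous_on_norm continuous_on_const sbs_continuous[OF sbs]
        sbs_grad_continuous[OF sbs]; simp add: assms(2))+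
  have z: "norm (\<phi> x) powr s = 0" "norm (grad \<phi> x) powr s = 0" if "x \<notin> \<Omega>" for x
    using that test_function_outside[OF assms(1)] test_function_grad_outside[OF assms(1)] by auto
  show "Lp_fun s (lebesgue_on \<Omega>) \<phi>" "Lp_fun s (lebesgue_on \<Omega>) (grad \<phi>)"
    unfolding Lp_fun_def using integral_domain_lborel(2)[OF c(1) z(1)] integral_domain_lborel(2)[OF c(2) z(2)]
      continuous_measurable_domain[OF sbs_continuous[OF sbs]] continuous_measurable_domain[OF sbs_grad_continuous[OF sbs]]
    by auto
  show "Lp_int s (lebesgue_on \<Omega>) \<phi> = (LINT x|lborel. \<bar>\<phi> x\<bar> powr s)" "Lp_int s (lebesgue_on \<Omega>) (grad \<phi>) = (LINT x|lborel. norm (grad \<phi> x) powr s)"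
    unfolding Lp_int_def using integral_domain_lborel(1)[OF c(1) z(1)] integral_domain_lborel(1)[OF c(2) z(2)] by auto
qed

text \<open>The product of the two functions is a test function, whose gradient integrates to
  0.\<close>

lemma test_function_integration_by_parts:
  assumes "test_function \<Omega> \<phi>" "test_function \<Omega> \<psi>"
  shows "(LINT x|lebesgue_on \<Omega>. \<phi> x * partial_deriv i \<psi> x) = - (LINT x|lebesgue_on \<Omega>. grad \<phi> x $ i * \<psi> x)"
proof -
  note sm = test_function_smooth[OF assms(1)] test_function_smooth[OF assms(2)]
  have t: "test_function \<Omega> (\<lambda>x. \<phi> x * \<psi> x)" by (rule test_function_mult[OF assms(1) sm(2)])
  have c: "continuous_on UNIV (\<lambda>x. \<phi> x * partial_deriv i \<psi> x)" "continuous_on UNIV (\<lambda>x. grad \<phi> x $ i * \<psi> x)"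
    unfolding partial_deriv_grad[symmetric]
    by (intro continuous_on_mult smooth_continuous_on smooth_partial_deriv sm)+
  have z: "\<phi> x * partial_deriv i \<psi> x = 0" "grad \<phi> x $ i * \<psi> x = 0" if "x \<notin> \<Omega>" for x
    using that test_function_outside assms by auto
  have "0 = (LINT x|lborel. grad (\<lambda>x. \<phi> x * \<psi> x) x \<bullet> axis i 1)"
    by (rule integral_grad_zero[OF test_function_sbs[OF t], symmetric])
  also have "\<dots> = (LINT x|lborel. \<phi> x * partial_deriv i \<psi> x + grad \<phi> x $ i * \<psi> x)"
    by (simp add: grad_mult[OF sm] inner_add_left inner_axis partial_deriv_grad mult.commute)
  also have "\<dots> = (LINT x|lebesgue_on \<Omega>. \<phi> x * partial_deriv i \<psi> x + grad \<phi> x $ i * \<psi> x)"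
    by (intro integral_domain_lborel(1)[symmetric] continuous_on_add c) (simp only: z add_0_left not_False_eq_True)
  also have "\<dots> = (LINT x|lebesgue_on \<Omega>. \<phi> x * partial_deriv i \<psi> x) + (LINT x|lebesgue_on \<Omega>. grad \<phi> x $ i * \<psi> x)"
    by (intro Bochner_Integration.integral_add integral_domain_lborel(2) c z)
  finally show ?thesis by simp
qed

lemma Lp_locally_integrable:
  fixes f :: "real^'n \<Rightarrow> 'b::euclidean_space"
  assumes "1 \<le> p" "Lp_fun p (lebesgue_on \<Omega>) f"
  shows "locally_integrable \<Omega> f"
  unfolding locally_integrable_def
proof (intro allI impI, elim conjE)
  fix K assume K: "compact K" "K \<subseteq> \<Omega>"
  have Ks: "K \<in> sets lebesgue" "K \<inter> space lebesgue \<in> sets lebesgue" using compact_imp_closed[OF K(1)] by auto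
  have "Lp_fun 1 (lebesgue_on \<Omega>) f" using assms by (intro Lp_fun_lower[OF finite_measure_domain _ _ assms(2)]) auto
  then have "integrable (lebesgue_on \<Omega>) f"
    by (auto simp: Lp_fun_def intro: integrable_norm_cancel)
  then have "integrable lebesgue (\<lambda>x. indicator K x *\<^sub>R (indicator \<Omega> x *\<^sub>R f x))"
    unfolding integrable_restrict_space[OF domain_sets(2)] by (rule integrable_mult_indicator[OF Ks(1)])
  moreover have "indicator K x *\<^sub>R (indicator \<Omega> x *\<^sub>R f x) = indicator K x *\<^sub>R f x" for x
    using K(2) by (auto simp: indicator_def)
  ultimately show "integrable (lebesgue_on K) f"
    by (simp only: integrable_restrict_space[OF Ks(2)])
qed

lemma integrable_times_compact_support:
  fixes f \<psi> :: "real^'n \<Rightarrow> real"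
  assumes f: "locally_integrable \<Omega> f" and K: "compact K" "K \<subseteq> \<Omega>"
    and \<psi>: "continuous_on UNIV \<psi>" "\<And>x. x \<notin> K \<Longrightarrow> \<psi> x = 0"
  shows "integrable (lebesgue_on \<Omega>) (\<lambda>x. f x * \<psi> x)"
proof -
  have int: "integrable lebesgue (\<lambda>x. indicator K x *\<^sub>R f x)" by (rule locally_integrable_compact[OF f K])
  have "R < norm x \<Longrightarrow> \<psi> x = 0" for x using \<psi>(2) K(2) \<Omega>(2) by force
  then obtain B where B: "0 < B" "\<And>x. norm (\<psi> x) \<le> B" using continuous_compact_support(2)[OF \<psi>(1)] by blast
  have "integrable lebesgue (\<lambda>x. indicator K x *\<^sub>R f x * \<psi> x)"
  proof (rule Bochner_Integration.integrable_bound[OF integrable_mult_right[OF integrable_norm[OF int], of B]])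
    have "\<psi> \<in> borel_measurable lebesgue"
      using borel_measurable_continuous_onI[OF \<psi>(1)] by (intro measurable_completion) simp
    then show "(\<lambda>x. indicator K x *\<^sub>R f x * \<psi> x) \<in> borel_measurable lebesgue"
      by (intro borel_measurable_times borel_measurable_integrable[OF int])
    have "norm (indicator K x *\<^sub>R f x * \<psi> x) \<le> B * norm (indicator K x *\<^sub>R f x)" for x
      unfolding norm_mult using mult_left_mono[OF B(2)[of x], of "norm (indicator K x *\<^sub>R f x)"]
      by (simp only: mult.commute[of B] norm_ge_zero)
    then show "AE x in lebesgue. norm (indicator K x *\<^sub>R f x * \<psi> x) \<le> norm (B * norm (indicator K x *\<^sub>R f x))"
      using B(1) by (auto simp: abs_mult)
  qed
  moreover have "indicator K x *\<^sub>R f x * \<psi> x = indicator \<Omega> x *\<^sub>R (f x * \<psi> x)" for x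
    using \<psi>(2) K(2) by (auto simp: indicator_def)
  ultimately show ?thesis by (simp only: integrable_restrict_space[OF domain_sets(2)])
qed

lemma integrable_times_test:
  assumes "locally_integrable \<Omega> f" "test_function \<Omega> \<psi>"
  shows "integrable (lebesgue_on \<Omega>) (\<lambda>x. f x * \<psi> x)" "integrable (lebesgue_on \<Omega>) (\<lambda>x. f x * partial_deriv i \<psi> x)"
proof -
  have K: "compact (closure {x. \<psi> x \<noteq> 0})" "closure {x. \<psi> x \<noteq> 0} \<subseteq> \<Omega>"
    using assms(2) by (auto simp: test_function_def)
  note sm = test_function_smooth[OF assms(2)]
  have "\<psi> x = 0" "partial_deriv i \<psi> x = 0" if "x \<notin> closure {x. \<psi> x \<noteq> 0}" for x
    using that closure_subset[of "{x. \<psi> x \<noteq> 0}"] grad_outside_support[OF that] by (auto simp: partial_deriv_grad)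
  then show "integrable (lebesgue_on \<Omega>) (\<lambda>x. f x * \<psi> x)" "integrable (lebesgue_on \<Omega>) (\<lambda>x. f x * partial_deriv i \<psi> x)"
    using integrable_times_compact_support[OF assms(1) K] smooth_continuous_on[OF sm]
      smooth_continuous_on[OF smooth_partial_deriv[OF sm]] by blast+
qed

lemma locally_integrable_component:
  "locally_integrable \<Omega> g \<Longrightarrow> locally_integrable \<Omega> (\<lambda>x. g x $ i)" for g :: "real^'n \<Rightarrow> real^'n"
  unfolding locally_integrable_def
  using integrable_bounded_linear[OF bounded_linear_vec_nth] by blast

lemma weak_gradient_unique_AE:
  assumes "is_weak_gradient \<Omega> u g" "is_weak_gradient \<Omega> v h" "AE x in lebesgue_on \<Omega>. u x = v x"
  shows "AE x in lebesgue_on \<Omega>. g x = h x"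
proof -
  have comp: "AE x in lebesgue_on \<Omega>. g x $ i - h x $ i = 0" for i
  proof (rule test_integrals_zero_imp_AE_zero[OF \<Omega>(1)])
    have gh: "locally_integrable \<Omega> (\<lambda>x. g x $ i)" "locally_integrable \<Omega> (\<lambda>x. h x $ i)"
      using assms locally_integrable_component unfolding is_weak_gradient_def by blast+
    then show "locally_integrable \<Omega> (\<lambda>x. g x $ i - h x $ i)"
      unfolding locally_integrable_def by (intro allI impI Bochner_Integration.integrable_diff) auto
    fix \<psi> assume \<psi>: "test_function \<Omega> \<psi>"
    have uv: "locally_integrable \<Omega> u" "locally_integrable \<Omega> v"
      using assms unfolding is_weak_gradient_def by blast+
    have "(LINT x|lebesgue_on \<Omega>. u x * partial_deriv i \<psi> x) = (LINT x|lebesgue_on \<Omega>. v x * partial_deriv i \<psi> x)"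
      using assms(3) integrable_times_test(2)[OF uv(1) \<psi>] integrable_times_test(2)[OF uv(2) \<psi>]
      by (intro integral_cong_AE) auto
    then have "(LINT x|lebesgue_on \<Omega>. g x $ i * \<psi> x) = (LINT x|lebesgue_on \<Omega>. h x $ i * \<psi> x)"
    proof -
      have "(LINT x|lebesgue_on \<Omega>. u x * partial_deriv i \<psi> x) = - (LINT x|lebesgue_on \<Omega>. g x $ i * \<psi> x)"
        "(LINT x|lebesgue_on \<Omega>. v x * partial_deriv i \<psi> x) = - (LINT x|lebesgue_on \<Omega>. h x $ i * \<psi> x)"
        using assms(1,2) \<psi> unfolding is_weak_gradient_def by blast+
      then show ?thesis using \<open>(LINT x|lebesgue_on \<Omega>. u x * partial_deriv i \<psi> x) = (LINT x|lebesgue_on \<Omega>. v x * partial_deriv i \<psi> x)\<close>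
        by linarith
    qed
    then show "(LINT x|lebesgue_on \<Omega>. (g x $ i - h x $ i) * \<psi> x) = 0"
      using integrable_times_test(1)[OF gh(1) \<psi>] integrable_times_test(1)[OF gh(2) \<psi>]
      by (simp add: left_diff_distrib)
  qed
  have "AE x in lebesgue_on \<Omega>. \<forall>i\<in>UNIV. g x $ i - h x $ i = 0"
    unfolding AE_finite_all[OF finite_class.finite_UNIV] using comp by blast
  then show ?thesis by eventually_elim (simp add: vec_eq_iff)
qed

text \<open>The defect \<open>D\<close> of the weak identity vanishes for test functions, and it is
  controlled by the integrals of the two approximation errors.\<close>

lemma sobolev_pair_is_weak_gradient:
  assumes p: "1 < p" and ug: "sobolev_pair p \<Omega> u g"
  shows "is_weak_gradient \<Omega> u g"
proof -
  have u: "Lp_fun p (lebesgue_on \<Omega>) u" and g: "Lp_fun p (lebesgue_on \<Omega>) g" using ug by (auto simp: sobolev_pair_def)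
  have loc: "locally_integrable \<Omega> u" "locally_integrable \<Omega> g"
    using p u g by (auto intro!: Lp_locally_integrable[of p])
  have "(LINT x|lebesgue_on \<Omega>. u x * partial_deriv i \<psi> x) = - (LINT x|lebesgue_on \<Omega>. g x $ i * \<psi> x)" if \<psi>: "test_function \<Omega> \<psi>" for \<psi> i
  proof -
    note sm = test_function_smooth[OF \<psi>] and sbs = test_function_sbs[OF \<psi>]
    obtain B1 where B1: "0 < B1" "\<And>x. norm (\<psi> x) \<le> B1"
      using continuous_compact_support(2)[OF sbs_continuous[OF sbs] sbs_outside[OF sbs]] by blast
    obtain B2 where B2: "0 < B2" "\<And>x. norm (grad \<psi> x) \<le> B2"
      using continuous_compact_support(2)[OF sbs_grad_continuous[OF sbs] sbs_grad_outside[OF sbs]] by blast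
    define B where "B = B1 + B2"
    have B: "0 < B" "\<And>x. \<bar>\<psi> x\<bar> \<le> B" "\<And>x. \<bar>partial_deriv i \<psi> x\<bar> \<le> B"
    proof -
      show "0 < B" using B1 B2 by (simp add: B_def)
      show "\<bar>\<psi> x\<bar> \<le> B" for x using B1(2)[of x] B2(1) by (simp add: B_def)
      show "\<bar>partial_deriv i \<psi> x\<bar> \<le> B" for x
        unfolding partial_deriv_grad using component_le_norm_cart[of "grad \<psi> x" i] B2(2)[of x] B1(1) by (simp add: B_def)
    qed
    define D where "D = (LINT x|lebesgue_on \<Omega>. u x * partial_deriv i \<psi> x) + (LINT x|lebesgue_on \<Omega>. g x $ i * \<psi> x)"
    have "\<bar>D\<bar> \<le> e" if e: "0 < e" for e
    proof -
      \<comment> \<open>Each of the two errors has an integral of at most \<open>2 * e'\<close> and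
        is multiplied by a function bounded by \<open>B\<close>, so the total is
        \<open>e\<close>.\<close>
      define e' where "e' = e / (4 * B)"
      have e': "0 < e'" using e B by (simp add: e'_def)
      obtain C1 where C1: "0 < C1" "\<And>f :: real^'n \<Rightarrow> real. Lp_fun p (lebesgue_on \<Omega>) f \<Longrightarrow> Lp_int 1 (lebesgue_on \<Omega>) f \<le> e' + C1 * Lp_int p (lebesgue_on \<Omega>) f"
        using Lp_int_lower_eps[OF finite_measure_domain zero_less_one p e'] by metis
      obtain C2 where C2: "0 < C2" "\<And>f :: real^'n \<Rightarrow> real^'n. Lp_fun p (lebesgue_on \<Omega>) f \<Longrightarrow> Lp_int 1 (lebesgue_on \<Omega>) f \<le> e' + C2 * Lp_int p (lebesgue_on \<Omega>) f"
        using Lp_int_lower_eps[OF finite_measure_domain zero_less_one p e'] by metis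
      obtain \<phi> where \<phi>: "test_function \<Omega> \<phi>" "Lp_int p (lebesgue_on \<Omega>) (\<lambda>x. u x - \<phi> x) < e' / (C1 + C2)"
        "Lp_int p (lebesgue_on \<Omega>) (\<lambda>x. g x - grad \<phi> x) < e' / (C1 + C2)"
        using ug e' C1(1) C2(1) unfolding sobolev_pair_def by (meson divide_pos_pos add_pos_pos)
      have small: "C * y \<le> e'" if "y < e' / (C1 + C2)" "0 < C" "C \<le> C1 + C2" "0 \<le> y" for C y
      proof -
        have "C * y \<le> (C1 + C2) * y" using that by (intro mult_right_mono) auto
        also have "\<dots> \<le> e'" using that C1(1) C2(1) by (simp add: field_simps)
        finally show ?thesis .
      qed
      have d: "Lp_fun p (lebesgue_on \<Omega>) (\<lambda>x. u x - \<phi> x)" "Lp_fun p (lebesgue_on \<Omega>) (\<lambda>x. g x - grad \<phi> x)"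
        using u g test_function_Lp(1,2)[OF \<phi>(1), of p] p by (auto intro!: Lp_fun_diff)
      have 1: "Lp_int 1 (lebesgue_on \<Omega>) (\<lambda>x. u x - \<phi> x) \<le> 2 * e'"
        using C1(2)[OF d(1)] small[OF \<phi>(2), of C1] C1(1) C2(1) by simp
      have 2: "Lp_int 1 (lebesgue_on \<Omega>) (\<lambda>x. g x - grad \<phi> x) \<le> 2 * e'"
        using C2(2)[OF d(2)] small[OF \<phi>(3), of C2] C1(1) C2(1) by simp
      have int1: "integrable (lebesgue_on \<Omega>) (\<lambda>x. norm (u x - \<phi> x))" "integrable (lebesgue_on \<Omega>) (\<lambda>x. norm (g x - grad \<phi> x))"
        using Lp_fun_lower[OF finite_measure_domain zero_less_one less_imp_le[OF p] d(1)]
          Lp_fun_lower[OF finite_measure_domain zero_less_one less_imp_le[OF p] d(2)]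
        by (auto simp: Lp_fun_def)
      have loc': "locally_integrable \<Omega> \<phi>" "locally_integrable \<Omega> (grad \<phi>)"
        using p test_function_Lp(1,2)[OF \<phi>(1), of p] by (auto intro!: Lp_locally_integrable[of p])
      note ints = integrable_times_test(2)[OF loc(1) \<psi>, of i] integrable_times_test(2)[OF loc'(1) \<psi>, of i]
        integrable_times_test(1)[OF locally_integrable_component[OF loc(2)] \<psi>, of i]
        integrable_times_test(1)[OF locally_integrable_component[OF loc'(2)] \<psi>, of i]
      have "D = (LINT x|lebesgue_on \<Omega>. (u x - \<phi> x) * partial_deriv i \<psi> x) + (LINT x|lebesgue_on \<Omega>. (g x - grad \<phi> x) $ i * \<psi> x)"
        using test_function_integration_by_parts[OF \<phi>(1) \<psi>, of i] ints
        by (simp add: D_def left_diff_distrib)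
      also have "\<bar>\<dots>\<bar> \<le> \<bar>LINT x|lebesgue_on \<Omega>. (u x - \<phi> x) * partial_deriv i \<psi> x\<bar> + \<bar>LINT x|lebesgue_on \<Omega>. (g x - grad \<phi> x) $ i * \<psi> x\<bar>"
        by (rule abs_triangle_ineq)
      also have "\<dots> \<le> B * (2 * e') + B * (2 * e')"
      proof (rule add_mono)
        have "\<bar>LINT x|lebesgue_on \<Omega>. (u x - \<phi> x) * partial_deriv i \<psi> x\<bar> \<le> (LINT x|lebesgue_on \<Omega>. \<bar>(u x - \<phi> x) * partial_deriv i \<psi> x\<bar>)"
          by (rule integral_abs_bound)
        also have "\<dots> \<le> (LINT x|lebesgue_on \<Omega>. B * norm (u x - \<phi> x))"
        proof (rule integral_mono)
          show "integrable (lebesgue_on \<Omega>) (\<lambda>x. \<bar>(u x - \<phi> x) * partial_deriv i \<psi> x\<bar>)"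
            using ints(1,2) by (intro integrable_abs) (simp add: left_diff_distrib)
          show "integrable (lebesgue_on \<Omega>) (\<lambda>x. B * norm (u x - \<phi> x))" using int1 by simp
          show "\<bar>(u x - \<phi> x) * partial_deriv i \<psi> x\<bar> \<le> B * norm (u x - \<phi> x)" for x
            unfolding abs_mult real_norm_def mult.commute[of B] by (intro mult_left_mono B) auto
        qed
        also have "\<dots> = B * Lp_int 1 (lebesgue_on \<Omega>) (\<lambda>x. u x - \<phi> x)" by (simp add: Lp_int_def)
        also have "\<dots> \<le> B * (2 * e')" using 1 B(1) by (intro mult_left_mono) auto
        finally show "\<bar>LINT x|lebesgue_on \<Omega>. (u x - \<phi> x) * partial_deriv i \<psi> x\<bar> \<le> B * (2 * e')" .
        have "\<bar>LINT x|lebesgue_on \<Omega>. (g x - grad \<phi> x) $ i * \<psi> x\<bar> \<le> (LINT x|lebesgue_on \<Omega>. \<bar>(g x - grad \<phi> x) $ i * \<psi> x\<bar>)"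
          by (rule integral_abs_bound)
        also have "\<dots> \<le> (LINT x|lebesgue_on \<Omega>. B * norm (g x - grad \<phi> x))"
        proof (rule integral_mono)
          show "integrable (lebesgue_on \<Omega>) (\<lambda>x. \<bar>(g x - grad \<phi> x) $ i * \<psi> x\<bar>)"
            using ints(3,4) by (intro integrable_abs) (simp add: left_diff_distrib)
          show "integrable (lebesgue_on \<Omega>) (\<lambda>x. B * norm (g x - grad \<phi> x))" using int1 by simp
          show "\<bar>(g x - grad \<phi> x) $ i * \<psi> x\<bar> \<le> B * norm (g x - grad \<phi> x)" for x
            unfolding abs_mult mult.commute[of B] by (intro mult_mono B component_le_norm_cart) auto
        qed
        also have "\<dots> = B * Lp_int 1 (lebesgue_on \<Omega>) (\<lambda>x. g x - grad \<phi> x)" by (simp add: Lp_int_def)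
        also have "\<dots> \<le> B * (2 * e')" using 2 B(1) by (intro mult_left_mono) auto
        finally show "\<bar>LINT x|lebesgue_on \<Omega>. (g x - grad \<phi> x) $ i * \<psi> x\<bar> \<le> B * (2 * e')" .
      qed
      also have "\<dots> = e" using B(1) by (simp add: e'_def)
      finally show ?thesis .
    qed
    then have "D = 0" by (metis abs_le_zero_iff field_le_epsilon add_0)
    then show ?thesis by (simp add: D_def)
  qed
  then show ?thesis using loc unfolding is_weak_gradient_def by blast
qed

end

context
  fixes \<Omega> :: "(real^'n::finite) set" and R p :: real
  assumes \<Omega>: "open \<Omega>" "\<Omega> \<subseteq> cball 0 R" and p: "1 < p"
begin

section \<open>Limits and linear combinations of Sobolev pairs\<close>

lemma sobolev_pair_Lp: "sobolev_pair p \<Omega> u g \<Longrightarrow> Lp_fun p (lebesgue_on \<Omega>) u" "sobolev_pair p \<Omega> u g \<Longrightarrow> Lp_fun p (lebesgue_on \<Omega>) g"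
  by (auto simp: sobolev_pair_def)

lemma test_function_sobolev_pair:
  assumes "test_function \<Omega> \<phi>"
  shows "sobolev_pair p \<Omega> \<phi> (grad \<phi>)"
  unfolding sobolev_pair_def
proof (intro conjI allI impI)
  show "Lp_fun p (lebesgue_on \<Omega>) \<phi>" "Lp_fun p (lebesgue_on \<Omega>) (grad \<phi>)"
    using p by (auto intro: test_function_Lp(1,2)[OF \<Omega> assms])
  show "\<exists>\<psi>. test_function \<Omega> \<psi> \<and> Lp_int p (lebesgue_on \<Omega>) (\<lambda>x. \<phi> x - \<psi> x) < \<epsilon> \<and> Lp_int p (lebesgue_on \<Omega>) (\<lambda>x. grad \<phi> x - grad \<psi> x) < \<epsilon>"
    if "0 < \<epsilon>" for \<epsilon>
    using assms that by (intro exI[of _ \<phi>]) (simp add: Lp_int_def)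
qed

lemma sobolev_pair_sequence:
  assumes "sobolev_pair p \<Omega> u g"
  shows "\<exists>\<phi>. (\<forall>k::nat. test_function \<Omega> (\<phi> k)) \<and>
    (\<lambda>k. Lp_int p (lebesgue_on \<Omega>) (\<lambda>x. \<phi> k x - u x)) \<longlonglongrightarrow> 0 \<and> (\<lambda>k. Lp_int p (lebesgue_on \<Omega>) (\<lambda>x. grad (\<phi> k) x - g x)) \<longlonglongrightarrow> 0"
proof -
  have "\<forall>k. \<exists>\<phi>. test_function \<Omega> \<phi> \<and> Lp_int p (lebesgue_on \<Omega>) (\<lambda>x. u x - \<phi> x) < 1 / real (Suc k) \<and>
        Lp_int p (lebesgue_on \<Omega>) (\<lambda>x. g x - grad \<phi> x) < 1 / real (Suc k)"
    using assms unfolding sobolev_pair_def by simp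
  from choice[OF this] obtain \<phi> where "\<forall>k. test_function \<Omega> (\<phi> k) \<and> Lp_int p (lebesgue_on \<Omega>) (\<lambda>x. u x - \<phi> k x) < 1 / real (Suc k) \<and>
        Lp_int p (lebesgue_on \<Omega>) (\<lambda>x. g x - grad (\<phi> k) x) < 1 / real (Suc k)" by (elim exE)
  then have \<phi>: "\<And>k. test_function \<Omega> (\<phi> k)" "\<And>k. Lp_int p (lebesgue_on \<Omega>) (\<lambda>x. u x - \<phi> k x) < 1 / real (Suc k)"
    "\<And>k. Lp_int p (lebesgue_on \<Omega>) (\<lambda>x. g x - grad (\<phi> k) x) < 1 / real (Suc k)" by simp_all
  have "norm (Lp_int p (lebesgue_on \<Omega>) (\<lambda>x. \<phi> k x - u x)) < 1 / real (Suc k)"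
    "norm (Lp_int p (lebesgue_on \<Omega>) (\<lambda>x. grad (\<phi> k) x - g x)) < 1 / real (Suc k)" for k
    using \<phi>(2,3)[of k] unfolding real_norm_def abs_of_nonneg[OF Lp_int_nonneg]
    by (simp_all only: Lp_int_diff_commute[of p "lebesgue_on \<Omega>" u] Lp_int_diff_commute[of p "lebesgue_on \<Omega>" g])
  from LIMSEQ_norm_0[OF this(1)] LIMSEQ_norm_0[OF this(2)] show ?thesis
    by (intro exI[of _ \<phi>] conjI allI \<phi>(1))
qed

text \<open>Besides closedness in the locale this yields multiples and sums: both are limits of the
  corresponding combinations of test functions.\<close>

lemma sobolev_pairI:
  assumes "Lp_fun p (lebesgue_on \<Omega>) u" "Lp_fun p (lebesgue_on \<Omega>) g"
    and "\<And>k::nat. sobolev_pair p \<Omega> (us k) (gs k)"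
    and "(\<lambda>k. Lp_int p (lebesgue_on \<Omega>) (\<lambda>x. us k x - u x)) \<longlonglongrightarrow> 0" "(\<lambda>k. Lp_int p (lebesgue_on \<Omega>) (\<lambda>x. gs k x - g x)) \<longlonglongrightarrow> 0"
  shows "sobolev_pair p \<Omega> u g"
  unfolding sobolev_pair_def
proof (intro conjI allI impI assms(1,2))
  fix \<epsilon> :: real assume \<epsilon>: "0 < \<epsilon>"
  define d where "d = \<epsilon> / 2 powr (p - 1) / 2"
  have d: "0 < d" "2 powr (p - 1) * (d + d) = \<epsilon>" using \<epsilon> by (auto simp: d_def)
  have "eventually (\<lambda>k. Lp_int p (lebesgue_on \<Omega>) (\<lambda>x. us k x - u x) < d \<and> Lp_int p (lebesgue_on \<Omega>) (\<lambda>x. gs k x - g x) < d) sequentially"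
    using order_tendstoD(2)[OF assms(4) d(1)] order_tendstoD(2)[OF assms(5) d(1)] by (rule eventually_conj)
  then obtain k where k: "Lp_int p (lebesgue_on \<Omega>) (\<lambda>x. us k x - u x) < d" "Lp_int p (lebesgue_on \<Omega>) (\<lambda>x. gs k x - g x) < d"
    by (auto simp: eventually_sequentially)
  obtain \<phi> where \<phi>: "test_function \<Omega> \<phi>" "Lp_int p (lebesgue_on \<Omega>) (\<lambda>x. us k x - \<phi> x) < d"
    "Lp_int p (lebesgue_on \<Omega>) (\<lambda>x. gs k x - grad \<phi> x) < d"
    using assms(3)[of k] d(1) unfolding sobolev_pair_def by blast
  have lp: "Lp_fun p (lebesgue_on \<Omega>) (us k)" "Lp_fun p (lebesgue_on \<Omega>) (gs k)" "Lp_fun p (lebesgue_on \<Omega>) \<phi>" "Lp_fun p (lebesgue_on \<Omega>) (grad \<phi>)"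
    using sobolev_pair_Lp[OF assms(3)] sobolev_pair_Lp[OF test_function_sobolev_pair[OF \<phi>(1)]] by auto
  have strict: "2 powr (p - 1) * (a + b) < \<epsilon>" if "a < d" "b < d" for a b
  proof -
    show ?thesis unfolding d(2)[symmetric] using that by (intro mult_strict_left_mono) auto
  qed
  have "Lp_int p (lebesgue_on \<Omega>) (\<lambda>x. u x - \<phi> x) \<le> 2 powr (p - 1) * (Lp_int p (lebesgue_on \<Omega>) (\<lambda>x. u x - us k x) + Lp_int p (lebesgue_on \<Omega>) (\<lambda>x. us k x - \<phi> x))"
    using p assms(1) lp by (intro Lp_int_triangle) auto
  also have "\<dots> < \<epsilon>" using strict k(1) \<phi>(2) by (simp add: Lp_int_diff_commute)
  finally have 1: "Lp_int p (lebesgue_on \<Omega>) (\<lambda>x. u x - \<phi> x) < \<epsilon>" .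
  have "Lp_int p (lebesgue_on \<Omega>) (\<lambda>x. g x - grad \<phi> x) \<le> 2 powr (p - 1) * (Lp_int p (lebesgue_on \<Omega>) (\<lambda>x. g x - gs k x) + Lp_int p (lebesgue_on \<Omega>) (\<lambda>x. gs k x - grad \<phi> x))"
    using p assms(2) lp by (intro Lp_int_triangle) auto
  also have "\<dots> < \<epsilon>" using strict k(2) \<phi>(3) by (simp add: Lp_int_diff_commute)
  finally show "\<exists>\<phi>. test_function \<Omega> \<phi> \<and> Lp_int p (lebesgue_on \<Omega>) (\<lambda>x. u x - \<phi> x) < \<epsilon> \<and> Lp_int p (lebesgue_on \<Omega>) (\<lambda>x. g x - grad \<phi> x) < \<epsilon>"
    using 1 \<phi>(1) by blast
qed

lemma sobolev_pair_scale:
  assumes "sobolev_pair p \<Omega> u g"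
  shows "sobolev_pair p \<Omega> (\<lambda>x. c * u x) (\<lambda>x. c *\<^sub>R g x)"
proof -
  obtain \<phi> where \<phi>: "\<And>k::nat. test_function \<Omega> (\<phi> k)"
    "(\<lambda>k. Lp_int p (lebesgue_on \<Omega>) (\<lambda>x. \<phi> k x - u x)) \<longlonglongrightarrow> 0" "(\<lambda>k. Lp_int p (lebesgue_on \<Omega>) (\<lambda>x. grad (\<phi> k) x - g x)) \<longlonglongrightarrow> 0"
    using sobolev_pair_sequence[OF assms] by blast
  show ?thesis
  proof (rule sobolev_pairI)
    show "Lp_fun p (lebesgue_on \<Omega>) (\<lambda>x. c * u x)" "Lp_fun p (lebesgue_on \<Omega>) (\<lambda>x. c *\<^sub>R g x)"
      using Lp_fun_scaleR[OF sobolev_pair_Lp(1)[OF assms], of c] Lp_fun_scaleR[OF sobolev_pair_Lp(2)[OF assms]] by auto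
    show "sobolev_pair p \<Omega> (\<lambda>x. c * \<phi> k x) (grad (\<lambda>x. c * \<phi> k x))" for k
      by (intro test_function_sobolev_pair test_function_scale \<phi>)
    have 1: "(\<lambda>x. c * \<phi> k x - c * u x) = (\<lambda>x. c *\<^sub>R (\<phi> k x - u x))" for k by (auto simp: algebra_simps)
    have 2: "(\<lambda>x. grad (\<lambda>x. c * \<phi> k x) x - c *\<^sub>R g x) = (\<lambda>x. c *\<^sub>R (grad (\<phi> k) x - g x))" for k
      by (simp add: grad_scale[OF test_function_smooth[OF \<phi>(1)]] scaleR_right_diff_distrib)
    show "(\<lambda>k. Lp_int p (lebesgue_on \<Omega>) (\<lambda>x. c * \<phi> k x - c * u x)) \<longlonglongrightarrow> 0"
      unfolding 1 Lp_int_scaleR by (rule tendsto_mult_right_zero[OF \<phi>(2)])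
    show "(\<lambda>k. Lp_int p (lebesgue_on \<Omega>) (\<lambda>x. grad (\<lambda>x. c * \<phi> k x) x - c *\<^sub>R g x)) \<longlonglongrightarrow> 0"
      unfolding 2 Lp_int_scaleR by (rule tendsto_mult_right_zero[OF \<phi>(3)])
  qed
qed

lemma sobolev_pair_add:
  assumes "sobolev_pair p \<Omega> u g" "sobolev_pair p \<Omega> v h"
  shows "sobolev_pair p \<Omega> (\<lambda>x. u x + v x) (\<lambda>x. g x + h x)"
proof -
  obtain \<phi> where \<phi>: "\<And>k::nat. test_function \<Omega> (\<phi> k)"
    "(\<lambda>k. Lp_int p (lebesgue_on \<Omega>) (\<lambda>x. \<phi> k x - u x)) \<longlonglongrightarrow> 0" "(\<lambda>k. Lp_int p (lebesgue_on \<Omega>) (\<lambda>x. grad (\<phi> k) x - g x)) \<longlonglongrightarrow> 0"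
    using sobolev_pair_sequence[OF assms(1)] by blast
  obtain \<psi> where \<psi>: "\<And>k::nat. test_function \<Omega> (\<psi> k)"
    "(\<lambda>k. Lp_int p (lebesgue_on \<Omega>) (\<lambda>x. \<psi> k x - v x)) \<longlonglongrightarrow> 0" "(\<lambda>k. Lp_int p (lebesgue_on \<Omega>) (\<lambda>x. grad (\<psi> k) x - h x)) \<longlonglongrightarrow> 0"
    using sobolev_pair_sequence[OF assms(2)] by blast
  note lp = sobolev_pair_Lp[OF assms(1)] sobolev_pair_Lp[OF assms(2)]
    sobolev_pair_Lp[OF test_function_sobolev_pair[OF \<phi>(1)]] sobolev_pair_Lp[OF test_function_sobolev_pair[OF \<psi>(1)]]
  have sum0: "(\<lambda>k. Lp_int p (lebesgue_on \<Omega>) (\<lambda>x. a k x + b k x)) \<longlonglongrightarrow> 0"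
    if "\<And>k. Lp_fun p (lebesgue_on \<Omega>) (a k)" "\<And>k. Lp_fun p (lebesgue_on \<Omega>) (b k)" "(\<lambda>k. Lp_int p (lebesgue_on \<Omega>) (a k)) \<longlonglongrightarrow> 0" "(\<lambda>k. Lp_int p (lebesgue_on \<Omega>) (b k)) \<longlonglongrightarrow> 0"
    for a b :: "nat \<Rightarrow> real^'n \<Rightarrow> 'c::euclidean_space"
  proof (rule real_tendsto_sandwich[OF _ _ tendsto_const])
    show "eventually (\<lambda>k. Lp_int p (lebesgue_on \<Omega>) (\<lambda>x. a k x + b k x) \<le> 2 powr (p - 1) * (Lp_int p (lebesgue_on \<Omega>) (a k) + Lp_int p (lebesgue_on \<Omega>) (b k))) sequentially"
      using p that by (intro always_eventually allI Lp_int_add_le) auto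
    show "(\<lambda>k. 2 powr (p - 1) * (Lp_int p (lebesgue_on \<Omega>) (a k) + Lp_int p (lebesgue_on \<Omega>) (b k))) \<longlonglongrightarrow> 0"
      using tendsto_mult_right_zero[OF tendsto_add_zero[OF that(3,4)]] .
  qed simp
  show ?thesis
  proof (rule sobolev_pairI)
    show "Lp_fun p (lebesgue_on \<Omega>) (\<lambda>x. u x + v x)" "Lp_fun p (lebesgue_on \<Omega>) (\<lambda>x. g x + h x)"
      using p lp by (auto intro!: Lp_fun_add)
    show "sobolev_pair p \<Omega> (\<lambda>x. \<phi> k x + \<psi> k x) (grad (\<lambda>x. \<phi> k x + \<psi> k x))" for k
      by (intro test_function_sobolev_pair test_function_add \<phi> \<psi>)
    have 1: "(\<lambda>x. \<phi> k x + \<psi> k x - (u x + v x)) = (\<lambda>x. (\<phi> k x - u x) + (\<psi> k x - v x))" for k by auto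
    have 2: "(\<lambda>x. grad (\<lambda>x. \<phi> k x + \<psi> k x) x - (g x + h x)) = (\<lambda>x. (grad (\<phi> k) x - g x) + (grad (\<psi> k) x - h x))" for k
      by (auto simp: grad_add[OF test_function_smooth[OF \<phi>(1)] test_function_smooth[OF \<psi>(1)]])
    show "(\<lambda>k. Lp_int p (lebesgue_on \<Omega>) (\<lambda>x. \<phi> k x + \<psi> k x - (u x + v x))) \<longlonglongrightarrow> 0"
      unfolding 1 using p lp by (intro sum0 Lp_fun_diff \<phi> \<psi>) auto
    show "(\<lambda>k. Lp_int p (lebesgue_on \<Omega>) (\<lambda>x. grad (\<lambda>x. \<phi> k x + \<psi> k x) x - (g x + h x))) \<longlonglongrightarrow> 0"
      unfolding 2 using p lp by (intro sum0 Lp_fun_diff \<phi> \<psi>) auto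
  qed
qed

lemma sobolev_pair_diff:
  assumes "sobolev_pair p \<Omega> u g" "sobolev_pair p \<Omega> v h"
  shows "sobolev_pair p \<Omega> (\<lambda>x. u x - v x) (\<lambda>x. g x - h x)"
  using sobolev_pair_add[OF assms(1) sobolev_pair_scale[OF assms(2), of "- 1"]] by simp

section \<open>Comparison with the space \<open>W1p_0\<close>\<close>

lemma weak_gradient_AE_eq:
  assumes "is_weak_gradient \<Omega> u g"
  shows "AE x in lebesgue_on \<Omega>. weak_gradient \<Omega> u x = g x"
proof -
  have "is_weak_gradient \<Omega> u (weak_gradient \<Omega> u)"
    unfolding weak_gradient_def by (rule someI[of "is_weak_gradient \<Omega> u", OF assms])
  from weak_gradient_unique_AE[OF \<Omega> this assms] show ?thesis by simp
qed

lemma Lp_weak_gradient: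
  assumes "is_weak_gradient \<Omega> u g" "Lp_fun p (lebesgue_on \<Omega>) g"
  shows "Lp_fun p (lebesgue_on \<Omega>) (weak_gradient \<Omega> u)" "Lp_int p (lebesgue_on \<Omega>) (weak_gradient \<Omega> u) = Lp_int p (lebesgue_on \<Omega>) g"
proof -
  have ae: "AE x in lebesgue_on \<Omega>. g x = weak_gradient \<Omega> u x"
    using weak_gradient_AE_eq[OF assms(1)] by eventually_elim simp
  have m: "weak_gradient \<Omega> u \<in> borel_measurable (lebesgue_on \<Omega>)"
    by (rule AE_eq_measurable_lebesgue_on[OF domain_sets(1)[OF \<Omega>] Lp_fun_measurable[OF assms(2)] ae])
  show "Lp_fun p (lebesgue_on \<Omega>) (weak_gradient \<Omega> u)" by (rule Lp_fun_cong_AE[OF assms(2) m ae])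
  show "Lp_int p (lebesgue_on \<Omega>) (weak_gradient \<Omega> u) = Lp_int p (lebesgue_on \<Omega>) g"
    by (rule Lp_int_cong_AE[OF Lp_fun_measurable[OF assms(2)] m ae, symmetric])
qed

lemma W1p_norm_Lp:
  assumes "is_weak_gradient \<Omega> u g" "Lp_fun p (lebesgue_on \<Omega>) g"
  shows "W1p_norm p \<Omega> u = (Lp_int p (lebesgue_on \<Omega>) u + Lp_int p (lebesgue_on \<Omega>) g) powr (1 / p)"
  unfolding W1p_norm_def Lp_weak_gradient(2)[OF assms, symmetric] by (simp add: Lp_int_def)

lemma sobolev_pair_imp_W1p_0:
  assumes "sobolev_pair p \<Omega> u g"
  shows "u \<in> W1p_0 p \<Omega>" "AE x in lebesgue_on \<Omega>. weak_gradient \<Omega> u x = g x" "Lp_fun p (lebesgue_on \<Omega>) (weak_gradient \<Omega> u)"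
proof -
  note wg = sobolev_pair_is_weak_gradient[OF \<Omega> p assms] and lp = sobolev_pair_Lp[OF assms]
  show "AE x in lebesgue_on \<Omega>. weak_gradient \<Omega> u x = g x" by (rule weak_gradient_AE_eq[OF wg])
  show lpw: "Lp_fun p (lebesgue_on \<Omega>) (weak_gradient \<Omega> u)" by (rule Lp_weak_gradient(1)[OF wg lp(2)])
  have "\<exists>\<phi>. test_function \<Omega> \<phi> \<and> W1p_norm p \<Omega> (\<lambda>x. u x - \<phi> x) < \<epsilon>" if "0 < \<epsilon>" for \<epsilon>
  proof -
    \<comment> \<open>The norm is the root of a sum of two integrals, so each of them may use half
      of \<open>\<epsilon> powr p\<close>.\<close>
    have "0 < \<epsilon> powr p / 2" using that by simp
    then obtain \<phi> where \<phi>: "test_function \<Omega> \<phi>" "Lp_int p (lebesgue_on \<Omega>) (\<lambda>x. u x - \<phi> x) < \<epsilon> powr p / 2"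
      "Lp_int p (lebesgue_on \<Omega>) (\<lambda>x. g x - grad \<phi> x) < \<epsilon> powr p / 2"
      using assms unfolding sobolev_pair_def by blast
    have d: "sobolev_pair p \<Omega> (\<lambda>x. u x - \<phi> x) (\<lambda>x. g x - grad \<phi> x)"
      by (rule sobolev_pair_diff[OF assms test_function_sobolev_pair[OF \<phi>(1)]])
    have "W1p_norm p \<Omega> (\<lambda>x. u x - \<phi> x)
        = (Lp_int p (lebesgue_on \<Omega>) (\<lambda>x. u x - \<phi> x) + Lp_int p (lebesgue_on \<Omega>) (\<lambda>x. g x - grad \<phi> x)) powr (1 / p)"
      by (rule W1p_norm_Lp[OF sobolev_pair_is_weak_gradient[OF \<Omega> p d] sobolev_pair_Lp(2)[OF d]])
    also have "\<dots> < (\<epsilon> powr p) powr (1 / p)"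
      using \<phi>(2,3) p by (intro powr_less_mono2) (auto intro: add_nonneg_nonneg)
    also have "\<dots> = \<epsilon>" using that p by (simp add: powr_powr)
    finally show ?thesis using \<phi>(1) by blast
  qed
  then show "u \<in> W1p_0 p \<Omega>"
    using lp(1) lpw wg unfolding W1p_0_def W1p_def in_Lp_def Lp_fun_def by blast
qed

text \<open>The norm of \<open>u - \<phi>\<close> refers to a representative chosen for the
  difference. That it equals the difference of the gradients almost everywhere follows from
  uniqueness of weak gradients.\<close>

lemma W1p_0_imp_sobolev_pair:
  assumes "u \<in> W1p_0 p \<Omega>"
  shows "sobolev_pair p \<Omega> u (weak_gradient \<Omega> u)"
proof -
  have u: "Lp_fun p (lebesgue_on \<Omega>) u" "Lp_fun p (lebesgue_on \<Omega>) (weak_gradient \<Omega> u)" and ex: "\<exists>g. is_weak_gradient \<Omega> u g"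
    and approx: "\<And>\<epsilon>. 0 < \<epsilon> \<Longrightarrow> \<exists>\<phi>. test_function \<Omega> \<phi> \<and> W1p_norm p \<Omega> (\<lambda>x. u x - \<phi> x) < \<epsilon>"
    using assms unfolding W1p_0_def W1p_def in_Lp_def Lp_fun_def by blast+
  have wu: "is_weak_gradient \<Omega> u (weak_gradient \<Omega> u)"
    unfolding weak_gradient_def by (rule someI_ex[OF ex])
  have "\<exists>\<phi>. test_function \<Omega> \<phi> \<and> Lp_int p (lebesgue_on \<Omega>) (\<lambda>x. u x - \<phi> x) < \<epsilon> \<and> Lp_int p (lebesgue_on \<Omega>) (\<lambda>x. weak_gradient \<Omega> u x - grad \<phi> x) < \<epsilon>"
    if "0 < \<epsilon>" for \<epsilon>
  proof -
    have "0 < \<epsilon> powr (1 / p)" using that by simp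
    then obtain \<phi> where \<phi>: "test_function \<Omega> \<phi>" "W1p_norm p \<Omega> (\<lambda>x. u x - \<phi> x) < \<epsilon> powr (1 / p)"
      using approx by blast
    note w\<phi> = sobolev_pair_is_weak_gradient[OF \<Omega> p test_function_sobolev_pair[OF \<phi>(1)]]
    note loc = wu[unfolded is_weak_gradient_def, THEN conjunct1] wu[unfolded is_weak_gradient_def, THEN conjunct2, THEN conjunct1]
      w\<phi>[unfolded is_weak_gradient_def, THEN conjunct1] w\<phi>[unfolded is_weak_gradient_def, THEN conjunct2, THEN conjunct1]
    have lpd: "Lp_fun p (lebesgue_on \<Omega>) (\<lambda>x. weak_gradient \<Omega> u x - grad \<phi> x)" "Lp_fun p (lebesgue_on \<Omega>) (\<lambda>x. u x - \<phi> x)"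
      using p u sobolev_pair_Lp[OF test_function_sobolev_pair[OF \<phi>(1)]] by (auto intro!: Lp_fun_diff)
    have "is_weak_gradient \<Omega> (\<lambda>x. u x - \<phi> x) (\<lambda>x. weak_gradient \<Omega> u x - grad \<phi> x)"
      unfolding is_weak_gradient_def
    proof (intro conjI allI impI)
      show "locally_integrable \<Omega> (\<lambda>x. u x - \<phi> x)" "locally_integrable \<Omega> (\<lambda>x. weak_gradient \<Omega> u x - grad \<phi> x)"
        using p lpd by (auto intro!: Lp_locally_integrable[OF \<Omega>, of p])
      fix \<psi> i assume \<psi>: "test_function \<Omega> \<psi>"
      note ints = integrable_times_test(2)[OF \<Omega> loc(1) \<psi>, of i] integrable_times_test(2)[OF \<Omega> loc(3) \<psi>, of i]
        integrable_times_test(1)[OF \<Omega> locally_integrable_component[OF \<Omega> loc(2)] \<psi>, of i]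
        integrable_times_test(1)[OF \<Omega> locally_integrable_component[OF \<Omega> loc(4)] \<psi>, of i]
      have "(LINT x|lebesgue_on \<Omega>. u x * partial_deriv i \<psi> x) = - (LINT x|lebesgue_on \<Omega>. weak_gradient \<Omega> u x $ i * \<psi> x)"
        "(LINT x|lebesgue_on \<Omega>. \<phi> x * partial_deriv i \<psi> x) = - (LINT x|lebesgue_on \<Omega>. grad \<phi> x $ i * \<psi> x)"
        using wu w\<phi> \<psi> unfolding is_weak_gradient_def by blast+
      then show "(LINT x|lebesgue_on \<Omega>. (u x - \<phi> x) * partial_deriv i \<psi> x) = - (LINT x|lebesgue_on \<Omega>. (weak_gradient \<Omega> u x - grad \<phi> x) $ i * \<psi> x)"
        using ints by (simp add: left_diff_distrib)
    qed
    from W1p_norm_Lp[OF this lpd(1)] \<phi>(2)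
    have "(Lp_int p (lebesgue_on \<Omega>) (\<lambda>x. u x - \<phi> x) + Lp_int p (lebesgue_on \<Omega>) (\<lambda>x. weak_gradient \<Omega> u x - grad \<phi> x)) powr (1 / p) < \<epsilon> powr (1 / p)"
      by simp
    then have "Lp_int p (lebesgue_on \<Omega>) (\<lambda>x. u x - \<phi> x) + Lp_int p (lebesgue_on \<Omega>) (\<lambda>x. weak_gradient \<Omega> u x - grad \<phi> x) < \<epsilon>"
      using powr_mono2[of "1 / p" \<epsilon> "Lp_int p (lebesgue_on \<Omega>) (\<lambda>x. u x - \<phi> x) + Lp_int p (lebesgue_on \<Omega>) (\<lambda>x. weak_gradient \<Omega> u x - grad \<phi> x)"]
        p less_imp_le[OF that] by (meson divide_nonneg_pos less_trans not_le zero_less_one zero_le_one)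
    then show ?thesis
      using \<phi>(1) Lp_int_nonneg[of p "lebesgue_on \<Omega>" "\<lambda>x. u x - \<phi> x"] Lp_int_nonneg[of p "lebesgue_on \<Omega>" "\<lambda>x. weak_gradient \<Omega> u x - grad \<phi> x"]
      by (intro exI[of _ \<phi>]) linarith
  qed
  then show ?thesis using u unfolding sobolev_pair_def by blast
qed

lemma gradient_pairs_sobolev:
  assumes "1 < q" "q < p"
  shows "gradient_pairs (lebesgue_on \<Omega>) p q (sobolev_pair p \<Omega>)"
proof (rule gradient_pairs.intro)
  fix us :: "nat \<Rightarrow> real^'n \<Rightarrow> real" and gs u g
  assume "\<And>k. sobolev_pair p \<Omega> (us k) (gs k)" "Lp_fun p (lebesgue_on \<Omega>) u" "Lp_fun p (lebesgue_on \<Omega>) g"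
    "(\<lambda>k. Lp_int p (lebesgue_on \<Omega>) (\<lambda>x. us k x - u x)) \<longlonglongrightarrow> 0" "(\<lambda>k. Lp_int p (lebesgue_on \<Omega>) (\<lambda>x. gs k x - g x)) \<longlonglongrightarrow> 0"
  then show "sobolev_pair p \<Omega> u g" by (intro sobolev_pairI[of u g us gs])
qed (fact finite_measure_domain[OF \<Omega>] assms sobolev_pair_Lp sobolev_pair_scale sobolev_pair_add)+

end

context
  fixes \<Omega> :: "(real^'n::finite) set" and R p q r :: real
  assumes \<Omega>: "open \<Omega>" "\<Omega> \<subseteq> cball 0 R" and R: "0 \<le> R"
    and exps: "1 < q" "q < p" "p < r" "p < real CARD('n)" "r < sobolev_exponent CARD('n) p"
begin

lemma p_gt_1: "1 < p"
  using exps by simp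

interpretation gradient_pairs "lebesgue_on \<Omega>" p q "sobolev_pair p \<Omega>"
  by (rule gradient_pairs_sobolev[OF \<Omega> p_gt_1 exps(1,2)])

section \<open>Embedding, compactness and absolute values for Sobolev pairs\<close>

lemma test_function_embedding:
  assumes "0 < s" "s < sobolev_exponent CARD('n) p"
  shows "\<exists>K>0. \<forall>\<phi>. test_function \<Omega> \<phi> \<longrightarrow> Lp_int s (lebesgue_on \<Omega>) \<phi> \<le> K * Lp_int p (lebesgue_on \<Omega>) (grad \<phi>) powr (s / p)"
proof -
  obtain K where K: "0 < K" "\<And>f :: real^'n \<Rightarrow> real. smooth_bounded_support R f \<Longrightarrow>
      (LINT x|lborel. \<bar>f x\<bar> powr s) \<le> K * (LINT x|lborel. norm (grad f x) powr p) powr (s / p)"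
    using Sobolev_embedding[OF R p_gt_1 exps(4) assms] by blast
  have "Lp_int s (lebesgue_on \<Omega>) \<phi> \<le> K * Lp_int p (lebesgue_on \<Omega>) (grad \<phi>) powr (s / p)" if \<phi>: "test_function \<Omega> \<phi>" for \<phi>
    using K(2)[OF test_function_sbs[OF \<Omega> \<phi>]] test_function_Lp(3)[OF \<Omega> \<phi> assms(1)] test_function_Lp(4)[OF \<Omega> \<phi>, of p] p_gt_1
    by simp
  then show ?thesis using K(1) by blast
qed

text \<open>The bound for test functions survives the limit by Fatou's lemma along an almost
  everywhere convergent subsequence.\<close>

lemma sobolev_pair_embedding:
  assumes "0 < s" "s < sobolev_exponent CARD('n) p"
  shows "\<exists>K>0. \<forall>u g. sobolev_pair p \<Omega> u g \<longrightarrow> Lp_fun s (lebesgue_on \<Omega>) u \<and> Lp_int s (lebesgue_on \<Omega>) u \<le> K * Lp_int p (lebesgue_on \<Omega>) g powr (s / p)"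
proof -
  obtain K where K: "0 < K" "\<And>\<phi>. test_function \<Omega> \<phi> \<Longrightarrow> Lp_int s (lebesgue_on \<Omega>) \<phi> \<le> K * Lp_int p (lebesgue_on \<Omega>) (grad \<phi>) powr (s / p)"
    using test_function_embedding[OF assms] by blast
  have p0: "0 < p" using p_gt_1 by simp
  have "Lp_fun s (lebesgue_on \<Omega>) u \<and> Lp_int s (lebesgue_on \<Omega>) u \<le> K * Lp_int p (lebesgue_on \<Omega>) g powr (s / p)" if ug: "sobolev_pair p \<Omega> u g" for u g
  proof -
    obtain \<phi> where \<phi>: "\<And>k::nat. test_function \<Omega> (\<phi> k)"
      "(\<lambda>k. Lp_int p (lebesgue_on \<Omega>) (\<lambda>x. \<phi> k x - u x)) \<longlonglongrightarrow> 0" "(\<lambda>k. Lp_int p (lebesgue_on \<Omega>) (\<lambda>x. grad (\<phi> k) x - g x)) \<longlonglongrightarrow> 0"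
      using sobolev_pair_sequence[OF \<Omega> p_gt_1 ug] by blast
    note lp = test_function_Lp(1,2)[OF \<Omega> \<phi>(1) p0] V_Lp[OF ug]
    obtain \<sigma> where \<sigma>: "strict_mono (\<sigma> :: nat \<Rightarrow> nat)" "AE x in lebesgue_on \<Omega>. (\<lambda>k. \<phi> (\<sigma> k) x) \<longlonglongrightarrow> u x"
      by (rule Lp_AE_convergent_subseq[OF p0 lp(1) lp(3) \<phi>(2)])
    have "(\<lambda>k. Lp_int p (lebesgue_on \<Omega>) (grad (\<phi> k))) \<longlonglongrightarrow> Lp_int p (lebesgue_on \<Omega>) g"
      by (rule Lp_int_continuous[OF p0 lp(2) lp(4) \<phi>(3)])
    from LIMSEQ_subseq_LIMSEQ[OF this \<sigma>(1)]
    have "(\<lambda>k. Lp_int p (lebesgue_on \<Omega>) (grad (\<phi> (\<sigma> k)))) \<longlonglongrightarrow> Lp_int p (lebesgue_on \<Omega>) g" by (simp add: o_def)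
    then have "(\<lambda>k. K * Lp_int p (lebesgue_on \<Omega>) (grad (\<phi> (\<sigma> k))) powr (s / p)) \<longlonglongrightarrow> K * Lp_int p (lebesgue_on \<Omega>) g powr (s / p)"
      using assms p0 by (intro tendsto_mult tendsto_const tendsto_powr') auto
    from Lp_int_Fatou[OF assms(1) test_function_Lp(1)[OF \<Omega> \<phi>(1) assms(1)] Lp_fun_measurable[OF lp(3)] \<sigma>(2) K(2)[OF \<phi>(1)] this]
    show ?thesis by blast
  qed
  then show ?thesis using K(1) by blast
qed

text \<open>The functions are replaced by test functions whose gradients differ by errors tending to
  0. A subsequence of these is Cauchy in L^p, and interpolation against a bounded higher power makes
  it Cauchy in L^r.\<close>

lemma sobolev_pair_compact:
  assumes V: "\<And>k::nat. sobolev_pair p \<Omega> (us k) (gs k)" and L: "\<And>k. Lp_int p (lebesgue_on \<Omega>) (gs k) \<le> L"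
  shows "\<exists>\<sigma> u. strict_mono (\<sigma> :: nat \<Rightarrow> nat) \<and> Lp_fun r (lebesgue_on \<Omega>) u \<and> (\<lambda>k. Lp_int r (lebesgue_on \<Omega>) (\<lambda>x. us (\<sigma> k) x - u x)) \<longlonglongrightarrow> 0"
proof -
  have p0: "0 < p" "1 \<le> p" "0 < r" "1 \<le> r" using exps by auto
  have "\<forall>k. \<exists>\<phi>. test_function \<Omega> \<phi> \<and> Lp_int p (lebesgue_on \<Omega>) (\<lambda>x. us k x - \<phi> x) < 1 / real (Suc k) \<and>
        Lp_int p (lebesgue_on \<Omega>) (\<lambda>x. gs k x - grad \<phi> x) < 1 / real (Suc k)"
    using V unfolding sobolev_pair_def by simp
  from choice[OF this] obtain \<phi> where "\<forall>k. test_function \<Omega> (\<phi> k) \<and> Lp_int p (lebesgue_on \<Omega>) (\<lambda>x. us k x - \<phi> k x) < 1 / real (Suc k) \<and>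
        Lp_int p (lebesgue_on \<Omega>) (\<lambda>x. gs k x - grad (\<phi> k) x) < 1 / real (Suc k)" by (elim exE)
  then have \<phi>: "\<And>k. test_function \<Omega> (\<phi> k)" "\<And>k. Lp_int p (lebesgue_on \<Omega>) (\<lambda>x. gs k x - grad (\<phi> k) x) < 1 / real (Suc k)"
    by simp_all
  have V\<phi>: "sobolev_pair p \<Omega> (\<phi> k) (grad (\<phi> k))" for k by (rule test_function_sobolev_pair[OF \<Omega> p_gt_1 \<phi>(1)])
  have Vd: "sobolev_pair p \<Omega> (\<lambda>x. us k x - \<phi> k x) (\<lambda>x. gs k x - grad (\<phi> k) x)" for k
    by (rule V_diff[OF V V\<phi>])
  have g0: "(\<lambda>k. Lp_int p (lebesgue_on \<Omega>) (\<lambda>x. gs k x - grad (\<phi> k) x)) \<longlonglongrightarrow> 0"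
    using \<phi>(2) by (intro LIMSEQ_norm_0) simp
  define B where "B = 2 powr (p - 1) * (L + 1)"
  have B: "Lp_int p (lebesgue_on \<Omega>) (grad (\<phi> k)) \<le> B" for k
  proof -
    have "Lp_int p (lebesgue_on \<Omega>) (grad (\<phi> k)) = Lp_int p (lebesgue_on \<Omega>) (\<lambda>x. gs k x - (gs k x - grad (\<phi> k) x))" by simp
    also have "\<dots> \<le> 2 powr (p - 1) * (Lp_int p (lebesgue_on \<Omega>) (gs k) + Lp_int p (lebesgue_on \<Omega>) (\<lambda>x. gs k x - grad (\<phi> k) x))"
      by (rule Lp_int_diff_le[OF p0(2) V_Lp(2)[OF V] V_Lp(2)[OF Vd]])
    also have "\<dots> \<le> B"
    proof -
      have "Lp_int p (lebesgue_on \<Omega>) (\<lambda>x. gs k x - grad (\<phi> k) x) \<le> 1"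
        by (rule order_trans[OF less_imp_le[OF \<phi>(2)]]) simp
      then show ?thesis unfolding B_def by (intro mult_left_mono add_mono L) simp_all
    qed
    finally show ?thesis .
  qed
  have B0: "0 \<le> B" using order_trans[OF Lp_int_nonneg B] .
  have Bl: "(LINT x|lborel. norm (grad (\<phi> k) x) powr p) \<le> B" for k
    using B test_function_Lp(4)[OF \<Omega> \<phi>(1) p0(1)] by simp
  have "\<exists>\<sigma>. strict_mono (\<sigma> :: nat \<Rightarrow> nat) \<and> (\<forall>e>0. (\<exists>N. \<forall>k\<ge>N. \<forall>l\<ge>N. (LINT x|lborel. \<bar>\<phi> (\<sigma> k) x - \<phi> (\<sigma> l) x\<bar> powr p) \<le> e))"
    by (rule Cauchy_subsequence[where f = \<phi>, OF R p_gt_1 test_function_sbs[OF \<Omega> \<phi>(1)] Bl]) blast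
  then obtain \<sigma> where \<sigma>: "strict_mono (\<sigma> :: nat \<Rightarrow> nat)" and Cauchy: "\<forall>e>0. (\<exists>N. \<forall>k\<ge>N. \<forall>l\<ge>N. (LINT x|lborel. \<bar>\<phi> (\<sigma> k) x - \<phi> (\<sigma> l) x\<bar> powr p) \<le> e)"
    by blast
  \<comment> \<open>Lies strictly between \<open>r\<close> and the critical exponent, so the
    embedding still bounds the \<open>t\<close>-integrals of the differences.\<close>
  define t where "t = (r + sobolev_exponent CARD('n) p) / 2"
  have t: "r < t" "t < sobolev_exponent CARD('n) p" "0 < t" using exps by (auto simp: t_def)
  obtain K where K: "0 < K" "\<And>\<psi>. test_function \<Omega> \<psi> \<Longrightarrow> Lp_int t (lebesgue_on \<Omega>) \<psi> \<le> K * Lp_int p (lebesgue_on \<Omega>) (grad \<psi>) powr (t / p)"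
    using test_function_embedding[OF t(3,2)] by blast
  define B' where "B' = K * (2 powr (p - 1) * (B + B)) powr (t / p) + 1"
  have B': "0 < B'" using K(1) by (simp add: B'_def add_nonneg_pos)
  have td: "test_function \<Omega> (\<lambda>x. \<phi> k x - \<phi> l x)" for k l by (intro test_function_diff \<phi>)
  have tB: "Lp_int t (lebesgue_on \<Omega>) (\<lambda>x. \<phi> k x - \<phi> l x) \<le> B'" for k l
  proof -
    have "Lp_int p (lebesgue_on \<Omega>) (grad (\<lambda>x. \<phi> k x - \<phi> l x)) = Lp_int p (lebesgue_on \<Omega>) (\<lambda>x. grad (\<phi> k) x - grad (\<phi> l) x)"
      by (simp add: Lp_int_def grad_diff[OF test_function_smooth[OF \<phi>(1)] test_function_smooth[OF \<phi>(1)]])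
    also have "\<dots> \<le> 2 powr (p - 1) * (Lp_int p (lebesgue_on \<Omega>) (grad (\<phi> k)) + Lp_int p (lebesgue_on \<Omega>) (grad (\<phi> l)))"
      by (rule Lp_int_diff_le[OF p0(2) V_Lp(2)[OF V\<phi>] V_Lp(2)[OF V\<phi>]])
    also have "\<dots> \<le> 2 powr (p - 1) * (B + B)" by (intro mult_left_mono add_mono B) auto
    finally have "Lp_int p (lebesgue_on \<Omega>) (grad (\<lambda>x. \<phi> k x - \<phi> l x)) powr (t / p) \<le> (2 powr (p - 1) * (B + B)) powr (t / p)"
      using t p0 by (intro powr_mono2) auto
    then have "K * Lp_int p (lebesgue_on \<Omega>) (grad (\<lambda>x. \<phi> k x - \<phi> l x)) powr (t / p) \<le> B' - 1"
      unfolding B'_def using K(1) by simp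
    then show ?thesis using K(2)[OF td[of k l]] by linarith
  qed
  have Cr: "\<exists>N. \<forall>k\<ge>N. \<forall>l\<ge>N. Lp_int r (lebesgue_on \<Omega>) (\<lambda>x. \<phi> (\<sigma> k) x - \<phi> (\<sigma> l) x) \<le> e" if e: "0 < e" for e
  proof -
    have e': "0 < e / 2 / B'" using e B' by simp
    obtain C where C: "0 < C" "\<And>f :: real^'n \<Rightarrow> real. Lp_fun p (lebesgue_on \<Omega>) f \<Longrightarrow> Lp_fun t (lebesgue_on \<Omega>) f \<Longrightarrow>
        Lp_int r (lebesgue_on \<Omega>) f \<le> e / 2 / B' * Lp_int t (lebesgue_on \<Omega>) f + C * Lp_int p (lebesgue_on \<Omega>) f"
      using Lp_int_interpolate[OF p0(1) exps(3) t(1) e'] by metis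
    obtain N where N: "\<And>k l. N \<le> k \<Longrightarrow> N \<le> l \<Longrightarrow> (LINT x|lborel. \<bar>\<phi> (\<sigma> k) x - \<phi> (\<sigma> l) x\<bar> powr p) \<le> e / 2 / C"
      using Cauchy[rule_format, of "e / 2 / C"] e C(1) by auto
    have "Lp_int r (lebesgue_on \<Omega>) (\<lambda>x. \<phi> (\<sigma> k) x - \<phi> (\<sigma> l) x) \<le> e" if "k \<ge> N" "l \<ge> N" for k l
    proof -
      note td' = td[of "\<sigma> k" "\<sigma> l"]
      have "C * Lp_int p (lebesgue_on \<Omega>) (\<lambda>x. \<phi> (\<sigma> k) x - \<phi> (\<sigma> l) x) \<le> C * (e / 2 / C)"
        unfolding test_function_Lp(3)[OF \<Omega> td' p0(1)] using C(1) by (intro mult_left_mono N that) auto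
      also have "\<dots> = e / 2" using C(1) by simp
      finally have 1: "C * Lp_int p (lebesgue_on \<Omega>) (\<lambda>x. \<phi> (\<sigma> k) x - \<phi> (\<sigma> l) x) \<le> e / 2" .
      have "e / 2 / B' * Lp_int t (lebesgue_on \<Omega>) (\<lambda>x. \<phi> (\<sigma> k) x - \<phi> (\<sigma> l) x) \<le> e / 2 / B' * B'"
        using e' by (intro mult_left_mono tB) auto
      also have "\<dots> = e / 2" using B' by simp
      finally have 2: "e / 2 / B' * Lp_int t (lebesgue_on \<Omega>) (\<lambda>x. \<phi> (\<sigma> k) x - \<phi> (\<sigma> l) x) \<le> e / 2" .
      show ?thesis
        using C(2)[OF test_function_Lp(1)[OF \<Omega> td' p0(1)] test_function_Lp(1)[OF \<Omega> td' t(3)]] 1 2 by linarith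
    qed
    then show ?thesis by blast
  qed
  obtain u where u: "Lp_fun r (lebesgue_on \<Omega>) u" "(\<lambda>k. Lp_int r (lebesgue_on \<Omega>) (\<lambda>x. \<phi> (\<sigma> k) x - u x)) \<longlonglongrightarrow> 0"
    by (rule Lp_complete[OF p0(4) test_function_Lp(1)[OF \<Omega> \<phi>(1) p0(3)], of \<sigma>, OF Cr])
  obtain S where S: "0 < S" "\<And>v h. sobolev_pair p \<Omega> v h \<Longrightarrow> Lp_fun r (lebesgue_on \<Omega>) v \<and> Lp_int r (lebesgue_on \<Omega>) v \<le> S * Lp_int p (lebesgue_on \<Omega>) h powr (r / p)"
    using sobolev_pair_embedding[OF p0(3) exps(5)] by blast
  have "(\<lambda>k. S * Lp_int p (lebesgue_on \<Omega>) (\<lambda>x. gs k x - grad (\<phi> k) x) powr (r / p)) \<longlonglongrightarrow> S * 0 powr (r / p)"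
    using p0 by (intro tendsto_mult tendsto_const tendsto_powr'[OF g0]) auto
  then have lim: "(\<lambda>k. S * Lp_int p (lebesgue_on \<Omega>) (\<lambda>x. gs k x - grad (\<phi> k) x) powr (r / p)) \<longlonglongrightarrow> 0" by simp
  \<comment> \<open>The embedding is applied to the difference pair, whose gradient energy tends to
    0.\<close>
  have "(\<lambda>k. Lp_int r (lebesgue_on \<Omega>) (\<lambda>x. us k x - \<phi> k x)) \<longlonglongrightarrow> 0"
    using S(2)[OF Vd] by (intro tendsto_sandwich[OF _ _ tendsto_const lim]) auto
  from LIMSEQ_subseq_LIMSEQ[OF this \<sigma>]
  have d0: "(\<lambda>k. Lp_int r (lebesgue_on \<Omega>) (\<lambda>x. us (\<sigma> k) x - \<phi> (\<sigma> k) x)) \<longlonglongrightarrow> 0" by (simp add: o_def)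
  have "(\<lambda>k. Lp_int r (lebesgue_on \<Omega>) (\<lambda>x. us (\<sigma> k) x - u x)) \<longlonglongrightarrow> 0"
  proof (rule tendsto_sandwich[OF _ _ tendsto_const])
    show "eventually (\<lambda>k. Lp_int r (lebesgue_on \<Omega>) (\<lambda>x. us (\<sigma> k) x - u x) \<le> 2 powr (r - 1) *
       (Lp_int r (lebesgue_on \<Omega>) (\<lambda>x. us (\<sigma> k) x - \<phi> (\<sigma> k) x) + Lp_int r (lebesgue_on \<Omega>) (\<lambda>x. \<phi> (\<sigma> k) x - u x))) sequentially"
      using S(2)[OF V] S(2)[OF V\<phi>] u(1) p0 by (intro always_eventually allI Lp_int_triangle) auto
    show "(\<lambda>k. 2 powr (r - 1) * (Lp_int r (lebesgue_on \<Omega>) (\<lambda>x. us (\<sigma> k) x - \<phi> (\<sigma> k) x) + Lp_int r (lebesgue_on \<Omega>) (\<lambda>x. \<phi> (\<sigma> k) x - u x))) \<longlonglongrightarrow> 0"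
      by (rule tendsto_mult_right_zero[OF tendsto_add_zero[OF d0 u(2)]])
  qed simp
  with \<sigma> u(1) show ?thesis by blast
qed

text \<open>The absolute value is approximated by \<open>sqrt (\<phi>\<^sup>2 + \<eta>\<^sup>2) - \<eta>\<close>, which has the same support.\<close>

lemma smooth_abs:
  assumes "test_function \<Omega> \<phi>" "0 < \<eta>"
  defines "v \<equiv> \<lambda>x. sqrt ((\<phi> x)\<^sup>2 + \<eta>\<^sup>2) - \<eta>"
  shows "test_function \<Omega> v" "\<bar>v x - \<bar>\<phi> x\<bar>\<bar> \<le> \<eta>" "norm (grad v x) \<le> norm (grad \<phi> x)"
proof -
  have sm: "smooth \<phi>" by (rule test_function_smooth[OF assms(1)])
  have smv: "smooth v" unfolding v_def using assms(2) by (intro smooth_diff smooth_const smooth_sqrt sm) auto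
  show "test_function \<Omega> v"
  proof (rule test_functionI[OF assms(1) smv])
    have "{x. v x \<noteq> 0} \<subseteq> {x. \<phi> x \<noteq> 0}" using assms(2) by (auto simp: v_def)
    then show "{x. v x \<noteq> 0} \<subseteq> closure {x. \<phi> x \<noteq> 0}" using closure_subset by blast
  qed
  have "sqrt ((\<phi> x)\<^sup>2 + \<eta>\<^sup>2) \<le> \<bar>\<phi> x\<bar> + \<eta>" using sqrt_sum_squares_le_sum_abs[of "\<phi> x" \<eta>] assms(2) by simp
  moreover have "\<bar>\<phi> x\<bar> \<le> sqrt ((\<phi> x)\<^sup>2 + \<eta>\<^sup>2)" by (rule real_le_rsqrt) simp
  ultimately show "\<bar>v x - \<bar>\<phi> x\<bar>\<bar> \<le> \<eta>" using assms(2) by (simp add: v_def abs_le_iff)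
  define s where "s = sqrt ((\<phi> x)\<^sup>2 + \<eta>\<^sup>2)"
  have s: "0 < s" "\<bar>\<phi> x\<bar> \<le> s"
    using assms(2) \<open>\<bar>\<phi> x\<bar> \<le> sqrt ((\<phi> x)\<^sup>2 + \<eta>\<^sup>2)\<close> by (auto simp: s_def add_nonneg_pos)
  have pos: "0 < (\<phi> x)\<^sup>2 + \<eta>\<^sup>2" using assms(2) by (simp add: add_nonneg_pos)
  have "((\<lambda>y. sqrt (y\<^sup>2 + \<eta>\<^sup>2) - \<eta>) has_real_derivative \<phi> x / s) (at (\<phi> x))"
    using pos by (auto intro!: derivative_eq_intros simp: s_def field_simps)
  from DERIV_compose_FDERIV[OF this grad_has_derivative[OF sm]]
  have "(v has_derivative (\<lambda>w. ((\<phi> x / s) *\<^sub>R grad \<phi> x) \<bullet> w)) (at x)"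
    by (simp add: v_def mult.commute)
  then have "grad v x = (\<phi> x / s) *\<^sub>R grad \<phi> x" by (rule grad_eqI)
  then have "norm (grad v x) = \<bar>\<phi> x\<bar> / s * norm (grad \<phi> x)" using s by simp
  also have "\<dots> \<le> 1 * norm (grad \<phi> x)" using s by (intro mult_right_mono) (auto simp: divide_le_eq)
  finally show "norm (grad v x) \<le> norm (grad \<phi> x)" by simp
qed

text \<open>The gradient of the absolute value is never computed: smooth approximants with no larger
  gradients are enough, and \<open>convex_limit\<close> supplies a gradient obeying the same
  bounds.\<close>

lemma sobolev_pair_abs:
  assumes ug: "sobolev_pair p \<Omega> u g"
  shows "\<exists>h. sobolev_pair p \<Omega> (\<lambda>x. \<bar>u x\<bar>) h \<and> Lp_int p (lebesgue_on \<Omega>) h \<le> Lp_int p (lebesgue_on \<Omega>) g \<and> Lp_int q (lebesgue_on \<Omega>) h \<le> Lp_int q (lebesgue_on \<Omega>) g"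
proof -
  have p0: "0 < p" "1 \<le> p" "0 < q" using exps by auto
  interpret finite_measure "lebesgue_on \<Omega>" by (rule finite_M)
  obtain \<phi> where \<phi>: "\<And>k::nat. test_function \<Omega> (\<phi> k)"
    "(\<lambda>k. Lp_int p (lebesgue_on \<Omega>) (\<lambda>x. \<phi> k x - u x)) \<longlonglongrightarrow> 0" "(\<lambda>k. Lp_int p (lebesgue_on \<Omega>) (\<lambda>x. grad (\<phi> k) x - g x)) \<longlonglongrightarrow> 0"
    using sobolev_pair_sequence[OF \<Omega> p_gt_1 ug] by blast
  note lp = test_function_Lp(1,2)[OF \<Omega> \<phi>(1) p0(1)] V_Lp[OF ug]
  have gp: "(\<lambda>k. Lp_int p (lebesgue_on \<Omega>) (grad (\<phi> k))) \<longlonglongrightarrow> Lp_int p (lebesgue_on \<Omega>) g"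
    by (rule Lp_int_continuous[OF p0(1) lp(2) lp(4) \<phi>(3)])
  have "(\<lambda>k. Lp_int q (lebesgue_on \<Omega>) (\<lambda>x. grad (\<phi> k) x - g x)) \<longlonglongrightarrow> 0"
    by (rule Lp_convergence_lower[OF finite_M p0(3) less_imp_le[OF exps(2)] Lp_fun_diff[OF p0(1) lp(2) lp(4)] \<phi>(3)])
  then have gq: "(\<lambda>k. Lp_int q (lebesgue_on \<Omega>) (grad (\<phi> k))) \<longlonglongrightarrow> Lp_int q (lebesgue_on \<Omega>) g"
    by (intro Lp_int_continuous[OF p0(3)] test_function_Lp(2)[OF \<Omega> \<phi>(1) p0(3)] V_Lq[OF ug])
  define m where "m = measure (lebesgue_on \<Omega>) (space (lebesgue_on \<Omega>))"
  have m: "0 \<le> m" by (simp add: m_def)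
  have absu: "Lp_fun p (lebesgue_on \<Omega>) (\<lambda>x. \<bar>u x\<bar>)" using lp(3) by (auto simp: Lp_fun_def)
  have approx: "\<exists>v h. sobolev_pair p \<Omega> v h \<and> Lp_int p (lebesgue_on \<Omega>) (\<lambda>x. v x - \<bar>u x\<bar>) \<le> \<epsilon> \<and> Lp_int p (lebesgue_on \<Omega>) h \<le> Lp_int p (lebesgue_on \<Omega>) g + \<epsilon>
      \<and> Lp_int q (lebesgue_on \<Omega>) h \<le> Lp_int q (lebesgue_on \<Omega>) g + \<epsilon>" if "0 < \<epsilon>" for \<epsilon>
  proof -
    define d where "d = \<epsilon> / 2 powr (p - 1) / 2"
    have d: "0 < d" "2 powr (p - 1) * (d + d) = \<epsilon>" using that by (auto simp: d_def)
    have "eventually (\<lambda>k. Lp_int p (lebesgue_on \<Omega>) (\<lambda>x. \<phi> k x - u x) < d) sequentially"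
      by (rule order_tendstoD(2)[OF \<phi>(2) d(1)])
    moreover have "eventually (\<lambda>k. Lp_int p (lebesgue_on \<Omega>) (grad (\<phi> k)) < Lp_int p (lebesgue_on \<Omega>) g + \<epsilon>) sequentially"
      using that by (intro order_tendstoD(2)[OF gp]) simp
    moreover have "eventually (\<lambda>k. Lp_int q (lebesgue_on \<Omega>) (grad (\<phi> k)) < Lp_int q (lebesgue_on \<Omega>) g + \<epsilon>) sequentially"
      using that by (intro order_tendstoD(2)[OF gq]) simp
    ultimately have "eventually (\<lambda>k. Lp_int p (lebesgue_on \<Omega>) (\<lambda>x. \<phi> k x - u x) < d \<and> Lp_int p (lebesgue_on \<Omega>) (grad (\<phi> k)) < Lp_int p (lebesgue_on \<Omega>) g + \<epsilon>
       \<and> Lp_int q (lebesgue_on \<Omega>) (grad (\<phi> k)) < Lp_int q (lebesgue_on \<Omega>) g + \<epsilon>) sequentially" by eventually_elim simp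
    then obtain k where k: "Lp_int p (lebesgue_on \<Omega>) (\<lambda>x. \<phi> k x - u x) < d" "Lp_int p (lebesgue_on \<Omega>) (grad (\<phi> k)) < Lp_int p (lebesgue_on \<Omega>) g + \<epsilon>"
       "Lp_int q (lebesgue_on \<Omega>) (grad (\<phi> k)) < Lp_int q (lebesgue_on \<Omega>) g + \<epsilon>"
      by (auto simp: eventually_sequentially)
    define \<eta> where "\<eta> = (d / (m + 1)) powr (1 / p)"
    have \<eta>: "0 < \<eta>" "\<eta> powr p * m \<le> d"
    proof -
      show "0 < \<eta>" using d m by (simp add: \<eta>_def)
      have "\<eta> powr p = d / (m + 1)" using d m p0 by (simp add: \<eta>_def powr_powr)
      then have "\<eta> powr p * (m + 1) = d" using m by simp
      moreover have "\<eta> powr p * m \<le> \<eta> powr p * (m + 1)" by (intro mult_left_mono) auto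
      ultimately show "\<eta> powr p * m \<le> d" by simp
    qed
    define v where "v = (\<lambda>x. sqrt ((\<phi> k x)\<^sup>2 + \<eta>\<^sup>2) - \<eta>)"
    have v: "test_function \<Omega> v" "\<And>x. \<bar>v x - \<bar>\<phi> k x\<bar>\<bar> \<le> \<eta>" "\<And>x. norm (grad v x) \<le> norm (grad (\<phi> k) x)"
      unfolding v_def by (rule smooth_abs[OF \<phi>(1) \<eta>(1)])+
    have grad_le: "Lp_int s (lebesgue_on \<Omega>) (grad v) \<le> Lp_int s (lebesgue_on \<Omega>) (grad (\<phi> k))" if "0 < s" for s
      unfolding Lp_int_def using v(3) that test_function_Lp(2)[OF \<Omega> v(1) that] test_function_Lp(2)[OF \<Omega> \<phi>(1) that]
      by (intro integral_mono powr_mono2) (auto simp: Lp_fun_def)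
    have abs\<phi>: "Lp_fun p (lebesgue_on \<Omega>) (\<lambda>x. \<bar>\<phi> k x\<bar>)" using lp(1)[of k] by (auto simp: Lp_fun_def)
    have vLp: "Lp_fun p (lebesgue_on \<Omega>) v" by (rule test_function_Lp(1)[OF \<Omega> v(1) p0(1)])
    have 1: "Lp_int p (lebesgue_on \<Omega>) (\<lambda>x. v x - \<bar>\<phi> k x\<bar>) \<le> d"
    proof -
      have "Lp_int p (lebesgue_on \<Omega>) (\<lambda>x. v x - \<bar>\<phi> k x\<bar>) \<le> (LINT x|lebesgue_on \<Omega>. \<eta> powr p)"
        unfolding Lp_int_def using v(2) p0 Lp_fun_diff[OF p0(1) vLp abs\<phi>]
        by (intro integral_mono powr_mono2) (auto simp: Lp_fun_def)
      also have "\<dots> = \<eta> powr p * m" by (simp add: m_def)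
      finally show ?thesis using \<eta>(2) by simp
    qed
    have 2: "Lp_int p (lebesgue_on \<Omega>) (\<lambda>x. \<bar>\<phi> k x\<bar> - \<bar>u x\<bar>) \<le> Lp_int p (lebesgue_on \<Omega>) (\<lambda>x. \<phi> k x - u x)"
      unfolding Lp_int_def using p0 Lp_fun_diff[OF p0(1) abs\<phi> absu] Lp_fun_diff[OF p0(1) lp(1) lp(3)]
      by (intro integral_mono powr_mono2) (auto simp: Lp_fun_def)
    have "Lp_int p (lebesgue_on \<Omega>) (\<lambda>x. v x - \<bar>u x\<bar>) \<le> 2 powr (p - 1) * (Lp_int p (lebesgue_on \<Omega>) (\<lambda>x. v x - \<bar>\<phi> k x\<bar>) + Lp_int p (lebesgue_on \<Omega>) (\<lambda>x. \<bar>\<phi> k x\<bar> - \<bar>u x\<bar>))"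
      by (rule Lp_int_triangle[OF p0(2) vLp abs\<phi> absu])
    also have "\<dots> \<le> 2 powr (p - 1) * (d + d)" using 1 2 k(1) by (intro mult_left_mono add_mono) auto
    finally have "Lp_int p (lebesgue_on \<Omega>) (\<lambda>x. v x - \<bar>u x\<bar>) \<le> \<epsilon>" using d(2) by simp
    moreover have "Lp_int p (lebesgue_on \<Omega>) (grad v) \<le> Lp_int p (lebesgue_on \<Omega>) g + \<epsilon>" "Lp_int q (lebesgue_on \<Omega>) (grad v) \<le> Lp_int q (lebesgue_on \<Omega>) g + \<epsilon>"
      using grad_le[OF p0(1)] grad_le[OF p0(3)] k by auto
    ultimately show ?thesis using test_function_sobolev_pair[OF \<Omega> p_gt_1 v(1)] by blast
  qed
  obtain h where "sobolev_pair p \<Omega> (\<lambda>x. \<bar>u x\<bar>) h" "Lp_int p (lebesgue_on \<Omega>) h \<le> Lp_int p (lebesgue_on \<Omega>) g" "Lp_int q (lebesgue_on \<Omega>) h \<le> Lp_int q (lebesgue_on \<Omega>) g"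
    by (rule convex_limit[OF absu approx])
  then show ?thesis by blast
qed

text \<open>One bump for each box of a countable cover by closed boxes; the bumps miss at most the
  faces, a null set.\<close>

lemma sobolev_pair_positive:
  assumes "\<Omega> \<noteq> {}"
  shows "\<exists>\<phi> \<psi>. (\<forall>j::nat. sobolev_pair p \<Omega> (\<phi> j) (\<psi> j) \<and> (\<forall>x. 0 \<le> \<phi> j x)) \<and> (AE x in lebesgue_on \<Omega>. \<exists>j. 0 < \<phi> j x)"
proof -
  obtain D where D: "countable D" "D \<subseteq> Pow \<Omega>" "\<And>X. X \<in> D \<Longrightarrow> \<exists>a b. X = cbox a b" "\<Union>D = \<Omega>"
    using open_countable_Union_open_cbox[OF \<Omega>(1)] by metis
  have ne: "D \<noteq> {}" using D(4) assms by auto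
  have "\<forall>j. \<exists>ab. from_nat_into D j = cbox (fst ab) (snd ab)"
    using D(3) from_nat_into[OF ne] by (metis fst_conv snd_conv)
  from choice[OF this] obtain ab where ab: "\<And>j. from_nat_into D j = cbox (fst (ab j)) (snd (ab j))" by blast
  define \<phi> where "\<phi> = (\<lambda>j. box_bump (fst (ab j)) (snd (ab j)) 0)"
  have "cbox (fst (ab j)) (snd (ab j)) \<subseteq> \<Omega>" for j using D(2) from_nat_into[OF ne, of j] ab[of j] by auto
  then have "sobolev_pair p \<Omega> (\<phi> j) (grad (\<phi> j))" for j
    unfolding \<phi>_def by (intro test_function_sobolev_pair[OF \<Omega> p_gt_1] test_function_box_bump)
  moreover have "0 \<le> \<phi> j x" for j x unfolding \<phi>_def by (rule box_bump_bounds)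
  moreover have "AE x in lebesgue_on \<Omega>. \<exists>j. 0 < \<phi> j x"
  proof -
    have "AE x in lebesgue. x \<notin> cbox (fst (ab j)) (snd (ab j)) - box (fst (ab j)) (snd (ab j))" for j
      using negligible_frontier_interval[of "fst (ab j)" "snd (ab j)"]
      by (intro AE_not_in) (simp add: negligible_iff_null_sets)
    then have "AE x in lebesgue. \<forall>j. x \<notin> cbox (fst (ab j)) (snd (ab j)) - box (fst (ab j)) (snd (ab j))"
      by (simp add: AE_all_countable)
    then have "AE x in lebesgue. x \<in> \<Omega> \<longrightarrow> (\<exists>j. 0 < \<phi> j x)"
    proof eventually_elim
      case (elim x)
      show ?case
      proof
        assume "x \<in> \<Omega>"
        then obtain X where X: "X \<in> D" "x \<in> X" using D(4) by blast
        obtain j where "from_nat_into D j = X" using from_nat_into_surj[OF D(1) X(1)] by blast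
        then have "x \<in> cbox (fst (ab j)) (snd (ab j))" using X(2) ab[of j] by simp
        then have "0 < \<phi> j x" unfolding \<phi>_def box_bump_pos using elim by blast
        then show "\<exists>j. 0 < \<phi> j x" by blast
      qed
    qed
    then show ?thesis by (simp add: AE_restrict_space_iff[OF domain_sets(2)[OF \<Omega>]])
  qed
  ultimately show ?thesis by (intro exI[of _ \<phi>] exI[of _ "\<lambda>j. grad (\<phi> j)"]) blast
qed

lemma compact_gradient_pairs_sobolev:
  assumes "\<Omega> \<noteq> {}" "0 < s" "s < 1"
  shows "compact_gradient_pairs (lebesgue_on \<Omega>) p q r s (sobolev_pair p \<Omega>)"
proof (intro compact_gradient_pairs.intro compact_gradient_pairs_axioms.intro)
  show "gradient_pairs (lebesgue_on \<Omega>) p q (sobolev_pair p \<Omega>)" by (rule gradient_pairs_axioms)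
  show "fiber_exponents p q r s" by (rule fiber_exponents.intro) (use assms exps in auto)
  show "\<exists>S>0. \<forall>u g. sobolev_pair p \<Omega> u g \<longrightarrow> Lp_fun r (lebesgue_on \<Omega>) u \<and> Lp_int r (lebesgue_on \<Omega>) u \<le> S * Lp_int p (lebesgue_on \<Omega>) g powr (r / p)"
    using exps by (intro sobolev_pair_embedding) auto
  show "\<exists>\<phi> \<psi>. (\<forall>j::nat. sobolev_pair p \<Omega> (\<phi> j) (\<psi> j) \<and> (\<forall>x. 0 \<le> \<phi> j x)) \<and> (AE x in lebesgue_on \<Omega>. \<exists>j. 0 < \<phi> j x)"
    by (rule sobolev_pair_positive[OF assms(1)])
  show "emeasure (lebesgue_on \<Omega>) (space (lebesgue_on \<Omega>)) \<noteq> 0"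
  proof
    assume "emeasure (lebesgue_on \<Omega>) (space (lebesgue_on \<Omega>)) = 0"
    moreover have "emeasure (lebesgue_on \<Omega>) \<Omega> = emeasure lebesgue \<Omega>"
      by (rule emeasure_restrict_space) (use domain_sets[OF \<Omega>] in auto)
    ultimately have "\<Omega> \<in> null_sets lebesgue" using domain_sets(1)[OF \<Omega>] by (simp add: space_restrict_space null_sets_def)
    then show False using open_not_negligible[OF \<Omega>(1) assms(1)] by (simp add: negligible_iff_null_sets)
  qed
  show "AE x in lebesgue_on \<Omega>. g x = h x" if "sobolev_pair p \<Omega> u g" "sobolev_pair p \<Omega> v h" "AE x in lebesgue_on \<Omega>. u x = v x" for u g v h
    by (rule weak_gradient_unique_AE[OF \<Omega> sobolev_pair_is_weak_gradient[OF \<Omega> p_gt_1 that(1)]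
          sobolev_pair_is_weak_gradient[OF \<Omega> p_gt_1 that(2)] that(3)])
qed (fact sobolev_pair_compact sobolev_pair_abs)+

text \<open>The abstract gradient \<open>g\<close> is exchanged for \<open>weak_gradient\<close>
  inside an integral, where agreement almost everywhere suffices, and every test element of
  \<open>W1p_0\<close> forms a pair with its own weak gradient.\<close>

lemma weak_pair_imp_weak_solution:
  assumes "\<Omega> \<noteq> {}" "0 < s" "s < 1"
    and weak: "compact_gradient_pairs.weak_pair (lebesgue_on \<Omega>) p q r s (sobolev_pair p \<Omega>) \<beta> lam u g"
  shows "weak_solution \<Omega> p q r (1 - s) \<beta> lam u"
proof -
  interpret compact_gradient_pairs "lebesgue_on \<Omega>" p q r s "sobolev_pair p \<Omega>"
    by (rule compact_gradient_pairs_sobolev[OF assms(1-3)])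
  have ug: "sobolev_pair p \<Omega> u g" and upos: "AE x in lebesgue_on \<Omega>. 0 < u x"
    and eq: "\<And>\<phi> h. sobolev_pair p \<Omega> \<phi> h \<Longrightarrow> has_bochner_integral (lebesgue_on \<Omega>)
        (\<lambda>x. norm (g x) powr (p - 2) * (g x \<bullet> h x) + \<beta> * (norm (g x) powr (q - 2) * (g x \<bullet> h x))
           - lam * u x powr (s - 1) * \<phi> x - u x powr (r - 1) * \<phi> x) 0"
    using weak by (auto simp: weak_pair_def)
  note u = sobolev_pair_imp_W1p_0[OF \<Omega> p_gt_1 ug]
  have "has_bochner_integral (lebesgue_on \<Omega>)
          (\<lambda>x. m_flux p (weak_gradient \<Omega> u x) \<bullet> weak_gradient \<Omega> \<phi> x
             + \<beta> * (m_flux q (weak_gradient \<Omega> u x) \<bullet> weak_gradient \<Omega> \<phi> x)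
             - lam * u x powr (- (1 - s)) * \<phi> x - u x powr (r - 1) * \<phi> x) 0"
    if "\<phi> \<in> W1p_0 p \<Omega>" for \<phi>
  proof -
    note V\<phi> = W1p_0_imp_sobolev_pair[OF \<Omega> p_gt_1 that]
    have [measurable]: "g \<in> borel_measurable (lebesgue_on \<Omega>)" "weak_gradient \<Omega> u \<in> borel_measurable (lebesgue_on \<Omega>)"
      "weak_gradient \<Omega> \<phi> \<in> borel_measurable (lebesgue_on \<Omega>)" "u \<in> borel_measurable (lebesgue_on \<Omega>)" "\<phi> \<in> borel_measurable (lebesgue_on \<Omega>)"
      using V_Lp[OF ug] V_Lp[OF V\<phi>] u(3) by (auto simp: Lp_fun_def)
    let ?f = "\<lambda>x. norm (g x) powr (p - 2) * (g x \<bullet> weak_gradient \<Omega> \<phi> x)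
         + \<beta> * (norm (g x) powr (q - 2) * (g x \<bullet> weak_gradient \<Omega> \<phi> x))
           - lam * u x powr (s - 1) * \<phi> x - u x powr (r - 1) * \<phi> x"
    let ?h = "\<lambda>x. norm (weak_gradient \<Omega> u x) powr (p - 2) * (weak_gradient \<Omega> u x \<bullet> weak_gradient \<Omega> \<phi> x)
         + \<beta> * (norm (weak_gradient \<Omega> u x) powr (q - 2) * (weak_gradient \<Omega> u x \<bullet> weak_gradient \<Omega> \<phi> x))
           - lam * u x powr (s - 1) * \<phi> x - u x powr (r - 1) * \<phi> x"
    have "?f \<in> borel_measurable (lebesgue_on \<Omega>)" by simp
    moreover have "?h \<in> borel_measurable (lebesgue_on \<Omega>)" by simp
    moreover have "AE x in lebesgue_on \<Omega>. ?f x = ?h x" using u(2) by eventually_elim simp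
    ultimately have "has_bochner_integral (lebesgue_on \<Omega>) ?h 0"
      using eq[OF V\<phi>] has_bochner_integral_cong_AE by blast
    then show ?thesis by (simp add: m_flux_def)
  qed
  then show ?thesis using u(1) upos by (simp add: weak_solution_def)
qed

end

theorem theorem2p2:
  fixes \<Omega> :: "(real^'n::finite) set" and p q r \<delta> :: real
  assumes "bounded_smooth_domain \<Omega>"
    and "real CARD('n) > p"
    and "1 < q" and "q < p" and "p < r"
    and "r < sobolev_exponent CARD('n) p"
    and "0 < \<delta>" and "\<delta> < 1"
  shows "\<exists>lam_star>0. \<forall>\<beta>>0. \<forall>lam. 0 < lam \<and> lam < lam_star \<longrightarrow>
           (\<exists>u v. weak_solution \<Omega> p q r \<delta> \<beta> lam u \<and> weak_solution \<Omega> p q r \<delta> \<beta> lam v \<and>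
                  \<not> (AE x in lebesgue_on \<Omega>. u x = v x))"
proof -
  have \<Omega>: "open \<Omega>" "\<Omega> \<noteq> {}" and "bounded \<Omega>"
    using assms(1) by (auto simp: bounded_smooth_domain_def)
  then obtain R where R: "0 < R" "\<And>x. x \<in> \<Omega> \<Longrightarrow> norm x \<le> R" using bounded_pos by metis
  have sub: "\<Omega> \<subseteq> cball 0 R" using R(2) by auto
  note exps = assms(3-5) assms(2) assms(6)
  have s: "0 < 1 - \<delta>" "1 - \<delta> < 1" using assms by auto
  interpret compact_gradient_pairs "lebesgue_on \<Omega>" p q r "1 - \<delta>" "sobolev_pair p \<Omega>"
    by (rule compact_gradient_pairs_sobolev[OF \<Omega>(1) sub less_imp_le[OF R(1)] exps \<Omega>(2) s])
  have "weak_solution \<Omega> p q r \<delta> \<beta> lam u" if "weak_pair \<beta> lam u g" for \<beta> lam u g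
    using weak_pair_imp_weak_solution[OF \<Omega>(1) sub less_imp_le[OF R(1)] exps \<Omega>(2) s that] by simp
  with two_weak_pairs show ?thesis by meson
qed

end
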